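(* Let $\Omega$ be a smooth, $n$-dimensional manifold without boundary. Let $g_i$ ($i=1,2,3,\dots$) and $g$ be $C^1$ Riemannian metrics on $\Omega$ such that the $g_i$ converge to $g$ in $C^1$. For each $i$, let $M_i$ be an $m$-dimensional varifold in $\Omega$ such that the mean curvature of $M_i$ with respect to $g_i$ is bounded by $h<\infty$ and such that the boundaries of the $M_i$ are uniformly bounded on compact subsets of $\Omega$: $$\limsup_i|\partial M_i|(U)<\infty\quad\text{for all } U\subset\subset\Omega.$$ Let $$Z=\{x\in\Omega:\ \limsup_i|M_i|(\mathbf{B}(x,r))=\infty\ \text{for every } r>0\}.$$ Then $Z$ is an $(m,h)$ subset of $(\Omega,g)$. More generally, the conclusion remains true if the hypothesis that the mean curvatures are bounded by $h$ is replaced by the hypothesis that $$\limsup_i\int_{M_i\cap K}(|H|-h)^+\,dA<\infty$$ for every compact $K\subset\Omega$, where $H$ is the mean curvature vector and $t^+=\max\{t,0\}$.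
   Context: For an $m$-dimensional varifold $M$ of locally bounded first variation, $|M|$ is its mass (weight) measure, the mean curvature $H$ is defined by the condition that the part of the first variation $\delta M$ absolutely continuous with respect to $|M|$ is $-H\,|M|$, $|\partial M|$ is the generalized boundary measure, i.e. the part of the total variation measure of $\delta M$ singular with respect to $|M|$, and $\int_{M\cap K}\cdot\,dA$ means $\int_K\cdot\,d|M|$. (A properly embedded submanifold-with-boundary is a special case: $|M|$ and $|\partial M|$ are then the $m$-dimensional area of $M$ and the $(m-1)$-dimensional area of $\partial M$.) Quantities for $M_i$ are taken with respect to $g_i$. $\mathbf{B}(x,r)$ is the ball of radius $r$ about $x$. $U\subset\subset\Omega$ means $U$ has compact closure in $\Omega$. Definition of $(m,h)$ subset: let $\Omega$ be a smooth manifold without boundary with a $C^1$ Riemannian metric $g$. A closed subset $Z\subset\Omega$ is an $(m,h)$ subset of $(\Omega,g)$ if, whenever $f:\Omega\to\mathbf{R}$ is a $C^2$ function such that $f|Z$ has a local maximum at $p\in Z$, we have $\operatorname{Trace}_m(\mathrm{D}^2f(p))\le h\,|\mathrm{D}f(p)|$. Here $\mathrm{D}^2f$ is the Hessian of $f$ with respect to $g$, $|\mathrm{D}f|$ is the norm of the derivative with respect to $g$, and $\operatorname{Trace}_m$ denotes the sum of the $m$ lowest eigenvalues (with respect to $g$, counted with multiplicity). *)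

theory Defs
  imports "HOL-Analysis.Analysis"
begin

section \<open>Smooth manifolds\<close>

text \<open>The manifold is the whole type \<open>'a\<close> (Hausdorff, second countable) with an atlas \<open>A\<close> of charts
  \<open>(U, \<phi>)\<close>; the model space is \<open>'e :: euclidean_space\<close>, so the dimension \<open>n\<close> is \<open>DIM('e)\<close>.
  Values of \<open>\<phi>\<close> outside \<open>U\<close> carry no meaning.\<close>

type_synonym ('a, 'e) chart = "'a set \<times> ('a \<Rightarrow> 'e)"

text \<open>\<open>Ck_on k S f\<close>: \<open>f\<close> is of class \<open>C\<^sup>k\<close> on the open set \<open>S\<close>.  Directional derivatives are used
  instead of the total derivative to keep the type of \<open>f\<close> in the recursion; for finite-dimensional
  domains this is the usual notion.\<close>

primrec Ck_on :: "nat \<Rightarrow> 'b::real_normed_vector set \<Rightarrow> ('b \<Rightarrow> 'c::real_normed_vector) \<Rightarrow> bool" where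
  "Ck_on 0 S f \<longleftrightarrow> continuous_on S f"
| "Ck_on (Suc k) S f \<longleftrightarrow>
     (\<forall>x\<in>S. f differentiable (at x)) \<and> (\<forall>v. Ck_on k S (\<lambda>x. frechet_derivative f (at x) v))"

definition chart_image :: "('a, 'e) chart \<Rightarrow> 'e set" where
  "chart_image c = snd c ` fst c"

definition inv_chart :: "('a, 'e) chart \<Rightarrow> 'e \<Rightarrow> 'a" where
  "inv_chart c = inv_into (fst c) (snd c)"

definition smooth_atlas ::
    "('a::{t2_space, second_countable_topology}, 'e::euclidean_space) chart set \<Rightarrow> bool" where
  "smooth_atlas A \<longleftrightarrow>
     \<Union>(fst ` A) = UNIV \<and>
     (\<forall>c\<in>A. open (fst c) \<and> open (chart_image c) \<and>
            homeomorphism (fst c) (chart_image c) (snd c) (inv_chart c)) \<and>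
     (\<forall>c\<in>A. \<forall>d\<in>A. \<forall>k. Ck_on k (snd c ` (fst c \<inter> fst d)) (snd d \<circ> inv_chart c))"

text \<open>All constructions that are carried out in \<open>chart_at A p\<close> are independent of the chart at \<open>p\<close>.\<close>

definition chart_at :: "('a, 'e) chart set \<Rightarrow> 'a \<Rightarrow> ('a, 'e) chart" where
  "chart_at A p = (SOME c. c \<in> A \<and> p \<in> fst c)"

text \<open>A tangent vector at \<open>p\<close> is the family of its components in all charts around \<open>p\<close>, subject to
  the transformation law; components with respect to other pairs are set to \<open>0\<close>.\<close>

type_synonym ('a, 'e) tangent = "('a, 'e) chart \<Rightarrow> 'e"

definition tangent_space ::
    "('a, 'e::euclidean_space) chart set \<Rightarrow> 'a \<Rightarrow> ('a, 'e) tangent set" where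
  "tangent_space A p =
     {v. (\<forall>c. \<not> (c \<in> A \<and> p \<in> fst c) \<longrightarrow> v c = 0) \<and>
         (\<forall>c\<in>A. \<forall>d\<in>A. p \<in> fst c \<inter> fst d \<longrightarrow>
            v d = frechet_derivative (snd d \<circ> inv_chart c) (at (snd c p)) (v c))}"

definition tvec ::
    "('a, 'e::euclidean_space) chart set \<Rightarrow> ('a, 'e) chart \<Rightarrow> 'a \<Rightarrow> 'e \<Rightarrow> ('a, 'e) tangent" where
  \<comment> \<open>the tangent vector at \<open>p\<close> with component \<open>u\<close> in the chart \<open>c\<close>\<close>
  "tvec A c p u =
     (\<lambda>d. if d \<in> A \<and> p \<in> fst d
          then frechet_derivative (snd d \<circ> inv_chart c) (at (snd c p)) u else 0)"

definition C2_function ::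
    "('a, 'e::euclidean_space) chart set \<Rightarrow> ('a \<Rightarrow> real) \<Rightarrow> bool" where
  "C2_function A f \<longleftrightarrow> (\<forall>c\<in>A. Ck_on 2 (chart_image c) (f \<circ> inv_chart c))"

definition vector_field ::
    "('a, 'e::euclidean_space) chart set \<Rightarrow> ('a \<Rightarrow> ('a, 'e) tangent) \<Rightarrow> bool" where
  "vector_field A X \<longleftrightarrow> (\<forall>p. X p \<in> tangent_space A p)"

definition C1_vector_field ::
    "('a, 'e::euclidean_space) chart set \<Rightarrow> ('a \<Rightarrow> ('a, 'e) tangent) \<Rightarrow> bool" where
  "C1_vector_field A X \<longleftrightarrow>
     vector_field A X \<and> (\<forall>c\<in>A. Ck_on 1 (chart_image c) (\<lambda>x. X (inv_chart c x) c))"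

definition vf_support :: "('a::topological_space \<Rightarrow> ('a, 'e::euclidean_space) tangent) \<Rightarrow> 'a set" where
  "vf_support X = closure {p. X p \<noteq> (\<lambda>_. 0)}"


section \<open>Riemannian metrics of class \<open>C\<^sup>1\<close>\<close>

text \<open>\<open>g p\<close> is only meaningful on \<open>tangent_space A p\<close>.\<close>

type_synonym ('a, 'e) metric = "'a \<Rightarrow> ('a, 'e) tangent \<Rightarrow> ('a, 'e) tangent \<Rightarrow> real"

definition metric_in_chart ::
    "('a, 'e::euclidean_space) chart set \<Rightarrow> ('a, 'e) metric \<Rightarrow> ('a, 'e) chart
      \<Rightarrow> 'e \<Rightarrow> 'e \<Rightarrow> 'e \<Rightarrow> real" where
  "metric_in_chart A g c x u v =
     (let p = inv_chart c x in g p (tvec A c p u) (tvec A c p v))"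

definition C1_metric :: "('a, 'e::euclidean_space) chart set \<Rightarrow> ('a, 'e) metric \<Rightarrow> bool" where
  "C1_metric A g \<longleftrightarrow>
     (\<forall>c\<in>A.
        (\<forall>x\<in>chart_image c.
           bilinear (metric_in_chart A g c x) \<and>
           (\<forall>u v. metric_in_chart A g c x u v = metric_in_chart A g c x v u) \<and>
           (\<forall>u. u \<noteq> 0 \<longrightarrow> metric_in_chart A g c x u u > 0)) \<and>
        (\<forall>u v. Ck_on 1 (chart_image c) (\<lambda>x. metric_in_chart A g c x u v)))"

text \<open>Convergence in \<open>C\<^sup>1\<close> is uniform convergence of the components and of their first derivatives
  on compact subsets of charts.\<close>

definition C1_metrics_converge ::
    "('a, 'e::euclidean_space) chart set \<Rightarrow> (nat \<Rightarrow> ('a, 'e) metric) \<Rightarrow> ('a, 'e) metric \<Rightarrow> bool" where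
  "C1_metrics_converge A gs g \<longleftrightarrow>
     (\<forall>c\<in>A. \<forall>K. compact K \<and> K \<subseteq> chart_image c \<longrightarrow>
        (\<forall>u v.
           uniform_limit K (\<lambda>i x. metric_in_chart A (gs i) c x u v)
             (\<lambda>x. metric_in_chart A g c x u v) sequentially \<and>
           (\<forall>w. uniform_limit K
             (\<lambda>i x. frechet_derivative (\<lambda>y. metric_in_chart A (gs i) c y u v) (at x) w)
             (\<lambda>x. frechet_derivative (\<lambda>y. metric_in_chart A g c y u v) (at x) w) sequentially)))"

definition tnorm :: "('a, 'e) metric \<Rightarrow> 'a \<Rightarrow> ('a, 'e) tangent \<Rightarrow> real" where
  "tnorm g p v = sqrt (g p v v)"

definition piecewise_C1_curve ::
    "('a::topological_space, 'e::euclidean_space) chart set \<Rightarrow> (real \<Rightarrow> 'a) \<Rightarrow> bool" where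
  "piecewise_C1_curve A \<gamma> \<longleftrightarrow>
     path \<gamma> \<and>
     (\<exists>S. finite S \<and>
        (\<forall>c\<in>A. (snd c \<circ> \<gamma>) C1_differentiable_on {t \<in> {0..1} - S. \<gamma> t \<in> fst c}))"

definition velocity ::
    "('a, 'e::euclidean_space) chart set \<Rightarrow> (real \<Rightarrow> 'a) \<Rightarrow> real \<Rightarrow> ('a, 'e) tangent" where
  "velocity A \<gamma> t =
     (let c = chart_at A (\<gamma> t) in tvec A c (\<gamma> t) (vector_derivative (snd c \<circ> \<gamma>) (at t)))"

definition curve_length ::
    "('a, 'e::euclidean_space) chart set \<Rightarrow> ('a, 'e) metric \<Rightarrow> (real \<Rightarrow> 'a) \<Rightarrow> ennreal" where
  "curve_length A g \<gamma> =
     (\<integral>\<^sup>+t\<in>{0..1}. ennreal (tnorm g (\<gamma> t) (velocity A \<gamma> t)) \<partial>lborel)"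

text \<open>The distance between points of different connected components is \<open>\<infinity>\<close>.\<close>

definition riem_dist ::
    "('a::topological_space, 'e::euclidean_space) chart set \<Rightarrow> ('a, 'e) metric
      \<Rightarrow> 'a \<Rightarrow> 'a \<Rightarrow> ennreal" where
  "riem_dist A g x y =
     (INF \<gamma> \<in> {\<gamma>. piecewise_C1_curve A \<gamma> \<and> pathstart \<gamma> = x \<and> pathfinish \<gamma> = y}.
        curve_length A g \<gamma>)"

definition riem_ball ::
    "('a::topological_space, 'e::euclidean_space) chart set \<Rightarrow> ('a, 'e) metric
      \<Rightarrow> 'a \<Rightarrow> real \<Rightarrow> 'a set" where
  "riem_ball A g x r = {y. riem_dist A g x y < ennreal r}"

text \<open>\<open>christoffel A g c x u v\<close> is the vector \<open>\<Sum>\<^sub>k (\<Sum>\<^sub>i\<^sub>j \<Gamma>\<^sup>k\<^sub>i\<^sub>j u\<^sup>i v\<^sup>j) e\<^sub>k\<close>, determined by the Koszul formula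
  for the Levi-Civita connection applied to constant vector fields in the chart \<open>c\<close>.\<close>

definition christoffel ::
    "('a, 'e::euclidean_space) chart set \<Rightarrow> ('a, 'e) metric \<Rightarrow> ('a, 'e) chart
      \<Rightarrow> 'e \<Rightarrow> 'e \<Rightarrow> 'e \<Rightarrow> 'e" where
  "christoffel A g c x u v =
     (let D = (\<lambda>a b w. frechet_derivative (\<lambda>y. metric_in_chart A g c y a b) (at x) w)
      in THE z. \<forall>w. metric_in_chart A g c x z w = (D v w u + D u w v - D u v w) / 2)"

definition cov_deriv ::
    "('a, 'e::euclidean_space) chart set \<Rightarrow> ('a, 'e) metric \<Rightarrow> ('a \<Rightarrow> ('a, 'e) tangent)
      \<Rightarrow> 'a \<Rightarrow> ('a, 'e) tangent \<Rightarrow> ('a, 'e) tangent" where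
  \<comment> \<open>the covariant derivative of \<open>X\<close> at \<open>p\<close> in the direction \<open>v\<close>\<close>
  "cov_deriv A g X p v =
     (let c = chart_at A p; x = snd c p
      in tvec A c p
           (frechet_derivative (\<lambda>y. X (inv_chart c y) c) (at x) (v c)
             + christoffel A g c x (v c) (X p c)))"

definition deriv_norm ::
    "('a, 'e::euclidean_space) chart set \<Rightarrow> ('a, 'e) metric \<Rightarrow> ('a \<Rightarrow> real) \<Rightarrow> 'a \<Rightarrow> real" where
  "deriv_norm A g f p =
     (let c = chart_at A p
      in SUP v \<in> {v \<in> tangent_space A p. tnorm g p v \<le> 1}.
           frechet_derivative (f \<circ> inv_chart c) (at (snd c p)) (v c))"

definition hessian ::
    "('a, 'e::euclidean_space) chart set \<Rightarrow> ('a, 'e) metric \<Rightarrow> ('a \<Rightarrow> real)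
      \<Rightarrow> 'a \<Rightarrow> ('a, 'e) tangent \<Rightarrow> ('a, 'e) tangent \<Rightarrow> real" where
  "hessian A g f p v w =
     (let c = chart_at A p; x = snd c p; F = f \<circ> inv_chart c
      in frechet_derivative (\<lambda>y. frechet_derivative F (at y) (w c)) (at x) (v c)
           - frechet_derivative F (at x) (christoffel A g c x (v c) (w c)))"

definition eigenspace ::
    "('a, 'e::euclidean_space) chart set \<Rightarrow> ('a, 'e) metric \<Rightarrow> 'a
      \<Rightarrow> (('a, 'e) tangent \<Rightarrow> ('a, 'e) tangent \<Rightarrow> real) \<Rightarrow> real \<Rightarrow> ('a, 'e) tangent set" where
  "eigenspace A g p B l =
     {v \<in> tangent_space A p. \<forall>w\<in>tangent_space A p. B v w = l * g p v w}"

text \<open>The dimension of a subspace of a tangent space is read off in a chart.\<close>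

definition eigen_multiplicity ::
    "('a, 'e::euclidean_space) chart set \<Rightarrow> ('a, 'e) metric \<Rightarrow> 'a
      \<Rightarrow> (('a, 'e) tangent \<Rightarrow> ('a, 'e) tangent \<Rightarrow> real) \<Rightarrow> real \<Rightarrow> nat" where
  "eigen_multiplicity A g p B l = dim ((\<lambda>v. v (chart_at A p)) ` eigenspace A g p B l)"

definition eigenvalue_list ::
    "('a, 'e::euclidean_space) chart set \<Rightarrow> ('a, 'e) metric \<Rightarrow> 'a
      \<Rightarrow> (('a, 'e) tangent \<Rightarrow> ('a, 'e) tangent \<Rightarrow> real) \<Rightarrow> real list" where
  \<comment> \<open>increasing, each eigenvalue repeated according to its multiplicity\<close>
  "eigenvalue_list A g p B =
     concat (map (\<lambda>l. replicate (eigen_multiplicity A g p B l) l)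
       (sorted_list_of_set {l. \<exists>v\<in>eigenspace A g p B l. v \<noteq> (\<lambda>_. 0)}))"

definition trace_lowest ::
    "('a, 'e::euclidean_space) chart set \<Rightarrow> ('a, 'e) metric \<Rightarrow> nat \<Rightarrow> 'a
      \<Rightarrow> (('a, 'e) tangent \<Rightarrow> ('a, 'e) tangent \<Rightarrow> real) \<Rightarrow> real" where
  "trace_lowest A g m p B = sum_list (take m (eigenvalue_list A g p B))"

definition mh_subset ::
    "('a::{t2_space, second_countable_topology}, 'e::euclidean_space) chart set
      \<Rightarrow> ('a, 'e) metric \<Rightarrow> nat \<Rightarrow> real \<Rightarrow> 'a set \<Rightarrow> bool" where
  "mh_subset A g m h Z \<longleftrightarrow>
     closed Z \<and>
     (\<forall>f p. C2_function A f \<and> p \<in> Z \<and>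
            (\<exists>U. open U \<and> p \<in> U \<and> (\<forall>x\<in>Z \<inter> U. f x \<le> f p)) \<longrightarrow>
        trace_lowest A g m p (hessian A g f p) \<le> h * deriv_norm A g f p)"


section \<open>Varifolds and their first variation\<close>

definition grassmann_bundle ::
    "('a, 'e::euclidean_space) chart set \<Rightarrow> nat \<Rightarrow> ('a \<times> ('a, 'e) tangent set) set" where
  "grassmann_bundle A m =
     {(p, S). \<exists>P. subspace P \<and> dim P = m \<and> S = tvec A (chart_at A p) p ` P}"

text \<open>Subspaces of the model space are topologised through their orthogonal projections, and the
  Grassmann bundle through its local trivialisations.\<close>

definition ortho_proj :: "'e::euclidean_space set \<Rightarrow> 'e \<Rightarrow>\<^sub>L 'e" where
  "ortho_proj P = Blinfun (closest_point P)"

definition grassmann_topology ::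
    "('a::topological_space, 'e::euclidean_space) chart set \<Rightarrow> nat
      \<Rightarrow> ('a \<times> ('a, 'e) tangent set) topology" where
  "grassmann_topology A m =
     topology_generated_by
       {{(p, S) \<in> grassmann_bundle A m.
           p \<in> fst c \<and> (p, ortho_proj ((\<lambda>v. v c) ` S)) \<in> W} | c W. c \<in> A \<and> open W}"

text \<open>A varifold is a Radon measure on the Grassmann bundle; as the bundle is locally compact,
  Hausdorff and second countable, this means a Borel measure that is finite on compact sets.\<close>

definition varifold ::
    "('a::{t2_space, second_countable_topology}, 'e::euclidean_space) chart set \<Rightarrow> nat
      \<Rightarrow> ('a \<times> ('a, 'e) tangent set) measure \<Rightarrow> bool" where
  "varifold A m M \<longleftrightarrow>
     space M = grassmann_bundle A m \<and>
     sets M = sigma_sets (grassmann_bundle A m) {W. openin (grassmann_topology A m) W} \<and>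
     (\<forall>K. compactin (grassmann_topology A m) K \<longrightarrow> emeasure M K < \<infinity>)"

definition weight :: "('a::topological_space \<times> ('a, 'e) tangent set) measure \<Rightarrow> 'a measure" where
  "weight M = distr M borel fst"

text \<open>For an \<open>m\<close>-dimensional plane \<open>S\<close>, any \<open>m\<close> orthonormal vectors of \<open>S\<close> form a basis.\<close>

definition orthonormal_basis ::
    "('a, 'e) metric \<Rightarrow> nat \<Rightarrow> 'a \<Rightarrow> ('a, 'e) tangent set \<Rightarrow> ('a, 'e) tangent set \<Rightarrow> bool" where
  "orthonormal_basis g m p S B \<longleftrightarrow>
     B \<subseteq> S \<and> finite B \<and> card B = m \<and> (\<forall>b\<in>B. \<forall>b'\<in>B. g p b b' = (if b = b' then 1 else 0))"

definition plane_div ::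
    "('a, 'e::euclidean_space) chart set \<Rightarrow> ('a, 'e) metric \<Rightarrow> nat \<Rightarrow> ('a \<Rightarrow> ('a, 'e) tangent)
      \<Rightarrow> 'a \<Rightarrow> ('a, 'e) tangent set \<Rightarrow> real" where
  "plane_div A g m X p S =
     (\<Sum>b\<in>(SOME B. orthonormal_basis g m p S B). g p (cov_deriv A g X p b) b)"

definition first_variation ::
    "('a, 'e::euclidean_space) chart set \<Rightarrow> ('a, 'e) metric \<Rightarrow> nat
      \<Rightarrow> ('a \<times> ('a, 'e) tangent set) measure \<Rightarrow> ('a \<Rightarrow> ('a, 'e) tangent) \<Rightarrow> real" where
  "first_variation A g m M X = (\<integral>(p, S). plane_div A g m X p S \<partial>M)"

definition test_fields ::
    "('a::topological_space, 'e::euclidean_space) chart set \<Rightarrow> ('a, 'e) metric \<Rightarrow> 'a set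
      \<Rightarrow> ('a \<Rightarrow> ('a, 'e) tangent) set" where
  "test_fields A g U =
     {X. C1_vector_field A X \<and> compact (vf_support X) \<and> vf_support X \<subseteq> U \<and>
         (\<forall>p. tnorm g p (X p) \<le> 1)}"

definition locally_bounded_first_variation ::
    "('a::topological_space, 'e::euclidean_space) chart set \<Rightarrow> ('a, 'e) metric \<Rightarrow> nat
      \<Rightarrow> ('a \<times> ('a, 'e) tangent set) measure \<Rightarrow> bool" where
  "locally_bounded_first_variation A g m M \<longleftrightarrow>
     (\<forall>K. compact K \<longrightarrow> (\<exists>C. \<forall>X\<in>test_fields A g K. \<bar>first_variation A g m M X\<bar> \<le> C))"

text \<open>\<open>\<nu>\<close> is the total variation measure of the linear functional \<open>L\<close> on compactly supported \<open>C\<^sup>1\<close>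
  vector fields.  For functionals that are bounded on fields of norm at most \<open>1\<close> supported in a given
  compact set, \<open>\<nu>\<close> exists and is determined by its values on open sets.\<close>

definition total_variation_measure ::
    "('a::topological_space, 'e::euclidean_space) chart set \<Rightarrow> ('a, 'e) metric
      \<Rightarrow> (('a \<Rightarrow> ('a, 'e) tangent) \<Rightarrow> real) \<Rightarrow> 'a measure \<Rightarrow> bool" where
  "total_variation_measure A g L \<nu> \<longleftrightarrow>
     sets \<nu> = sets borel \<and>
     (\<forall>U. open U \<longrightarrow> emeasure \<nu> U = (SUP X \<in> test_fields A g U. ennreal (L X)))"

definition mutually_singular :: "'a::topological_space measure \<Rightarrow> 'a measure \<Rightarrow> bool" where
  "mutually_singular \<mu> \<nu> \<longleftrightarrow> (\<exists>N\<in>sets borel. emeasure \<mu> N = 0 \<and> emeasure \<nu> (- N) = 0)"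

text \<open>\<open>H\<close> is the mean curvature of \<open>M\<close> if \<open>- H |M|\<close> is the part of the first variation that is
  absolutely continuous with respect to \<open>|M|\<close>, that is, if \<open>\<delta>M - (- H |M|)\<close> is singular
  with respect to \<open>|M|\<close>.  Such an \<open>H\<close> is unique up to \<open>|M|\<close>-null sets.\<close>

definition mean_curvature ::
    "('a::topological_space, 'e::euclidean_space) chart set \<Rightarrow> ('a, 'e) metric \<Rightarrow> nat
      \<Rightarrow> ('a \<times> ('a, 'e) tangent set) measure \<Rightarrow> ('a \<Rightarrow> ('a, 'e) tangent) \<Rightarrow> bool" where
  "mean_curvature A g m M H \<longleftrightarrow>
     vector_field A H \<and>
     (\<forall>c\<in>A. (\<lambda>p. H p c) \<in> borel_measurable borel) \<and>
     (\<forall>K. compact K \<longrightarrow> (\<integral>\<^sup>+p\<in>K. ennreal (tnorm g p (H p)) \<partial>weight M) < \<infinity>) \<and>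
     (\<exists>\<sigma>. total_variation_measure A g
            (\<lambda>X. first_variation A g m M X + (\<integral>p. g p (H p) (X p) \<partial>weight M)) \<sigma> \<and>
          mutually_singular (weight M) \<sigma>)"

text \<open>\<open>\<beta> = |\<partial>M|\<close> is the singular part in the Lebesgue decomposition, with respect to \<open>|M|\<close>, of the
  total variation measure of the first variation.\<close>

definition boundary_measure ::
    "('a::topological_space, 'e::euclidean_space) chart set \<Rightarrow> ('a, 'e) metric \<Rightarrow> nat
      \<Rightarrow> ('a \<times> ('a, 'e) tangent set) measure \<Rightarrow> 'a measure \<Rightarrow> bool" where
  "boundary_measure A g m M \<beta> \<longleftrightarrow>
     sets \<beta> = sets borel \<and>
     (\<exists>\<nu> \<rho>. total_variation_measure A g (first_variation A g m M) \<nu> \<and>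
        sets \<rho> = sets borel \<and> absolutely_continuous (weight M) \<rho> \<and>
        mutually_singular (weight M) \<beta> \<and>
        (\<forall>B\<in>sets borel. emeasure \<nu> B = emeasure \<rho> B + emeasure \<beta> B))"

definition area_blowup_set ::
    "('a::topological_space, 'e::euclidean_space) chart set \<Rightarrow> ('a, 'e) metric
      \<Rightarrow> (nat \<Rightarrow> ('a \<times> ('a, 'e) tangent set) measure) \<Rightarrow> 'a set" where
  "area_blowup_set A g M =
     {x. \<forall>r>0. limsup (\<lambda>i. emeasure (weight (M i)) (riem_ball A g x r)) = \<infinity>}"

end

theory Submission
  imports Defs
begin

text \<open>Suppose that \<open>f\<close> restricted to \<open>Z\<close> has a local maximum at \<open>p\<close> and that the sum of the \<open>m\<close> lowest
  eigenvalues of the Hessian exceeds \<open>h |Df|\<close> at \<open>p\<close>.  Subtracting the fourth power of the distance to \<open>p\<close> in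
  a chart keeps the 2-jet at \<open>p\<close> and makes the maximum strict, giving a function \<open>F\<close>.  Take the test fields
  \<open>X\<^sub>i = \<zeta> \<phi>(F) \<nabla>\<^sub>i F\<close>, where \<open>\<nabla>\<^sub>i\<close> is the gradient of \<open>g\<^sub>i\<close>, \<open>\<phi>(t) = max(0, t - a)\<^sup>2\<close> with \<open>a\<close> slightly below \<open>F(p)\<close>, and
  \<open>\<zeta>\<close> is a cutoff.  Since \<open>\<phi>\<close> is nondecreasing, the divergence of \<open>X\<^sub>i\<close> over an \<open>m\<close>-plane is at least
  \<open>\<zeta> \<phi>(F)\<close> times the trace of the Hessian over this plane, up to an error supported where \<open>D\<zeta> \<noteq> 0\<close> and
  \<open>F \<ge> a\<close>.  This set is compact and disjoint from \<open>Z\<close>, so its mass is bounded.  For large \<open>i\<close> the trace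
  exceeds \<open>h |\<nabla>\<^sub>i F| + c\<close> with a fixed \<open>c > 0\<close>, so the first variation formula bounds \<open>c \<integral> \<zeta> \<phi>(F) d|M\<^sub>i|\<close>
  by the boundary mass and the integral of \<open>(|H| - h)\<^sup>+\<close>.  Hence the masses near \<open>p\<close> are
  bounded, contradicting \<open>p \<in> Z\<close>.\<close>

section \<open>Differential calculus\<close>

text \<open>All computation takes place in one chart around \<open>p\<close>. There a metric is a
  family of inner products \<open>G x\<close>, and the gradient of \<open>F\<close> is the solution
  \<open>z\<close> of \<open>G x (z x) w = fd F x w\<close>; its continuity, differentiability and
  dependence on the metric are read off this equation. The metrics being only C^1, the gradient of a
  C^2 function is only C^1, which is just what test fields may be. Three obstacles shape the rest.
  The strict inequality at \<open>p\<close> must hold with one constant for all nearby points, all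
  large \<open>i\<close> and all planes; a sequence of counterexamples has orthonormal frames with a
  convergent subsequence, whose limit contradicts it. The mean curvature and the boundary arise from
  Lebesgue decompositions, so an inequality for a single field requires outer regularity of the
  measures. The blow-up set is defined by distance balls, which must be shown to be open and
  arbitrarily small before closedness and mass bounds become topological. Finally, total variation
  tests only fields of length at most 1, whence a normalising factor in the field.\<close>

abbreviation fd :: "('b::real_normed_vector \<Rightarrow> 'c::real_normed_vector) \<Rightarrow> 'b \<Rightarrow> 'b \<Rightarrow> 'c" where
  "fd f x \<equiv> frechet_derivative f (at x)"

section \<open>Rules for the class C^1 and for directional derivatives\<close>

lemma Ck_on_1_iff:
  "Ck_on 1 S f \<longleftrightarrow> (\<forall>x\<in>S. f differentiable (at x)) \<and> (\<forall>v. continuous_on S (\<lambda>x. fd f x v))"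
  by simp

lemma Ck_on_2_iff:
  "Ck_on 2 S f \<longleftrightarrow> (\<forall>x\<in>S. f differentiable (at x)) \<and> (\<forall>v. Ck_on 1 S (\<lambda>x. fd f x v))"
  by (simp add: numeral_2_eq_2)

lemma fd_works: "f differentiable (at x) \<Longrightarrow> (f has_derivative fd f x) (at x)"
  by (simp add: frechet_derivative_works)

lemma fd_eq: "(f has_derivative f') (at x) \<Longrightarrow> fd f x = f'"
  using frechet_derivative_at by metis

lemma fd_linear: "f differentiable (at x) \<Longrightarrow> linear (fd f x)"
  using fd_works has_derivative_linear by blast

lemma has_derivative_cong_open:
  assumes "(f has_derivative f') (at x)" "open S" "x \<in> S" "\<And>y. y \<in> S \<Longrightarrow> f y = g y"
  shows "(g has_derivative f') (at x)"
  using has_derivative_transform_within_open[OF assms(1-3)] assms(4) by blast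

lemma fd_cong_open:
  assumes "f differentiable (at x)" "open S" "x \<in> S" "\<And>y. y \<in> S \<Longrightarrow> f y = g y"
  shows "g differentiable (at x)" "fd g x = fd f x"
  using has_derivative_cong_open[OF fd_works[OF assms(1)] assms(2-4)] fd_eq
  by (auto simp: differentiable_def)

text \<open>A proof of class C^1 then only has to exhibit a candidate derivative, which equals
  \<open>fd\<close> by uniqueness.\<close>

lemma Ck_on_1I:
  assumes "\<And>x. x \<in> S \<Longrightarrow> (f has_derivative f' x) (at x)" "\<And>v. continuous_on S (\<lambda>x. f' x v)"
  shows "Ck_on 1 S f"
proof -
  have "continuous_on S (\<lambda>x. fd f x v)" for v
    using assms(2)[of v] by (rule continuous_on_eq) (simp add: fd_eq[OF assms(1)])
  then show ?thesis using assms(1) by (auto simp: Ck_on_1_iff differentiable_def)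
qed

lemma Ck_on_1_cong:
  assumes "Ck_on 1 S f" "open S" "\<And>y. y \<in> S \<Longrightarrow> f y = g y"
  shows "Ck_on 1 S g"
  by (rule Ck_on_1I[where f'="fd f"])
    (use assms in \<open>auto simp: Ck_on_1_iff intro: has_derivative_cong_open[OF fd_works]\<close>)

lemma Ck_on_1_subset: "Ck_on 1 S f \<Longrightarrow> T \<subseteq> S \<Longrightarrow> Ck_on 1 T f"
  unfolding Ck_on_1_iff by (meson continuous_on_subset subset_iff)

lemma Ck_on_1_diff: "Ck_on 1 S f \<Longrightarrow> x \<in> S \<Longrightarrow> f differentiable (at x)"
  by (simp add: Ck_on_1_iff)

lemma Ck_on_1_continuous: "Ck_on 1 S f \<Longrightarrow> continuous_on S f"
  by (meson Ck_on_1_diff continuous_at_imp_continuous_on differentiable_imp_continuous_within)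

lemma Ck_on_1_fd_continuous: "Ck_on 1 S f \<Longrightarrow> continuous_on S (\<lambda>x. fd f x v)"
  by (simp add: Ck_on_1_iff)

text \<open>Families of linear or bilinear maps occur below as plain functions, known only for each
  fixed argument. Expansion over the standard basis reduces continuity, differentiability and limits
  with moving arguments to finite sums of such fixed entries.\<close>

lemma linear_expand:
  fixes f :: "'e::euclidean_space \<Rightarrow> 'c::real_vector"
  assumes "linear f" shows "f u = (\<Sum>a\<in>Basis. (u \<bullet> a) *\<^sub>R f a)"
proof -
  have "f u = f (\<Sum>a\<in>Basis. (u \<bullet> a) *\<^sub>R a)" by (simp add: euclidean_representation)
  also have "\<dots> = (\<Sum>a\<in>Basis. (u \<bullet> a) *\<^sub>R f a)"
    by (simp add: linear_sum[OF assms] linear_scale[OF assms])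
  finally show ?thesis .
qed

lemma bilinear_expand:
  fixes B :: "'e::euclidean_space \<Rightarrow> 'e \<Rightarrow> real"
  assumes "bilinear B" shows "B u v = (\<Sum>a\<in>Basis. \<Sum>b\<in>Basis. (u \<bullet> a) * (v \<bullet> b) * B a b)"
proof -
  have l: "linear (\<lambda>u. B u v)" and r: "\<And>u. linear (B u)"
    using assms by (auto simp: bilinear_def)
  show ?thesis
    by (subst linear_expand[OF l], rule sum.cong[OF refl], subst linear_expand[OF r])
      (simp add: sum_distrib_left mult.assoc)
qed

lemma continuous_on_linear_apply:
  fixes u :: "'a::topological_space \<Rightarrow> 'e::euclidean_space"
    and L :: "'a \<Rightarrow> 'e \<Rightarrow> 'c::real_normed_vector"
  assumes "\<And>x. x \<in> S \<Longrightarrow> linear (L x)" "\<And>v. continuous_on S (\<lambda>x. L x v)" "continuous_on S u"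
  shows "continuous_on S (\<lambda>x. L x (u x))"
proof (rule continuous_on_eq)
  show "continuous_on S (\<lambda>x. \<Sum>a\<in>Basis. (u x \<bullet> a) *\<^sub>R L x a)"
    using assms(2,3) by (intro continuous_intros)
qed (simp add: linear_expand[OF assms(1), symmetric])

lemma continuous_on_bilinear_apply:
  fixes u v :: "'a::topological_space \<Rightarrow> 'e::euclidean_space"
    and B :: "'a \<Rightarrow> 'e \<Rightarrow> 'e \<Rightarrow> real"
  assumes "\<And>x. x \<in> S \<Longrightarrow> bilinear (B x)" "\<And>a b. continuous_on S (\<lambda>x. B x a b)"
    "continuous_on S u" "continuous_on S v"
  shows "continuous_on S (\<lambda>x. B x (u x) (v x))"
proof (rule continuous_on_eq)
  show "continuous_on S (\<lambda>x. \<Sum>a\<in>Basis. \<Sum>b\<in>Basis. (u x \<bullet> a) * (v x \<bullet> b) * B x a b)"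
    using assms(2-4) by (intro continuous_intros)
qed (simp add: bilinear_expand[OF assms(1), symmetric])

lemma Ck_on_1_compose:
  fixes u :: "'b::real_normed_vector \<Rightarrow> 'e::euclidean_space"
  assumes g: "Ck_on 1 T g" and u: "Ck_on 1 S u" and "u ` S \<subseteq> T"
  shows "Ck_on 1 S (\<lambda>x. g (u x))"
proof (rule Ck_on_1I)
  fix x assume x: "x \<in> S"
  then have "(g has_derivative fd g (u x)) (at (u x))"
    using assms by (auto intro!: fd_works Ck_on_1_diff)
  from has_derivative_compose[OF fd_works[OF Ck_on_1_diff[OF u x]] this]
  show "((\<lambda>x. g (u x)) has_derivative (\<lambda>h. fd g (u x) (fd u x h))) (at x)" .
next
  fix v
  show "continuous_on S (\<lambda>x. fd g (u x) (fd u x v))"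
  proof (rule continuous_on_linear_apply)
    show "linear (fd g (u x))" if "x \<in> S" for x
      using that assms by (auto intro!: fd_linear Ck_on_1_diff)
    show "continuous_on S (\<lambda>x. fd g (u x) v)" for v
      using continuous_on_compose2[OF Ck_on_1_fd_continuous[OF g] Ck_on_1_continuous[OF u] assms(3)] .
    show "continuous_on S (\<lambda>x. fd u x v)"
      by (rule Ck_on_1_fd_continuous[OF u])
  qed
qed

lemma Ck_on_1_scaleR:
  fixes f :: "'b::real_normed_vector \<Rightarrow> real" and g :: "'b \<Rightarrow> 'c::real_normed_vector"
  assumes f: "Ck_on 1 S f" and g: "Ck_on 1 S g"
  shows "Ck_on 1 S (\<lambda>x. f x *\<^sub>R g x)"
proof (rule Ck_on_1I)
  show "((\<lambda>x. f x *\<^sub>R g x) has_derivative (\<lambda>h. f x *\<^sub>R fd g x h + fd f x h *\<^sub>R g x)) (at x)"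
    if "x \<in> S" for x
    using fd_works[OF Ck_on_1_diff[OF f that]] fd_works[OF Ck_on_1_diff[OF g that]]
    by (rule has_derivative_scaleR)
  show "continuous_on S (\<lambda>x. f x *\<^sub>R fd g x v + fd f x v *\<^sub>R g x)" for v
    using f g by (intro continuous_intros Ck_on_1_continuous Ck_on_1_fd_continuous)
qed

lemma Ck_on_1_mult:
  fixes f g :: "'b::real_normed_vector \<Rightarrow> real"
  assumes "Ck_on 1 S f" "Ck_on 1 S g"
  shows "Ck_on 1 S (\<lambda>x. f x * g x)"
  using Ck_on_1_scaleR[OF assms] by simp

lemma Ck_on_1_diff_fun:
  assumes f: "Ck_on 1 S f" and g: "Ck_on 1 S g"
  shows "Ck_on 1 S (\<lambda>x. f x - g x)"
proof (rule Ck_on_1I)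
  show "((\<lambda>x. f x - g x) has_derivative (\<lambda>h. fd f x h - fd g x h)) (at x)"
    if "x \<in> S" for x
    using fd_works[OF Ck_on_1_diff[OF f that]] fd_works[OF Ck_on_1_diff[OF g that]]
    by (rule has_derivative_diff)
  show "continuous_on S (\<lambda>x. fd f x v - fd g x v)" for v
    using f g by (intro continuous_intros Ck_on_1_fd_continuous)
qed

lemma Ck_on_1_const: "Ck_on 1 S (\<lambda>x. a)"
  by (rule Ck_on_1I[where f'="\<lambda>x h. 0"]) auto

lemma Ck_on_2_imp_1: "Ck_on 2 S f \<Longrightarrow> Ck_on 1 S f"
  using Ck_on_1_continuous by (fastforce simp: Ck_on_1_iff Ck_on_2_iff)

lemma Ck_on_2D1: "Ck_on 2 S f \<Longrightarrow> Ck_on 1 S (\<lambda>x. fd f x v)"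
  by (simp add: Ck_on_2_iff)

text \<open>Product rule with three factors, the form itself being one of them. The matrix entries
  are differentiated as scalar functions, and the first summand of the result is the derivative of
  the form with its arguments frozen at \<open>x\<close>.\<close>

lemma bilinear_form_has_derivative:
  fixes u v :: "'b::real_normed_vector \<Rightarrow> 'e::euclidean_space"
    and G :: "'b \<Rightarrow> 'e \<Rightarrow> 'e \<Rightarrow> real"
  assumes S: "open S" "x \<in> S" and bil: "\<And>y. y \<in> S \<Longrightarrow> bilinear (G y)"
    and dG: "\<And>a b. (\<lambda>y. G y a b) differentiable (at x)"
    and u: "(u has_derivative u') (at x)" and v: "(v has_derivative v') (at x)"
  shows "((\<lambda>y. G y (u y) (v y)) has_derivative
    (\<lambda>h. fd (\<lambda>y. G y (u x) (v x)) x h + G x (u' h) (v x) + G x (u x) (v' h))) (at x)"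
proof -
  have dG': "((\<lambda>y. G y a b) has_derivative fd (\<lambda>y. G y a b) x) (at x)" for a b
    using fd_works[OF dG] .
  have ex: "fd (\<lambda>y. G y p q) x h = (\<Sum>a\<in>Basis. \<Sum>b\<in>Basis. (p \<bullet> a) * (q \<bullet> b) * fd (\<lambda>y. G y a b) x h)"
    for p q h
  proof -
    have "((\<lambda>y. \<Sum>a\<in>Basis. \<Sum>b\<in>Basis. (p \<bullet> a) * (q \<bullet> b) * G y a b) has_derivative
      (\<lambda>h. \<Sum>a\<in>Basis. \<Sum>b\<in>Basis. (p \<bullet> a) * (q \<bullet> b) * fd (\<lambda>y. G y a b) x h)) (at x)"
      by (intro has_derivative_sum has_derivative_mult_right dG')
    then have "((\<lambda>y. G y p q) has_derivative
      (\<lambda>h. \<Sum>a\<in>Basis. \<Sum>b\<in>Basis. (p \<bullet> a) * (q \<bullet> b) * fd (\<lambda>y. G y a b) x h)) (at x)"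
      by (rule has_derivative_cong_open[OF _ S]) (simp add: bilinear_expand[OF bil, symmetric])
    then show ?thesis by (simp add: fd_eq)
  qed
  have "((\<lambda>y. \<Sum>a\<in>Basis. \<Sum>b\<in>Basis. ((u y \<bullet> a) * (v y \<bullet> b)) * G y a b) has_derivative
     (\<lambda>h. \<Sum>a\<in>Basis. \<Sum>b\<in>Basis. ((u x \<bullet> a) * (v x \<bullet> b)) * fd (\<lambda>y. G y a b) x h
       + ((u x \<bullet> a) * (v' h \<bullet> b) + (u' h \<bullet> a) * (v x \<bullet> b)) * G x a b)) (at x)"
    by (intro has_derivative_sum has_derivative_mult dG' has_derivative_inner_left u v)
  then have "((\<lambda>y. G y (u y) (v y)) has_derivative
     (\<lambda>h. \<Sum>a\<in>Basis. \<Sum>b\<in>Basis. ((u x \<bullet> a) * (v x \<bullet> b)) * fd (\<lambda>y. G y a b) x h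
       + ((u x \<bullet> a) * (v' h \<bullet> b) + (u' h \<bullet> a) * (v x \<bullet> b)) * G x a b)) (at x)"
    by (rule has_derivative_cong_open[OF _ S]) (simp add: bilinear_expand[OF bil, symmetric])
  moreover have "(\<Sum>a\<in>Basis. \<Sum>b\<in>Basis. ((u x \<bullet> a) * (v x \<bullet> b)) * fd (\<lambda>y. G y a b) x h
       + ((u x \<bullet> a) * (v' h \<bullet> b) + (u' h \<bullet> a) * (v x \<bullet> b)) * G x a b)
     = fd (\<lambda>y. G y (u x) (v x)) x h + G x (u' h) (v x) + G x (u x) (v' h)" for h
    unfolding ex[of "u x" "v x" h] bilinear_expand[OF bil[OF S(2)], of "u' h" "v x"]
      bilinear_expand[OF bil[OF S(2)], of "u x" "v' h"]
    by (simp add: sum.distrib distrib_right add.commute add.left_commute)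
  ultimately show ?thesis by simp
qed

lemma linear_apply_has_derivative:
  fixes L :: "'b::real_normed_vector \<Rightarrow> 'e::euclidean_space \<Rightarrow> 'c::real_normed_vector"
  assumes S: "open S" "x \<in> S" and lin: "\<And>y. y \<in> S \<Longrightarrow> linear (L y)"
    and dL: "\<And>a. (\<lambda>y. L y a) differentiable (at x)" and u: "(u has_derivative u') (at x)"
  shows "((\<lambda>y. L y (u y)) has_derivative (\<lambda>h. fd (\<lambda>y. L y (u x)) x h + L x (u' h))) (at x)"
proof -
  have dL': "((\<lambda>y. L y a) has_derivative fd (\<lambda>y. L y a) x) (at x)" for a
    using fd_works[OF dL] .
  have ex: "fd (\<lambda>y. L y p) x h = (\<Sum>a\<in>Basis. (p \<bullet> a) *\<^sub>R fd (\<lambda>y. L y a) x h)" for p h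
  proof -
    have "((\<lambda>y. \<Sum>a\<in>Basis. (p \<bullet> a) *\<^sub>R L y a) has_derivative
      (\<lambda>h. \<Sum>a\<in>Basis. (p \<bullet> a) *\<^sub>R fd (\<lambda>y. L y a) x h)) (at x)"
      by (intro has_derivative_sum has_derivative_scaleR_right dL')
    then have "((\<lambda>y. L y p) has_derivative (\<lambda>h. \<Sum>a\<in>Basis. (p \<bullet> a) *\<^sub>R fd (\<lambda>y. L y a) x h)) (at x)"
      by (rule has_derivative_cong_open[OF _ S]) (simp add: linear_expand[OF lin, symmetric])
    then show ?thesis by (simp add: fd_eq)
  qed
  have "((\<lambda>y. \<Sum>a\<in>Basis. (u y \<bullet> a) *\<^sub>R L y a) has_derivative
     (\<lambda>h. \<Sum>a\<in>Basis. (u x \<bullet> a) *\<^sub>R fd (\<lambda>y. L y a) x h + (u' h \<bullet> a) *\<^sub>R L x a)) (at x)"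
    by (intro has_derivative_sum has_derivative_scaleR dL' has_derivative_inner_left u)
  then have "((\<lambda>y. L y (u y)) has_derivative
     (\<lambda>h. \<Sum>a\<in>Basis. (u x \<bullet> a) *\<^sub>R fd (\<lambda>y. L y a) x h + (u' h \<bullet> a) *\<^sub>R L x a)) (at x)"
    by (rule has_derivative_cong_open[OF _ S]) (simp add: linear_expand[OF lin, symmetric])
  moreover have "(\<Sum>a\<in>Basis. (u x \<bullet> a) *\<^sub>R fd (\<lambda>y. L y a) x h + (u' h \<bullet> a) *\<^sub>R L x a)
     = fd (\<lambda>y. L y (u x)) x h + L x (u' h)" for h
    unfolding ex[of "u x" h] linear_expand[OF lin[OF S(2)], of "u' h"] by (simp add: sum.distrib)
  ultimately show ?thesis by simp
qed

text \<open>Differentiation in \<open>y\<close> commutes with the linear relations between entries.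
  This is what makes the Koszul expression linear in each of its arguments.\<close>

lemma bilinear_fd:
  fixes G :: "'b::real_normed_vector \<Rightarrow> 'e::euclidean_space \<Rightarrow> 'e \<Rightarrow> real"
  assumes S: "open S" "x \<in> S" and bil: "\<And>y. y \<in> S \<Longrightarrow> bilinear (G y)"
    and dG: "\<And>a b. (\<lambda>y. G y a b) differentiable (at x)"
  shows "bilinear (\<lambda>a b. fd (\<lambda>y. G y a b) x h)"
proof -
  have d: "((\<lambda>y. G y a b) has_derivative fd (\<lambda>y. G y a b) x) (at x)" for a b
    using fd_works[OF dG] .
  have add1: "fd (\<lambda>y. G y (a + a') b) x h = fd (\<lambda>y. G y a b) x h + fd (\<lambda>y. G y a' b) x h" for a a' b
  proof -
    have "((\<lambda>y. G y (a + a') b) has_derivative (\<lambda>h. fd (\<lambda>y. G y a b) x h + fd (\<lambda>y. G y a' b) x h)) (at x)"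
      by (rule has_derivative_cong_open[OF has_derivative_add[OF d d] S]) (simp add: bilinear_ladd[OF bil])
    then show ?thesis by (simp add: fd_eq)
  qed
  have add2: "fd (\<lambda>y. G y b (a + a')) x h = fd (\<lambda>y. G y b a) x h + fd (\<lambda>y. G y b a') x h" for a a' b
  proof -
    have "((\<lambda>y. G y b (a + a')) has_derivative (\<lambda>h. fd (\<lambda>y. G y b a) x h + fd (\<lambda>y. G y b a') x h)) (at x)"
      by (rule has_derivative_cong_open[OF has_derivative_add[OF d d] S]) (simp add: bilinear_radd[OF bil])
    then show ?thesis by (simp add: fd_eq)
  qed
  have sc1: "fd (\<lambda>y. G y (r *\<^sub>R a) b) x h = r * fd (\<lambda>y. G y a b) x h" for r a b
  proof -
    have "((\<lambda>y. G y (r *\<^sub>R a) b) has_derivative (\<lambda>h. r * fd (\<lambda>y. G y a b) x h)) (at x)"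
      by (rule has_derivative_cong_open[OF has_derivative_mult_right[OF d] S])
        (simp add: bilinear_lmul[OF bil])
    then show ?thesis by (simp add: fd_eq)
  qed
  have sc2: "fd (\<lambda>y. G y a (r *\<^sub>R b)) x h = r * fd (\<lambda>y. G y a b) x h" for r a b
  proof -
    have "((\<lambda>y. G y a (r *\<^sub>R b)) has_derivative (\<lambda>h. r * fd (\<lambda>y. G y a b) x h)) (at x)"
      by (rule has_derivative_cong_open[OF has_derivative_mult_right[OF d] S])
        (simp add: bilinear_rmul[OF bil])
    then show ?thesis by (simp add: fd_eq)
  qed
  show ?thesis
    unfolding bilinear_def by (auto intro!: linearI simp: add1 add2 sc1 sc2)
qed

text \<open>Schwarz's theorem: both mixed derivatives are limits of the same second difference quotient.\<close>

lemma second_difference: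
  fixes f :: "'b::real_normed_vector \<Rightarrow> real"
  assumes f: "Ck_on 2 S f" and t: "t > 0"
    and sub: "\<And>s r. 0 \<le> s \<Longrightarrow> s \<le> t \<Longrightarrow> 0 \<le> r \<Longrightarrow> r \<le> t \<Longrightarrow> x + s *\<^sub>R v + r *\<^sub>R w \<in> S"
  shows "\<exists>s r. 0 < s \<and> s < t \<and> 0 < r \<and> r < t \<and>
    f (x + t *\<^sub>R v + t *\<^sub>R w) - f (x + t *\<^sub>R v) - f (x + t *\<^sub>R w) + f x
      = t * (t * fd (\<lambda>z. fd f z v) (x + s *\<^sub>R v + r *\<^sub>R w) w)"
proof -
  have d: "f differentiable (at y)" if "y \<in> S" for y
    using f that by (simp add: Ck_on_2_iff)
  have d1: "((\<lambda>s. f (x + s *\<^sub>R v + r *\<^sub>R w)) has_real_derivative fd f (x + s *\<^sub>R v + r *\<^sub>R w) v) (at s)"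
    if "0 \<le> s" "s \<le> t" "0 \<le> r" "r \<le> t" for s r
  proof -
    have "((\<lambda>s. x + s *\<^sub>R v + r *\<^sub>R w) has_derivative (\<lambda>h. h *\<^sub>R v)) (at s)"
      by (auto intro!: derivative_eq_intros)
    from has_derivative_compose[OF this fd_works[OF d[OF sub[OF that]]]]
    show ?thesis
      by (simp add: has_field_derivative_def linear_scale[OF fd_linear[OF d[OF sub[OF that]]]] mult_commute_abs)
  qed
  have d2: "((\<lambda>r. fd f (x + s *\<^sub>R v + r *\<^sub>R w) v) has_real_derivative
      fd (\<lambda>z. fd f z v) (x + s *\<^sub>R v + r *\<^sub>R w) w) (at r)"
    if "0 \<le> s" "s \<le> t" "0 \<le> r" "r \<le> t" for s r
  proof -
    have D: "(\<lambda>z. fd f z v) differentiable (at (x + s *\<^sub>R v + r *\<^sub>R w))"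
      using Ck_on_1_diff[OF Ck_on_2D1[OF f] sub[OF that]] .
    have "((\<lambda>r. x + s *\<^sub>R v + r *\<^sub>R w) has_derivative (\<lambda>h. h *\<^sub>R w)) (at r)"
      by (auto intro!: derivative_eq_intros)
    from has_derivative_compose[OF this fd_works[OF D]]
    show ?thesis
      by (simp add: has_field_derivative_def linear_scale[OF fd_linear[OF D]] mult_commute_abs)
  qed
  \<comment> \<open>The mean value theorem in direction \<open>v\<close> for this difference of
    parallel translates leaves a difference of first derivatives, to which the mean value theorem in
    direction \<open>w\<close> applies.\<close>
  define \<phi> where "\<phi> s = f (x + s *\<^sub>R v + t *\<^sub>R w) - f (x + s *\<^sub>R v + 0 *\<^sub>R w)" for s
  have "\<exists>s>0. s < t \<and> \<phi> t - \<phi> 0 = (t - 0) * (fd f (x + s *\<^sub>R v + t *\<^sub>R w) v - fd f (x + s *\<^sub>R v + 0 *\<^sub>R w) v)"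
    unfolding \<phi>_def using t by (intro MVT2 DERIV_diff d1) auto
  then obtain s where s: "0 < s" "s < t"
    "\<phi> t - \<phi> 0 = t * (fd f (x + s *\<^sub>R v + t *\<^sub>R w) v - fd f (x + s *\<^sub>R v + 0 *\<^sub>R w) v)" by auto
  have "\<exists>r>0. r < t \<and> fd f (x + s *\<^sub>R v + t *\<^sub>R w) v - fd f (x + s *\<^sub>R v + 0 *\<^sub>R w) v
      = (t - 0) * fd (\<lambda>z. fd f z v) (x + s *\<^sub>R v + r *\<^sub>R w) w"
    using t s by (intro MVT2 d2) auto
  then obtain r where "0 < r" "r < t" "fd f (x + s *\<^sub>R v + t *\<^sub>R w) v - fd f (x + s *\<^sub>R v + 0 *\<^sub>R w) v
      = t * fd (\<lambda>z. fd f z v) (x + s *\<^sub>R v + r *\<^sub>R w) w" by auto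
  then show ?thesis using s
    by (intro exI[of _ s] exI[of _ r]) (simp add: \<phi>_def algebra_simps)
qed

lemma second_derivative_symmetric_real:
  fixes f :: "'b::real_normed_vector \<Rightarrow> real"
  assumes f: "Ck_on 2 S f" and S: "open S" "x \<in> S"
  shows "fd (\<lambda>z. fd f z v) x w = fd (\<lambda>z. fd f z w) x v"
proof (rule ccontr)
  assume ne: "\<not> ?thesis"
  \<comment> \<open>Half the supposed gap: numbers within \<open>e\<close> of the two mixed
    derivatives cannot coincide, yet the second difference will make them equal.\<close>
  define e where "e = \<bar>fd (\<lambda>z. fd f z v) x w - fd (\<lambda>z. fd f z w) x v\<bar> / 2"
  have e: "e > 0" using ne by (simp add: e_def)
  have c: "continuous_on S (\<lambda>y. fd (\<lambda>z. fd f z a) y b)" for a b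
    using Ck_on_1_fd_continuous[OF Ck_on_2D1[OF f]] .
  have lim: "\<forall>\<^sub>F y in nhds x. dist (fd (\<lambda>z. fd f z a) y b) (fd (\<lambda>z. fd f z a) x b) < e" for a b
  proof -
    have "isCont (\<lambda>y. fd (\<lambda>z. fd f z a) y b) x"
      using c[of a b] S by (simp add: continuous_on_eq_continuous_at)
    then have "((\<lambda>y. fd (\<lambda>z. fd f z a) y b) \<longlongrightarrow> fd (\<lambda>z. fd f z a) x b) (nhds x)"
      unfolding isCont_def by (rule tendsto_at_iff_tendsto_nhds[THEN iffD1])
    from tendstoD[OF this e] show ?thesis .
  qed
  have "\<forall>\<^sub>F y in nhds x. y \<in> S \<and> dist (fd (\<lambda>z. fd f z v) y w) (fd (\<lambda>z. fd f z v) x w) < e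
     \<and> dist (fd (\<lambda>z. fd f z w) y v) (fd (\<lambda>z. fd f z w) x v) < e"
    using lim[of v w] lim[of w v] eventually_nhds_in_open[OF S] by eventually_elim auto
  then obtain \<delta> where \<delta>: "\<delta> > 0" and near: "\<And>y. dist y x < \<delta> \<Longrightarrow> y \<in> S
     \<and> dist (fd (\<lambda>z. fd f z v) y w) (fd (\<lambda>z. fd f z v) x w) < e
     \<and> dist (fd (\<lambda>z. fd f z w) y v) (fd (\<lambda>z. fd f z w) x v) < e"
    unfolding eventually_nhds_metric by blast
  \<comment> \<open>Small enough for the whole parallelogram with sides along \<open>v\<close> and
    \<open>w\<close> to stay in the \<delta>-ball; the summand 1 avoids a zero denominator when both
    vectors vanish.\<close>
  define t where "t = \<delta> / (2 * (norm v + norm w + 1))"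
  have t: "t > 0" using \<delta> by (simp add: t_def add_nonneg_pos)
  have td: "t * (norm v + norm w) < \<delta>"
  proof -
    have "norm v + norm w + 1 > 0" by (simp add: add_nonneg_pos)
    then have eq: "t * (norm v + norm w + 1) = \<delta> / 2" by (simp add: t_def divide_simps)
    have "t * (norm v + norm w) \<le> t * (norm v + norm w + 1)" using t by simp
    also note eq
    finally show ?thesis using \<delta> by simp
  qed
  have ball: "dist (x + s *\<^sub>R v + r *\<^sub>R w) x < \<delta>" if "0 \<le> s" "s \<le> t" "0 \<le> r" "r \<le> t" for s r
  proof -
    have "dist (x + s *\<^sub>R v + r *\<^sub>R w) x \<le> norm (s *\<^sub>R v) + norm (r *\<^sub>R w)"
      using norm_triangle_ineq[of "s *\<^sub>R v" "r *\<^sub>R w"] by (simp add: dist_norm add.assoc)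
    also have "\<dots> \<le> t * norm v + t * norm w"
      using that by (auto intro!: add_mono mult_right_mono)
    finally show ?thesis using td by (simp add: distrib_left)
  qed
  have ball': "dist (x + r *\<^sub>R w + s *\<^sub>R v) x < \<delta>" if "0 \<le> s" "s \<le> t" "0 \<le> r" "r \<le> t" for s r
    using ball[OF that] by (simp add: ac_simps)
  obtain s r where 1: "0 < s" "s < t" "0 < r" "r < t"
    "f (x + t *\<^sub>R v + t *\<^sub>R w) - f (x + t *\<^sub>R v) - f (x + t *\<^sub>R w) + f x
      = t * (t * fd (\<lambda>z. fd f z v) (x + s *\<^sub>R v + r *\<^sub>R w) w)"
    using second_difference[OF f t, of x v w] near ball by blast
  obtain s' r' where 2: "0 < s'" "s' < t" "0 < r'" "r' < t"
    "f (x + t *\<^sub>R w + t *\<^sub>R v) - f (x + t *\<^sub>R w) - f (x + t *\<^sub>R v) + f x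
      = t * (t * fd (\<lambda>z. fd f z w) (x + s' *\<^sub>R w + r' *\<^sub>R v) v)"
    using second_difference[OF f t, of x w v] near ball' by blast
  have "t * (t * fd (\<lambda>z. fd f z v) (x + s *\<^sub>R v + r *\<^sub>R w) w)
      = t * (t * fd (\<lambda>z. fd f z w) (x + s' *\<^sub>R w + r' *\<^sub>R v) v)"
    unfolding 1(5)[symmetric] 2(5)[symmetric] by (simp add: ac_simps)
  then have "fd (\<lambda>z. fd f z v) (x + s *\<^sub>R v + r *\<^sub>R w) w = fd (\<lambda>z. fd f z w) (x + s' *\<^sub>R w + r' *\<^sub>R v) v"
    using t by simp
  moreover have "dist (fd (\<lambda>z. fd f z v) (x + s *\<^sub>R v + r *\<^sub>R w) w) (fd (\<lambda>z. fd f z v) x w) < e"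
    using near ball[of s r] 1 by simp
  moreover have "dist (fd (\<lambda>z. fd f z w) (x + s' *\<^sub>R w + r' *\<^sub>R v) v) (fd (\<lambda>z. fd f z w) x v) < e"
    using near ball'[of r' s'] 2 by simp
  moreover have "False" if "\<bar>q - a\<bar> < \<bar>a - b\<bar> / 2" "\<bar>q - b\<bar> < \<bar>a - b\<bar> / 2" for q a b :: real
    using that by (auto simp: abs_if split: if_splits)
  ultimately show False unfolding e_def dist_real_def by metis
qed

lemma second_derivative_symmetric:
  fixes f :: "'b::real_normed_vector \<Rightarrow> 'c::euclidean_space"
  assumes f: "Ck_on 2 S f" and S: "open S" "x \<in> S"
  shows "fd (\<lambda>z. fd f z v) x w = fd (\<lambda>z. fd f z w) x v"
proof (rule euclidean_eqI)
  fix b :: 'c assume "b \<in> Basis"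
  have inner: "((\<lambda>z. g z \<bullet> b) has_derivative (\<lambda>h. fd g y h \<bullet> b)) (at y)"
    if "g differentiable (at y)" for g :: "'b \<Rightarrow> 'c" and y
    using fd_works[OF that] by (rule has_derivative_inner_left)
  have C1: "Ck_on 1 S (\<lambda>z. g z \<bullet> b)" if "Ck_on 1 S g" for g :: "'b \<Rightarrow> 'c"
  proof (rule Ck_on_1I[where f'="\<lambda>x h. fd g x h \<bullet> b"])
    show "((\<lambda>z. g z \<bullet> b) has_derivative (\<lambda>h. fd g y h \<bullet> b)) (at y)" if "y \<in> S" for y
      using inner[OF Ck_on_1_diff[OF \<open>Ck_on 1 S g\<close> that]] .
    show "continuous_on S (\<lambda>x. fd g x v \<bullet> b)" for v
      using that by (intro continuous_intros Ck_on_1_fd_continuous)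
  qed
  have d: "f differentiable (at y)" if "y \<in> S" for y using f that by (simp add: Ck_on_2_iff)
  have fdf: "fd (\<lambda>z. f z \<bullet> b) y h = fd f y h \<bullet> b" if "y \<in> S" for y h
    using inner[OF d[OF that]] by (simp add: fd_eq)
  have d1: "(\<lambda>z. fd f z h) differentiable (at y)" if "y \<in> S" for y h
    using Ck_on_1_diff[OF Ck_on_2D1[OF f] that] .
  have "Ck_on 2 S (\<lambda>z. f z \<bullet> b)"
    unfolding Ck_on_2_iff
  proof (intro conjI ballI allI)
    show "(\<lambda>z. f z \<bullet> b) differentiable (at y)" if "y \<in> S" for y
      using inner[OF d[OF that]] by (auto simp: differentiable_def)
    show "Ck_on 1 S (\<lambda>x. fd (\<lambda>z. f z \<bullet> b) x v)" for v
      by (rule Ck_on_1_cong[OF C1[OF Ck_on_2D1[OF f, of v]] S(1)]) (simp add: fdf)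
  qed
  from second_derivative_symmetric_real[OF this S]
  have "fd (\<lambda>z. fd (\<lambda>z. f z \<bullet> b) z v) x w = fd (\<lambda>z. fd (\<lambda>z. f z \<bullet> b) z w) x v" .
  moreover have "fd (\<lambda>z. fd (\<lambda>z. f z \<bullet> b) z p) x q = fd (\<lambda>z. fd f z p) x q \<bullet> b" for p q
  proof -
    have "((\<lambda>z. fd (\<lambda>z. f z \<bullet> b) z p) has_derivative (\<lambda>h. fd (\<lambda>z. fd f z p) x h \<bullet> b)) (at x)"
      by (rule has_derivative_cong_open[OF inner[OF d1[OF S(2)]] S]) (simp add: fdf)
    then show ?thesis by (simp add: fd_eq)
  qed
  ultimately show "fd (\<lambda>z. fd f z v) x w \<bullet> b = fd (\<lambda>z. fd f z w) x v \<bullet> b" by simp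
qed

lemma Ck_on_2_second_linear:
  fixes f :: "'b::real_normed_vector \<Rightarrow> 'c::real_normed_vector"
  assumes f: "Ck_on 2 S f" and S: "open S" "x \<in> S"
  shows "bilinear (\<lambda>v w. fd (\<lambda>z. fd f z v) x w)"
proof -
  have d: "f differentiable (at y)" if "y \<in> S" for y using f that by (simp add: Ck_on_2_iff)
  have d1: "((\<lambda>z. fd f z h) has_derivative fd (\<lambda>z. fd f z h) x) (at x)" for h
    using fd_works[OF Ck_on_1_diff[OF Ck_on_2D1[OF f] S(2)]] .
  have "fd (\<lambda>z. fd f z (a + b)) x w = fd (\<lambda>z. fd f z a) x w + fd (\<lambda>z. fd f z b) x w" for a b w
  proof -
    have "((\<lambda>z. fd f z (a + b)) has_derivative (\<lambda>w. fd (\<lambda>z. fd f z a) x w + fd (\<lambda>z. fd f z b) x w)) (at x)"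
      by (rule has_derivative_cong_open[OF has_derivative_add[OF d1 d1] S])
        (simp add: linear_add[OF fd_linear[OF d]])
    then show ?thesis by (simp add: fd_eq)
  qed
  moreover have "fd (\<lambda>z. fd f z (r *\<^sub>R a)) x w = r *\<^sub>R fd (\<lambda>z. fd f z a) x w" for a r w
  proof -
    have "((\<lambda>z. fd f z (r *\<^sub>R a)) has_derivative (\<lambda>w. r *\<^sub>R fd (\<lambda>z. fd f z a) x w)) (at x)"
      by (rule has_derivative_cong_open[OF has_derivative_scaleR_right[OF d1] S])
        (simp add: linear_scale[OF fd_linear[OF d]])
    then show ?thesis by (simp add: fd_eq)
  qed
  ultimately show ?thesis
    unfolding bilinear_def
    by (auto intro!: linearI simp: linear_add[OF has_derivative_linear[OF d1]] linear_scale[OF has_derivative_linear[OF d1]])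
qed

section \<open>Positive definite forms and the Riesz representation\<close>

definition inner_form :: "('e::euclidean_space \<Rightarrow> 'e \<Rightarrow> real) \<Rightarrow> bool" where
  "inner_form G \<longleftrightarrow> bilinear G \<and> (\<forall>u v. G u v = G v u) \<and> (\<forall>u. u \<noteq> 0 \<longrightarrow> G u u > 0)"

lemma inner_formD:
  assumes "inner_form G"
  shows "bilinear G" "G u v = G v u" "u \<noteq> 0 \<Longrightarrow> G u u > 0" "G u u \<ge> 0" "G u u = 0 \<longleftrightarrow> u = 0"
proof -
  show b: "bilinear G" "G u v = G v u" and p: "u \<noteq> 0 \<Longrightarrow> G u u > 0"
    using assms by (auto simp: inner_form_def)
  show "G u u \<ge> 0" "G u u = 0 \<longleftrightarrow> u = 0"
    using p bilinear_lzero[OF b(1)] by (cases "u = 0"; fastforce)+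
qed

text \<open>Expressed through the standard inner product, \<open>G z w\<close> is
  \<open>T z \<bullet> w\<close>; definiteness makes \<open>T\<close> injective, hence surjective in
  finite dimension. Gradients and Christoffel vectors are obtained in this way.\<close>

lemma riesz_ex1:
  assumes G: "inner_form G" and l: "linear l"
  shows "\<exists>!z. \<forall>w. G z w = l w"
proof -
  define T where "T u = (\<Sum>b\<in>Basis. G u b *\<^sub>R b)" for u
  have bil: "bilinear G" using inner_formD(1)[OF G] .
  have Tb: "T u \<bullet> b = G u b" if "b \<in> Basis" for u b
    using that by (simp add: T_def)
  have lT: "linear T"
    by (rule linearI)
      (simp_all add: T_def bilinear_ladd[OF bil] bilinear_lmul[OF bil] scaleR_left_distrib sum.distrib scaleR_sum_right)
  have Gz: "G z w = T z \<bullet> w" for z w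
  proof -
    have "linear (G z)" using bil by (simp add: bilinear_def)
    from linear_expand[OF this, of w] show ?thesis
      by (simp add: T_def inner_sum_left inner_sum_right mult.commute inner_commute)
  qed
  have "inj T"
    unfolding linear_injective_0[OF lT]
    using Gz inner_formD(5)[OF G] by (metis inner_zero_left)
  then have "surj T" using linear_inj_imp_surj lT by blast
  define \<xi> where "\<xi> = (\<Sum>b\<in>Basis. l b *\<^sub>R b)"
  obtain z where z: "T z = \<xi>" using \<open>surj T\<close> by (metis surjD)
  have "G z w = l w" for w
    unfolding Gz z linear_expand[OF l, of w] by (simp add: \<xi>_def inner_sum_left inner_sum_right mult.commute inner_commute)
  moreover have "y = z" if "\<forall>w. G y w = l w" for y
  proof -
    have "G (y - z) (y - z) = 0" using that \<open>\<And>w. G z w = l w\<close> by (simp add: bilinear_lsub[OF bil])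
    then show ?thesis using inner_formD(5)[OF G] by auto
  qed
  ultimately show ?thesis by blast
qed

lemma sum_basis_abs_le:
  fixes u :: "'e::euclidean_space"
  assumes "\<And>a. a \<in> Basis \<Longrightarrow> 0 \<le> k a"
  shows "(\<Sum>a\<in>Basis. \<bar>u \<bullet> a\<bar> * k a) \<le> norm u * (\<Sum>a\<in>Basis. k a)"
  unfolding sum_distrib_left by (rule sum_mono) (simp add: Basis_le_norm mult_right_mono assms)

lemma linear_le_basis:
  fixes l :: "'e::euclidean_space \<Rightarrow> real"
  assumes "linear l" shows "\<bar>l u\<bar> \<le> norm u * (\<Sum>a\<in>Basis. \<bar>l a\<bar>)"
proof -
  have "\<bar>l u\<bar> \<le> (\<Sum>a\<in>Basis. \<bar>u \<bullet> a\<bar> * \<bar>l a\<bar>)"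
    unfolding linear_expand[OF assms, of u] by (rule sum_abs[THEN order_trans]) (simp add: abs_mult)
  also have "\<dots> \<le> norm u * (\<Sum>a\<in>Basis. \<bar>l a\<bar>)" by (rule sum_basis_abs_le) simp
  finally show ?thesis .
qed

lemma bilinear_le_basis:
  fixes B :: "'e::euclidean_space \<Rightarrow> 'e \<Rightarrow> real"
  assumes "bilinear B" shows "\<bar>B u v\<bar> \<le> norm u * norm v * (\<Sum>a\<in>Basis. \<Sum>b\<in>Basis. \<bar>B a b\<bar>)"
proof -
  have l: "linear (\<lambda>u. B u v)" and r: "\<And>u. linear (B u)"
    using assms by (auto simp: bilinear_def)
  have "\<bar>B u v\<bar> \<le> norm u * (\<Sum>a\<in>Basis. \<bar>B a v\<bar>)" by (rule linear_le_basis[OF l])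
  also have "\<dots> \<le> norm u * (\<Sum>a\<in>Basis. norm v * (\<Sum>b\<in>Basis. \<bar>B a b\<bar>))"
    by (intro mult_left_mono sum_mono linear_le_basis[OF r]) auto
  finally show ?thesis by (simp add: sum_distrib_left mult_ac)
qed

text \<open>Compactness of the unit sphere gives a positive minimum of \<open>G0\<close>, and half
  of it survives a small change of the entries. The same constant therefore serves all nearby points
  and all late metrics of a convergent sequence.\<close>

lemma coercive_near:
  fixes G0 :: "'e::euclidean_space \<Rightarrow> 'e \<Rightarrow> real"
  assumes G0: "inner_form G0"
  obtains lam \<epsilon> where "lam > 0" "\<epsilon> > 0"
    "\<And>G u. bilinear G \<Longrightarrow> (\<And>a b. a \<in> Basis \<Longrightarrow> b \<in> Basis \<Longrightarrow> \<bar>G a b - G0 a b\<bar> < \<epsilon>) \<Longrightarrow> lam * (norm u)\<^sup>2 \<le> G u u"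
proof -
  have bil: "bilinear G0" using inner_formD(1)[OF G0] .
  have cont: "continuous_on (sphere 0 1) (\<lambda>u. G0 u u)"
    by (rule continuous_on_bilinear_apply) (auto simp: bil)
  have ne: "sphere (0::'e) 1 \<noteq> {}" by simp
  obtain u0 where u0: "u0 \<in> sphere 0 1" "\<And>u. u \<in> sphere 0 1 \<Longrightarrow> G0 u0 u0 \<le> G0 u u"
    using continuous_attains_inf[OF compact_sphere ne cont] by blast
  define lam where "lam = G0 u0 u0 / 2"
  have l: "lam > 0" using u0(1) inner_formD(3)[OF G0, of u0] by (cases "u0 = 0") (auto simp: lam_def)
  define N where "N = real (DIM('e)) * real (DIM('e))"
  have N: "N > 0" by (simp add: N_def)
  \<comment> \<open>There are \<open>N\<close> matrix entries, each of which changes the quadratic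
    form by at most \<open>\<epsilon>\<close> times the squared norm.\<close>
  define \<epsilon> where "\<epsilon> = lam / N"
  have e: "\<epsilon> > 0" using l N by (simp add: \<epsilon>_def)
  have low: "2 * lam * (norm u)\<^sup>2 \<le> G0 u u" for u
  proof (cases "u = 0")
    case False
    have "2 * lam \<le> G0 (u /\<^sub>R norm u) (u /\<^sub>R norm u)" using u0(2)[of "u /\<^sub>R norm u"] False by (simp add: lam_def)
    also have "\<dots> = inverse (norm u) * (inverse (norm u) * G0 u u)"
      by (simp only: bilinear_lmul[OF bil] bilinear_rmul[OF bil] real_scaleR_def)
    also have "\<dots> = G0 u u / (norm u)\<^sup>2"
      by (simp add: power2_eq_square divide_inverse)
    finally show ?thesis using False by (simp add: field_simps)
  qed (simp add: bilinear_lzero[OF bil])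
  have "lam * (norm u)\<^sup>2 \<le> G u u" if G: "bilinear G"
    and near: "\<And>a b. a \<in> Basis \<Longrightarrow> b \<in> Basis \<Longrightarrow> \<bar>G a b - G0 a b\<bar> < \<epsilon>" for G u
  proof -
    have b: "bilinear (\<lambda>u v. G u v - G0 u v)"
      using G bil unfolding bilinear_def by (auto intro: linear_compose_sub)
    have "\<bar>G u u - G0 u u\<bar> \<le> norm u * norm u * (\<Sum>a\<in>Basis. \<Sum>b\<in>Basis. \<bar>G a b - G0 a b\<bar>)"
      by (rule bilinear_le_basis[OF b])
    also have "\<dots> \<le> norm u * norm u * (\<Sum>a\<in>(Basis::'e set). \<Sum>b\<in>(Basis::'e set). \<epsilon>)"
      using near by (intro mult_left_mono sum_mono) (auto intro: less_imp_le)
    also have "\<dots> = lam * (norm u)\<^sup>2" using N by (simp add: \<epsilon>_def N_def power2_eq_square)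
    finally show ?thesis using low[of u] by linarith
  qed
  with l e show thesis by (rule that)
qed

text \<open>Tested against \<open>z y - z0\<close> itself, the form \<open>G y\<close> returns the
  defect of \<open>z0\<close> in the equation at \<open>y\<close>. This defect tends to zero, and
  coercivity of \<open>G y\<close> bounds the difference by it.\<close>

lemma riesz_tendsto:
  fixes G :: "'a \<Rightarrow> 'e::euclidean_space \<Rightarrow> 'e \<Rightarrow> real"
  assumes G0: "inner_form G0" and l0: "linear l0" and z0: "\<And>w. G0 z0 w = l0 w"
    and G: "\<forall>\<^sub>F y in F. bilinear (G y) \<and> linear (l y) \<and> (\<forall>w. G y (z y) w = l y w)"
    and tG: "\<And>a b. ((\<lambda>y. G y a b) \<longlongrightarrow> G0 a b) F" and tl: "\<And>w. ((\<lambda>y. l y w) \<longlongrightarrow> l0 w) F"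
  shows "(z \<longlongrightarrow> z0) F"
proof -
  obtain lam \<epsilon> where le: "lam > 0" "\<epsilon> > 0" and co: "\<And>G' u. bilinear G' \<Longrightarrow>
      (\<And>a b. a \<in> Basis \<Longrightarrow> b \<in> Basis \<Longrightarrow> \<bar>G' a b - G0 a b\<bar> < \<epsilon>) \<Longrightarrow> lam * (norm u)\<^sup>2 \<le> G' u u"
    using coercive_near[OF G0] by metis
  have ev: "\<forall>\<^sub>F y in F. \<forall>a\<in>Basis. \<forall>b\<in>Basis. \<bar>G y a b - G0 a b\<bar> < \<epsilon>"
    using tendstoD[OF tG le(2)] by (simp add: eventually_ball_finite_distrib dist_real_def)
  define N where "N y = (\<Sum>b\<in>Basis. \<bar>(l y b - l0 b) - (G y z0 b - G0 z0 b)\<bar>) / lam" for y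
  have "(N \<longlongrightarrow> (\<Sum>b\<in>(Basis::'e set). \<bar>(l0 b - l0 b) - (G0 z0 b - G0 z0 b)\<bar>) / lam) F"
    unfolding N_def using le by (intro tendsto_intros tl tG) auto
  then have N0: "(N \<longlongrightarrow> 0) F" by simp
  have "\<forall>\<^sub>F y in F. norm (z y - z0) \<le> N y"
    using ev G
  proof eventually_elim
    case (elim y)
    then have b: "bilinear (G y)" and ly: "linear (l y)" and zy: "\<And>w. G y (z y) w = l y w" by blast+
    note b0 = inner_formD(1)[OF G0]
    define d where "d = z y - z0"
    \<comment> \<open>By the equation for \<open>z0\<close> this is \<open>l y w - G y z0 w\<close>,
      written as a combination of differences that tend to zero.\<close>
    define k where "k w = (l y w - l0 w) - (G y z0 w - G0 z0 w)" for w
    have lk: "linear k" unfolding k_def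
      using l0 ly b b0 by (intro linear_compose_sub) (auto simp: bilinear_def)
    have "lam * (norm d)\<^sup>2 \<le> G y d d" using elim by (intro co b) auto
    also have "G y d d = k d"
      unfolding k_def z0 zy[symmetric] by (simp add: d_def bilinear_lsub[OF b])
    also have "\<dots> \<le> norm d * (\<Sum>b\<in>Basis. \<bar>k b\<bar>)" using linear_le_basis[OF lk, of d] by linarith
    finally have "norm d * (lam * norm d) \<le> norm d * (\<Sum>b\<in>Basis. \<bar>k b\<bar>)"
      by (simp add: power2_eq_square mult_ac)
    then have "lam * norm d \<le> (\<Sum>b\<in>Basis. \<bar>k b\<bar>)"
      by (cases "d = 0") (auto intro: sum_nonneg)
    then show ?case using le unfolding N_def d_def k_def by (simp add: field_simps)
  qed
  then have "((\<lambda>y. z y - z0) \<longlongrightarrow> 0) F" by (rule Lim_null_comparison) (rule N0)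
  then show ?thesis by (simp add: Lim_null[symmetric])
qed

lemma riesz_continuous_on:
  fixes G :: "'a::topological_space \<Rightarrow> 'e::euclidean_space \<Rightarrow> 'e \<Rightarrow> real"
  assumes G: "\<And>x. x \<in> S \<Longrightarrow> inner_form (G x)" and cG: "\<And>a b. continuous_on S (\<lambda>x. G x a b)"
    and l: "\<And>x. x \<in> S \<Longrightarrow> linear (l x)" and cl: "\<And>w. continuous_on S (\<lambda>x. l x w)"
    and z: "\<And>x w. x \<in> S \<Longrightarrow> G x (z x) w = l x w"
  shows "continuous_on S z"
  unfolding continuous_on_def
proof
  fix x assume x: "x \<in> S"
  show "(z \<longlongrightarrow> z x) (at x within S)"
  proof (rule riesz_tendsto[OF G[OF x] l[OF x] z[OF x]])
    show "\<forall>\<^sub>F y in at x within S. bilinear (G y) \<and> linear (l y) \<and> (\<forall>w. G y (z y) w = l y w)"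
      unfolding eventually_at_filter by (intro always_eventually) (auto simp: l z inner_formD(1)[OF G])
  qed (use cG cl x in \<open>auto simp: continuous_on_def\<close>)
qed

text \<open>Near \<open>x\<close> the increment of \<open>k\<close> multiplies a quantity of order
  \<open>norm (y - x)\<close>, so it contributes nothing to first order. The lemma admits a factor
  \<open>k\<close> of which only continuity is known so far.\<close>

lemma has_derivative_mult_vanishing:
  fixes k m :: "'b::real_normed_vector \<Rightarrow> real"
  assumes k: "isCont k x" and m: "(m has_derivative m') (at x)" and 0: "m x = 0"
  shows "((\<lambda>y. k y * m y) has_derivative (\<lambda>h. k x * m' h)) (at x)"
proof -
  obtain B where B: "\<And>h. norm (m' h) \<le> norm h * B"
    using bounded_linear.bounded[OF has_derivative_bounded_linear[OF m]] by blast
  have lim: "((\<lambda>y. (m y - m x - m' (y - x)) /\<^sub>R norm (y - x)) \<longlongrightarrow> 0) (at x)"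
    using m unfolding has_derivative_at2 by (simp add: divide_inverse mult.commute diff_diff_eq)
  have k0: "((\<lambda>y. k y - k x) \<longlongrightarrow> 0) (at x)" using k by (simp add: isCont_def Lim_null[symmetric])
  have "((\<lambda>y. (k y - k x) * (m y / norm (y - x))) \<longlongrightarrow> 0) (at x)"
  proof (rule Lim_null_comparison)
    show "\<forall>\<^sub>F y in at x. norm ((k y - k x) * (m y / norm (y - x)))
       \<le> \<bar>k y - k x\<bar> * (\<bar>(m y - m x - m' (y - x)) /\<^sub>R norm (y - x)\<bar> + B)"
      unfolding eventually_at
    proof (intro exI[of _ 1] conjI ballI impI)
      fix y assume "y \<noteq> x \<and> dist y x < 1"
      then have p: "norm (y - x) > 0" by simp
      have "\<bar>m y / norm (y - x)\<bar> \<le> \<bar>(m y - m x - m' (y - x)) /\<^sub>R norm (y - x)\<bar> + \<bar>m' (y - x) / norm (y - x)\<bar>"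
        using 0 by (simp add: divide_inverse algebra_simps)
      also have "\<bar>m' (y - x) / norm (y - x)\<bar> \<le> B"
        using B[of "y - x"] p by (simp add: field_simps abs_divide)
      finally show "norm ((k y - k x) * (m y / norm (y - x)))
       \<le> \<bar>k y - k x\<bar> * (\<bar>(m y - m x - m' (y - x)) /\<^sub>R norm (y - x)\<bar> + B)"
        by (simp only: real_norm_def abs_mult) (rule mult_left_mono, auto)
    qed simp
    have "((\<lambda>y. \<bar>k y - k x\<bar> * (\<bar>(m y - m x - m' (y - x)) /\<^sub>R norm (y - x)\<bar> + B)) \<longlongrightarrow> \<bar>0\<bar> * (\<bar>0\<bar> + B)) (at x)"
      by (intro tendsto_intros k0 lim)
    then show "((\<lambda>y. \<bar>k y - k x\<bar> * (\<bar>(m y - m x - m' (y - x)) /\<^sub>R norm (y - x)\<bar> + B)) \<longlongrightarrow> 0) (at x)" by simp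
  qed
  then have "((\<lambda>y. (k y - k x) * m y) has_derivative (\<lambda>h. 0)) (at x)"
    by (simp add: has_derivative_at2 0 divide_inverse mult_ac)
  from has_derivative_add[OF this has_derivative_mult_right[OF m, of "k x"]]
  show ?thesis by (simp add: algebra_simps)
qed

text \<open>The difference \<open>z y - z x\<close> solves an equation with the fixed form \<open>G x\<close>, whose right-hand side
  is differentiable at \<open>x\<close> as soon as \<open>z\<close> is continuous.\<close>

lemma riesz_C1:
  fixes G :: "'b::real_normed_vector \<Rightarrow> 'e::euclidean_space \<Rightarrow> 'e \<Rightarrow> real"
  assumes S: "open S" and G: "\<And>x. x \<in> S \<Longrightarrow> inner_form (G x)" and CG: "\<And>a b. Ck_on 1 S (\<lambda>x. G x a b)"
    and l: "\<And>x. x \<in> S \<Longrightarrow> linear (l x)" and Cl: "\<And>w. Ck_on 1 S (\<lambda>x. l x w)"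
    and z: "\<And>x w. x \<in> S \<Longrightarrow> G x (z x) w = l x w"
  shows "Ck_on 1 S z"
proof -
  have bil: "bilinear (G x)" if "x \<in> S" for x using inner_formD(1) G that by blast
  have cz: "continuous_on S z"
    by (rule riesz_continuous_on[OF G _ l _ z]) (use CG Cl Ck_on_1_continuous in blast)+
  have dG: "((\<lambda>y. G y a b) has_derivative fd (\<lambda>y. G y a b) x) (at x)" if "x \<in> S" for x a b
    using fd_works[OF Ck_on_1_diff[OF CG that]] .
  have dl: "((\<lambda>y. l y w) has_derivative fd (\<lambda>y. l y w) x) (at x)" if "x \<in> S" for x w
    using fd_works[OF Ck_on_1_diff[OF Cl that]] .
  have dz: "\<exists>z'. (z has_derivative z') (at x)" if x: "x \<in> S" for x
  proof -
    \<comment> \<open>The vectors \<open>r b\<close> are dual to the standard basis with respect to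
      \<open>G x\<close>, so a linear functional \<open>k\<close> is represented by the sum of the
      vectors \<open>r b\<close> with coefficients \<open>k b\<close>.\<close>
    have "\<exists>r. \<forall>w. G x r w = w \<bullet> b" for b
      using riesz_ex1[OF G[OF x], of "\<lambda>w. w \<bullet> b"] bounded_linear_inner_left bounded_linear.linear by blast
    then obtain r where r: "\<And>b w. G x (r b) w = w \<bullet> b" by metis
    have eq: "z y = z x + (\<Sum>b\<in>Basis. (l y b - l x b - (\<Sum>a\<in>Basis. (z y \<bullet> a) * (G y a b - G x a b))) *\<^sub>R r b)"
      if y: "y \<in> S" for y
    proof -
      define k where "k w = l y w - l x w - (G y (z y) w - G x (z y) w)" for w
      have lk: "linear k" unfolding k_def
        using l[OF x] l[OF y] bil[OF x] bil[OF y] by (intro linear_compose_sub) (auto simp: bilinear_def)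
      have "G x (z y - z x) w = k w" for w
        by (simp add: bilinear_lsub[OF bil[OF x]] k_def z[OF x] z[OF y])
      moreover have "G x (\<Sum>b\<in>Basis. k b *\<^sub>R r b) w = k w" for w
      proof -
        have "G x (\<Sum>b\<in>Basis. k b *\<^sub>R r b) w = (\<Sum>b\<in>Basis. G x (k b *\<^sub>R r b) w)"
          using bil[OF x] by (simp add: bilinear_def linear_sum[of "\<lambda>u. G x u w"])
        also have "\<dots> = k w"
          by (simp add: bilinear_lmul[OF bil[OF x]] r linear_expand[OF lk, of w] mult.commute)
        finally show ?thesis .
      qed
      ultimately have "z y - z x = (\<Sum>b\<in>Basis. k b *\<^sub>R r b)"
        using riesz_ex1[OF G[OF x] lk] by blast
      moreover have "k b = l y b - l x b - (\<Sum>a\<in>Basis. (z y \<bullet> a) * (G y a b - G x a b))" for b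
      proof -
        have l1: "linear (\<lambda>u. G y u b - G x u b)"
          using bil[OF x] bil[OF y] by (intro linear_compose_sub) (auto simp: bilinear_def)
        show ?thesis unfolding k_def using linear_expand[OF l1, of "z y"] by simp
      qed
      ultimately show ?thesis by (simp add: algebra_simps)
    qed
    have zc: "isCont (\<lambda>y. z y \<bullet> a) x" for a
      using cz S x by (intro continuous_intros) (simp add: continuous_on_eq_continuous_at)
    \<comment> \<open>Continuity of \<open>z\<close> is enough here, because the increment of the
      metric entry vanishes at \<open>x\<close>.\<close>
    have "((\<lambda>y. (z y \<bullet> a) * (G y a b - G x a b)) has_derivative (\<lambda>h. (z x \<bullet> a) * fd (\<lambda>y. G y a b) x h)) (at x)" for a b
      by (rule has_derivative_mult_vanishing[OF zc])
        (auto intro!: derivative_eq_intros dG x)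
    note [derivative_intros] = this
    have "((\<lambda>y. z x + (\<Sum>b\<in>Basis. (l y b - l x b - (\<Sum>a\<in>Basis. (z y \<bullet> a) * (G y a b - G x a b))) *\<^sub>R r b))
      has_derivative (\<lambda>h. 0 + (\<Sum>b\<in>Basis. (fd (\<lambda>y. l y b) x h - 0 - (\<Sum>a\<in>Basis. (z x \<bullet> a) * fd (\<lambda>y. G y a b) x h)) *\<^sub>R r b))) (at x)"
      by (intro derivative_intros dl x)
    then show ?thesis
      using has_derivative_cong_open[OF _ S x] eq by (metis (no_types, lifting))
  qed
  then have dz': "(z has_derivative fd z x) (at x)" if "x \<in> S" for x
    using that fd_eq by metis
  show ?thesis
  proof (rule Ck_on_1I[OF dz'])
    fix v
    show "continuous_on S (\<lambda>x. fd z x v)"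
    \<comment> \<open>Differentiating the equation shows that \<open>fd z x v\<close> solves a Riesz
      problem for the same form, with a right-hand side that is continuous in \<open>x\<close>; its
      continuity follows as that of \<open>z\<close> did.\<close>
    proof (rule riesz_continuous_on[OF G])
      fix x w assume x: "x \<in> S"
      have "((\<lambda>y. G y (z y) w) has_derivative
        (\<lambda>h. fd (\<lambda>y. G y (z x) w) x h + G x (fd z x h) w + G x (z x) 0)) (at x)"
        by (rule bilinear_form_has_derivative[OF S x bil _ dz'[OF x] has_derivative_const])
          (use Ck_on_1_diff[OF CG x] in auto)
      moreover have "((\<lambda>y. G y (z y) w) has_derivative fd (\<lambda>y. l y w) x) (at x)"
        by (rule has_derivative_cong_open[OF dl[OF x] S x]) (simp add: z)
      ultimately have "fd (\<lambda>y. G y (z x) w) x v + G x (fd z x v) w = fd (\<lambda>y. l y w) x v"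
        using has_derivative_unique bilinear_rzero[OF bil[OF x]] by (metis (no_types, lifting) add.right_neutral)
      then show "G x (fd z x v) w = fd (\<lambda>y. l y w) x v - fd (\<lambda>y. G y (z x) w) x v" by simp
    next
      fix x assume x: "x \<in> S"
      have "inner_form (G x)" by (rule G[OF x])
      have "linear (\<lambda>w. fd (\<lambda>y. l y w) x v)"
      proof (rule linearI)
        show "fd (\<lambda>y. l y (a + b)) x v = fd (\<lambda>y. l y a) x v + fd (\<lambda>y. l y b) x v" for a b
        proof -
          have "((\<lambda>y. l y (a + b)) has_derivative (\<lambda>h. fd (\<lambda>y. l y a) x h + fd (\<lambda>y. l y b) x h)) (at x)"
            by (rule has_derivative_cong_open[OF has_derivative_add[OF dl[OF x] dl[OF x]] S x])
              (simp add: linear_add[OF l])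
          then show ?thesis by (simp add: fd_eq)
        qed
        show "fd (\<lambda>y. l y (c *\<^sub>R a)) x v = c *\<^sub>R fd (\<lambda>y. l y a) x v" for a c
        proof -
          have "((\<lambda>y. l y (c *\<^sub>R a)) has_derivative (\<lambda>h. c * fd (\<lambda>y. l y a) x h)) (at x)"
            by (rule has_derivative_cong_open[OF has_derivative_mult_right[OF dl[OF x]] S x])
              (simp add: linear_scale[OF l])
          then show ?thesis by (simp add: fd_eq)
        qed
      qed
      moreover have "linear (\<lambda>w. fd (\<lambda>y. G y (z x) w) x v)"
        using bilinear_fd[OF S x bil Ck_on_1_diff[OF CG x]] by (simp add: bilinear_def)
      ultimately show "linear (\<lambda>w. fd (\<lambda>y. l y w) x v - fd (\<lambda>y. G y (z x) w) x v)"
        by (rule linear_compose_sub)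
    next
      fix w
      have "continuous_on S (\<lambda>x. fd (\<lambda>y. G y (z x) w) x v)"
      proof (rule continuous_on_linear_apply[of S "\<lambda>x u. fd (\<lambda>y. G y u w) x v", OF _ _ cz])
        show "linear (\<lambda>u. fd (\<lambda>y. G y u w) x v)" if "x \<in> S" for x
          using bilinear_fd[OF S that bil Ck_on_1_diff[OF CG that]] by (simp add: bilinear_def)
      qed (rule Ck_on_1_fd_continuous[OF CG])
      then show "continuous_on S (\<lambda>x. fd (\<lambda>y. l y w) x v - fd (\<lambda>y. G y (z x) w) x v)"
        using Cl by (intro continuous_intros Ck_on_1_fd_continuous)
    qed (auto intro: Ck_on_1_continuous[OF CG])
  qed
qed

section \<open>Charts and tangent vectors\<close>

locale manifold =
  fixes A :: "('a::{t2_space, second_countable_topology}, 'e::euclidean_space) chart set"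
  assumes atlas: "smooth_atlas A"
begin

lemma chart_ex: "\<exists>c\<in>A. p \<in> fst c"
proof -
  have "\<Union>(fst ` A) = UNIV" using atlas unfolding smooth_atlas_def by (elim conjE)
  then have "p \<in> \<Union>(fst ` A)" by simp
  then show ?thesis by (simp only: UN_iff)
qed

lemma chart_at_in: "chart_at A p \<in> A" "p \<in> fst (chart_at A p)"
proof -
  have "chart_at A p \<in> A \<and> p \<in> fst (chart_at A p)"
    unfolding chart_at_def by (rule someI_ex[OF chart_ex[unfolded Bex_def]])
  then show "chart_at A p \<in> A" "p \<in> fst (chart_at A p)" by auto
qed

lemma chart_homeo:
  assumes "c \<in> A"
  shows "open (fst c)" "open (chart_image c)" "homeomorphism (fst c) (chart_image c) (snd c) (inv_chart c)"
  using atlas assms by (auto simp: smooth_atlas_def)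

lemma chart_inv:
  assumes "c \<in> A"
  shows "x \<in> chart_image c \<Longrightarrow> inv_chart c x \<in> fst c"
    "x \<in> chart_image c \<Longrightarrow> snd c (inv_chart c x) = x"
    "p \<in> fst c \<Longrightarrow> inv_chart c (snd c p) = p"
    "p \<in> fst c \<Longrightarrow> snd c p \<in> chart_image c"
    "continuous_on (fst c) (snd c)" "continuous_on (chart_image c) (inv_chart c)"
  using chart_homeo(3)[OF assms] by (auto simp: homeomorphism_def)

lemma open_inv_chart_image:
  assumes "c \<in> A" "open W" "W \<subseteq> chart_image c"
  shows "open (inv_chart c ` W)"
proof -
  have "inv_chart c ` W = fst c \<inter> snd c -` W"
    using assms(3) chart_inv[OF assms(1)] by (force simp: image_iff)
  then show ?thesis
    using continuous_open_preimage[OF chart_inv(5)[OF assms(1)] chart_homeo(1)[OF assms(1)] assms(2)] by simp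
qed

lemma open_chart_image:
  assumes "c \<in> A" "open U" "U \<subseteq> fst c"
  shows "open (snd c ` U)"
proof -
  have "snd c ` U = chart_image c \<inter> inv_chart c -` U"
    using assms(3) chart_inv[OF assms(1)] by (force simp: image_iff)
  then show ?thesis
    using continuous_open_preimage[OF chart_inv(6)[OF assms(1)] chart_homeo(2)[OF assms(1)] assms(2)] by simp
qed

lemma compact_inv_chart_image:
  assumes "c \<in> A" "compact K" "K \<subseteq> chart_image c"
  shows "compact (inv_chart c ` K)"
  using assms chart_inv(6)[OF assms(1)] compact_continuous_image continuous_on_subset by blast

definition overlap where "overlap c d = snd c ` (fst c \<inter> fst d)"

lemma overlap:
  assumes "c \<in> A" "d \<in> A"
  shows "open (overlap c d)" "x \<in> overlap c d \<longleftrightarrow> x \<in> chart_image c \<and> inv_chart c x \<in> fst d"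
    "p \<in> fst c \<Longrightarrow> p \<in> fst d \<Longrightarrow> snd c p \<in> overlap c d"
    "x \<in> overlap c d \<Longrightarrow> snd d (inv_chart c x) \<in> overlap d c"
    "Ck_on k (overlap c d) (snd d \<circ> inv_chart c)"
proof -
  show "open (overlap c d)" unfolding overlap_def
    using assms by (intro open_chart_image) (auto intro: chart_homeo)
  show *: "x \<in> overlap c d \<longleftrightarrow> x \<in> chart_image c \<and> inv_chart c x \<in> fst d" for x
    unfolding overlap_def using chart_inv[OF assms(1)] by (force simp: image_iff)
  show "p \<in> fst c \<Longrightarrow> p \<in> fst d \<Longrightarrow> snd c p \<in> overlap c d" by (auto simp: overlap_def)
  show "x \<in> overlap c d \<Longrightarrow> snd d (inv_chart c x) \<in> overlap d c"
    unfolding * using chart_inv[OF assms(1)] by (auto simp: overlap_def)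
  show "Ck_on k (overlap c d) (snd d \<circ> inv_chart c)"
    using atlas assms by (auto simp: smooth_atlas_def overlap_def)
qed

definition jac where "jac c d p = fd (snd d \<circ> inv_chart c) (snd c p)"

lemma trans_has_derivative:
  assumes "c \<in> A" "d \<in> A" "p \<in> fst c" "p \<in> fst d"
  shows "((snd d \<circ> inv_chart c) has_derivative jac c d p) (at (snd c p))"
  unfolding jac_def using overlap(3,5)[OF assms(1,2)] assms
  by (intro fd_works) (blast intro: Ck_on_1_diff)

lemma jac_linear:
  assumes "c \<in> A" "d \<in> A" "p \<in> fst c" "p \<in> fst d"
  shows "linear (jac c d p)"
  using trans_has_derivative[OF assms] has_derivative_linear by blast

lemma jac_self:
  assumes "c \<in> A" "p \<in> fst c"
  shows "jac c c p u = u"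
proof -
  have "((snd c \<circ> inv_chart c) has_derivative (\<lambda>x. x)) (at (snd c p))"
    by (rule has_derivative_cong_open[OF has_derivative_ident chart_homeo(2)[OF assms(1)]])
      (use assms chart_inv in auto)
  then show ?thesis unfolding jac_def by (simp add: fd_eq)
qed

lemma jac_comp:
  assumes "c \<in> A" "d \<in> A" "e \<in> A" "p \<in> fst c" "p \<in> fst d" "p \<in> fst e"
  shows "jac d e p (jac c d p u) = jac c e p u"
proof -
  have pe: "(snd d \<circ> inv_chart c) (snd c p) = snd d p" using assms chart_inv by simp
  have "((snd e \<circ> inv_chart d) \<circ> (snd d \<circ> inv_chart c) has_derivative jac d e p \<circ> jac c d p) (at (snd c p))"
    by (rule diff_chain_at) (use trans_has_derivative assms pe in \<open>metis+\<close>)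
  then have "(snd e \<circ> inv_chart c has_derivative jac d e p \<circ> jac c d p) (at (snd c p))"
    by (rule has_derivative_cong_open[OF _ overlap(1)[OF assms(1,2)]])
      (use assms overlap(2,3) chart_inv in auto)
  then have "jac c e p = jac d e p \<circ> jac c d p" unfolding jac_def[of c e] by (simp add: fd_eq)
  then show ?thesis by simp
qed

lemma jac_inverse:
  assumes "c \<in> A" "d \<in> A" "p \<in> fst c" "p \<in> fst d"
  shows "jac d c p (jac c d p u) = u"
  using jac_comp[of c d c p u] jac_self assms by simp

lemma tvec_apply: "d \<in> A \<Longrightarrow> p \<in> fst d \<Longrightarrow> tvec A c p u d = jac c d p u"
  by (simp add: tvec_def jac_def)

lemma tvec_self: "c \<in> A \<Longrightarrow> p \<in> fst c \<Longrightarrow> tvec A c p u c = u"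
  by (simp add: tvec_apply jac_self)

lemma tvec_in_tangent:
  assumes "c \<in> A" "p \<in> fst c"
  shows "tvec A c p u \<in> tangent_space A p"
  unfolding tangent_space_def mem_Collect_eq
proof (intro conjI allI ballI impI)
  fix d d' assume "d \<in> A" "d' \<in> A" "p \<in> fst d \<inter> fst d'"
  then show "tvec A c p u d' = frechet_derivative (snd d' \<circ> inv_chart d) (at (snd d p)) (tvec A c p u d)"
    using assms jac_comp[of c "d" "d'" p u] by (simp add: tvec_apply jac_def[of d d'])
qed (auto simp: tvec_def)

lemma tangent_jac:
  assumes "v \<in> tangent_space A p" "c \<in> A" "d \<in> A" "p \<in> fst c" "p \<in> fst d"
  shows "v d = jac c d p (v c)"
proof -
  have "\<forall>c\<in>A. \<forall>d\<in>A. p \<in> fst c \<inter> fst d \<longrightarrow> v d = frechet_derivative (snd d \<circ> inv_chart c) (at (snd c p)) (v c)"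
    using assms(1) unfolding tangent_space_def mem_Collect_eq by (elim conjE)
  then show ?thesis using assms(2-5) unfolding jac_def by blast
qed

lemma tangent_zero:
  assumes "v \<in> tangent_space A p" "\<not> (d \<in> A \<and> p \<in> fst d)"
  shows "v d = 0"
proof -
  have "\<forall>c. \<not> (c \<in> A \<and> p \<in> fst c) \<longrightarrow> v c = 0"
    using assms(1) unfolding tangent_space_def mem_Collect_eq by (elim conjE)
  then show ?thesis using assms(2) by blast
qed

text \<open>A tangent vector is a family over all charts, but the transformation law leaves only one
  component free. Every later computation uses the component in a single chart.\<close>

lemma tangent_eq:
  assumes "v \<in> tangent_space A p" "c \<in> A" "p \<in> fst c"
  shows "v = tvec A c p (v c)"
proof
  fix d show "v d = tvec A c p (v c) d"
  proof (cases "d \<in> A \<and> p \<in> fst d")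
    case True
    then have "v d = jac c d p (v c)" using tangent_jac[OF assms(1,2) _ assms(3)] by metis
    then show ?thesis using True by (simp only: tvec_apply)
  next
    case False
    then have "v d = 0" by (rule tangent_zero[OF assms(1)])
    then show ?thesis using False by (auto simp: tvec_def)
  qed
qed

lemma tvec_change:
  assumes "c \<in> A" "d \<in> A" "p \<in> fst c" "p \<in> fst d"
  shows "tvec A d p (jac c d p u) = tvec A c p u"
  using tangent_eq[OF tvec_in_tangent[OF assms(1,3), of u] assms(2,4)] assms by (simp add: tvec_apply)

lemma metric_tangent:
  assumes "v \<in> tangent_space A p" "w \<in> tangent_space A p" "c \<in> A" "p \<in> fst c"
  shows "g p v w = metric_in_chart A g c (snd c p) (v c) (w c)"
  unfolding metric_in_chart_def using assms chart_inv(3)[OF assms(3,4)]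
  by (simp add: Let_def tangent_eq[OF assms(1,3,4), symmetric] tangent_eq[OF assms(2,3,4), symmetric])

lemma metric_change:
  assumes "c \<in> A" "d \<in> A" "p \<in> fst c" "p \<in> fst d"
  shows "metric_in_chart A g d (snd d p) (jac c d p u) (jac c d p v) = metric_in_chart A g c (snd c p) u v"
  unfolding metric_in_chart_def using assms chart_inv(3) by (simp add: Let_def tvec_change)

lemma C1_metric_inner_form:
  assumes "C1_metric A g" "c \<in> A" "x \<in> chart_image c"
  shows "inner_form (metric_in_chart A g c x)"
  using assms by (auto simp: C1_metric_def inner_form_def)

lemma C1_metric_Ck:
  assumes "C1_metric A g" "c \<in> A"
  shows "Ck_on 1 (chart_image c) (\<lambda>x. metric_in_chart A g c x u v)"
  using assms by (auto simp: C1_metric_def)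

lemma tnorm_chart:
  assumes "v \<in> tangent_space A p" "c \<in> A" "p \<in> fst c"
  shows "tnorm g p v = sqrt (metric_in_chart A g c (snd c p) (v c) (v c))"
  unfolding tnorm_def using metric_tangent[OF assms(1,1,2,3)] by simp

end

section \<open>Levi-Civita connection in charts\<close>

text \<open>The Christoffel symbol of the first kind for the constant fields \<open>u\<close> and
  \<open>v\<close>, contracted with \<open>w\<close>. Unlike \<open>christoffel\<close> it is
  explicit in the derivatives of the metric, so linearity, continuity and limits can be read
  off.\<close>

definition koszul :: "('e::euclidean_space \<Rightarrow> 'e \<Rightarrow> 'e \<Rightarrow> real) \<Rightarrow> 'e \<Rightarrow> 'e \<Rightarrow> 'e \<Rightarrow> 'e \<Rightarrow> real" where
  "koszul G x u v w =
    (fd (\<lambda>y. G y v w) x u + fd (\<lambda>y. G y u w) x v - fd (\<lambda>y. G y u v) x w) / 2"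

lemma koszul_linear:
  fixes G :: "'e::euclidean_space \<Rightarrow> 'e \<Rightarrow> 'e \<Rightarrow> real"
  assumes S: "open S" "x \<in> S" and bil: "\<And>y. y \<in> S \<Longrightarrow> bilinear (G y)"
    and C: "\<And>a b. Ck_on 1 S (\<lambda>y. G y a b)"
  shows "linear (koszul G x u v)" "linear (\<lambda>u. koszul G x u v w)" "linear (\<lambda>v. koszul G x u v w)"
proof -
  have b: "bilinear (\<lambda>a b. fd (\<lambda>y. G y a b) x h)" for h
    by (rule bilinear_fd[OF S bil Ck_on_1_diff[OF C S(2)]])
  have l1: "linear (\<lambda>a. fd (\<lambda>y. G y a b) x h)" and l2: "linear (\<lambda>a. fd (\<lambda>y. G y b a) x h)" for b h
    using b by (simp_all add: bilinear_def)
  have l3: "linear (fd (\<lambda>y. G y a b) x)" for a b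
    by (rule fd_linear[OF Ck_on_1_diff[OF C S(2)]])
  note l = linear_add[OF l1] linear_add[OF l2] linear_add[OF l3]
    linear_scale[OF l1] linear_scale[OF l2] linear_scale[OF l3]
  show "linear (koszul G x u v)"
    by (rule linearI) (simp_all add: koszul_def l field_simps)
  show "linear (\<lambda>u. koszul G x u v w)"
    by (rule linearI) (simp_all add: koszul_def l field_simps)
  show "linear (\<lambda>v. koszul G x u v w)"
    by (rule linearI) (simp_all add: koszul_def l field_simps)
qed

lemma koszul_sym:
  assumes "open S" "x \<in> S" "\<And>y a b. y \<in> S \<Longrightarrow> G y a b = G y b a" "\<And>a b. Ck_on 1 S (\<lambda>y. G y a b)"
  shows "koszul G x u v w = koszul G x v u w"
proof -
  have "fd (\<lambda>y. G y v u) x = fd (\<lambda>y. G y u v) x"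
    by (rule fd_cong_open(2)[OF Ck_on_1_diff[OF assms(4,2)] assms(1,2)]) (use assms(3) in auto)
  then show ?thesis by (simp add: koszul_def)
qed

context manifold
begin

lemma metric_bilinear: "C1_metric A g \<Longrightarrow> c \<in> A \<Longrightarrow> x \<in> chart_image c \<Longrightarrow> bilinear (metric_in_chart A g c x)"
  using C1_metric_inner_form inner_formD(1) by blast

lemma metric_sym: "C1_metric A g \<Longrightarrow> c \<in> A \<Longrightarrow> x \<in> chart_image c \<Longrightarrow>
    metric_in_chart A g c x a b = metric_in_chart A g c x b a"
  using C1_metric_inner_form inner_formD(2) by blast

lemma christoffel_koszul:
  assumes g: "C1_metric A g" and c: "c \<in> A" and x: "x \<in> chart_image c"
  shows "metric_in_chart A g c x (christoffel A g c x u v) w = koszul (metric_in_chart A g c) x u v w"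
proof -
  have "linear (koszul (metric_in_chart A g c) x u v)"
    by (rule koszul_linear(1)[OF chart_homeo(2)[OF c] x metric_bilinear[OF g c] C1_metric_Ck[OF g c]])
  note ex1 = riesz_ex1[OF C1_metric_inner_form[OF g c x] this]
  have "christoffel A g c x u v =
    (THE z. \<forall>w. metric_in_chart A g c x z w = koszul (metric_in_chart A g c) x u v w)"
    by (simp add: christoffel_def koszul_def)
  with theI'[OF ex1] show ?thesis by metis
qed

text \<open>Differentiating the transformation law of the metric produces, besides the transformed
  first derivatives, six terms with second derivatives of the transition map. By symmetry of second
  derivatives four of them cancel in the Koszul combination, and the remaining two are
  equal.\<close>

lemma koszul_change:
  assumes g: "C1_metric A g" and c: "c \<in> A" and d: "d \<in> A" and p: "p \<in> fst c" "p \<in> fst d"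
  defines "J \<equiv> jac c d p" and "x \<equiv> snd c p" and "\<tau> \<equiv> snd d \<circ> inv_chart c"
  shows "koszul (metric_in_chart A g c) x u v w =
    koszul (metric_in_chart A g d) (snd d p) (J u) (J v) (J w)
      + metric_in_chart A g d (snd d p) (fd (\<lambda>y. fd \<tau> y u) x v) (J w)"
proof -
  let ?G = "metric_in_chart A g c" and ?H = "metric_in_chart A g d"
  have oS: "open (overlap c d)" and xS: "x \<in> overlap c d"
    using overlap[OF c d] p by (auto simp: x_def)
  have tx: "\<tau> x = snd d p" using chart_inv(3)[OF c p(1)] by (simp add: \<tau>_def x_def)
  have t2: "Ck_on 2 (overlap c d) \<tau>" unfolding \<tau>_def by (rule overlap(5)[OF c d])
  have J: "J = fd \<tau> x" by (simp add: J_def jac_def \<tau>_def x_def)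
  have dt: "(\<tau> has_derivative J) (at x)"
    unfolding J_def \<tau>_def x_def by (rule trans_has_derivative[OF c d p])
  have lJ: "linear J" unfolding J_def by (rule jac_linear[OF c d p])
  have d\<tau>: "((\<lambda>y. fd \<tau> y a) has_derivative fd (\<lambda>y. fd \<tau> y a) x) (at x)" for a
    by (rule fd_works[OF Ck_on_1_diff[OF Ck_on_2D1[OF t2] xS]])
  have td: "\<tau> y \<in> chart_image d" if "y \<in> overlap c d" for y
    using that overlap(2)[OF c d] chart_inv(4)[OF d] by (simp add: \<tau>_def)
  have dH: "((\<lambda>y. ?H (\<tau> y) a b) has_derivative (\<lambda>h. fd (\<lambda>y. ?H y a b) (snd d p) (J h))) (at x)" for a b
  proof -
    have "((\<lambda>y. ?H y a b) has_derivative fd (\<lambda>y. ?H y a b) (\<tau> x)) (at (\<tau> x))"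
      by (rule fd_works[OF Ck_on_1_diff[OF C1_metric_Ck[OF g d] td[OF xS]]])
    from has_derivative_compose[OF dt this] show ?thesis by (simp add: tx)
  qed
  have bH: "bilinear (?H (\<tau> y))" if "y \<in> overlap c d" for y
    by (rule metric_bilinear[OF g d td[OF that]])
  have D: "fd (\<lambda>y. ?G y a b) x h = fd (\<lambda>y. ?H y (J a) (J b)) (snd d p) (J h)
      + ?H (snd d p) (fd (\<lambda>y. fd \<tau> y a) x h) (J b) + ?H (snd d p) (J a) (fd (\<lambda>y. fd \<tau> y b) x h)" for a b h
  proof -
    have "((\<lambda>y. ?H (\<tau> y) (fd \<tau> y a) (fd \<tau> y b)) has_derivative
       (\<lambda>h. fd (\<lambda>y. ?H (\<tau> y) (fd \<tau> x a) (fd \<tau> x b)) x h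
         + ?H (\<tau> x) (fd (\<lambda>y. fd \<tau> y a) x h) (fd \<tau> x b)
         + ?H (\<tau> x) (fd \<tau> x a) (fd (\<lambda>y. fd \<tau> y b) x h))) (at x)"
      by (rule bilinear_form_has_derivative[where G="\<lambda>y. ?H (\<tau> y)", OF oS xS bH _ d\<tau> d\<tau>])
        (use dH in \<open>auto simp: differentiable_def\<close>)
    moreover have "?H (\<tau> y) (fd \<tau> y a) (fd \<tau> y b) = ?G y a b" if "y \<in> overlap c d" for y
    proof -
      have y: "y \<in> chart_image c" "inv_chart c y \<in> fst d" using that overlap(2)[OF c d] by auto
      note q = chart_inv(1,2)[OF c y(1)]
      show ?thesis
        using metric_change[OF c d q(1) y(2), of g a b] q(2) by (simp add: jac_def \<tau>_def)
    qed
    ultimately have "((\<lambda>y. ?G y a b) has_derivative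
       (\<lambda>h. fd (\<lambda>y. ?H (\<tau> y) (fd \<tau> x a) (fd \<tau> x b)) x h
         + ?H (\<tau> x) (fd (\<lambda>y. fd \<tau> y a) x h) (fd \<tau> x b)
         + ?H (\<tau> x) (fd \<tau> x a) (fd (\<lambda>y. fd \<tau> y b) x h))) (at x)"
      by (rule has_derivative_cong_open[OF _ oS xS])
    from fd_eq[OF this] show ?thesis by (simp add: fd_eq[OF dH] J[symmetric] tx)
  qed
  have sym: "fd (\<lambda>y. fd \<tau> y a) x b = fd (\<lambda>y. fd \<tau> y b) x a" for a b
    by (rule second_derivative_symmetric[OF t2 oS xS])
  have sH: "?H (snd d p) a b = ?H (snd d p) b a" for a b
    by (rule metric_sym[OF g d]) (use chart_inv(4)[OF d p(2)] in auto)
  show ?thesis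
    unfolding koszul_def D sym[of w] sym[of v u] sH[of "J _" "fd _ _ _"]
    by (simp add: field_simps)
qed

text \<open>The Koszul identities of the two charts are compared by pairing with an arbitrary
  vector; every vector of the second chart is the image of one of the first, and definiteness
  removes the pairing.\<close>

lemma christoffel_change:
  assumes g: "C1_metric A g" and c: "c \<in> A" and d: "d \<in> A" and p: "p \<in> fst c" "p \<in> fst d"
  shows "jac c d p (christoffel A g c (snd c p) u v) =
    christoffel A g d (snd d p) (jac c d p u) (jac c d p v)
      + fd (\<lambda>y. fd (snd d \<circ> inv_chart c) y u) (snd c p) v" (is "?L = ?R")
proof -
  let ?H = "metric_in_chart A g d (snd d p)"
  note xc = chart_inv(4)[OF c p(1)] and xd = chart_inv(4)[OF d p(2)]
  have b: "bilinear ?H" by (rule metric_bilinear[OF g d xd])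
  have eq: "?H ?L w = ?H ?R w" for w
  proof -
    obtain w' where w: "w = jac c d p w'" using jac_inverse[OF d c p(2,1)] by metis
    have "?H ?L w = metric_in_chart A g c (snd c p) (christoffel A g c (snd c p) u v) w'"
      unfolding w by (rule metric_change[OF c d p])
    also have "\<dots> = koszul (metric_in_chart A g c) (snd c p) u v w'"
      by (rule christoffel_koszul[OF g c xc])
    also have "\<dots> = ?H ?R w"
      unfolding koszul_change[OF g c d p] w bilinear_ladd[OF b] christoffel_koszul[OF g d xd] ..
    finally show ?thesis .
  qed
  have "?H (?L - ?R) (?L - ?R) = 0" using eq by (simp add: bilinear_lsub[OF b])
  then show ?thesis using inner_formD(5)[OF C1_metric_inner_form[OF g d xd]] by simp
qed

text \<open>The definition works in \<open>chart_at A p\<close>, which varies with \<open>p\<close>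
  in an uncontrolled way. The same formula holds in any fixed chart because the second derivative of
  the transition map enters once through the components of \<open>X\<close> and once through the
  Christoffel vector, with opposite signs.\<close>

lemma cov_deriv_chart:
  assumes g: "C1_metric A g" and d: "d \<in> A" and p: "p \<in> fst d" and v: "v \<in> tangent_space A p"
    and X: "C1_vector_field A X"
  shows "cov_deriv A g X p v = tvec A d p (fd (\<lambda>y. X (inv_chart d y) d) (snd d p) (v d)
     + christoffel A g d (snd d p) (v d) (X p d))"
proof -
  define c where "c = chart_at A p"
  have c: "c \<in> A" and pc: "p \<in> fst c" using chart_at_in by (auto simp: c_def)
  define \<tau> where "\<tau> = snd d \<circ> inv_chart c"
  let ?Xc = "\<lambda>y. X (inv_chart c y) c" and ?Xd = "\<lambda>y. X (inv_chart d y) d"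
  let ?x = "snd c p" and ?J = "jac c d p"
  have oS: "open (overlap c d)" and xS: "?x \<in> overlap c d"
    using overlap[OF c d] pc p by auto
  have Xt: "X q \<in> tangent_space A q" for q using X by (simp add: C1_vector_field_def vector_field_def)
  have t2: "Ck_on 2 (overlap c d) \<tau>" unfolding \<tau>_def by (rule overlap(5)[OF c d])
  have dt: "(\<tau> has_derivative ?J) (at ?x)"
    unfolding \<tau>_def by (rule trans_has_derivative[OF c d pc p])
  have tx: "\<tau> ?x = snd d p" using chart_inv(3)[OF c pc] by (simp add: \<tau>_def)
  have dXc: "(?Xc has_derivative fd ?Xc ?x) (at ?x)" and dXd: "(?Xd has_derivative fd ?Xd (snd d p)) (at (snd d p))"
    using X chart_inv(4)[OF c pc] chart_inv(4)[OF d p] c d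
    by (auto simp: C1_vector_field_def intro!: fd_works Ck_on_1_diff)
  have "((\<lambda>y. fd \<tau> y (?Xc y)) has_derivative
     (\<lambda>h. fd (\<lambda>y. fd \<tau> y (?Xc ?x)) ?x h + fd \<tau> ?x (fd ?Xc ?x h))) (at ?x)"
  proof (rule linear_apply_has_derivative[OF oS xS _ _ dXc])
    show "linear (fd \<tau> y)" if "y \<in> overlap c d" for y
      using fd_linear Ck_on_1_diff[OF Ck_on_2_imp_1[OF t2] that] by blast
    show "(\<lambda>y. fd \<tau> y a) differentiable at ?x" for a
      by (rule Ck_on_1_diff[OF Ck_on_2D1[OF t2] xS])
  qed
  moreover have "fd \<tau> y (?Xc y) = ?Xd (\<tau> y)" if "y \<in> overlap c d" for y
  proof -
    have y: "y \<in> chart_image c" "inv_chart c y \<in> fst d" using that overlap(2)[OF c d] by auto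
    note q = chart_inv(1,2)[OF c y(1)]
    have "X (inv_chart c y) d = jac c d (inv_chart c y) (X (inv_chart c y) c)"
      by (rule tangent_jac[OF Xt c d q(1) y(2)])
    then show ?thesis using q chart_inv(3)[OF d y(2)] by (simp add: jac_def \<tau>_def)
  qed
  ultimately have 1: "((\<lambda>y. ?Xd (\<tau> y)) has_derivative
     (\<lambda>h. fd (\<lambda>y. fd \<tau> y (?Xc ?x)) ?x h + fd \<tau> ?x (fd ?Xc ?x h))) (at ?x)"
    by (rule has_derivative_cong_open[OF _ oS xS])
  have "((\<lambda>y. ?Xd (\<tau> y)) has_derivative (\<lambda>h. fd ?Xd (snd d p) (?J h))) (at ?x)"
    using has_derivative_compose[OF dt, of ?Xd] dXd tx by simp
  from has_derivative_unique[OF this 1]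
  have 2: "fd ?Xd (snd d p) (?J h) = fd (\<lambda>y. fd \<tau> y (?Xc ?x)) ?x h + ?J (fd ?Xc ?x h)" for h
    by (metis fd_eq[OF dt])
  have Xp: "?Xc ?x = X p c" using chart_inv(3)[OF c pc] by simp
  have vd: "v d = ?J (v c)" "X p d = ?J (X p c)"
    using tangent_jac[OF v c d pc p] tangent_jac[OF Xt c d pc p] by auto
  have sym: "fd (\<lambda>y. fd \<tau> y (X p c)) ?x (v c) = fd (\<lambda>y. fd \<tau> y (v c)) ?x (X p c)"
    by (rule second_derivative_symmetric[OF t2 oS xS])
  have "cov_deriv A g X p v = tvec A c p (fd ?Xc ?x (v c) + christoffel A g c ?x (v c) (X p c))"
    by (simp add: cov_deriv_def c_def Let_def)
  also have "\<dots> = tvec A d p (?J (fd ?Xc ?x (v c) + christoffel A g c ?x (v c) (X p c)))"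
    by (rule tvec_change[OF c d pc p, symmetric])
  also have "?J (fd ?Xc ?x (v c) + christoffel A g c ?x (v c) (X p c)) =
     fd ?Xd (snd d p) (v d) + christoffel A g d (snd d p) (v d) (X p d)"
    unfolding linear_add[OF jac_linear[OF c d pc p]] christoffel_change[OF g c d pc p] vd 2 Xp sym
    by (simp add: \<tau>_def)
  finally show ?thesis .
qed

end

section \<open>Traces over planes\<close>

text \<open>Frames are indexed families rather than sets, so that limits of frames can be taken
  entry by entry. \<open>P\<close> only has to contain the vectors; they form a basis of it once
  \<open>dim P = k\<close> is added.\<close>

definition onb :: "('e::euclidean_space \<Rightarrow> 'e \<Rightarrow> real) \<Rightarrow> nat \<Rightarrow> 'e set \<Rightarrow> (nat \<Rightarrow> 'e) \<Rightarrow> bool" where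
  "onb G k P b \<longleftrightarrow> (\<forall>j<k. b j \<in> P) \<and> (\<forall>i<k. \<forall>j<k. G (b i) (b j) = (if i = j then 1 else 0))"

lemma onb_inner:
  assumes b: "onb G k P b" and G: "inner_form G" and j: "j < k"
  shows "G (\<Sum>i<k. a i *\<^sub>R b i) (b j) = a j"
proof -
  have l: "linear (\<lambda>u. G u (b j))" using inner_formD(1)[OF G] by (simp add: bilinear_def)
  have "G (\<Sum>i<k. a i *\<^sub>R b i) (b j) = (\<Sum>i<k. a i * G (b i) (b j))"
    by (simp add: linear_sum[OF l] linear_scale[OF l])
  also have "\<dots> = (\<Sum>i<k. if i = j then a i else 0)"
    using b j by (intro sum.cong) (auto simp: onb_def)
  finally show ?thesis using j by simp
qed

lemma onb_independent:
  assumes b: "onb G k P b" and G: "inner_form G"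
  shows "inj_on b {..<k}" "independent (b ` {..<k})"
proof -
  show i: "inj_on b {..<k}"
    using b unfolding onb_def inj_on_def by (metis lessThan_iff zero_neq_one)
  show "independent (b ` {..<k})"
    unfolding dependent_finite[OF finite_imageI[OF finite_lessThan]]
  proof (intro notI, elim exE conjE bexE)
    fix u v assume v: "v \<in> b ` {..<k}" "u v \<noteq> 0" and 0: "(\<Sum>v\<in>b ` {..<k}. u v *\<^sub>R v) = 0"
    then obtain j where j: "j < k" "v = b j" by auto
    have "(\<Sum>i<k. u (b i) *\<^sub>R b i) = 0" using 0 by (simp add: sum.reindex[OF i])
    with onb_inner[OF b G j(1), of "\<lambda>i. u (b i)"] have "u (b j) = 0"
      by (simp add: bilinear_lzero[OF inner_formD(1)[OF G]])
    with v j show False by simp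
  qed
qed

lemma onb_le_dim:
  assumes "onb G k P b" "inner_form G" shows "k \<le> dim P"
proof -
  have "card (b ` {..<k}) \<le> dim P"
    using assms(1) by (intro independent_card_le_dim onb_independent(2)[OF assms]) (auto simp: onb_def)
  then show ?thesis by (simp add: card_image[OF onb_independent(1)[OF assms]])
qed

text \<open>The Gram-Schmidt step for a vector already orthogonal to the frame. With
  \<open>k = 0\<close> it also serves to normalise a single vector.\<close>

lemma onb_extend:
  assumes b: "onb G k P b" and G: "inner_form G" and P: "subspace P"
    and r: "r \<in> P" "r \<noteq> 0" "\<And>j. j < k \<Longrightarrow> G r (b j) = 0"
  shows "onb G (Suc k) P (b(k := r /\<^sub>R sqrt (G r r)))"
proof -
  note bil = inner_formD(1)[OF G]
  have s: "sqrt (G r r) > 0" using inner_formD(3)[OF G r(2)] by simp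
  have ss: "G r r = sqrt (G r r) * sqrt (G r r)" using s by simp
  have "c > 0 \<Longrightarrow> G r r = c * c \<Longrightarrow> G (r /\<^sub>R c) (r /\<^sub>R c) = 1" for c
    unfolding bilinear_lmul[OF bil] bilinear_rmul[OF bil] by (simp add: field_simps)
  from this[OF s ss] have 1: "G (r /\<^sub>R sqrt (G r r)) (r /\<^sub>R sqrt (G r r)) = 1" .
  have 2: "G (r /\<^sub>R sqrt (G r r)) (b j) = 0" "G (b j) (r /\<^sub>R sqrt (G r r)) = 0" if "j < k" for j
    using r(3)[OF that] inner_formD(2)[OF G, of r "b j"] unfolding bilinear_lmul[OF bil] bilinear_rmul[OF bil] by auto
  show ?thesis
    using b 1 2 r(1) P unfolding onb_def by (auto simp: less_Suc_eq subspace_scale)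
qed

lemma onb_residual:
  assumes b: "onb G k P b" and G: "inner_form G" and P: "subspace P" and v: "v \<in> P"
  shows "v - (\<Sum>i<k. G v (b i) *\<^sub>R b i) \<in> P"
    "j < k \<Longrightarrow> G (v - (\<Sum>i<k. G v (b i) *\<^sub>R b i)) (b j) = 0"
proof -
  show "v - (\<Sum>i<k. G v (b i) *\<^sub>R b i) \<in> P"
    using b v P by (intro subspace_diff subspace_sum subspace_scale) (auto simp: onb_def)
  show "j < k \<Longrightarrow> G (v - (\<Sum>i<k. G v (b i) *\<^sub>R b i)) (b j) = 0"
    using onb_inner[OF b G] by (simp add: bilinear_lsub[OF inner_formD(1)[OF G]])
qed

text \<open>A nonzero residual could be normalised and appended, giving more orthonormal vectors
  than \<open>dim P\<close> permits.\<close>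

lemma onb_expand:
  assumes b: "onb G m P b" and G: "inner_form G" and P: "subspace P" "dim P = m" and v: "v \<in> P"
  shows "v = (\<Sum>j<m. G v (b j) *\<^sub>R b j)"
proof (rule ccontr)
  assume "v \<noteq> (\<Sum>j<m. G v (b j) *\<^sub>R b j)"
  then have "v - (\<Sum>j<m. G v (b j) *\<^sub>R b j) \<noteq> 0" by simp
  from onb_le_dim[OF onb_extend[OF b G P(1) onb_residual(1)[OF b G P(1) v] this onb_residual(2)[OF b G P(1) v]] G]
  show False using P(2) by simp
qed

lemma onb_exists:
  assumes G: "inner_form G" and P: "subspace P" and "k \<le> dim P"
  shows "\<exists>b. onb G k P b"
  using assms(3)
proof (induction k)
  case 0 then show ?case by (simp add: onb_def)
next
  case (Suc k)
  then obtain b where b: "onb G k P b" by auto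
  have "\<not> P \<subseteq> span (b ` {..<k})"
  proof
    assume "P \<subseteq> span (b ` {..<k})"
    then have "dim P \<le> card (b ` {..<k})" by (intro dim_le_card) auto
    also have "\<dots> \<le> k" using card_image_le[of "{..<k}" b] by simp
    finally show False using Suc.prems by simp
  qed
  then obtain v where v: "v \<in> P" "v \<notin> span (b ` {..<k})" by auto
  have "(\<Sum>i<k. G v (b i) *\<^sub>R b i) \<in> span (b ` {..<k})"
    by (intro span_sum span_scale span_base) auto
  then have "v - (\<Sum>i<k. G v (b i) *\<^sub>R b i) \<noteq> 0" using v(2) by auto
  from onb_extend[OF b G P onb_residual(1)[OF b G P v(1)] this onb_residual(2)[OF b G P v(1)]]
  show ?case by blast
qed

text \<open>Expanding each \<open>b j\<close> in the frame \<open>b'\<close> and exchanging sums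
  leaves, as coefficient of \<open>Q (b' k) (b' i)\<close>, the sum over \<open>j\<close> of
  \<open>G (b j) (b' k) * G (b j) (b' i)\<close>. Expanding \<open>b' k\<close> in \<open>b\<close>
  identifies it with \<open>G (b' k) (b' i)\<close>, the Kronecker symbol.\<close>

lemma onb_trace_eq:
  assumes b: "onb G m P b" and b': "onb G m P b'" and G: "inner_form G"
    and P: "subspace P" "dim P = m" and Q: "bilinear Q"
  shows "(\<Sum>j<m. Q (b j) (b j) :: real) = (\<Sum>j<m. Q (b' j) (b' j))"
proof -
  have l: "linear (\<lambda>u. Q u v)" and r: "linear (Q u)" for u v using Q by (auto simp: bilinear_def)
  have lG: "linear (\<lambda>u. G u v)" and rG: "linear (G u)" for u v
    using inner_formD(1)[OF G] by (auto simp: bilinear_def)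
  have "Q (b j) (b j) = (\<Sum>k<m. \<Sum>i<m. G (b j) (b' k) * (G (b j) (b' i) * Q (b' k) (b' i)))" if "j < m" for j
  proof -
    have bj: "b j \<in> P" using b that by (simp add: onb_def)
    note ex = onb_expand[OF b' G P bj]
    have "Q (b j) (b j) = Q (\<Sum>k<m. G (b j) (b' k) *\<^sub>R b' k) (\<Sum>i<m. G (b j) (b' i) *\<^sub>R b' i)"
      using ex by simp
    also have "\<dots> = (\<Sum>k<m. G (b j) (b' k) * Q (b' k) (\<Sum>i<m. G (b j) (b' i) *\<^sub>R b' i))"
      by (simp add: linear_sum[OF l] linear_scale[OF l])
    also have "\<dots> = (\<Sum>k<m. \<Sum>i<m. G (b j) (b' k) * (G (b j) (b' i) * Q (b' k) (b' i)))"
      by (simp add: linear_sum[OF r] linear_scale[OF r] sum_distrib_left)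
    finally show ?thesis .
  qed
  then have "(\<Sum>j<m. Q (b j) (b j)) = (\<Sum>j<m. \<Sum>k<m. \<Sum>i<m. G (b j) (b' k) * (G (b j) (b' i) * Q (b' k) (b' i)))"
    by simp
  also have "\<dots> = (\<Sum>k<m. \<Sum>i<m. \<Sum>j<m. G (b j) (b' k) * (G (b j) (b' i) * Q (b' k) (b' i)))"
    by (subst sum.swap, rule sum.cong[OF refl], subst sum.swap) simp
  also have "\<dots> = (\<Sum>k<m. \<Sum>i<m. (if k = i then Q (b' k) (b' i) else 0))"
  proof (intro sum.cong refl)
    fix k i assume ki: "k \<in> {..<m}" "i \<in> {..<m}"
    then have P': "b' k \<in> P" using b' by (auto simp: onb_def)
    have "(\<Sum>j<m. G (b j) (b' k) * (G (b j) (b' i) * Q (b' k) (b' i)))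
      = (\<Sum>j<m. G (b j) (b' k) * G (b j) (b' i)) * Q (b' k) (b' i)"
      by (simp add: sum_distrib_right mult.assoc)
    also have "(\<Sum>j<m. G (b j) (b' k) * G (b j) (b' i)) = G (\<Sum>j<m. G (b' k) (b j) *\<^sub>R b j) (b' i)"
      by (simp add: linear_sum[OF lG] linear_scale[OF lG] inner_formD(2)[OF G, of "b' k"])
    also have "\<dots> = G (b' k) (b' i)" using onb_expand[OF b G P P'] by simp
    also have "\<dots> = (if k = i then 1 else 0)" using b' ki by (auto simp: onb_def)
    finally show "(\<Sum>j<m. G (b j) (b' k) * (G (b j) (b' i) * Q (b' k) (b' i))) = (if k = i then Q (b' k) (b' i) else 0)"
      by auto
  qed
  also have "\<dots> = (\<Sum>j<m. Q (b' j) (b' j))" by simp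
  finally show ?thesis .
qed

text \<open>The choice of the frame does not matter when \<open>P\<close> is an
  \<open>m\<close>-dimensional subspace, \<open>G\<close> an inner product and \<open>Q\<close>
  bilinear, by \<open>onb_trace_eq\<close>.\<close>

definition plane_trace :: "('e::euclidean_space \<Rightarrow> 'e \<Rightarrow> real) \<Rightarrow> ('e \<Rightarrow> 'e \<Rightarrow> real) \<Rightarrow> nat \<Rightarrow> 'e set \<Rightarrow> real" where
  "plane_trace G Q m P = (let b = (SOME b. onb G m P b) in \<Sum>j<m. Q (b j) (b j))"

lemma plane_trace_eq:
  assumes "onb G m P b" "inner_form G" "subspace P" "dim P = m" "bilinear Q"
  shows "plane_trace G Q m P = (\<Sum>j<m. Q (b j) (b j))"
proof -
  have "onb G m P (SOME b. onb G m P b)" using assms(1) by (rule someI[where P="\<lambda>b. onb G m P b"])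
  from onb_trace_eq[OF this assms] show ?thesis by (simp add: plane_trace_def Let_def)
qed

section \<open>Planes as orthogonal projections: continuity of traces and compactness\<close>

lemma inner_form_inner: "inner_form ((\<bullet>) :: 'e::euclidean_space \<Rightarrow> _)"
  unfolding inner_form_def bilinear_def
proof (intro conjI allI impI)
  fix x y :: 'e
  show "linear ((\<bullet>) x)"
    by (rule bounded_linear.linear[OF bounded_linear_inner_right])
  show "linear (\<lambda>x. x \<bullet> y)"
    by (rule bounded_linear.linear[OF bounded_linear_inner_left])
  show "x \<bullet> y = y \<bullet> x" by (rule inner_commute)
  show "0 < x \<bullet> x" if "x \<noteq> 0" using that by (rule inner_gt_zero_iff[THEN iffD2])
qed

lemma closest_point_subspaceI:
  fixes P :: "'e::euclidean_space set"
  assumes P: "subspace P" and y: "y \<in> P" and o: "\<And>w. w \<in> P \<Longrightarrow> (x - y) \<bullet> w = 0"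
  shows "closest_point P x = y"
proof (rule sym, rule closest_point_unique)
  show "convex P" "closed P" using P by (auto intro: subspace_imp_convex closed_subspace)
  show "\<forall>z\<in>P. dist x y \<le> dist x z"
  proof
    fix z assume z: "z \<in> P"
    have "(norm (x - z))\<^sup>2 = (norm ((x - y) + (y - z)))\<^sup>2" by simp
    also have "\<dots> = (norm (x - y))\<^sup>2 + (norm (y - z))\<^sup>2"
      using o[OF subspace_diff[OF P y z]] by (intro norm_add_Pythagorean) (simp add: orthogonal_def)
    finally have "(norm (x - y))\<^sup>2 \<le> (norm (x - z))\<^sup>2" by simp
    from power2_le_imp_le[OF this norm_ge_zero] show "dist x y \<le> dist x z" by (simp only: dist_norm)
  qed
qed (rule y)

lemma ortho_proj_frame:
  fixes P :: "'e::euclidean_space set"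
  assumes b: "onb (\<bullet>) m P b" and P: "subspace P" "dim P = m"
  shows "blinfun_apply (ortho_proj P) u = (\<Sum>j<m. (u \<bullet> b j) *\<^sub>R b j)"
proof -
  have "closest_point P x = (\<Sum>j<m. (x \<bullet> b j) *\<^sub>R b j)" for x
  proof (rule closest_point_subspaceI[OF P(1)])
    show "(\<Sum>j<m. (x \<bullet> b j) *\<^sub>R b j) \<in> P"
      using b P(1) by (intro subspace_sum subspace_scale) (auto simp: onb_def)
    fix w assume w: "w \<in> P"
    have "(x - (\<Sum>j<m. (x \<bullet> b j) *\<^sub>R b j)) \<bullet> b j = 0" if "j < m" for j
      using onb_inner[OF b inner_form_inner that] by (simp add: inner_diff_left)
    then have "(x - (\<Sum>j<m. (x \<bullet> b j) *\<^sub>R b j)) \<bullet> (\<Sum>j<m. (w \<bullet> b j) *\<^sub>R b j) = 0"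
      by (simp add: inner_sum_right)
    then show "(x - (\<Sum>j<m. (x \<bullet> b j) *\<^sub>R b j)) \<bullet> w = 0"
      using onb_expand[OF b inner_form_inner P w] by simp
  qed
  then have "closest_point P = (\<lambda>x. \<Sum>j<m. (x \<bullet> b j) *\<^sub>R b j)" by auto
  moreover have "bounded_linear (\<lambda>x. \<Sum>j<m. (x \<bullet> b j) *\<^sub>R b j)"
    by (intro bounded_linear_sum bounded_linear_scaleR_const bounded_linear_inner_left)
  ultimately show ?thesis unfolding ortho_proj_def by (simp add: bounded_linear_Blinfun_apply)
qed

lemma ortho_proj_fix:
  fixes P :: "'e::euclidean_space set"
  assumes P: "subspace P"
  shows "blinfun_apply (ortho_proj P) u = u \<longleftrightarrow> u \<in> P" "range (blinfun_apply (ortho_proj P)) = P"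
proof -
  obtain b where b: "onb (\<bullet>) (dim P) P b" using onb_exists[OF inner_form_inner P] by blast
  note f = ortho_proj_frame[OF b P refl]
  have 1: "blinfun_apply (ortho_proj P) u \<in> P" for u
    unfolding f using b P by (intro subspace_sum subspace_scale) (auto simp: onb_def)
  have 2: "blinfun_apply (ortho_proj P) u = u" if "u \<in> P" for u
    unfolding f using onb_expand[OF b inner_form_inner P refl that] by simp
  show "blinfun_apply (ortho_proj P) u = u \<longleftrightarrow> u \<in> P" using 1 2 by metis
  show "range (blinfun_apply (ortho_proj P)) = P" using 1 2 by (auto simp: image_iff) metis
qed

text \<open>The Grassmannian of \<open>m\<close>-planes of the model space as a subset of a normed
  space. The plane is recovered as the range, or equally as the set of fixed vectors, and being
  fixed passes to limits.\<close>

definition projections :: "nat \<Rightarrow> ('e::euclidean_space \<Rightarrow>\<^sub>L 'e) set" where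
  "projections m = {ortho_proj P | P. subspace P \<and> dim P = m}"

lemma projectionsE:
  assumes "T \<in> projections m"
  shows "subspace (range (blinfun_apply T))" "dim (range (blinfun_apply T)) = m"
    "ortho_proj (range (blinfun_apply T)) = T" "blinfun_apply T u = u \<longleftrightarrow> u \<in> range (blinfun_apply T)"
proof -
  obtain P where P: "T = ortho_proj P" "subspace P" "dim P = m" using assms by (auto simp: projections_def)
  note r = ortho_proj_fix(2)[OF P(2)]
  show "subspace (range (blinfun_apply T))" "dim (range (blinfun_apply T)) = m"
    "ortho_proj (range (blinfun_apply T)) = T" "blinfun_apply T u = u \<longleftrightarrow> u \<in> range (blinfun_apply T)"
    unfolding P(1) r using P ortho_proj_fix(1)[OF P(2)] by auto
qed

lemma frames_subseq:
  fixes b :: "nat \<Rightarrow> nat \<Rightarrow> 'e::heine_borel"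
  assumes "\<And>j. j < m \<Longrightarrow> bounded (range (\<lambda>k. b k j))"
  shows "\<exists>r l. strict_mono (r :: nat \<Rightarrow> nat) \<and> (\<forall>j<m. (\<lambda>k. b (r k) j) \<longlonglongrightarrow> l j)"
  using assms
proof (induction m)
  case 0 then show ?case using strict_mono_id by (auto simp: id_def)
next
  case (Suc m)
  then obtain r l where r: "strict_mono r" "\<And>j. j < m \<Longrightarrow> (\<lambda>k. b (r k) j) \<longlonglongrightarrow> l j"
    by (metis less_SucI)
  have "bounded (range (\<lambda>k. b (r k) m))"
    using Suc.prems[of m] by (rule bounded_subset[OF _ ]) auto
  then obtain s a where s: "strict_mono s" "((\<lambda>k. b (r k) m) \<circ> s) \<longlonglongrightarrow> a"
    using bounded_imp_convergent_subsequence by blast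
  have "(\<lambda>k. b ((r \<circ> s) k) j) \<longlonglongrightarrow> (l(m := a)) j" if "j < Suc m" for j
  proof (cases "j = m")
    case True then show ?thesis using s(2) by (simp add: o_def)
  next
    case False
    then have "(\<lambda>k. b (r k) j) \<longlonglongrightarrow> l j" using that r(2) by simp
    from LIMSEQ_subseq_LIMSEQ[OF this s(1)] show ?thesis using False by (simp add: o_def)
  qed
  then show ?case using strict_mono_o[OF r(1) s(1)] by blast
qed

lemma bilinear_tendsto:
  fixes B :: "nat \<Rightarrow> 'e::euclidean_space \<Rightarrow> 'e \<Rightarrow> real"
  assumes "\<And>k. bilinear (B k)" "bilinear B0" "\<And>a b. (\<lambda>k. B k a b) \<longlonglongrightarrow> B0 a b"
    "u \<longlonglongrightarrow> u0" "v \<longlonglongrightarrow> v0"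
  shows "(\<lambda>k. B k (u k) (v k)) \<longlonglongrightarrow> B0 u0 v0"
  unfolding bilinear_expand[OF assms(1), of _ "u _" "v _"] bilinear_expand[OF assms(2), of u0 v0]
  using assms(3-5) by (intro tendsto_intros)

lemma linear_tendsto:
  fixes L :: "nat \<Rightarrow> 'e::euclidean_space \<Rightarrow> 'c::real_normed_vector"
  assumes "\<And>k. linear (L k)" "linear L0" "\<And>a. (\<lambda>k. L k a) \<longlonglongrightarrow> L0 a" "u \<longlonglongrightarrow> u0"
  shows "(\<lambda>k. L k (u k)) \<longlonglongrightarrow> L0 u0"
  unfolding linear_expand[OF assms(1), of _ "u _"] linear_expand[OF assms(2), of u0]
  using assms(3,4) by (intro tendsto_intros)

text \<open>Compactness of orthonormal frames replaces explicit formulas for the trace over a plane in terms of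
  its projection.\<close>

lemma onb_subseq:
  fixes G :: "nat \<Rightarrow> 'e::euclidean_space \<Rightarrow> 'e \<Rightarrow> real"
  assumes G: "\<And>k. bilinear (G k)" "inner_form G0" "\<And>a b. (\<lambda>k. G k a b) \<longlonglongrightarrow> G0 a b"
    and b: "\<And>k. onb (G k) m (P k) (b k)"
  obtains r l where "strict_mono (r :: nat \<Rightarrow> nat)" "\<And>j. j < m \<Longrightarrow> (\<lambda>k. b (r k) j) \<longlonglongrightarrow> l j" "onb G0 m UNIV l"
proof -
  obtain lam \<epsilon> where le: "lam > 0" "\<epsilon> > 0" and co: "\<And>G u. bilinear G \<Longrightarrow>
      (\<And>a b. a \<in> Basis \<Longrightarrow> b \<in> Basis \<Longrightarrow> \<bar>G a b - G0 a b\<bar> < \<epsilon>) \<Longrightarrow> lam * (norm u)\<^sup>2 \<le> G u u"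
    using coercive_near[OF G(2)] by metis
  have "\<forall>\<^sub>F k in sequentially. \<forall>a\<in>Basis. \<forall>b\<in>Basis. \<bar>G k a b - G0 a b\<bar> < \<epsilon>"
    using tendstoD[OF G(3) le(2)] by (simp add: eventually_ball_finite_distrib dist_real_def)
  then obtain N where N: "\<And>k a b. k \<ge> N \<Longrightarrow> a \<in> Basis \<Longrightarrow> b \<in> Basis \<Longrightarrow> \<bar>G k a b - G0 a b\<bar> < \<epsilon>"
    unfolding eventually_sequentially by blast
  have "bounded (range (\<lambda>k. b (k + N) j))" if j: "j < m" for j
  proof (rule boundedI)
    fix x assume "x \<in> range (\<lambda>k. b (k + N) j)"
    then obtain k where x: "x = b (k + N) j" by auto
    have "lam * (norm x)\<^sup>2 \<le> G (k + N) x x" using N by (intro co G) auto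
    also have "\<dots> = 1" using b[of "k + N"] j by (simp add: onb_def x)
    finally have "(norm x)\<^sup>2 \<le> 1 / lam" using le by (simp add: field_simps)
    then show "norm x \<le> sqrt (1 / lam)" using real_le_rsqrt by blast
  qed
  from frames_subseq[of m "\<lambda>k. b (k + N)", OF this]
  obtain r l where r: "strict_mono r" "\<And>j. j < m \<Longrightarrow> (\<lambda>k. b (r k + N) j) \<longlonglongrightarrow> l j" by blast
  \<comment> \<open>Coercivity is available only from index \<open>N\<close> on, so the subsequence
    is extracted from the shifted frames and its indices are shifted back.\<close>
  define r' where "r' k = r k + N" for k
  have r': "strict_mono r'" using r(1) by (simp add: r'_def strict_mono_def)
  have l: "(\<lambda>k. b (r' k) j) \<longlonglongrightarrow> l j" if "j < m" for j using r(2)[OF that] by (simp add: r'_def)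
  have "G0 (l i) (l j) = (if i = j then 1 else 0)" if ij: "i < m" "j < m" for i j
  proof -
    have "(\<lambda>k. G (r' k) (b (r' k) i) (b (r' k) j)) \<longlonglongrightarrow> G0 (l i) (l j)"
      by (rule bilinear_tendsto[OF G(1) inner_formD(1)[OF G(2)] _ l[OF ij(1)] l[OF ij(2)]])
        (use LIMSEQ_subseq_LIMSEQ[OF G(3) r'] in \<open>simp add: o_def\<close>)
    moreover have "(\<lambda>k. G (r' k) (b (r' k) i) (b (r' k) j)) = (\<lambda>k. if i = j then 1 else 0)"
      using b ij by (auto simp: onb_def)
    ultimately show ?thesis by (simp add: LIMSEQ_const_iff)
  qed
  then have "onb G0 m UNIV l" by (simp add: onb_def)
  with r' l show thesis by (rule that)
qed

text \<open>If the traces stayed away from the limit along a subsequence, a further subsequence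
  would have convergent orthonormal frames. The limit frame lies in the limit plane and computes the
  trace there, a contradiction.\<close>

lemma plane_trace_continuous:
  fixes G Q :: "'x::metric_space \<Rightarrow> 'e::euclidean_space \<Rightarrow> 'e \<Rightarrow> real"
  assumes G: "\<And>x. x \<in> S \<Longrightarrow> inner_form (G x)" "\<And>a b. continuous_on S (\<lambda>x. G x a b)"
    and Q: "\<And>x. x \<in> S \<Longrightarrow> bilinear (Q x)" "\<And>a b. continuous_on S (\<lambda>x. Q x a b)"
  shows "continuous_on (S \<times> projections m) (\<lambda>(x, T). plane_trace (G x) (Q x) m (range (blinfun_apply T)))"
proof -
  define F where "F z = plane_trace (G (fst z)) (Q (fst z)) m (range (blinfun_apply (snd z)))" for z :: "'x \<times> ('e \<Rightarrow>\<^sub>L 'e)"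
  have "continuous_on (S \<times> projections m) F"
    unfolding continuous_on_sequentially
  proof (intro allI ballI impI, elim conjE)
    fix z :: "nat \<Rightarrow> 'x \<times> ('e \<Rightarrow>\<^sub>L 'e)" and a assume a: "a \<in> S \<times> projections m" and z: "\<forall>n. z n \<in> S \<times> projections m" and lim: "z \<longlonglongrightarrow> a"
    obtain x0 T0 where a': "a = (x0, T0)" by force
    have x0: "x0 \<in> S" and T0: "T0 \<in> projections m" using a a' by auto
    define P0 where "P0 = range (blinfun_apply T0)"
    have P0: "subspace P0" "dim P0 = m" "\<And>u. blinfun_apply T0 u = u \<longleftrightarrow> u \<in> P0"
      using projectionsE[OF T0] by (auto simp: P0_def)
    have xS: "fst (z n) \<in> S" and TS: "snd (z n) \<in> projections m" for n using z[rule_format, of n] by (auto simp: mem_Times_iff)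
    have limx: "(\<lambda>n. fst (z n)) \<longlonglongrightarrow> x0" and limT: "(\<lambda>n. snd (z n)) \<longlonglongrightarrow> T0"
      using tendsto_fst[OF lim] tendsto_snd[OF lim] by (auto simp: a')
    have limG: "(\<lambda>n. G (fst (z n)) a b) \<longlonglongrightarrow> G x0 a b" and limQ: "(\<lambda>n. Q (fst (z n)) a b) \<longlonglongrightarrow> Q x0 a b" for a b
      using continuous_on_tendsto_compose[OF G(2) limx x0] continuous_on_tendsto_compose[OF Q(2) limx x0] xS
      by auto
    show "(F \<circ> z) \<longlonglongrightarrow> F a"
      unfolding tendsto_iff
    proof (intro allI impI, rule ccontr)
      fix e :: real assume e: "e > 0" and ev: "\<not> (\<forall>\<^sub>F n in sequentially. dist ((F \<circ> z) n) (F a) < e)"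
      from not_eventually_sequentiallyD[OF ev]
      obtain s :: "nat \<Rightarrow> nat" where s0: "strict_mono s \<and> (\<forall>n. \<not> dist ((F \<circ> z) (s n)) (F a) < e)" ..
      then have s: "strict_mono s" "\<And>n. \<not> dist ((F \<circ> z) (s n)) (F a) < e" by blast+
      define P where "P n = range (blinfun_apply (snd (z (s n))))" for n
      have P: "subspace (P n)" "dim (P n) = m" "\<And>u. blinfun_apply (snd (z (s n))) u = u \<longleftrightarrow> u \<in> P n" for n
        using projectionsE[OF TS] by (auto simp: P_def)
      have "\<exists>b. onb (G (fst (z (s n)))) m (P n) b" for n
        using onb_exists[OF G(1)[OF xS] P(1)] P(2) by simp
      then obtain b where b: "\<And>n. onb (G (fst (z (s n)))) m (P n) (b n)" by metis
      have limGs: "(\<lambda>n. G (fst (z (s n))) a b) \<longlonglongrightarrow> G x0 a b" for a b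
        using LIMSEQ_subseq_LIMSEQ[OF limG s(1)] by (simp add: o_def)
      obtain r l where r: "strict_mono r" "\<And>j. j < m \<Longrightarrow> (\<lambda>k. b (r k) j) \<longlonglongrightarrow> l j" "onb (G x0) m UNIV l"
        using onb_subseq[OF inner_formD(1)[OF G(1)[OF xS]] G(1)[OF x0] limGs b] by metis
      have sr: "strict_mono (s \<circ> r)" using s(1) r(1) by (rule strict_mono_o)
      \<comment> \<open>Each projection fixes the frame vectors of its plane, so \<open>T0\<close>
        fixes their limit, and the fixed vectors of \<open>T0\<close> are exactly
        \<open>P0\<close>.\<close>
      have "l j \<in> P0" if j: "j < m" for j
      proof -
        have "(\<lambda>k. blinfun_apply (snd (z (s (r k)))) (b (r k) j)) \<longlonglongrightarrow> blinfun_apply T0 (l j)"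
          using LIMSEQ_subseq_LIMSEQ[OF limT sr] r(2)[OF j] by (intro blinfun.tendsto) (simp_all add: o_def)
        moreover have "blinfun_apply (snd (z (s (r k)))) (b (r k) j) = b (r k) j" for k
          using P(3) b j unfolding onb_def by blast
        ultimately have "blinfun_apply T0 (l j) = l j"
          using r(2)[OF j] LIMSEQ_unique by simp
        then show ?thesis using P0(3) by simp
      qed
      then have l: "onb (G x0) m P0 l" using r(3) by (simp add: onb_def)
      have Fa: "F a = (\<Sum>j<m. Q x0 (l j) (l j))"
        unfolding F_def a' using plane_trace_eq[OF l G(1)[OF x0] P0(1,2) Q(1)[OF x0]] by (simp add: P0_def)
      have Fk: "F (z (s (r k))) = (\<Sum>j<m. Q (fst (z (s (r k)))) (b (r k) j) (b (r k) j))" for k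
        unfolding F_def using plane_trace_eq[OF b G(1)[OF xS] P(1,2) Q(1)[OF xS]] by (simp add: P_def)
      have "(\<lambda>k. F (z (s (r k)))) \<longlonglongrightarrow> F a"
        unfolding Fa Fk
      proof (rule tendsto_sum)
        fix j assume "j \<in> {..<m}"
        then have lb: "(\<lambda>k. b (r k) j) \<longlonglongrightarrow> l j" using r(2) by simp
        have lq: "(\<lambda>k. Q (fst (z (s (r k)))) a b) \<longlonglongrightarrow> Q x0 a b" for a b
          using LIMSEQ_subseq_LIMSEQ[OF limQ sr] by (simp add: o_def)
        show "(\<lambda>k. Q (fst (z (s (r k)))) (b (r k) j) (b (r k) j)) \<longlonglongrightarrow> Q x0 (l j) (l j)"
          by (rule bilinear_tendsto[OF Q(1)[OF xS] Q(1)[OF x0] lq lb lb])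
      qed
      from tendstoD[OF this e] obtain k where "dist (F (z (s (r k)))) (F a) < e"
        by (auto simp: eventually_sequentially)
      with s(2)[of "r k"] show False by simp
    qed
  qed
  then show ?thesis by (simp add: F_def case_prod_unfold)
qed

text \<open>A limit of orthonormal frames spans an \<open>m\<close>-plane again, and by the frame
  formula \<open>ortho_proj_frame\<close> the projections converge pointwise to that of the limit
  plane, which is enough in finite dimension.\<close>

lemma compact_projections: "compact (projections m :: ('e::euclidean_space \<Rightarrow>\<^sub>L 'e) set)"
  unfolding compact_eq_seq_compact_metric seq_compact_def
proof (intro allI impI)
  fix T :: "nat \<Rightarrow> 'e \<Rightarrow>\<^sub>L 'e" assume T: "\<forall>n. T n \<in> projections m"
  define P where "P n = range (blinfun_apply (T n))" for n
  have P: "subspace (P n)" "dim (P n) = m" "ortho_proj (P n) = T n" for n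
    using projectionsE[OF T[rule_format, of n]] by (auto simp: P_def)
  have "\<exists>b. onb (\<bullet>) m (P n) b" for n
    using onb_exists[OF inner_form_inner P(1)] P(2) by simp
  then obtain b where b: "\<And>n. onb (\<bullet>) m (P n) (b n)" by metis
  obtain r l where r: "strict_mono r" "\<And>j. j < m \<Longrightarrow> (\<lambda>k. b (r k) j) \<longlonglongrightarrow> l j" "onb (\<bullet>) m UNIV l"
    using onb_subseq[of "\<lambda>_. (\<bullet>)" "(\<bullet>)" m P b, OF inner_formD(1)[OF inner_form_inner] inner_form_inner tendsto_const b]
    by metis
  define P0 where "P0 = span (l ` {..<m})"
  have l: "onb (\<bullet>) m P0 l" using r(3) by (auto simp: onb_def P0_def intro: span_base)
  have P0: "subspace P0" "dim P0 = m"
    using onb_independent[OF r(3) inner_form_inner]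
    by (auto simp: P0_def dim_span dim_eq_card_independent card_image)
  have "(T \<circ> r) \<longlonglongrightarrow> ortho_proj P0"
  proof (rule tendsto_componentwise1)
    fix u :: 'e
    have "(\<lambda>n. \<Sum>j<m. (u \<bullet> b (r n) j) *\<^sub>R b (r n) j) \<longlonglongrightarrow> (\<Sum>j<m. (u \<bullet> l j) *\<^sub>R l j)"
      by (intro tendsto_intros r(2)) auto
    then show "(\<lambda>n. blinfun_apply ((T \<circ> r) n) u) \<longlonglongrightarrow> blinfun_apply (ortho_proj P0) u"
      unfolding ortho_proj_frame[OF l P0] using ortho_proj_frame[OF b P(1,2)] P(3) by simp
  qed
  moreover have "ortho_proj P0 \<in> projections m" using P0 by (auto simp: projections_def)
  ultimately show "\<exists>l\<in>projections m. \<exists>r. strict_mono r \<and> (T \<circ> r) \<longlonglongrightarrow> l"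
    using r(1) by blast
qed

text \<open>An orthonormal frame of the image plane is the image of a frame that is orthonormal for
  the pulled-back inner product \<open>G x\<close>. Hence each matrix entry of the projection is the
  trace over the original plane of the rank-one form \<open>Q a c x\<close>, and
  \<open>plane_trace_continuous\<close> applies.\<close>

lemma ortho_proj_image_continuous:
  fixes J :: "'x::metric_space \<Rightarrow> 'e::euclidean_space \<Rightarrow> 'e"
  assumes J: "\<And>x. x \<in> S \<Longrightarrow> linear (J x)" "\<And>x. x \<in> S \<Longrightarrow> inj (J x)" "\<And>a. continuous_on S (\<lambda>x. J x a)"
  shows "continuous_on (S \<times> projections m) (\<lambda>(x, T). ortho_proj (J x ` range (blinfun_apply T)))"
proof -
  define G where "G x u v = J x u \<bullet> J x v" for x u v
  have G: "inner_form (G x)" if "x \<in> S" for x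
    unfolding inner_form_def
  proof (intro conjI allI impI)
    show "bilinear (G x)"
      using J(1)[OF that] unfolding bilinear_def G_def
      by (auto intro!: linearI simp: linear_add linear_scale inner_add_left inner_add_right)
    show "G x u v = G x v u" for u v by (simp add: G_def inner_commute)
    show "G x u u > 0" if "u \<noteq> 0" for u
      using that J(2)[OF \<open>x \<in> S\<close>] linear_injective_0[OF J(1)[OF \<open>x \<in> S\<close>]] by (auto simp: G_def)
  qed
  define Q where "Q a c x u v = (J x u \<bullet> a) * (J x v \<bullet> c)" for a c x u v
  have Q: "bilinear (Q a c x)" if "x \<in> S" for a c x
    using J(1)[OF that] unfolding bilinear_def Q_def
    by (auto intro!: linearI simp: linear_add linear_scale inner_add_left algebra_simps)
  have eq: "blinfun_apply (ortho_proj (J x ` range (blinfun_apply T))) a \<bullet> c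
      = plane_trace (G x) (Q a c x) m (range (blinfun_apply T))"
    if x: "x \<in> S" and T: "T \<in> projections m" for x T a c
  proof -
    define P where "P = range (blinfun_apply T)"
    have P: "subspace P" "dim P = m" using projectionsE[OF T] by (auto simp: P_def)
    obtain b where b: "onb (G x) m P b" using onb_exists[OF G[OF x] P(1)] P(2) by blast
    then have b': "onb (\<bullet>) m (J x ` P) (\<lambda>j. J x (b j))" by (auto simp: onb_def G_def)
    have "subspace (J x ` P)" by (rule linear_subspace_image[OF J(1)[OF x] P(1)])
    moreover have "dim (J x ` P) = m"
      using dim_image_eq[OF J(1)[OF x], of P] J(2)[OF x] P(2) by (auto simp: inj_on_subset)
    ultimately have "blinfun_apply (ortho_proj (J x ` P)) a \<bullet> c = (\<Sum>j<m. (a \<bullet> J x (b j)) *\<^sub>R J x (b j)) \<bullet> c"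
      using ortho_proj_frame[OF b'] by simp
    also have "\<dots> = (\<Sum>j<m. Q a c x (b j) (b j))"
      by (simp add: inner_sum_left inner_sum_right Q_def inner_commute)
    also have "\<dots> = plane_trace (G x) (Q a c x) m P" by (rule plane_trace_eq[OF b G[OF x] P Q[OF x], symmetric])
    finally show ?thesis by (simp add: P_def)
  qed
  have c: "continuous_on (S \<times> projections m) (\<lambda>(x, T). plane_trace (G x) (Q a c x) m (range (blinfun_apply T)))" for a c
  proof (rule plane_trace_continuous[OF G _ Q])
    show "continuous_on S (\<lambda>x. G x a b)" for a b
      unfolding G_def by (intro continuous_intros J(3))
    show "continuous_on S (\<lambda>x. Q a c x p q)" for p q
      unfolding Q_def by (intro continuous_intros J(3))
  qed
  have "((\<lambda>(x, T). ortho_proj (J x ` range (blinfun_apply T))) \<longlongrightarrow>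
      ortho_proj (J (fst z) ` range (blinfun_apply (snd z)))) (at z within S \<times> projections m)"
    if z: "z \<in> S \<times> projections m" for z
  proof (rule tendsto_componentwise1)
    fix a :: 'e assume "a \<in> Basis"
    show "((\<lambda>w. blinfun_apply (case w of (x, T) \<Rightarrow> ortho_proj (J x ` range (blinfun_apply T))) a) \<longlongrightarrow>
        blinfun_apply (ortho_proj (J (fst z) ` range (blinfun_apply (snd z)))) a) (at z within S \<times> projections m)"
    proof (subst tendsto_componentwise_iff, intro ballI)
      fix k :: 'e assume "k \<in> Basis"
      have "((\<lambda>(x, T). plane_trace (G x) (Q a k x) m (range (blinfun_apply T))) \<longlongrightarrow>
        (case z of (x, T) \<Rightarrow> plane_trace (G x) (Q a k x) m (range (blinfun_apply T)))) (at z within S \<times> projections m)"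
        using c[of a k] z unfolding continuous_on_def by blast
      moreover have "\<forall>\<^sub>F w in at z within S \<times> projections m.
          (case w of (x, T) \<Rightarrow> plane_trace (G x) (Q a k x) m (range (blinfun_apply T))) =
          blinfun_apply (case w of (x, T) \<Rightarrow> ortho_proj (J x ` range (blinfun_apply T))) a \<bullet> k"
        unfolding eventually_at_filter by (intro always_eventually) (auto simp: eq)
      ultimately have "((\<lambda>w. blinfun_apply (case w of (x, T) \<Rightarrow> ortho_proj (J x ` range (blinfun_apply T))) a \<bullet> k) \<longlongrightarrow>
        (case z of (x, T) \<Rightarrow> plane_trace (G x) (Q a k x) m (range (blinfun_apply T)))) (at z within S \<times> projections m)"
        by (rule Lim_transform_eventually)
      then show "((\<lambda>w. blinfun_apply (case w of (x, T) \<Rightarrow> ortho_proj (J x ` range (blinfun_apply T))) a \<bullet> k) \<longlongrightarrow>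
        blinfun_apply (ortho_proj (J (fst z) ` range (blinfun_apply (snd z)))) a \<bullet> k) (at z within S \<times> projections m)"
        using eq z by (auto simp: case_prod_unfold mem_Times_iff)
    qed
  qed
  then show ?thesis unfolding continuous_on_def by (simp add: case_prod_unfold)
qed

section \<open>Topology and measurability of the Grassmann bundle\<close>

context manifold
begin

text \<open>The bundle is defined through \<open>chart_at\<close>. Transition Jacobians are linear
  and injective, so they carry \<open>m\<close>-planes to \<open>m\<close>-planes and any chart
  around \<open>p\<close> may be used instead.\<close>

lemma grassmann_iff:
  assumes c: "c \<in> A" "p \<in> fst c"
  shows "(p, S) \<in> grassmann_bundle A m \<longleftrightarrow> (\<exists>P. subspace P \<and> dim P = m \<and> S = tvec A c p ` P)"
proof -
  have main: "\<exists>P'. subspace P' \<and> dim P' = m \<and> S = tvec A d p ` P'"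
    if c: "c \<in> A" "p \<in> fst c" and d: "d \<in> A" "p \<in> fst d" and P: "subspace P" "dim P = m" "S = tvec A c p ` P" for c d P
  proof (intro exI conjI)
    show "subspace (jac c d p ` P)" by (rule linear_subspace_image[OF jac_linear[OF c(1) d(1) c(2) d(2)] P(1)])
    have "inj (jac c d p)" using jac_inverse[OF c(1) d(1) c(2) d(2)] by (metis injI)
    then show "dim (jac c d p ` P) = m"
      using dim_image_eq[OF jac_linear[OF c(1) d(1) c(2) d(2)], of P] P(2) by (simp add: inj_on_subset)
    show "S = tvec A d p ` jac c d p ` P"
      unfolding P(3) image_image tvec_change[OF c(1) d(1) c(2) d(2)] ..
  qed
  show ?thesis
    unfolding grassmann_bundle_def using main[OF chart_at_in c] main[OF c chart_at_in] by auto
qed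

definition in_chart :: "('a, 'e) chart \<Rightarrow> ('a, 'e) tangent set \<Rightarrow> 'e set" where
  "in_chart c S = (\<lambda>v. v c) ` S"

lemma in_chart_tvec: "c \<in> A \<Longrightarrow> p \<in> fst c \<Longrightarrow> in_chart c (tvec A c p ` P) = P"
  by (simp add: in_chart_def image_image tvec_self)

lemma grassmann_chart:
  assumes "(p, S) \<in> grassmann_bundle A m" "c \<in> A" "p \<in> fst c"
  shows "subspace (in_chart c S)" "dim (in_chart c S) = m" "S = tvec A c p ` in_chart c S"
    "ortho_proj (in_chart c S) \<in> projections m" "v \<in> S \<Longrightarrow> v \<in> tangent_space A p"
proof -
  obtain P where P: "subspace P" "dim P = m" "S = tvec A c p ` P"
    using assms grassmann_iff[OF assms(2,3)] by blast
  then have eq: "in_chart c S = P" using in_chart_tvec assms by simp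
  show "subspace (in_chart c S)" "dim (in_chart c S) = m" "S = tvec A c p ` in_chart c S"
    "ortho_proj (in_chart c S) \<in> projections m" "v \<in> S \<Longrightarrow> v \<in> tangent_space A p"
    using P eq tvec_in_tangent[OF assms(2,3)] by (auto simp: projections_def)
qed

lemma grassmann_generator:
  assumes "c \<in> A" "open W"
  shows "openin (grassmann_topology A m)
    {(p, S) \<in> grassmann_bundle A m. p \<in> fst c \<and> (p, ortho_proj (in_chart c S)) \<in> W}"
  unfolding grassmann_topology_def in_chart_def
  using assms by (intro topology_generated_by_Basis) blast

lemma grassmann_open_base:
  assumes "open U"
  shows "openin (grassmann_topology A m) {(p, S) \<in> grassmann_bundle A m. p \<in> U}"
proof -
  have "{(p, S) \<in> grassmann_bundle A m. p \<in> U} =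
     (\<Union>c\<in>A. {(p, S) \<in> grassmann_bundle A m. p \<in> fst c \<and> (p, ortho_proj (in_chart c S)) \<in> U \<times> UNIV})"
    using chart_ex by fastforce
  then show ?thesis
    by (simp only:) (intro openin_Union ballI, elim imageE, simp only:, rule grassmann_generator, auto intro: open_Times assms)
qed

lemma grassmann_topspace: "topspace (grassmann_topology A m) = grassmann_bundle A m"
proof
  show "topspace (grassmann_topology A m) \<subseteq> grassmann_bundle A m"
    unfolding grassmann_topology_def topology_generated_by_topspace by auto
  show "grassmann_bundle A m \<subseteq> topspace (grassmann_topology A m)"
    using openin_subset[OF grassmann_open_base[OF open_UNIV]] by auto
qed

text \<open>Over a compact subset of a chart domain the bundle is the image, under the
  trivialisation \<open>\<psi>\<close>, of a compact product with \<open>projections m\<close>.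
  Continuity of \<open>\<psi>\<close> has to be tested on generators coming from every other chart
  \<open>d\<close>, where the planes are moved by \<open>jac c d\<close>.\<close>

lemma compactin_grassmann:
  assumes c: "c \<in> A" and K: "compact K" "K \<subseteq> fst c"
  shows "compactin (grassmann_topology A m) {(p, S) \<in> grassmann_bundle A m. p \<in> K}"
proof -
  define D where "D = (snd c ` K) \<times> (projections m :: ('e \<Rightarrow>\<^sub>L 'e) set)"
  define \<psi> where "\<psi> z = (inv_chart c (fst z), tvec A c (inv_chart c (fst z)) ` range (blinfun_apply (snd z)))"
    for z :: "'e \<times> ('e \<Rightarrow>\<^sub>L 'e)"
  have cD: "compact D" unfolding D_def
    using K chart_inv(5)[OF c] by (intro compact_Times compact_projections compact_continuous_image) (auto intro: continuous_on_subset)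
  have DK: "inv_chart c (fst z) \<in> K" "fst z \<in> chart_image c" "snd z \<in> projections m" if "z \<in> D" for z
    using that K(2) chart_inv(3,4)[OF c] by (auto simp: D_def)
  have \<psi>in: "\<psi> z \<in> grassmann_bundle A m" if "z \<in> D" for z
    unfolding \<psi>_def using DK[OF that] projectionsE[of "snd z"] K(2)
    by (subst grassmann_iff[OF c]) auto
  have cont: "continuous_map (top_of_set D) (grassmann_topology A m) \<psi>"
    unfolding grassmann_topology_def
  proof (rule continuous_on_generated_topo)
    fix V assume "V \<in> {{(p, S). (p, S) \<in> grassmann_bundle A m \<and> p \<in> fst d \<and> (p, ortho_proj ((\<lambda>v. v d) ` S)) \<in> W} |d W. d \<in> A \<and> open W}"
    then obtain d W where d: "d \<in> A" "open W"
      and V: "V = {(p, S). (p, S) \<in> grassmann_bundle A m \<and> p \<in> fst d \<and> (p, ortho_proj (in_chart d S)) \<in> W}"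
      unfolding in_chart_def by blast
    \<comment> \<open>The part of \<open>D\<close> over the overlap with \<open>d\<close>: it is
      open in \<open>D\<close>, and outside it \<open>\<psi>\<close> misses
      \<open>V\<close>.\<close>
    define E where "E = D \<inter> (overlap c d \<times> UNIV)"
    define \<theta> where "\<theta> z = (inv_chart c (fst z), ortho_proj (jac c d (inv_chart c (fst z)) ` range (blinfun_apply (snd z))))"
      for z :: "'e \<times> ('e \<Rightarrow>\<^sub>L 'e)"
    have Ov: "inv_chart c x \<in> fst c" "inv_chart c x \<in> fst d" "x \<in> chart_image c" "snd c (inv_chart c x) = x" if "x \<in> overlap c d" for x
      using that overlap(2)[OF c d(1)] chart_inv(1,2)[OF c] by auto
    have 1: "continuous_on (overlap c d \<times> projections m) (\<lambda>(x, T). ortho_proj (jac c d (inv_chart c x) ` range (blinfun_apply T)))"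
    proof (rule ortho_proj_image_continuous)
      fix x assume x: "x \<in> overlap c d"
      show "linear (jac c d (inv_chart c x))" using jac_linear[OF c d(1)] Ov[OF x] by blast
      show "inj (jac c d (inv_chart c x))" using jac_inverse[OF c d(1) Ov(1,2)[OF x]] by (metis injI)
    next
      fix a
      have "continuous_on (overlap c d) (\<lambda>x. fd (snd d \<circ> inv_chart c) x a)"
        using Ck_on_1_fd_continuous[OF overlap(5)[OF c d(1)]] .
      then show "continuous_on (overlap c d) (\<lambda>x. jac c d (inv_chart c x) a)"
        by (rule continuous_on_eq) (simp add: jac_def Ov)
    qed
    have "continuous_on E \<theta>"
      unfolding \<theta>_def
    proof (intro continuous_on_Pair)
      show "continuous_on E (\<lambda>z. inv_chart c (fst z))"
        by (rule continuous_on_compose2[OF chart_inv(6)[OF c]]) (auto simp: E_def Ov intro!: continuous_intros)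
      show "continuous_on E (\<lambda>z. ortho_proj (jac c d (inv_chart c (fst z)) ` range (blinfun_apply (snd z))))"
        using continuous_on_subset[OF 1, of E] by (auto simp: E_def D_def case_prod_unfold)
    qed
    then have "openin (top_of_set E) (E \<inter> \<theta> -` W)"
      using d(2) by (simp add: continuous_on_open_gen[of _ _ UNIV] continuous_openin_preimage_gen)
    moreover have "openin (top_of_set D) E"
      unfolding E_def by (intro openin_open_Int open_Times overlap(1)[OF c d(1)]) auto
    ultimately have "openin (top_of_set D) (E \<inter> \<theta> -` W)" by (rule openin_trans)
    moreover have "\<psi> -` V \<inter> topspace (top_of_set D) = E \<inter> \<theta> -` W"
    proof -
      have "\<psi> z \<in> V \<longleftrightarrow> z \<in> E \<inter> \<theta> -` W" if z: "z \<in> D" for z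
      proof -
        have zE: "z \<in> E \<longleftrightarrow> inv_chart c (fst z) \<in> fst d"
          using z DK[OF z] overlap(2)[OF c d(1)] by (auto simp: E_def mem_Times_iff)
        have "in_chart d (snd (\<psi> z)) = jac c d (inv_chart c (fst z)) ` range (blinfun_apply (snd z))"
          if "z \<in> E"
          using that unfolding in_chart_def \<psi>_def zE by (simp add: image_image tvec_apply[OF d(1)])
        then show ?thesis using \<psi>in[OF z] zE unfolding V by (auto simp: \<psi>_def \<theta>_def)
      qed
      moreover have "E \<subseteq> D" by (auto simp: E_def)
      ultimately have "\<psi> -` V \<inter> D = E \<inter> \<theta> -` W" by blast
      then show ?thesis by simp
    qed
    ultimately show "openin (top_of_set D) (\<psi> -` V \<inter> topspace (top_of_set D))" by simp
  next
    show "\<psi> ` topspace (top_of_set D) \<subseteq>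
      \<Union> {{(p, S). (p, S) \<in> grassmann_bundle A m \<and> p \<in> fst d \<and> (p, ortho_proj ((\<lambda>v. v d) ` S)) \<in> W} |d W. d \<in> A \<and> open W}"
      using \<psi>in grassmann_topspace[of m] unfolding grassmann_topology_def topology_generated_by_topspace
      by auto
  qed
  have "compactin (grassmann_topology A m) (\<psi> ` D)"
    by (rule image_compactin[OF _ cont]) (simp add: compactin_subtopology cD)
  moreover have "\<psi> ` D = {(p, S) \<in> grassmann_bundle A m. p \<in> K}"
  proof (intro equalityI subsetI)
    fix z assume "z \<in> \<psi> ` D"
    then show "z \<in> {(p, S) \<in> grassmann_bundle A m. p \<in> K}"
      using \<psi>in DK by (auto simp: \<psi>_def)
  next
    fix z assume z: "z \<in> {(p, S) \<in> grassmann_bundle A m. p \<in> K}"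
    obtain p S where zp: "z = (p, S)" by force
    have pS: "(p, S) \<in> grassmann_bundle A m" "p \<in> K" "p \<in> fst c" using z zp K(2) by auto
    note g = grassmann_chart[OF pS(1) c pS(3)]
    have "\<psi> (snd c p, ortho_proj (in_chart c S)) = (p, S)"
      unfolding \<psi>_def by (simp add: chart_inv(3)[OF c pS(3)] ortho_proj_fix(2)[OF g(1)] g(3)[symmetric])
    moreover have "(snd c p, ortho_proj (in_chart c S)) \<in> D" using g(4) pS(2) by (auto simp: D_def)
    ultimately show "z \<in> \<psi> ` D" unfolding zp by (metis imageI)
  qed
  ultimately show ?thesis by simp
qed

end

section \<open>Local finiteness and measurability for a varifold\<close>

locale varifold_on = manifold A for A :: "('a::{t2_space, second_countable_topology}, 'e::euclidean_space) chart set" +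
  fixes m :: nat and M :: "('a \<times> ('a, 'e) tangent set) measure"
  assumes M: "varifold A m M"
begin

lemma space_M: "space M = grassmann_bundle A m"
  and sets_M: "sets M = sigma_sets (grassmann_bundle A m) {W. openin (grassmann_topology A m) W}"
  and finite_M: "compactin (grassmann_topology A m) K \<Longrightarrow> emeasure M K < \<infinity>"
  using M by (auto simp: varifold_def)

lemma openin_sets: "openin (grassmann_topology A m) W \<Longrightarrow> W \<in> sets M"
  unfolding sets_M by (intro sigma_sets.Basic) simp

lemma fst_measurable [measurable]: "fst \<in> measurable M borel"
proof (rule borel_measurableI)
  fix U :: "'a set" assume "open U"
  have "fst -` U \<inter> space M = {(p, S) \<in> grassmann_bundle A m. p \<in> U}" by (auto simp: space_M)
  then show "fst -` U \<inter> space M \<in> sets M"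
    using openin_sets[OF grassmann_open_base[OF \<open>open U\<close>]] by simp
qed

lemma weight_simps: "sets (weight M) = sets borel" "space (weight M) = UNIV"
  by (simp_all add: weight_def)

lemma emeasure_weight: "B \<in> sets borel \<Longrightarrow> emeasure (weight M) B = emeasure M (fst -` B \<inter> space M)"
  unfolding weight_def by (rule emeasure_distr[OF fst_measurable])

lemma weight_finite:
  assumes c: "c \<in> A" and K: "compact K" "K \<subseteq> fst c"
  shows "emeasure (weight M) K < \<infinity>"
proof -
  have "emeasure (weight M) K = emeasure M {(p, S) \<in> grassmann_bundle A m. p \<in> K}"
    using K(1) by (subst emeasure_weight) (auto simp: compact_imp_closed borel_closed space_M intro!: arg_cong[where f="emeasure M"])
  then show ?thesis using finite_M[OF compactin_grassmann[OF c K]] by simp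
qed

text \<open>The preimage of an open set is a union of two open sets of the bundle: one over the
  chart domain, where \<open>F\<close> is continuous, and, if 0 belongs to the open set, the part
  over the complement of \<open>K\<close>. Open sets are measurable by the definition of a
  varifold.\<close>

lemma plane_trace_measurable:
  fixes G Q :: "'e \<Rightarrow> 'e \<Rightarrow> 'e \<Rightarrow> real"
  assumes c: "c \<in> A" and K: "closed K" "K \<subseteq> fst c"
    and G: "\<And>x. x \<in> chart_image c \<Longrightarrow> inner_form (G x)" "\<And>a b. continuous_on (chart_image c) (\<lambda>x. G x a b)"
    and Q: "\<And>x. x \<in> chart_image c \<Longrightarrow> bilinear (Q x)" "\<And>a b. continuous_on (chart_image c) (\<lambda>x. Q x a b)"
    and F: "\<And>p S. (p, S) \<in> grassmann_bundle A m \<Longrightarrow> p \<in> fst c \<Longrightarrow>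
       F (p, S) = plane_trace (G (snd c p)) (Q (snd c p)) m (in_chart c S)"
    and F0: "\<And>p S. (p, S) \<in> grassmann_bundle A m \<Longrightarrow> p \<notin> K \<Longrightarrow> F (p, S) = 0"
  shows "F \<in> borel_measurable M"
proof (rule borel_measurableI)
  fix U :: "real set" assume U: "open U"
  define D where "D = chart_image c \<times> (projections m :: ('e \<Rightarrow>\<^sub>L 'e) set)"
  define \<Phi> where "\<Phi> z = plane_trace (G (fst z)) (Q (fst z)) m (range (blinfun_apply (snd z)))"
    for z :: "'e \<times> ('e \<Rightarrow>\<^sub>L 'e)"
  have "continuous_on D \<Phi>"
    using plane_trace_continuous[OF G Q, of m] unfolding D_def \<Phi>_def by (simp add: case_prod_unfold)
  \<comment> \<open>Continuity on \<open>D\<close> yields a relatively open preimage. The generators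
    of the bundle topology are described by open sets of the whole product, so an open extension is
    chosen.\<close>
  then obtain W0 where W0: "open W0" "W0 \<inter> D = \<Phi> -` U \<inter> D"
    using U unfolding continuous_on_open_invariant by blast
  define W where "W = (fst c \<times> (UNIV :: ('e \<Rightarrow>\<^sub>L 'e) set)) \<inter> (\<lambda>(p, T). (snd c p, T)) -` W0"
  have "open W" unfolding W_def
  proof (rule continuous_open_preimage[OF _ _ W0(1)])
    show "continuous_on (fst c \<times> UNIV) (\<lambda>(p, T :: 'e \<Rightarrow>\<^sub>L 'e). (snd c p, T))"
      unfolding case_prod_unfold
      by (intro continuous_on_Pair continuous_on_snd continuous_on_id continuous_on_compose2[OF chart_inv(5)[OF c]] continuous_on_fst) auto
    show "open (fst c \<times> (UNIV :: ('e \<Rightarrow>\<^sub>L 'e) set))" by (intro open_Times chart_homeo(1)[OF c]) simp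
  qed
  note o1 = grassmann_generator[OF c \<open>open W\<close>, of m]
  have o2: "openin (grassmann_topology A m) {(p, S) \<in> grassmann_bundle A m. p \<in> - K}"
    by (rule grassmann_open_base) (use K(1) in auto)
  have iff: "(p, ortho_proj (in_chart c S)) \<in> W \<longleftrightarrow> F (p, S) \<in> U"
    if pS: "(p, S) \<in> grassmann_bundle A m" "p \<in> fst c" for p S
  proof -
    note g = grassmann_chart[OF pS(1) c pS(2)]
    have D: "(snd c p, ortho_proj (in_chart c S)) \<in> D" using g(4) chart_inv(4)[OF c pS(2)] by (auto simp: D_def)
    have "\<Phi> (snd c p, ortho_proj (in_chart c S)) = F (p, S)"
      unfolding F[OF pS] \<Phi>_def by (simp add: ortho_proj_fix(2)[OF g(1)])
    moreover have "(p, ortho_proj (in_chart c S)) \<in> W \<longleftrightarrow> (snd c p, ortho_proj (in_chart c S)) \<in> W0 \<inter> D"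
      using D pS(2) by (auto simp: W_def)
    ultimately show ?thesis using D unfolding W0(2) by auto
  qed
  have "F -` U \<inter> space M =
     {(p, S) \<in> grassmann_bundle A m. p \<in> fst c \<and> (p, ortho_proj (in_chart c S)) \<in> W} \<union>
     (if 0 \<in> U then {(p, S) \<in> grassmann_bundle A m. p \<in> - K} else {})"
  proof (rule set_eqI)
    fix z :: "'a \<times> ('a, 'e) tangent set"
    obtain p S where z: "z = (p, S)" by force
    show "z \<in> F -` U \<inter> space M \<longleftrightarrow> z \<in> {(p, S) \<in> grassmann_bundle A m. p \<in> fst c \<and> (p, ortho_proj (in_chart c S)) \<in> W} \<union>
     (if 0 \<in> U then {(p, S) \<in> grassmann_bundle A m. p \<in> - K} else {})"
    proof (cases "(p, S) \<in> grassmann_bundle A m")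
      case True
      show ?thesis
      proof (cases "p \<in> K")
        case pK: True
        then have "p \<in> fst c" using K(2) by blast
        then show ?thesis using iff[OF True] True pK by (simp add: z space_M)
      next
        case pK: False
        then show ?thesis using iff[OF True] F0[OF True] True by (auto simp: z space_M)
      qed
    qed (simp add: z space_M)
  qed
  then show "F -` U \<inter> space M \<in> sets M"
    using openin_sets[OF o1] openin_sets[OF o2] by auto
qed

end

section \<open>Lowest eigenvalues\<close>

lemma inner_form_cauchy_schwarz:
  assumes G: "inner_form G"
  shows "G u v \<le> sqrt (G u u) * sqrt (G v v)" "\<bar>G u v\<bar> \<le> sqrt (G u u) * sqrt (G v v)"
proof -
  note bil = inner_formD(1)[OF G]
  have sq: "(G u v)\<^sup>2 \<le> G u u * G v v"
  proof (cases "v = 0")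
    case True then show ?thesis by (simp add: bilinear_rzero[OF bil])
  next
    case False
    then have pos: "G v v > 0" using inner_formD(3)[OF G] by blast
    define t where "t = G u v / G v v"
    have "0 \<le> G (u - t *\<^sub>R v) (u - t *\<^sub>R v)" by (rule inner_formD(4)[OF G])
    also have "\<dots> = G u u - 2 * t * G u v + t * t * G v v"
      using inner_formD(2)[OF G, of v u]
      by (simp add: bilinear_lsub[OF bil] bilinear_rsub[OF bil] bilinear_lmul[OF bil] bilinear_rmul[OF bil] algebra_simps)
    also have "\<dots> = G u u - (G u v)\<^sup>2 / G v v"
      using pos by (simp add: t_def power2_eq_square field_simps)
    finally show ?thesis using pos by (simp add: field_simps)
  qed
  then have "\<bar>G u v\<bar> \<le> sqrt (G u u * G v v)" by (metis real_sqrt_abs real_sqrt_le_mono)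
  then show "\<bar>G u v\<bar> \<le> sqrt (G u u) * sqrt (G v v)" by (simp add: real_sqrt_mult)
  then show "G u v \<le> sqrt (G u u) * sqrt (G v v)" by linarith
qed

lemma nonneg_quadratic_linear_coeff_zero:
  fixes a b :: real
  assumes "\<And>t. 2 * t * a + t * t * b \<ge> 0"
  shows "a = 0"
proof (rule ccontr)
  assume a: "a \<noteq> 0"
  \<comment> \<open>Any positive number above \<open>b\<close> would do: at
    \<open>t = - a / c\<close> the linear term then outweighs the quadratic one.\<close>
  define c where "c = \<bar>b\<bar> + 1"
  have c: "c > 0" "b < c" by (auto simp: c_def)
  have "2 * (- a / c) * a + (- a / c) * (- a / c) * b = (a * a / c) * (b / c - 2)"
    using c by (simp add: field_simps)
  moreover have "a * a / c > 0"
    using a c zero_less_power2[of a] by (intro divide_pos_pos) (simp_all add: power2_eq_square)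
  moreover have "b / c - 2 < 0" using c by (simp add: field_simps)
  ultimately have "2 * (- a / c) * a + (- a / c) * (- a / c) * b < 0"
    by (metis mult_pos_neg)
  with assms[of "- a / c"] show False by linarith
qed

text \<open>The \<open>G\<close>-unit sphere of \<open>W\<close> is compact, so \<open>B w w\<close>
  has a minimiser \<open>e\<close> on it. The first-order condition at \<open>e\<close> in a
  direction \<open>w\<close> is the eigenvalue equation, tested only against vectors of
  \<open>W\<close>.\<close>

lemma rayleigh_minimizer:
  fixes G B :: "'e::euclidean_space \<Rightarrow> 'e \<Rightarrow> real"
  assumes G: "inner_form G" and B: "bilinear B" "\<And>u v. B u v = B v u"
    and W: "subspace W" "w0 \<in> W" "w0 \<noteq> 0"
  obtains e \<mu> where "e \<in> W" "G e e = 1" "\<And>w. w \<in> W \<Longrightarrow> B w w \<ge> \<mu> * G w w" "\<And>w. w \<in> W \<Longrightarrow> B e w = \<mu> * G e w" "\<mu> = B e e"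
proof -
  note bil = inner_formD(1)[OF G]
  define K where "K = {w \<in> W. G w w = 1}"
  have norm1: "r /\<^sub>R sqrt (G r r) \<in> K" if r: "r \<in> W" "r \<noteq> 0" for r
  proof -
    have "onb G (Suc 0) W ((\<lambda>_. 0)(0 := r /\<^sub>R sqrt (G r r)))"
      by (rule onb_extend[OF _ G W(1) r]) (auto simp: onb_def)
    then show ?thesis by (auto simp: onb_def K_def)
  qed
  obtain lam \<epsilon> where le: "lam > 0" "\<epsilon> > 0" and co: "\<And>G' u. bilinear G' \<Longrightarrow>
      (\<And>a b. a \<in> Basis \<Longrightarrow> b \<in> Basis \<Longrightarrow> \<bar>G' a b - G a b\<bar> < \<epsilon>) \<Longrightarrow> lam * (norm u)\<^sup>2 \<le> G' u u"
    using coercive_near[OF G] by metis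
  have "norm w \<le> sqrt (1 / lam)" if "w \<in> K" for w
  proof -
    have "lam * (norm w)\<^sup>2 \<le> 1" using co[OF bil, of w] le that by (simp add: K_def)
    then have "(norm w)\<^sup>2 \<le> 1 / lam" using le by (simp add: field_simps)
    then show ?thesis using real_le_rsqrt by blast
  qed
  then have "bounded K" by (rule boundedI)
  have cG: "continuous_on UNIV (\<lambda>w. G w w)" and cB: "continuous_on UNIV (\<lambda>w. B w w)"
    by (rule continuous_on_bilinear_apply; auto simp: bil B)+
  have "closed K"
  proof -
    have "K = W \<inter> (\<lambda>w. G w w) -` {1}" by (auto simp: K_def)
    then show ?thesis
      using closed_subspace[OF W(1)] continuous_closed_preimage[OF cG closed_UNIV, of "{1}"] by auto
  qed
  then have "compact K" using \<open>bounded K\<close> compact_eq_bounded_closed by blast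
  moreover have "K \<noteq> {}" using norm1[OF W(2,3)] by blast
  ultimately obtain e where e: "e \<in> K" "\<And>w. w \<in> K \<Longrightarrow> B e e \<le> B w w"
    using continuous_attains_inf[of K "\<lambda>w. B w w"] continuous_on_subset[OF cB] by blast
  define \<mu> where "\<mu> = B e e"
  have eW: "e \<in> W" and e1: "G e e = 1" using e(1) by (auto simp: K_def)
  have low: "B w w \<ge> \<mu> * G w w" if w: "w \<in> W" for w
  proof (cases "w = 0")
    case True then show ?thesis by (simp add: bilinear_lzero[OF bil] bilinear_lzero[OF B(1)])
  next
    case False
    have pos: "G w w > 0" using inner_formD(3)[OF G False] .
    have "\<mu> \<le> B (w /\<^sub>R sqrt (G w w)) (w /\<^sub>R sqrt (G w w))"
      unfolding \<mu>_def by (rule e(2)[OF norm1[OF w False]])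
    also have "\<dots> = inverse (sqrt (G w w)) * (inverse (sqrt (G w w)) * B w w)"
      by (simp only: bilinear_lmul[OF B(1)] bilinear_rmul[OF B(1)] real_scaleR_def)
    also have "\<dots> = inverse (sqrt (G w w) * sqrt (G w w)) * B w w"
      by (simp only: inverse_mult_distrib mult.assoc)
    also have "\<dots> = B w w / G w w" using pos by (simp add: divide_inverse)
    finally show ?thesis using pos by (simp add: field_simps)
  qed
  have "B e w = \<mu> * G e w" if w: "w \<in> W" for w
  proof -
    have "B e w - \<mu> * G e w = 0"
    proof (rule nonneg_quadratic_linear_coeff_zero)
      fix t :: real
      have "e + t *\<^sub>R w \<in> W" using eW w W(1) by (intro subspace_add subspace_scale)
      from low[OF this] have "0 \<le> B (e + t *\<^sub>R w) (e + t *\<^sub>R w) - \<mu> * G (e + t *\<^sub>R w) (e + t *\<^sub>R w)" by simp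
      also have "\<dots> = 2 * t * (B e w - \<mu> * G e w) + t * t * (B w w - \<mu> * G w w)"
        using B(2)[of w e] inner_formD(2)[OF G, of w e] e1
        by (simp add: bilinear_ladd[OF bil] bilinear_radd[OF bil] bilinear_lmul[OF bil] bilinear_rmul[OF bil]
            bilinear_ladd[OF B(1)] bilinear_radd[OF B(1)] bilinear_lmul[OF B(1)] bilinear_rmul[OF B(1)] \<mu>_def algebra_simps)
      finally show "2 * t * (B e w - \<mu> * G e w) + t * t * (B w w - \<mu> * G w w) \<ge> 0" .
    qed
    then show ?thesis by simp
  qed
  with eW e1 low show thesis using that \<mu>_def by blast
qed

text \<open>The next eigenvector minimises the Rayleigh quotient on the orthogonal complement of
  those already found. The last clause strengthens the induction: it is what places the new
  eigenvalue above the old ones.\<close>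

lemma spectral_aux:
  fixes G B :: "'e::euclidean_space \<Rightarrow> 'e \<Rightarrow> real"
  assumes G: "inner_form G" and B: "bilinear B" "\<And>u v. B u v = B v u" and k: "k \<le> DIM('e)"
  shows "\<exists>e l. onb G k UNIV e \<and> (\<forall>j<k. \<forall>w. B (e j) w = l j * G (e j) w) \<and> (\<forall>i j. i \<le> j \<longrightarrow> j < k \<longrightarrow> l i \<le> l j) \<and>
    (\<forall>w. (\<forall>j<k. G w (e j) = 0) \<longrightarrow> (\<forall>j<k. B w w \<ge> (l j :: real) * G w w))"
  using k
proof (induction k)
  case 0 show ?case by (simp add: onb_def)
next
  case (Suc k)
  from Suc.IH[OF Suc_leD[OF Suc.prems]] obtain e l where e: "onb G k UNIV e"
    and eig': "\<forall>j<k. \<forall>w. B (e j) w = l j * G (e j) w"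
    and srt': "\<forall>i j. i \<le> j \<longrightarrow> j < k \<longrightarrow> l i \<le> l j"
    and low': "\<forall>w. (\<forall>j<k. G w (e j) = 0) \<longrightarrow> (\<forall>j<k. B w w \<ge> l j * G w w)"
    by (elim exE conjE)
  note eig = eig'[rule_format] and srt = srt'[rule_format]
  have low: "\<And>w j. (\<forall>j<k. G w (e j) = 0) \<Longrightarrow> j < k \<Longrightarrow> B w w \<ge> l j * G w w" using low' by blast
  note bil = inner_formD(1)[OF G]
  define W where "W = {w. \<forall>j<k. G w (e j) = 0}"
  have W: "subspace W"
    unfolding W_def subspace_def by (simp add: bilinear_lzero[OF bil] bilinear_ladd[OF bil] bilinear_lmul[OF bil])
  have "\<not> UNIV \<subseteq> span (e ` {..<k})"
  proof
    assume "(UNIV :: 'e set) \<subseteq> span (e ` {..<k})"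
    then have "dim (UNIV :: 'e set) \<le> card (e ` {..<k})" by (intro dim_le_card) auto
    also have "\<dots> \<le> k" using card_image_le[of "{..<k}" e] by simp
    finally show False using Suc.prems by simp
  qed
  then obtain v where v: "v \<notin> span (e ` {..<k})" by auto
  have res: "w - (\<Sum>i<k. G w (e i) *\<^sub>R e i) \<in> W" for w
    using onb_residual(2)[OF e G subspace_UNIV UNIV_I, of _ w] by (simp add: W_def)
  have "(\<Sum>i<k. G v (e i) *\<^sub>R e i) \<in> span (e ` {..<k})"
    by (intro span_sum span_scale span_base) auto
  then have "v - (\<Sum>i<k. G v (e i) *\<^sub>R e i) \<noteq> 0" using v by auto
  from rayleigh_minimizer[OF G B W res this]
  obtain f \<mu> where f: "f \<in> W" "G f f = 1" "\<And>w. w \<in> W \<Longrightarrow> B w w \<ge> \<mu> * G w w"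
    "\<And>w. w \<in> W \<Longrightarrow> B f w = \<mu> * G f w" "\<mu> = B f f" by metis
  have fe: "G f (e j) = 0" "G (e j) f = 0" if "j < k" for j
    using f(1) that inner_formD(2)[OF G] unfolding W_def by auto
  \<comment> \<open>The equation holds on \<open>W\<close>; the other component of \<open>w\<close>
    lies in the span of the earlier eigenvectors, where both sides vanish by symmetry of
    \<open>B\<close>.\<close>
  have fB: "B f w = \<mu> * G f w" for w
  proof -
    have l: "linear (B f)" "linear (G f)" using B(1) bil by (simp_all add: bilinear_def)
    have z: "B f (\<Sum>i<k. G w (e i) *\<^sub>R e i) = 0" "G f (\<Sum>i<k. G w (e i) *\<^sub>R e i) = 0"
      using fe by (auto simp: linear_sum[OF l(1)] linear_scale[OF l(1)] linear_sum[OF l(2)] linear_scale[OF l(2)] B(2)[of f "e _"] eig)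
    show ?thesis using f(4)[OF res[of w]] by (simp add: linear_diff[OF l(1)] linear_diff[OF l(2)] z)
  qed
  let ?e = "e(k := f)" and ?l = "l(k := \<mu>)"
  have "onb G (Suc k) UNIV ?e"
    using e f(2) fe by (auto simp: onb_def less_Suc_eq)
  moreover have "\<forall>j<Suc k. \<forall>w. B (?e j) w = ?l j * G (?e j) w"
    using eig fB by (auto simp: less_Suc_eq)
  moreover have "\<forall>i j. i \<le> j \<longrightarrow> j < Suc k \<longrightarrow> ?l i \<le> ?l j"
  proof -
    have "l i \<le> \<mu>" if "i < k" for i
      using low[of f i] f(1,2,5) that by (simp add: W_def)
    then show ?thesis using srt by (auto simp: less_Suc_eq)
  qed
  moreover have "\<forall>w. (\<forall>j<Suc k. G w (?e j) = 0) \<longrightarrow> (\<forall>j<Suc k. B w w \<ge> ?l j * G w w)"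
  proof (intro allI impI)
    fix w j assume w: "\<forall>j<Suc k. G w (?e j) = 0" and j: "j < Suc k"
    then have w': "\<forall>j<k. G w (e j) = 0" by (metis fun_upd_apply less_Suc_eq less_irrefl)
    show "B w w \<ge> ?l j * G w w"
      using low[OF w', of j] f(3)[of w] w' j by (auto simp: W_def less_Suc_eq)
  qed
  ultimately show ?case by blast
qed

lemma spectral_theorem:
  fixes G B :: "'e::euclidean_space \<Rightarrow> 'e \<Rightarrow> real"
  assumes G: "inner_form G" and B: "bilinear B" "\<And>u v. B u v = B v u"
  obtains e l where "onb G DIM('e) UNIV e" "\<And>j w. j < DIM('e) \<Longrightarrow> B (e j) w = l j * G (e j) w"
    "\<And>i j. i \<le> j \<Longrightarrow> j < DIM('e) \<Longrightarrow> l i \<le> l j"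
proof -
  from spectral_aux[OF G B order.refl] obtain e l where "onb G DIM('e) UNIV e"
    "\<forall>j<DIM('e). \<forall>w. B (e j) w = l j * G (e j) w" "\<forall>i j. i \<le> j \<longrightarrow> j < DIM('e) \<longrightarrow> l i \<le> l j"
    by (elim exE conjE)
  then show thesis by (intro that[of e l]) simp_all
qed

text \<open>In the eigenbasis the trace is the sum of \<open>l i * t i\<close>, where
  \<open>t i\<close> is the squared length of the projection of \<open>e i\<close> to the span of
  \<open>b\<close>. These weights lie between 0 and 1 and add up to \<open>m\<close>, so the sum is
  least when they sit on the \<open>m\<close> smallest eigenvalues.\<close>

lemma ky_fan:
  fixes G B :: "'e::euclidean_space \<Rightarrow> 'e \<Rightarrow> real"
  assumes G: "inner_form G" and B: "bilinear B"
    and e: "onb G DIM('e) UNIV e" and eig: "\<And>j w. j < DIM('e) \<Longrightarrow> B (e j) w = l j * G (e j) w"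
    and srt: "\<And>i j. i \<le> j \<Longrightarrow> j < DIM('e) \<Longrightarrow> l i \<le> l j" and b: "onb G m UNIV b"
  shows "(\<Sum>i<m. l i) \<le> (\<Sum>j<m. B (b j) (b j))"
proof -
  define n where "n = DIM('e)"
  note bil = inner_formD(1)[OF G]
  have mn: "m \<le> n" using onb_le_dim[OF b G] by (simp add: n_def)
  have lB: "linear (\<lambda>u. B u v)" and lG: "linear (\<lambda>u. G u v)" for v
    using B bil by (simp_all add: bilinear_def)
  have ex: "v = (\<Sum>i<n. G v (e i) *\<^sub>R e i)" for v
    unfolding n_def by (rule onb_expand[OF e G subspace_UNIV _ UNIV_I]) simp
  have Gvv: "G v w = (\<Sum>i<n. G v (e i) * G w (e i))" for v w
  proof -
    have "G v w = G (\<Sum>i<n. G v (e i) *\<^sub>R e i) w" using ex[of v] by simp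
    also have "\<dots> = (\<Sum>i<n. G v (e i) * G w (e i))"
      by (simp add: linear_sum[OF lG] linear_scale[OF lG] inner_formD(2)[OF G, of w])
    finally show ?thesis .
  qed
  have Bvv: "B v v = (\<Sum>i<n. l i * (G v (e i))\<^sup>2)" for v
  proof -
    have "B v v = B (\<Sum>i<n. G v (e i) *\<^sub>R e i) v" using ex[of v] by simp
    also have "\<dots> = (\<Sum>i<n. G v (e i) * (l i * G (e i) v))"
      by (simp add: linear_sum[OF lB] linear_scale[OF lB] eig n_def)
    also have "\<dots> = (\<Sum>i<n. l i * (G v (e i))\<^sup>2)"
      by (simp add: power2_eq_square inner_formD(2)[OF G, of "e _"] mult_ac)
    finally show ?thesis .
  qed
  define t where "t i = (\<Sum>j<m. (G (b j) (e i))\<^sup>2)" for i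
  have t0: "t i \<ge> 0" for i by (simp add: t_def sum_nonneg)
  have t1: "t i \<le> 1" if "i < n" for i
  proof -
    let ?v = "e i"
    let ?s = "\<Sum>j<m. G ?v (b j) *\<^sub>R b j"
    have "G (?v - ?s) ?s = (\<Sum>j<m. G ?v (b j) * G (?v - ?s) (b j))"
    proof -
      have "linear (G (?v - ?s))" using bil by (simp add: bilinear_def)
      then show ?thesis by (simp only: linear_sum[of "G (?v - ?s)"] linear_scale[of "G (?v - ?s)"] real_scaleR_def)
    qed
    also have "\<dots> = 0"
      by (rule sum.neutral) (use onb_residual(2)[OF b G subspace_UNIV UNIV_I] in auto)
    finally have z: "G (?v - ?s) ?s = 0" .
    have "0 \<le> G (?v - ?s) (?v - ?s)" by (rule inner_formD(4)[OF G])
    also have "\<dots> = G (?v - ?s) ?v - G (?v - ?s) ?s" by (rule bilinear_rsub[OF bil])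
    also have "\<dots> = G ?v ?v - G ?s ?v" by (simp only: z diff_zero) (rule bilinear_lsub[OF bil])
    also have "G ?s ?v = t i"
      by (simp add: t_def linear_sum[OF lG] linear_scale[OF lG] power2_eq_square inner_formD(2)[OF G, of "e i"])
    also have "G ?v ?v = 1" using e that by (simp add: onb_def n_def)
    finally show ?thesis by simp
  qed
  have ts: "(\<Sum>i<n. t i) = m"
  proof -
    have "(\<Sum>i<n. t i) = (\<Sum>j<m. G (b j) (b j))"
    proof -
      have "(\<Sum>i<n. t i) = (\<Sum>j<m. \<Sum>i<n. (G (b j) (e i))\<^sup>2)" unfolding t_def by (rule sum.swap)
      also have "\<dots> = (\<Sum>j<m. G (b j) (b j))"
        by (rule sum.cong[OF refl], subst Gvv) (simp add: power2_eq_square)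
      finally show ?thesis .
    qed
    also have "\<dots> = (\<Sum>j<m. 1)" using b by (intro sum.cong) (auto simp: onb_def)
    finally show ?thesis by simp
  qed
  have Bs: "(\<Sum>j<m. B (b j) (b j)) = (\<Sum>i<n. l i * t i)"
    unfolding Bvv t_def sum_distrib_left by (rule sum.swap)
  show ?thesis
  proof (cases "m = 0")
    case False
    \<comment> \<open>After subtraction of the \<open>m\<close>-th eigenvalue the first
      \<open>m\<close> coefficients are nonpositive and the others nonnegative. Raising the first
      weights to 1 and dropping the remaining terms therefore cannot increase the sum.\<close>
    define \<mu> where "\<mu> = l (m - 1)"
    have split: "(\<Sum>i<n. f i) = (\<Sum>i<m. f i) + (\<Sum>i=m..<n. f i)" for f :: "nat \<Rightarrow> real"
      using mn sum.atLeastLessThan_concat[of 0 m n f] by (simp add: atLeast0LessThan)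
    have "(\<Sum>i<m. (l i - \<mu>) * 1) \<le> (\<Sum>i<m. (l i - \<mu>) * t i)"
    proof (intro sum_mono mult_left_mono_neg)
      fix i assume "i \<in> {..<m}"
      then show "t i \<le> 1" "l i - \<mu> \<le> 0" using t1 srt[of i "m - 1"] mn by (auto simp: \<mu>_def n_def)
    qed
    moreover have "0 \<le> (\<Sum>i=m..<n. (l i - \<mu>) * t i)"
      by (intro sum_nonneg mult_nonneg_nonneg t0) (use srt in \<open>auto simp: \<mu>_def n_def\<close>)
    ultimately have "(\<Sum>i<m. (l i - \<mu>) * 1) \<le> (\<Sum>i<n. (l i - \<mu>) * t i)" unfolding split by linarith
    also have "\<dots> = (\<Sum>i<n. l i * t i) - \<mu> * m"
      by (simp add: left_diff_distrib sum_subtractf sum_distrib_left[symmetric] ts)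
    finally show ?thesis unfolding Bs by (simp add: sum_subtractf mult.commute)
  qed simp
qed

section \<open>The list of eigenvalues with multiplicity\<close>

lemma sorted_concat_replicate:
  "sorted ys \<Longrightarrow> sorted (concat (map (\<lambda>l. replicate (f l) l) (ys :: 'a::linorder list)))"
  by (induction ys) (auto simp: sorted_append)

lemma count_concat_replicate:
  "distinct ys \<Longrightarrow> count (mset (concat (map (\<lambda>l. replicate (f l) l) ys))) x = (if x \<in> set ys then f x else 0)"
  by (induction ys) auto

lemma concat_replicate_eq:
  fixes xs :: "'a::linorder list"
  assumes "sorted xs" "\<And>x. x \<in> set xs \<Longrightarrow> f x = count (mset xs) x"
  shows "concat (map (\<lambda>l. replicate (f l) l) (sorted_list_of_set (set xs))) = xs" (is "?ys = xs")
proof -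
  have "mset ?ys = mset xs"
    by (rule multiset_eqI) (use assms(2) in \<open>auto simp: count_concat_replicate count_eq_zero_iff simp del: count_mset\<close>)
  moreover have "sorted ?ys" by (rule sorted_concat_replicate) simp
  ultimately show ?thesis using assms(1) properties_for_sort sorted_sort_id by metis
qed

text \<open>By symmetry of \<open>B\<close>, an eigenvector for \<open>x\<close> is
  \<open>G\<close>-orthogonal to every \<open>e i\<close> with \<open>l i \<noteq> x\<close>, so it
  lies in the span of the remaining ones.\<close>

lemma eigenspace_dim:
  fixes G B :: "'e::euclidean_space \<Rightarrow> 'e \<Rightarrow> real"
  assumes G: "inner_form G" and B: "bilinear B" "\<And>u v. B u v = B v u"
    and e: "onb G DIM('e) UNIV e" and eig: "\<And>j w. j < DIM('e) \<Longrightarrow> B (e j) w = l j * G (e j) w"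
  shows "dim {v. \<forall>w. B v w = x * G v w} = card {i. i < DIM('e) \<and> l i = x}"
proof -
  define I where "I = {i. i < DIM('e) \<and> l i = x}"
  note bil = inner_formD(1)[OF G]
  have I: "I \<subseteq> {..<DIM('e)}" by (auto simp: I_def)
  note ind = onb_independent[OF e G]
  have "independent (e ` I)" using ind(2) independent_mono I by blast
  moreover have "card (e ` I) = card I" using inj_on_subset[OF ind(1) I] by (rule card_image)
  moreover have "{v. \<forall>w. B v w = x * G v w} \<subseteq> span (e ` I)"
  proof
    fix v assume v: "v \<in> {v. \<forall>w. B v w = x * G v w}"
    have z: "G v (e i) = 0" if "i < DIM('e)" "i \<notin> I" for i
    proof -
      have "x * G v (e i) = l i * G v (e i)"
        using v eig[OF that(1), of v] B(2)[of v "e i"] inner_formD(2)[OF G, of v "e i"] by simp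
      moreover have "l i \<noteq> x" using that by (simp add: I_def)
      ultimately show ?thesis by simp
    qed
    have "v = (\<Sum>i<DIM('e). G v (e i) *\<^sub>R e i)"
      by (rule onb_expand[OF e G subspace_UNIV _ UNIV_I]) simp
    also have "\<dots> = (\<Sum>i\<in>I. G v (e i) *\<^sub>R e i)"
      by (rule sum.mono_neutral_right) (use I z in auto)
    also have "\<dots> \<in> span (e ` I)" by (intro span_sum span_scale span_base) auto
    finally show "v \<in> span (e ` I)" .
  qed
  moreover have "e ` I \<subseteq> {v. \<forall>w. B v w = x * G v w}" using eig by (auto simp: I_def)
  ultimately show ?thesis using basis_card_eq_dim[of "e ` I"] by (simp add: I_def)
qed

context manifold
begin

lemma tvec_zero: "c \<in> A \<Longrightarrow> p \<in> fst c \<Longrightarrow> tvec A c p 0 = (\<lambda>_. 0)"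
proof
  fix d assume c: "c \<in> A" "p \<in> fst c"
  show "tvec A c p 0 d = 0"
  proof (cases "d \<in> A \<and> p \<in> fst d")
    case True then show ?thesis using c linear_0[OF jac_linear] by (simp add: tvec_apply)
  qed (auto simp: tvec_def)
qed

text \<open>The spectral theorem in the chart identifies \<open>eigenvalue_list\<close> with the
  sorted list of the \<open>l j\<close>, multiplicities included, and \<open>ky_fan\<close> compares
  it with an arbitrary frame. The existence of the frame \<open>b\<close> forces \<open>m\<close> to
  be at most the dimension, so \<open>take m\<close> really returns \<open>m\<close>
  eigenvalues.\<close>

lemma trace_lowest_le:
  fixes B :: "('a, 'e) tangent \<Rightarrow> ('a, 'e) tangent \<Rightarrow> real" and Bc :: "'e \<Rightarrow> 'e \<Rightarrow> real"
  assumes g: "C1_metric A g"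
    and B: "\<And>v w. B v w = Bc (v (chart_at A p)) (w (chart_at A p))"
    and Bc: "bilinear Bc" "\<And>u v. Bc u v = Bc v u"
    and b: "onb (metric_in_chart A g (chart_at A p) (snd (chart_at A p) p)) m UNIV b"
  shows "trace_lowest A g m p B \<le> (\<Sum>j<m. Bc (b j) (b j))"
proof -
  define c where "c = chart_at A p"
  have c: "c \<in> A" "p \<in> fst c" using chart_at_in by (auto simp: c_def)
  define G where "G = metric_in_chart A g c (snd c p)"
  have G: "inner_form G" unfolding G_def by (rule C1_metric_inner_form[OF g c(1) chart_inv(4)[OF c]])
  obtain e l where e: "onb G DIM('e) UNIV e" and eig: "\<And>j w. j < DIM('e) \<Longrightarrow> Bc (e j) w = l j * G (e j) w"
    and srt: "\<And>i j. i \<le> j \<Longrightarrow> j < DIM('e) \<Longrightarrow> l i \<le> l j" using spectral_theorem[OF G Bc] by metis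
  define xs where "xs = map l [0..<DIM('e)]"
  have B': "B v w = Bc (v c) (w c)" for v w using B by (simp add: c_def)
  define V where "V x = {v. \<forall>w. Bc v w = x * G v w}" for x
  have esp: "eigenspace A g p B x = tvec A c p ` V x" for x
  proof (intro equalityI subsetI)
    fix v assume v: "v \<in> eigenspace A g p B x"
    then have vT: "v \<in> tangent_space A p" by (simp add: eigenspace_def)
    have "Bc (v c) w = x * G (v c) w" for w
    proof -
      have wT: "tvec A c p w \<in> tangent_space A p" by (rule tvec_in_tangent[OF c])
      have "B v (tvec A c p w) = x * g p v (tvec A c p w)" using v wT by (simp add: eigenspace_def)
      then show ?thesis unfolding B' metric_tangent[OF vT wT c] by (simp add: tvec_self[OF c] G_def)
    qed
    then have "v c \<in> V x" by (simp add: V_def)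
    then show "v \<in> tvec A c p ` V x" using tangent_eq[OF vT c] by blast
  next
    fix v assume "v \<in> tvec A c p ` V x"
    then obtain u where u: "v = tvec A c p u" "u \<in> V x" by blast
    have vT: "v \<in> tangent_space A p" unfolding u(1) by (rule tvec_in_tangent[OF c])
    have "B v w = x * g p v w" if w: "w \<in> tangent_space A p" for w
      unfolding B' metric_tangent[OF vT w c] using u by (simp add: V_def G_def tvec_self[OF c])
    then show "v \<in> eigenspace A g p B x" using vT by (simp add: eigenspace_def)
  qed
  have mult: "eigen_multiplicity A g p B x = card {i. i < DIM('e) \<and> l i = x}" for x
    unfolding eigen_multiplicity_def c_def[symmetric] esp image_image tvec_self[OF c]
    using eigenspace_dim[OF G Bc e eig, of x] by (simp add: V_def)
  have cnt: "count (mset xs) x = card {i. i < DIM('e) \<and> l i = x}" for x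
  proof -
    have "count (mset xs) x = length (filter (\<lambda>i. x = l i) [0..<DIM('e)])"
      unfolding xs_def count_mset by (simp add: count_list_eq_length_filter filter_map o_def)
    also have "\<dots> = card {i. i < DIM('e) \<and> x = l i}"
      by (simp add: length_filter_conv_card) (metis (mono_tags, lifting) add.left_neutral nth_upt)
    finally show ?thesis by (simp add: eq_commute conj_commute)
  qed
  have E: "{x. \<exists>v\<in>eigenspace A g p B x. v \<noteq> (\<lambda>_. 0)} = set xs"
  proof -
    have nz: "tvec A c p u \<noteq> (\<lambda>_. 0) \<longleftrightarrow> u \<noteq> 0" for u
      using tvec_zero[OF c] tvec_self[OF c, of u] by auto
    have "(\<exists>v\<in>eigenspace A g p B x. v \<noteq> (\<lambda>_. 0)) \<longleftrightarrow> x \<in> set xs" for x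
    proof -
      have "(\<exists>v\<in>eigenspace A g p B x. v \<noteq> (\<lambda>_. 0)) \<longleftrightarrow> (\<exists>u\<in>V x. u \<noteq> 0)"
        unfolding esp using nz by simp
      also have "\<dots> \<longleftrightarrow> dim (V x) \<noteq> 0"
        unfolding dim_eq_0 by auto
      also have "\<dots> \<longleftrightarrow> card {i. i < DIM('e) \<and> l i = x} \<noteq> 0"
        using eigenspace_dim[OF G Bc e eig, of x] by (simp add: V_def)
      also have "\<dots> \<longleftrightarrow> x \<in> set xs" by (auto simp: xs_def)
      finally show ?thesis .
    qed
    then show ?thesis by blast
  qed
  have "sorted xs"
    unfolding xs_def by (auto simp: sorted_iff_nth_mono srt)
  then have "eigenvalue_list A g p B = xs"
    unfolding eigenvalue_list_def E by (rule concat_replicate_eq) (simp only: mult cnt)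
  moreover have "m \<le> DIM('e)" using onb_le_dim[OF b] G by (simp add: G_def c_def)
  ultimately have "trace_lowest A g m p B = (\<Sum>i<m. l i)"
    by (simp add: trace_lowest_def xs_def take_map interv_sum_list_conv_sum_set_nat atLeast0LessThan)
  also have "\<dots> \<le> (\<Sum>j<m. Bc (b j) (b j))"
    by (rule ky_fan[OF G Bc(1) e eig srt]) (use b in \<open>auto simp: G_def c_def\<close>)
  finally show ?thesis .
qed

text \<open>By Cauchy-Schwarz the supremum is at most the length of the gradient \<open>z\<close>,
  and the normalised gradient attains it; for \<open>z = 0\<close> the zero vector does.\<close>

lemma deriv_norm_eq:
  fixes p :: 'a
  assumes g: "C1_metric A g"
  defines "c \<equiv> chart_at A p"
  defines "G \<equiv> metric_in_chart A g c (snd c p)"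
  assumes z: "\<And>w. G z w = frechet_derivative (f \<circ> inv_chart c) (at (snd c p)) w"
  shows "deriv_norm A g f p = sqrt (G z z)"
proof -
  have c: "c \<in> A" "p \<in> fst c" using chart_at_in by (auto simp: c_def)
  have G: "inner_form G" unfolding G_def by (rule C1_metric_inner_form[OF g c(1) chart_inv(4)[OF c]])
  define N where "N = {v \<in> tangent_space A p. tnorm g p v \<le> 1}"
  have tn: "tnorm g p v = sqrt (G (v c) (v c))" if "v \<in> tangent_space A p" for v
    unfolding G_def by (rule tnorm_chart[OF that c])
  have "\<exists>u. sqrt (G u u) \<le> 1 \<and> G z u = sqrt (G z z)"
  proof (cases "z = 0")
    case True
    then show ?thesis using bilinear_lzero[OF inner_formD(1)[OF G]] by (intro exI[of _ 0]) simp
  next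
    case False
    have pos: "sqrt (G z z) > 0" using inner_formD(3)[OF G False] by simp
    have "onb G (Suc 0) UNIV ((\<lambda>_. 0)(0 := z /\<^sub>R sqrt (G z z)))"
      by (rule onb_extend[OF _ G subspace_UNIV UNIV_I False]) (auto simp: onb_def)
    then have "G (z /\<^sub>R sqrt (G z z)) (z /\<^sub>R sqrt (G z z)) = 1" by (simp add: onb_def)
    moreover have "G z (z /\<^sub>R sqrt (G z z)) = inverse (sqrt (G z z)) * G z z"
      by (simp only: bilinear_rmul[OF inner_formD(1)[OF G]] real_scaleR_def)
    moreover have "\<dots> = sqrt (G z z)"
      using pos by (metis divide_inverse_commute less_imp_le mult.commute real_div_sqrt real_sqrt_ge_0_iff)
    ultimately show ?thesis by (intro exI[of _ "z /\<^sub>R sqrt (G z z)"]) (simp only: real_sqrt_one order_refl simp_thms)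
  qed
  then obtain u where u: "sqrt (G u u) \<le> 1" "G z u = sqrt (G z z)" by blast
  have "(SUP v\<in>N. G z (v c)) = sqrt (G z z)"
  proof (rule cSup_eq_maximum)
    have "tvec A c p u \<in> N"
      using tn[OF tvec_in_tangent[OF c, of u]] u(1) by (simp add: N_def tvec_in_tangent[OF c] tvec_self[OF c])
    then show "sqrt (G z z) \<in> (\<lambda>v. G z (v c)) ` N"
      by (rule rev_image_eqI) (simp add: tvec_self[OF c] u(2))
  next
    fix y assume "y \<in> (\<lambda>v. G z (v c)) ` N"
    then obtain v where v: "v \<in> tangent_space A p" "tnorm g p v \<le> 1" "y = G z (v c)" by (auto simp: N_def)
    have "y \<le> sqrt (G z z) * sqrt (G (v c) (v c))" unfolding v(3) by (rule inner_form_cauchy_schwarz[OF G])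
    also have "\<dots> \<le> sqrt (G z z) * 1"
      using v(2) tn[OF v(1)] inner_formD(4)[OF G] by (intro mult_left_mono) auto
    finally show "y \<le> sqrt (G z z)" by simp
  qed
  then show ?thesis unfolding deriv_norm_def c_def[symmetric] Let_def N_def z .
qed

end

section \<open>Balls of the Riemannian distance\<close>

text \<open>If the right side is infinite the bound is trivial. Otherwise the derivative is Lebesgue
  integrable, and the fundamental theorem with finitely many exceptional points expresses the
  increment as its integral.\<close>

lemma norm_increment_le_nn_integral:
  fixes f f' :: "real \<Rightarrow> 'e::euclidean_space"
  assumes "a \<le> b" and f: "continuous_on {a..b} f" and S: "finite S"
    and d: "\<And>t. t \<in> {a<..<b} - S \<Longrightarrow> (f has_vector_derivative f' t) (at t)"
    and c: "continuous_on ({a<..<b} - S) f'"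
  shows "ennreal (norm (f b - f a)) \<le> (\<integral>\<^sup>+t\<in>{a<..<b} - S. ennreal (norm (f' t)) \<partial>lborel)"
proof -
  define E where "E = {a<..<b} - S"
  \<comment> \<open>Extension by zero off the good set gives a Borel function on the whole line, to
    which both notions of integral apply.\<close>
  define D where "D t = indicat_real E t *\<^sub>R f' t" for t
  have E: "E \<in> sets borel" using S by (auto simp: E_def intro!: borel_open open_Diff finite_imp_closed)
  have mD: "D \<in> borel_measurable borel"
    unfolding D_def using borel_measurable_continuous_on_indicator[OF E, of f'] c by (simp add: E_def)
  have eq: "(\<integral>\<^sup>+t\<in>E. ennreal (norm (f' t)) \<partial>lborel) = (\<integral>\<^sup>+t. ennreal (norm (D t)) \<partial>lborel)"
    by (intro nn_integral_cong) (auto simp: D_def indicator_def)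
  show ?thesis
  proof (cases "(\<integral>\<^sup>+t. ennreal (norm (D t)) \<partial>lborel) < \<infinity>")
    case True
    have int: "integrable lborel D"
      using mD True by (intro integrableI_bounded) auto
    have "(D has_integral f b - f a) {a..b}"
    proof (rule fundamental_theorem_of_calculus_interior_strong[OF S \<open>a \<le> b\<close> _ f])
      fix t assume t: "t \<in> {a<..<b} - S"
      then have "D t = f' t" by (simp add: D_def E_def)
      then show "(f has_vector_derivative D t) (at t)" using d[OF t] by simp
    qed
    then have "(D has_integral f b - f a) UNIV"
      by (rule has_integral_on_superset) (auto simp: D_def E_def)
    moreover have "(D has_integral integral\<^sup>L lborel D) UNIV"
      by (rule has_integral_integral_lborel[OF int])
    ultimately have "f b - f a = integral\<^sup>L lborel D" by (rule has_integral_unique)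
    then show ?thesis using integral_norm_bound_ennreal[OF int] eq by (simp add: E_def)
  next
    case False
    then have "(\<integral>\<^sup>+t. ennreal (norm (D t)) \<partial>lborel) = \<infinity>" by (simp add: less_top[symmetric])
    then show ?thesis using eq by (simp add: E_def)
  qed
qed

section \<open>Curves: speed, length, reparametrisation and concatenation\<close>

context manifold
begin

definition speed where "speed g \<gamma> t = tnorm g (\<gamma> t) (velocity A \<gamma> t)"

text \<open>The exceptional set is made explicit and contains the endpoints, so that
  \<open>{0..1} - S\<close> is open and two-sided derivatives are available on it in every
  chart.\<close>

definition smooth_off where
  "smooth_off \<gamma> S \<longleftrightarrow> finite S \<and> {0, 1} \<subseteq> S \<and> path \<gamma> \<and>
     (\<forall>c\<in>A. (snd c \<circ> \<gamma>) C1_differentiable_on {t \<in> {0..1} - S. \<gamma> t \<in> fst c})"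

lemma piecewise_C1_curve_iff: "piecewise_C1_curve A \<gamma> \<longleftrightarrow> (\<exists>S. smooth_off \<gamma> S)"
proof
  assume "piecewise_C1_curve A \<gamma>"
  then obtain S where S: "path \<gamma>" "finite S"
    "\<forall>c\<in>A. (snd c \<circ> \<gamma>) C1_differentiable_on {t \<in> {0..1} - S. \<gamma> t \<in> fst c}"
    by (auto simp: piecewise_C1_curve_def)
  have "smooth_off \<gamma> (S \<union> {0, 1})"
    unfolding smooth_off_def using S by (auto intro: C1_differentiable_on_subset)
  then show "\<exists>S. smooth_off \<gamma> S" ..
qed (auto simp: piecewise_C1_curve_def smooth_off_def)

lemma smooth_offD:
  assumes "smooth_off \<gamma> S"
  shows "finite S" "open ({0..1} - S)" "path \<gamma>" "continuous_on ({0..1} - S) \<gamma>"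
    "{0..1} - S \<subseteq> {0<..<1}"
    "c \<in> A \<Longrightarrow> t \<in> {0..1} - S \<Longrightarrow> \<gamma> t \<in> fst c \<Longrightarrow>
      ((snd c \<circ> \<gamma>) has_vector_derivative vector_derivative (snd c \<circ> \<gamma>) (at t)) (at t)"
    "c \<in> A \<Longrightarrow> continuous_on {t \<in> {0..1} - S. \<gamma> t \<in> fst c} (\<lambda>t. vector_derivative (snd c \<circ> \<gamma>) (at t))"
    "c \<in> A \<Longrightarrow> open {t \<in> {0..1} - S. \<gamma> t \<in> fst c}"
proof -
  show fin: "finite S" and p: "path \<gamma>" using assms by (auto simp: smooth_off_def)
  have eq: "{0..1} - S = {0<..<1} - S" using assms by (auto simp: smooth_off_def) (metis insert_subset order_le_less)+
  show o: "open ({0..1} - S)" unfolding eq using fin by (intro open_Diff finite_imp_closed) auto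
  show "{0..1} - S \<subseteq> {0<..<1}" using eq by auto
  show c\<gamma>: "continuous_on ({0..1} - S) \<gamma>" using p unfolding path_def by (rule continuous_on_subset) auto
  {
    assume c: "c \<in> A"
    have "(snd c \<circ> \<gamma>) C1_differentiable_on {t \<in> {0..1} - S. \<gamma> t \<in> fst c}"
      using assms c by (auto simp: smooth_off_def)
    then have C: "\<forall>x\<in>{t \<in> {0..1} - S. \<gamma> t \<in> fst c}. (snd c \<circ> \<gamma>) differentiable at x"
      "continuous_on {t \<in> {0..1} - S. \<gamma> t \<in> fst c} (\<lambda>t. vector_derivative (snd c \<circ> \<gamma>) (at t))"
      unfolding C1_differentiable_on_eq by auto
    show "t \<in> {0..1} - S \<Longrightarrow> \<gamma> t \<in> fst c \<Longrightarrow>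
      ((snd c \<circ> \<gamma>) has_vector_derivative vector_derivative (snd c \<circ> \<gamma>) (at t)) (at t)"
      using C(1) by (simp add: vector_derivative_works[symmetric])
    show "continuous_on {t \<in> {0..1} - S. \<gamma> t \<in> fst c} (\<lambda>t. vector_derivative (snd c \<circ> \<gamma>) (at t))" by (rule C(2))
    have "{t \<in> {0..1} - S. \<gamma> t \<in> fst c} = ({0..1} - S) \<inter> \<gamma> -` fst c" by auto
    then show "open {t \<in> {0..1} - S. \<gamma> t \<in> fst c}"
      using continuous_open_preimage[OF c\<gamma> o chart_homeo(1)[OF c]] by simp
  }
qed

text \<open>\<open>velocity\<close> uses a chart that changes along the curve, whereas length
  estimates need one chart during a whole time interval.\<close>

lemma velocity_chart:
  assumes \<gamma>: "smooth_off \<gamma> S" and d: "d \<in> A" and t: "t \<in> {0..1} - S" "\<gamma> t \<in> fst d"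
  shows "velocity A \<gamma> t = tvec A d (\<gamma> t) (vector_derivative (snd d \<circ> \<gamma>) (at t))"
proof -
  define c where "c = chart_at A (\<gamma> t)"
  have c: "c \<in> A" and tc: "\<gamma> t \<in> fst c" using chart_at_in by (auto simp: c_def)
  let ?U = "{t \<in> {0..1} - S. \<gamma> t \<in> fst c} \<inter> {t \<in> {0..1} - S. \<gamma> t \<in> fst d}"
  have U: "open ?U" "t \<in> ?U" using smooth_offD(8)[OF \<gamma> c] smooth_offD(8)[OF \<gamma> d] t tc by auto
  have "((snd c \<circ> \<gamma>) has_derivative (\<lambda>h. h *\<^sub>R vector_derivative (snd c \<circ> \<gamma>) (at t))) (at t)"
    using smooth_offD(6)[OF \<gamma> c t(1) tc] by (simp add: has_vector_derivative_def)
  moreover have "((snd d \<circ> inv_chart c) has_derivative jac c d (\<gamma> t)) (at ((snd c \<circ> \<gamma>) t))"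
    using trans_has_derivative[OF c d tc t(2)] by simp
  ultimately have "((snd d \<circ> inv_chart c) \<circ> (snd c \<circ> \<gamma>) has_derivative
      jac c d (\<gamma> t) \<circ> (\<lambda>h. h *\<^sub>R vector_derivative (snd c \<circ> \<gamma>) (at t))) (at t)"
    by (rule diff_chain_at)
  then have "((snd d \<circ> \<gamma>) has_derivative
      jac c d (\<gamma> t) \<circ> (\<lambda>h. h *\<^sub>R vector_derivative (snd c \<circ> \<gamma>) (at t))) (at t)"
    by (rule has_derivative_cong_open[OF _ U]) (simp add: chart_inv(3)[OF c])
  then have "((snd d \<circ> \<gamma>) has_vector_derivative jac c d (\<gamma> t) (vector_derivative (snd c \<circ> \<gamma>) (at t))) (at t)"
    by (simp add: has_vector_derivative_def o_def linear_scale[OF jac_linear[OF c d tc t(2)]])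
  then have eq: "vector_derivative (snd d \<circ> \<gamma>) (at t) = jac c d (\<gamma> t) (vector_derivative (snd c \<circ> \<gamma>) (at t))"
    by (rule vector_derivative_at)
  show ?thesis
    unfolding velocity_def c_def[symmetric] Let_def eq tvec_change[OF c d tc t(2)] ..
qed

lemma speed_chart:
  assumes \<gamma>: "smooth_off \<gamma> S" and d: "d \<in> A" and t: "t \<in> {0..1} - S" "\<gamma> t \<in> fst d"
  defines "v \<equiv> vector_derivative (snd d \<circ> \<gamma>) (at t)"
  shows "speed g \<gamma> t = sqrt (metric_in_chart A g d (snd d (\<gamma> t)) v v)"
  unfolding speed_def velocity_chart[OF assms(1-4)] tnorm_chart[OF tvec_in_tangent[OF d t(2)] d t(2)]
  by (simp add: tvec_self[OF d t(2)] v_def)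

lemma speed_continuous:
  assumes g: "C1_metric A g" and \<gamma>: "smooth_off \<gamma> S"
  shows "continuous_on ({0..1} - S) (speed g \<gamma>)"
  unfolding continuous_on_eq_continuous_at[OF smooth_offD(2)[OF \<gamma>]]
proof
  fix t assume t: "t \<in> {0..1} - S"
  obtain d where d: "d \<in> A" "\<gamma> t \<in> fst d" using chart_ex by metis
  let ?U = "{t \<in> {0..1} - S. \<gamma> t \<in> fst d}"
  have c\<gamma>: "continuous_on ?U (\<lambda>t. snd d (\<gamma> t))"
    by (rule continuous_on_compose2[OF chart_inv(5)[OF d(1)] continuous_on_subset[OF smooth_offD(4)[OF \<gamma>]]]) auto
  have "continuous_on ?U (\<lambda>t. metric_in_chart A g d (snd d (\<gamma> t)) (vector_derivative (snd d \<circ> \<gamma>) (at t)) (vector_derivative (snd d \<circ> \<gamma>) (at t)))"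
  proof (rule continuous_on_bilinear_apply[where B="\<lambda>t. metric_in_chart A g d (snd d (\<gamma> t))"])
    show "bilinear (metric_in_chart A g d (snd d (\<gamma> t)))" if "t \<in> ?U" for t
      by (rule metric_bilinear[OF g d(1)]) (use that chart_inv(4)[OF d(1)] in auto)
    show "continuous_on ?U (\<lambda>t. metric_in_chart A g d (snd d (\<gamma> t)) a b)" for a b
      by (rule continuous_on_compose2[OF Ck_on_1_continuous[OF C1_metric_Ck[OF g d(1)]] c\<gamma>])
        (use chart_inv(4)[OF d(1)] in auto)
  qed (rule smooth_offD(7)[OF \<gamma> d(1)])+
  then have "continuous_on ?U (\<lambda>t. sqrt (metric_in_chart A g d (snd d (\<gamma> t)) (vector_derivative (snd d \<circ> \<gamma>) (at t)) (vector_derivative (snd d \<circ> \<gamma>) (at t))))"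
    by (intro continuous_intros)
  then have "continuous_on ?U (speed g \<gamma>)"
    by (rule continuous_on_eq) (simp add: speed_chart[OF \<gamma> d(1)])
  then show "isCont (speed g \<gamma>) t"
    using continuous_on_eq_continuous_at[OF smooth_offD(8)[OF \<gamma> d(1)]] t d(2) by blast
qed

lemma curve_length_eq:
  assumes "finite S"
  shows "curve_length A g \<gamma> = (\<integral>\<^sup>+t. ennreal (speed g \<gamma> t) * indicator ({0..1} - S) t \<partial>lborel)"
  unfolding curve_length_def speed_def[symmetric]
proof (rule nn_integral_cong_AE)
  have "AE t in lborel. t \<notin> S"
    using assms by (intro AE_not_in finite_imp_null_set_lborel)
  then show "AE t in lborel. ennreal (speed g \<gamma> t) * indicator {0..1} t = ennreal (speed g \<gamma> t) * indicator ({0..1} - S) t"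
    by eventually_elim (auto simp: indicator_def)
qed

lemma speed_measurable:
  assumes g: "C1_metric A g" and \<gamma>: "smooth_off \<gamma> S"
  shows "(\<lambda>t. ennreal (speed g \<gamma> t) * indicator ({0..1} - S) t) \<in> borel_measurable borel"
proof -
  have "(\<lambda>t. indicat_real ({0..1} - S) t *\<^sub>R speed g \<gamma> t) \<in> borel_measurable borel"
    by (rule borel_measurable_continuous_on_indicator[OF borel_open[OF smooth_offD(2)[OF \<gamma>]] speed_continuous[OF g \<gamma>]])
  then have "(\<lambda>t. ennreal (indicat_real ({0..1} - S) t *\<^sub>R speed g \<gamma> t)) \<in> borel_measurable borel"
    by measurable
  moreover have "ennreal (indicat_real ({0..1} - S) t *\<^sub>R speed g \<gamma> t) = ennreal (speed g \<gamma> t) * indicator ({0..1} - S) t" for t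
    by (auto simp: indicator_def)
  ultimately show ?thesis by simp
qed

lemma inner_form_near:
  assumes g: "C1_metric A g" and c: "c \<in> A" and x: "x0 \<in> chart_image c"
  obtains lam \<rho> where "lam > 0" "\<rho> > 0" "cball x0 \<rho> \<subseteq> chart_image c"
    "\<And>y u. y \<in> cball x0 \<rho> \<Longrightarrow> lam * (norm u)\<^sup>2 \<le> metric_in_chart A g c y u u"
proof -
  let ?G = "metric_in_chart A g c"
  obtain lam \<epsilon> where le: "lam > 0" "\<epsilon> > 0" and co: "\<And>G' u. bilinear G' \<Longrightarrow>
      (\<And>a b. a \<in> Basis \<Longrightarrow> b \<in> Basis \<Longrightarrow> \<bar>G' a b - ?G x0 a b\<bar> < \<epsilon>) \<Longrightarrow> lam * (norm u)\<^sup>2 \<le> G' u u"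
    using coercive_near[OF C1_metric_inner_form[OF g c x]] by metis
  have "\<forall>\<^sub>F y in nhds x0. \<bar>?G y a b - ?G x0 a b\<bar> < \<epsilon>" for a b
  proof -
    have "isCont (\<lambda>y. ?G y a b) x0"
      using Ck_on_1_continuous[OF C1_metric_Ck[OF g c]] continuous_on_eq_continuous_at[OF chart_homeo(2)[OF c]] x by blast
    then have "((\<lambda>y. ?G y a b) \<longlongrightarrow> ?G x0 a b) (nhds x0)"
      unfolding isCont_def by (rule tendsto_at_iff_tendsto_nhds[THEN iffD1])
    from tendstoD[OF this le(2)] show ?thesis by (simp add: dist_real_def)
  qed
  then have "\<forall>\<^sub>F y in nhds x0. \<forall>a\<in>Basis. \<forall>b\<in>Basis. \<bar>?G y a b - ?G x0 a b\<bar> < \<epsilon>"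
    by (simp add: eventually_ball_finite_distrib)
  with eventually_nhds_in_open[OF chart_homeo(2)[OF c] x]
  have "\<forall>\<^sub>F y in nhds x0. y \<in> chart_image c \<and> (\<forall>a\<in>Basis. \<forall>b\<in>Basis. \<bar>?G y a b - ?G x0 a b\<bar> < \<epsilon>)"
    by eventually_elim simp
  then obtain d where d: "d > 0" "\<And>y. dist y x0 < d \<Longrightarrow> y \<in> chart_image c \<and> (\<forall>a\<in>Basis. \<forall>b\<in>Basis. \<bar>?G y a b - ?G x0 a b\<bar> < \<epsilon>)"
    unfolding eventually_nhds_metric by blast
  show thesis
  proof (rule that[of lam "d / 2"])
    show "cball x0 (d / 2) \<subseteq> chart_image c" using d by (force simp: dist_commute)
    fix y u assume "y \<in> cball x0 (d / 2)"
    then have "dist y x0 < d" using d(1) by (simp add: dist_commute)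
    with d(2) show "lam * (norm u)\<^sup>2 \<le> ?G y u u" by (intro co metric_bilinear[OF g c]) auto
  qed (use le d in auto)
qed

text \<open>On a small closed coordinate ball the metric dominates \<open>lam\<close> times the
  Euclidean one. A curve that starts at the centre and ends outside the ball covers a coordinate
  distance of at least \<open>\<rho>\<close> before first leaving it, so its length is at least
  \<open>sqrt lam * \<rho>\<close>.\<close>

lemma riem_ball_small:
  assumes g: "C1_metric A g" and U: "open U" "x \<in> U"
  shows "\<exists>r>0. riem_ball A g x r \<subseteq> U"
proof -
  obtain c where c: "c \<in> A" "x \<in> fst c" using chart_ex by metis
  let ?G = "metric_in_chart A g c"
  define x0 where "x0 = snd c x"
  note x0 = chart_inv(4)[OF c, folded x0_def]
  obtain lam \<rho>1 where le: "lam > 0" "\<rho>1 > 0" "cball x0 \<rho>1 \<subseteq> chart_image c"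
    and low: "\<And>y u. y \<in> cball x0 \<rho>1 \<Longrightarrow> lam * (norm u)\<^sup>2 \<le> ?G y u u"
    using inner_form_near[OF g c(1) x0] by metis
  have "open (snd c ` (U \<inter> fst c))" using U chart_homeo(1)[OF c(1)] by (intro open_chart_image[OF c(1)]) auto
  moreover have "x0 \<in> snd c ` (U \<inter> fst c)" using U c by (auto simp: x0_def)
  ultimately obtain \<rho>2 where \<rho>2: "\<rho>2 > 0" "cball x0 \<rho>2 \<subseteq> snd c ` (U \<inter> fst c)"
    using open_contains_cball by blast
  define \<rho> where "\<rho> = min \<rho>1 \<rho>2"
  have \<rho>: "\<rho> > 0" "cball x0 \<rho> \<subseteq> cball x0 \<rho>1" "cball x0 \<rho> \<subseteq> chart_image c" using le \<rho>2 by (auto simp: \<rho>_def)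
  have \<rho>U: "inv_chart c y \<in> U" if "y \<in> cball x0 \<rho>" for y
  proof -
    have "y \<in> snd c ` (U \<inter> fst c)" using that \<rho>2(2) by (auto simp: \<rho>_def)
    then show ?thesis using chart_inv(3)[OF c(1)] by auto
  qed
  define V where "V = inv_chart c ` ball x0 \<rho>"
  define K where "K = inv_chart c ` cball x0 \<rho>"
  have oV: "open V" unfolding V_def using \<rho>(3) by (intro open_inv_chart_image[OF c(1)]) auto
  have cK: "closed K" unfolding K_def using \<rho>(3) by (intro compact_imp_closed compact_inv_chart_image[OF c(1)]) auto
  have VK: "V \<subseteq> K" and KU: "K \<subseteq> U" using \<rho>U by (auto simp: V_def K_def)
  have xV: "x \<in> V" using chart_inv(3)[OF c] \<rho>(1) by (auto simp: V_def x0_def intro!: image_eqI[of _ _ "snd c x"])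
  have len: "ennreal (sqrt lam * \<rho>) \<le> curve_length A g \<gamma>"
    if \<gamma>': "piecewise_C1_curve A \<gamma>" "pathstart \<gamma> = x" "pathfinish \<gamma> \<notin> V" for \<gamma>
  proof -
    obtain S where \<gamma>: "smooth_off \<gamma> S" using \<gamma>'(1) piecewise_C1_curve_iff by blast
    have p: "continuous_on {0..1} \<gamma>" using smooth_offD(3)[OF \<gamma>] by (simp add: path_def)
    define T where "T = {0..1} \<inter> \<gamma> -` (- V)"
    have cT: "closed T" unfolding T_def using p oV by (intro continuous_closed_preimage) auto
    have "1 \<in> T" using \<gamma>'(3) by (auto simp: T_def pathfinish_def)
    moreover have "bdd_below T" by (rule bdd_belowI[of _ 0]) (auto simp: T_def)
    ultimately have sT: "Inf T \<in> T" using closed_contains_Inf[OF _ _ cT] by blast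
    \<comment> \<open>The first time at which the curve is outside the open ball \<open>V\<close>.
      Up to and including this time it stays in the closed ball \<open>K\<close>, hence in the
      chart.\<close>
    define s where "s = Inf T"
    have s: "0 \<le> s" "s \<le> 1" "\<gamma> s \<notin> V" using sT by (auto simp: T_def s_def)
    have before: "\<gamma> t \<in> V" if "0 \<le> t" "t < s" for t
    proof (rule ccontr)
      assume "\<gamma> t \<notin> V"
      then have "t \<in> T" using that s by (auto simp: T_def)
      then have "s \<le> t" unfolding s_def using \<open>bdd_below T\<close> by (rule cInf_lower)
      then show False using that by simp
    qed
    have "s \<noteq> 0" using s(3) xV \<gamma>'(2) by (auto simp: pathstart_def)
    then have s0: "0 < s" using s(1) by simp
    have "\<gamma> s \<in> K"
    proof -
      have "(\<gamma> \<longlongrightarrow> \<gamma> s) (at s within {0..1})" using p s by (auto simp: continuous_on_def)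
      then have "(\<gamma> \<longlongrightarrow> \<gamma> s) (at s within {0..<s})" by (rule tendsto_within_subset) (use s in auto)
      moreover have "\<forall>\<^sub>F t in at s within {0..<s}. \<gamma> t \<in> K"
        unfolding eventually_at_filter using before VK by (intro always_eventually) auto
      moreover have "at s within {0..<s} \<noteq> bot"
        using s0 by (simp add: at_within_eq_bot_iff)
      ultimately show ?thesis using Lim_in_closed_set[OF cK] by blast
    qed
    then have \<gamma>K: "\<gamma> t \<in> K" if "t \<in> {0..s}" for t
      using that before[of t] VK by (cases "t = s") auto
    have Kc: "q \<in> fst c" "snd c q \<in> cball x0 \<rho>" if "q \<in> K" for q
      using that \<rho>(3) chart_inv(1,2)[OF c(1)] by (auto simp: K_def)
    define \<sigma> where "\<sigma> = snd c \<circ> \<gamma>"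
    have far: "\<rho> \<le> norm (\<sigma> s - \<sigma> 0)"
    proof (rule ccontr)
      assume "\<not> ?thesis"
      moreover have "\<sigma> 0 = x0" using \<gamma>'(2) by (simp add: \<sigma>_def x0_def pathstart_def)
      ultimately have "\<sigma> s \<in> ball x0 \<rho>" by (simp add: dist_norm norm_minus_commute)
      moreover have "\<gamma> s = inv_chart c (\<sigma> s)" using chart_inv(3)[OF c(1) Kc(1)[OF \<open>\<gamma> s \<in> K\<close>]] by (simp add: \<sigma>_def)
      ultimately show False using s(3) by (auto simp: V_def)
    qed
    let ?D = "\<lambda>t. vector_derivative \<sigma> (at t)"
    have sub: "t \<in> {0..1} - S" "\<gamma> t \<in> fst c" "\<sigma> t \<in> cball x0 \<rho>1" if "t \<in> {0<..<s} - S" for t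
      using that s \<gamma>K[of t] Kc[of "\<gamma> t"] \<rho>(2) by (auto simp: \<sigma>_def)
    have "ennreal (norm (\<sigma> s - \<sigma> 0)) \<le> (\<integral>\<^sup>+t\<in>{0<..<s} - S. ennreal (norm (?D t)) \<partial>lborel)"
    proof (rule norm_increment_le_nn_integral[OF s(1) _ smooth_offD(1)[OF \<gamma>]])
      show "continuous_on {0..s} \<sigma>"
        unfolding \<sigma>_def using s \<gamma>K Kc(1)
        by (intro continuous_on_compose continuous_on_subset[OF p] continuous_on_subset[OF chart_inv(5)[OF c(1)]]) auto
      show "(\<sigma> has_vector_derivative ?D t) (at t)" if "t \<in> {0<..<s} - S" for t
        unfolding \<sigma>_def using smooth_offD(6)[OF \<gamma> c(1)] sub[OF that] by blast
      show "continuous_on ({0<..<s} - S) ?D"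
        unfolding \<sigma>_def by (rule continuous_on_subset[OF smooth_offD(7)[OF \<gamma> c(1)]]) (use sub in auto)
    qed
    also have "\<dots> \<le> (\<integral>\<^sup>+t. ennreal (1 / sqrt lam) * (ennreal (speed g \<gamma> t) * indicator ({0..1} - S) t) \<partial>lborel)"
    proof (rule nn_integral_mono)
      fix t
      show "ennreal (norm (?D t)) * indicator ({0<..<s} - S) t \<le> ennreal (1 / sqrt lam) * (ennreal (speed g \<gamma> t) * indicator ({0..1} - S) t)"
      proof (cases "t \<in> {0<..<s} - S")
        case True
        note sb = sub[OF True]
        have "lam * (norm (?D t))\<^sup>2 \<le> ?G (\<sigma> t) (?D t) (?D t)" by (rule low[OF sb(3)])
        then have "sqrt (lam * (norm (?D t))\<^sup>2) \<le> speed g \<gamma> t"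
          unfolding speed_chart[OF \<gamma> c(1) sb(1,2)] by (simp add: \<sigma>_def)
        then have "norm (?D t) \<le> 1 / sqrt lam * speed g \<gamma> t"
          using le(1) by (simp add: real_sqrt_mult field_simps)
        then show ?thesis using True sb(1) le(1)
          by (simp add: ennreal_mult'[symmetric] ennreal_leI)
      qed auto
    qed
    also have "\<dots> = ennreal (1 / sqrt lam) * curve_length A g \<gamma>"
      unfolding curve_length_eq[OF smooth_offD(1)[OF \<gamma>]]
      by (rule nn_integral_cmult) (simp add: speed_measurable[OF g \<gamma>])
    finally have "ennreal (sqrt lam) * ennreal (norm (\<sigma> s - \<sigma> 0)) \<le> ennreal (sqrt lam) * (ennreal (1 / sqrt lam) * curve_length A g \<gamma>)"
      by (rule mult_left_mono) simp
    also have "\<dots> = curve_length A g \<gamma>"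
      using le(1) by (simp add: mult.assoc[symmetric] ennreal_mult'[symmetric])
    finally have "ennreal (sqrt lam * norm (\<sigma> s - \<sigma> 0)) \<le> curve_length A g \<gamma>"
      using le(1) by (simp add: ennreal_mult')
    moreover have "ennreal (sqrt lam * \<rho>) \<le> ennreal (sqrt lam * norm (\<sigma> s - \<sigma> 0))"
      using far le(1) by (intro ennreal_leI mult_left_mono) auto
    ultimately show ?thesis by (rule order_trans[rotated])
  qed
  have "riem_ball A g x (sqrt lam * \<rho>) \<subseteq> U"
  proof
    fix y assume y: "y \<in> riem_ball A g x (sqrt lam * \<rho>)"
    then obtain \<gamma> where "piecewise_C1_curve A \<gamma>" "pathstart \<gamma> = x" "pathfinish \<gamma> = y" "curve_length A g \<gamma> < ennreal (sqrt lam * \<rho>)"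
      unfolding riem_ball_def riem_dist_def by (auto simp: INF_less_iff)
    with len[of \<gamma>] have "y \<in> V" by (metis not_le)
    then show "y \<in> U" using VK KU by blast
  qed
  then show ?thesis using le(1) \<rho>(1) by (intro exI[of _ "sqrt lam * \<rho>"]) simp
qed

text \<open>Agreement of the curves is asked only on an open set, because each half of a
  concatenation is an affine reparametrisation on one side of the junction.\<close>

lemma speed_reparam:
  assumes \<gamma>: "smooth_off \<gamma> S" and W: "open W" "t \<in> W" and a: "a > 0"
    and eq: "\<And>u. u \<in> W \<Longrightarrow> \<eta> u = \<gamma> (a * u + b)" and t: "a * t + b \<in> {0..1} - S"
  shows "c \<in> A \<Longrightarrow> \<gamma> (a * t + b) \<in> fst c \<Longrightarrow>
      ((snd c \<circ> \<eta>) has_vector_derivative a *\<^sub>R vector_derivative (snd c \<circ> \<gamma>) (at (a * t + b))) (at t)"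
    "C1_metric A g \<Longrightarrow> speed g \<eta> t = a * speed g \<gamma> (a * t + b)"
proof -
  show D: "((snd c \<circ> \<eta>) has_vector_derivative a *\<^sub>R vector_derivative (snd c \<circ> \<gamma>) (at (a * t + b))) (at t)"
    if c: "c \<in> A" "\<gamma> (a * t + b) \<in> fst c" for c
  proof -
    have "((\<lambda>u. a * u + b) has_vector_derivative a) (at t)"
      by (auto intro!: derivative_eq_intros simp: has_vector_derivative_def)
    from vector_diff_chain_at[OF this smooth_offD(6)[OF \<gamma> c(1) t c(2)]]
    have "((snd c \<circ> \<gamma>) \<circ> (\<lambda>u. a * u + b) has_vector_derivative a *\<^sub>R vector_derivative (snd c \<circ> \<gamma>) (at (a * t + b))) (at t)" .
    then show ?thesis
      unfolding has_vector_derivative_def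
      by (rule has_derivative_cong_open[OF _ W]) (simp add: eq)
  qed
  assume g: "C1_metric A g"
  define c where "c = chart_at A (\<gamma> (a * t + b))"
  have c: "c \<in> A" "\<gamma> (a * t + b) \<in> fst c" using chart_at_in by (auto simp: c_def)
  have \<eta>: "\<eta> t = \<gamma> (a * t + b)" by (rule eq[OF W(2)])
  let ?v = "vector_derivative (snd c \<circ> \<gamma>) (at (a * t + b))"
  have v: "velocity A \<eta> t = tvec A c (\<gamma> (a * t + b)) (a *\<^sub>R ?v)"
    unfolding velocity_def \<eta> c_def[symmetric] Let_def vector_derivative_at[OF D[OF c]] ..
  have b: "bilinear (metric_in_chart A g c (snd c (\<gamma> (a * t + b))))"
    by (rule metric_bilinear[OF g c(1) chart_inv(4)[OF c]])
  have aa: "sqrt (a * (a * x)) = a * sqrt x" for x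
    using a by (simp add: mult.assoc[symmetric] real_sqrt_mult)
  show "speed g \<eta> t = a * speed g \<gamma> (a * t + b)"
    unfolding speed_chart[OF \<gamma> c(1) t c(2)] speed_def[of g \<eta>] \<eta> v tnorm_chart[OF tvec_in_tangent[OF c] c] tvec_self[OF c]
      bilinear_lmul[OF b] bilinear_rmul[OF b] real_scaleR_def by (rule aa)
qed

lemma nn_integral_affine:
  fixes f :: "real \<Rightarrow> ennreal"
  assumes "f \<in> borel_measurable borel" "a > 0"
  shows "(\<integral>\<^sup>+t. ennreal a * f (a * t + b) \<partial>lborel) = (\<integral>\<^sup>+t. f t \<partial>lborel)"
proof -
  have "(\<integral>\<^sup>+t. f t \<partial>lborel) = ennreal \<bar>a\<bar> * (\<integral>\<^sup>+t. f (b + a * t) \<partial>lborel)"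
    using assms by (intro nn_integral_real_affine) auto
  also have "\<dots> = (\<integral>\<^sup>+t. ennreal a * f (a * t + b) \<partial>lborel)"
    using assms by (subst nn_integral_cmult[symmetric]) (auto simp: add.commute)
  finally show ?thesis ..
qed

lemma join_curves:
  assumes g: "C1_metric A g" and c1: "piecewise_C1_curve A \<gamma>" and c2: "piecewise_C1_curve A \<delta>"
    and j: "pathfinish \<gamma> = pathstart \<delta>"
  shows "piecewise_C1_curve A (\<gamma> +++ \<delta>)"
    "curve_length A g (\<gamma> +++ \<delta>) \<le> curve_length A g \<gamma> + curve_length A g \<delta>"
proof -
  obtain S where S: "smooth_off \<gamma> S" using c1 piecewise_C1_curve_iff by blast
  obtain R where R: "smooth_off \<delta> R" using c2 piecewise_C1_curve_iff by blast
  \<comment> \<open>The rescaled break points of both halves, together with the junction and the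
    endpoints.\<close>
  define Q where "Q = (\<lambda>s. s / 2) ` S \<union> (\<lambda>s. (s + 1) / 2) ` R \<union> {0, 1/2, 1}"
  have finQ: "finite Q" using smooth_offD(1)[OF S] smooth_offD(1)[OF R] by (simp add: Q_def)
  let ?\<eta> = "\<gamma> +++ \<delta>"
  have eq1: "?\<eta> u = \<gamma> (2 * u + 0)" if "u \<in> {..<1/2}" for u using that by (simp add: joinpaths_def)
  have eq2: "?\<eta> u = \<delta> (2 * u + - 1)" if "u \<in> {1/2<..}" for u using that by (simp add: joinpaths_def)
  have t1: "t \<in> {..<1/2}" "2 * t + 0 \<in> {0..1} - S" if "t \<in> {0..1} - Q" "t < 1/2" for t
    using that by (auto simp: Q_def image_iff mult.commute)
  have t2: "t \<in> {1/2<..}" "2 * t + - 1 \<in> {0..1} - R" if "t \<in> {0..1} - Q" "\<not> t < 1/2" for t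
  proof -
    have "t \<noteq> 1/2" using that by (auto simp: Q_def)
    then show "t \<in> {1/2<..}" using that by auto
    moreover have "t = (2 * t - 1 + 1) / 2" by simp
    ultimately show "2 * t + - 1 \<in> {0..1} - R" using that by (force simp: Q_def image_iff)
  qed
  have "smooth_off ?\<eta> Q"
    unfolding smooth_off_def
  proof (intro conjI ballI finQ)
    show "{0, 1} \<subseteq> Q" by (simp add: Q_def)
    show "path ?\<eta>" using path_join_imp[OF smooth_offD(3)[OF S] smooth_offD(3)[OF R] j] .
    fix c assume c: "c \<in> A"
    let ?D1 = "\<lambda>t. vector_derivative (snd c \<circ> \<gamma>) (at t)" and ?D2 = "\<lambda>t. vector_derivative (snd c \<circ> \<delta>) (at t)"
    let ?T = "{t \<in> {0..1} - Q. ?\<eta> t \<in> fst c}"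
    define D where "D t = (if t < 1/2 then 2 *\<^sub>R ?D1 (2 * t + 0) else 2 *\<^sub>R ?D2 (2 * t + - 1))" for t
    have "((snd c \<circ> ?\<eta>) has_vector_derivative D t) (at t)" if t: "t \<in> ?T" for t
    proof (cases "t < 1/2")
      case True
      note h = t1[OF _ True]
      have "\<gamma> (2 * t + 0) \<in> fst c" using t eq1[of t] True by simp
      with speed_reparam(1)[OF S open_lessThan h(1) _ eq1 h(2) c] t True show ?thesis by (simp add: D_def)
    next
      case False
      note h = t2[OF _ False]
      have "\<delta> (2 * t + - 1) \<in> fst c" using t eq2[of t] h(1) by simp
      with speed_reparam(1)[OF R open_greaterThan h(1) _ eq2 h(2) c] t False show ?thesis by (simp add: D_def)
    qed
    moreover have "continuous_on ?T D"
    proof -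
      have "?T \<subseteq> {..<1/2} \<union> {1/2<..}" using t2(1) by fastforce
      then have T: "?T = (?T \<inter> {..<1/2}) \<union> (?T \<inter> {1/2<..})" by blast
      have "continuous_on (?T \<inter> {..<1/2}) (\<lambda>t. 2 *\<^sub>R ?D1 (2 * t + 0))"
        by (intro continuous_intros continuous_on_compose2[OF smooth_offD(7)[OF S c]])
          (use t1 eq1 in auto)
      then have 1: "continuous_on (?T \<inter> {..<1/2}) D" by (rule continuous_on_eq) (simp add: D_def)
      have "continuous_on (?T \<inter> {1/2<..}) (\<lambda>t. 2 *\<^sub>R ?D2 (2 * t + - 1))"
        by (intro continuous_intros continuous_on_compose2[OF smooth_offD(7)[OF R c]])
          (use t2 eq2 in auto)
      then have 2: "continuous_on (?T \<inter> {1/2<..}) D" by (rule continuous_on_eq) (simp add: D_def)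
      have o: "openin (top_of_set ?T) (?T \<inter> {..<1/2})" "openin (top_of_set ?T) (?T \<inter> {1/2<..})"
        by (auto intro!: openin_open_Int)
      show ?thesis
        using continuous_on_Un_local_open[of "?T \<inter> {..<1/2}" "?T \<inter> {1/2<..}" D, folded T, OF o 1 2] .
    qed
    ultimately show "(snd c \<circ> ?\<eta>) C1_differentiable_on ?T"
      unfolding C1_differentiable_on_def by blast
  qed
  then show "piecewise_C1_curve A ?\<eta>" using piecewise_C1_curve_iff by blast
  let ?f1 = "\<lambda>t. ennreal (speed g \<gamma> t) * indicator ({0..1} - S) t" and ?f2 = "\<lambda>t. ennreal (speed g \<delta> t) * indicator ({0..1} - R) t"
  note m = speed_measurable[OF g S] speed_measurable[OF g R]
  have "curve_length A g ?\<eta> = (\<integral>\<^sup>+t. ennreal (speed g ?\<eta> t) * indicator ({0..1} - Q) t \<partial>lborel)"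
    by (rule curve_length_eq[OF finQ])
  \<comment> \<open>At each good time only one summand represents the speed; the other is
    nonnegative, and an upper bound is all that is required.\<close>
  also have "\<dots> \<le> (\<integral>\<^sup>+t. ennreal 2 * ?f1 (2 * t + 0) + ennreal 2 * ?f2 (2 * t + - 1) \<partial>lborel)"
  proof (rule nn_integral_mono)
    fix t
    show "ennreal (speed g ?\<eta> t) * indicator ({0..1} - Q) t \<le> ennreal 2 * ?f1 (2 * t + 0) + ennreal 2 * ?f2 (2 * t + - 1)"
    proof (cases "t \<in> {0..1} - Q")
      case T: True
      show ?thesis
      proof (cases "t < 1/2")
        case True
        have "speed g ?\<eta> t = 2 * speed g \<gamma> (2 * t + 0)"
          by (rule speed_reparam(2)[OF S open_lessThan t1(1)[OF T True] _ eq1 t1(2)[OF T True] g]) simp_all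
        then have "ennreal (speed g ?\<eta> t) * indicator ({0..1} - Q) t = ennreal 2 * ?f1 (2 * t + 0)"
          using T t1(2)[OF T True] by (simp add: ennreal_mult')
        then show ?thesis by simp
      next
        case False
        have "speed g ?\<eta> t = 2 * speed g \<delta> (2 * t + - 1)"
          by (rule speed_reparam(2)[OF R open_greaterThan t2(1)[OF T False] _ eq2 t2(2)[OF T False] g]) simp_all
        then have "ennreal (speed g ?\<eta> t) * indicator ({0..1} - Q) t = ennreal 2 * ?f2 (2 * t + - 1)"
          using T t2(2)[OF T False] by (simp add: ennreal_mult')
        then show ?thesis by simp
      qed
    qed simp
  qed
  also have "\<dots> = curve_length A g \<gamma> + curve_length A g \<delta>"
  proof -
    have add: "(\<integral>\<^sup>+t. ennreal 2 * F (2 * t + 0) + ennreal 2 * F' (2 * t + - 1) \<partial>lborel)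
        = (\<integral>\<^sup>+t. F t \<partial>lborel) + (\<integral>\<^sup>+t. F' t \<partial>lborel)"
      if [measurable]: "F \<in> borel_measurable borel" "F' \<in> borel_measurable borel" for F F' :: "real \<Rightarrow> ennreal"
    proof -
      have "(\<integral>\<^sup>+t. ennreal 2 * F (2 * t + 0) + ennreal 2 * F' (2 * t + - 1) \<partial>lborel)
        = (\<integral>\<^sup>+t. ennreal 2 * F (2 * t + 0) \<partial>lborel) + (\<integral>\<^sup>+t. ennreal 2 * F' (2 * t + - 1) \<partial>lborel)"
        by (rule nn_integral_add) measurable
      then show ?thesis using nn_integral_affine[OF that(1), of 2 0] nn_integral_affine[OF that(2), of 2 "- 1"] by simp
    qed
    show ?thesis
      unfolding curve_length_eq[OF smooth_offD(1)[OF S], of g \<gamma>] curve_length_eq[OF smooth_offD(1)[OF R], of g \<delta>]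
      by (rule add[OF m])
  qed
  finally show "curve_length A g ?\<eta> \<le> curve_length A g \<gamma> + curve_length A g \<delta>" .
qed

text \<open>Coordinate segments are the short curves that show distance balls to be open and to
  contain their centres. The constant \<open>B\<close> compares the metric with the Euclidean norm
  along the segment.\<close>

lemma chart_segment:
  assumes g: "C1_metric A g" and c: "c \<in> A" and seg: "closed_segment y z \<subseteq> chart_image c"
    and B: "\<And>x u. x \<in> closed_segment y z \<Longrightarrow> metric_in_chart A g c x u u \<le> B\<^sup>2 * (norm u)\<^sup>2" and "B \<ge> 0"
  shows "piecewise_C1_curve A (inv_chart c \<circ> linepath y z)"
    "curve_length A g (inv_chart c \<circ> linepath y z) \<le> ennreal (B * norm (z - y))"
proof -
  let ?\<delta> = "inv_chart c \<circ> linepath y z"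
  have lp: "linepath y z t \<in> closed_segment y z" if "t \<in> {0..1}" for t
    using that linepath_image_01[of y z] by blast
  have lpc: "linepath y z t \<in> chart_image c" if "t \<in> {0..1}" for t using lp[OF that] seg by blast
  have dl: "(linepath y z has_derivative (\<lambda>h. h *\<^sub>R (z - y))) (at t)" for t
    using has_vector_derivative_linepath_within[of y z t UNIV] by (simp add: has_vector_derivative_def)
  have vd: "((snd d \<circ> ?\<delta>) has_vector_derivative jac c d (?\<delta> t) (z - y)) (at t)"
    if d: "d \<in> A" and t: "t \<in> {0..1}" "?\<delta> t \<in> fst d" for d t
  proof -
    have q: "?\<delta> t \<in> fst c" "snd c (?\<delta> t) = linepath y z t" using chart_inv(1,2)[OF c lpc[OF t(1)]] by auto
    have "((snd d \<circ> inv_chart c) \<circ> linepath y z has_derivative jac c d (?\<delta> t) \<circ> (\<lambda>h. h *\<^sub>R (z - y))) (at t)"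
      by (rule diff_chain_at[OF dl]) (use trans_has_derivative[OF c d q(1) t(2)] q(2) in simp)
    moreover have "jac c d (?\<delta> t) \<circ> (\<lambda>h. h *\<^sub>R (z - y)) = (\<lambda>h. h *\<^sub>R jac c d (?\<delta> t) (z - y))"
      by (rule ext, simp only: o_apply) (rule linear_scale[OF jac_linear[OF c d q(1) t(2), unfolded o_apply]])
    ultimately show ?thesis by (simp only: has_vector_derivative_def o_assoc)
  qed
  have so: "smooth_off ?\<delta> {0, 1}"
    unfolding smooth_off_def
  proof (intro conjI ballI)
    show "path ?\<delta>"
      unfolding path_def
      by (intro continuous_on_compose continuous_on_linepath continuous_on_subset[OF chart_inv(6)[OF c]])
        (use lpc in auto)
    fix d assume d: "d \<in> A"
    let ?T = "{t \<in> {0..1} - {0, 1}. ?\<delta> t \<in> fst d}"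
    have "continuous_on ?T (\<lambda>t. fd (snd d \<circ> inv_chart c) (linepath y z t) (z - y))"
    proof (rule continuous_on_compose2[OF Ck_on_1_fd_continuous[OF overlap(5)[OF c d]]])
      show "linepath y z ` ?T \<subseteq> overlap c d" using lpc overlap(2)[OF c d] by auto
    qed (rule continuous_on_linepath)
    then have "continuous_on ?T (\<lambda>t. jac c d (?\<delta> t) (z - y))"
      by (rule continuous_on_eq) (simp add: jac_def chart_inv(2)[OF c lpc])
    moreover have "\<forall>t\<in>?T. ((snd d \<circ> ?\<delta>) has_vector_derivative jac c d (?\<delta> t) (z - y)) (at t)"
      using vd[OF d] by auto
    ultimately show "(snd d \<circ> ?\<delta>) C1_differentiable_on ?T"
      unfolding C1_differentiable_on_def by (intro exI[of _ "\<lambda>t. jac c d (?\<delta> t) (z - y)"] conjI)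
  qed auto
  then show "piecewise_C1_curve A ?\<delta>" using piecewise_C1_curve_iff by blast
  have sp: "speed g ?\<delta> t \<le> B * norm (z - y)" if t: "t \<in> {0..1} - {0, 1}" for t
  proof -
    have t': "t \<in> {0..1}" using t by auto
    have q: "?\<delta> t \<in> fst c" "snd c (?\<delta> t) = linepath y z t" using chart_inv(1,2)[OF c lpc[OF t']] by auto
    have "speed g ?\<delta> t = sqrt (metric_in_chart A g c (linepath y z t) (z - y) (z - y))"
      unfolding speed_chart[OF so c t q(1)] vector_derivative_at[OF vd[OF c t' q(1)]] jac_self[OF c q(1)] q(2) ..
    also have "\<dots> \<le> sqrt (B\<^sup>2 * (norm (z - y))\<^sup>2)" by (rule real_sqrt_le_mono[OF B[OF lp[OF t']]])
    also have "\<dots> = B * norm (z - y)" using \<open>B \<ge> 0\<close> by (simp add: real_sqrt_mult)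
    finally show ?thesis .
  qed
  have "curve_length A g ?\<delta> = (\<integral>\<^sup>+t. ennreal (speed g ?\<delta> t) * indicator ({0..1} - {0, 1}) t \<partial>lborel)"
    by (rule curve_length_eq) simp
  also have "\<dots> \<le> (\<integral>\<^sup>+t. ennreal (B * norm (z - y)) * indicator {0..1::real} t \<partial>lborel)"
  proof (rule nn_integral_mono)
    fix t :: real
    show "ennreal (speed g ?\<delta> t) * indicator ({0..1} - {0, 1}) t \<le> ennreal (B * norm (z - y)) * indicator {0..1::real} t"
      using sp[of t] by (cases "t \<in> {0..1} - {0, 1}") (auto intro: ennreal_leI)
  qed
  also have "\<dots> = ennreal (B * norm (z - y))" by (subst nn_integral_cmult_indicator) auto
  finally show "curve_length A g ?\<delta> \<le> ennreal (B * norm (z - y))" .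
qed

text \<open>A curve to \<open>y\<close> of length \<open>L < r\<close> leaves the amount
  \<open>r - L\<close> for a coordinate segment from \<open>y\<close> to a nearby point.\<close>

lemma riem_ball_open:
  assumes g: "C1_metric A g"
  shows "open (riem_ball A g x r)"
  unfolding open_subopen[of "riem_ball A g x r"]
proof
  fix y assume "y \<in> riem_ball A g x r"
  then obtain \<gamma> where \<gamma>: "piecewise_C1_curve A \<gamma>" "pathstart \<gamma> = x" "pathfinish \<gamma> = y" "curve_length A g \<gamma> < ennreal r"
    unfolding riem_ball_def riem_dist_def by (auto simp: INF_less_iff)
  define L where "L = enn2real (curve_length A g \<gamma>)"
  have "curve_length A g \<gamma> < \<infinity>" using \<gamma>(4) by (rule less_trans) simp
  then have L: "curve_length A g \<gamma> = ennreal L" "L \<ge> 0" by (auto simp: L_def)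
  then have Lr: "L < r" using \<gamma>(4) by (simp add: ennreal_less_iff)
  obtain c where c: "c \<in> A" "y \<in> fst c" using chart_ex by metis
  let ?G = "metric_in_chart A g c"
  define y0 where "y0 = snd c y"
  note y0 = chart_inv(4)[OF c, folded y0_def]
  obtain \<rho> where \<rho>: "\<rho> > 0" "cball y0 \<rho> \<subseteq> chart_image c"
    using chart_homeo(2)[OF c(1)] y0 open_contains_cball by blast
  have "continuous_on (cball y0 \<rho>) (\<lambda>x. \<Sum>a\<in>Basis. \<Sum>b\<in>Basis. \<bar>?G x a b\<bar>)"
    using Ck_on_1_continuous[OF C1_metric_Ck[OF g c(1)]] \<rho>(2)
    by (intro continuous_intros) (blast intro: continuous_on_subset)
  then have "bounded ((\<lambda>x. \<Sum>a\<in>Basis. \<Sum>b\<in>Basis. \<bar>?G x a b\<bar>) ` cball y0 \<rho>)"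
    by (intro compact_imp_bounded compact_continuous_image) auto
  then obtain N where N: "N > 0" "\<And>x. x \<in> cball y0 \<rho> \<Longrightarrow> (\<Sum>a\<in>Basis. \<Sum>b\<in>Basis. \<bar>?G x a b\<bar>) \<le> N"
    unfolding bounded_pos by force
  have GN: "?G x u u \<le> (sqrt N)\<^sup>2 * (norm u)\<^sup>2" if "x \<in> cball y0 \<rho>" for x u
  proof -
    have "x \<in> chart_image c" using that \<rho>(2) by blast
    then have "?G x u u \<le> norm u * norm u * (\<Sum>a\<in>Basis. \<Sum>b\<in>Basis. \<bar>?G x a b\<bar>)"
      using bilinear_le_basis[OF metric_bilinear[OF g c(1)], of x u u] by linarith
    also have "\<dots> \<le> norm u * norm u * N" by (intro mult_left_mono N(2)[OF that]) auto
    finally show ?thesis using N(1) by (simp add: power2_eq_square mult_ac)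
  qed
  define \<rho>' where "\<rho>' = min \<rho> ((r - L) / sqrt N)"
  have \<rho>': "\<rho>' > 0" "\<rho>' \<le> \<rho>" "sqrt N * \<rho>' \<le> r - L"
  proof -
    show "\<rho>' > 0" "\<rho>' \<le> \<rho>" using \<rho> Lr N(1) by (auto simp: \<rho>'_def)
    have "sqrt N * \<rho>' \<le> sqrt N * ((r - L) / sqrt N)" using N(1) by (intro mult_left_mono) (auto simp: \<rho>'_def)
    then show "sqrt N * \<rho>' \<le> r - L" using N(1) by simp
  qed
  have "inv_chart c ` ball y0 \<rho>' \<subseteq> riem_ball A g x r"
  proof
    fix q assume "q \<in> inv_chart c ` ball y0 \<rho>'"
    then obtain z where z: "z \<in> ball y0 \<rho>'" "q = inv_chart c z" by blast
    have seg: "closed_segment y0 z \<subseteq> cball y0 \<rho>"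
      using z(1) \<rho>' \<rho>(1) by (intro closed_segment_subset) auto
    define \<delta> where "\<delta> = inv_chart c \<circ> linepath y0 z"
    have s: "piecewise_C1_curve A \<delta>" "curve_length A g \<delta> \<le> ennreal (sqrt N * norm (z - y0))"
    proof -
      have 1: "closed_segment y0 z \<subseteq> chart_image c" using seg \<rho>(2) by blast
      have 2: "?G x u u \<le> (sqrt N)\<^sup>2 * (norm u)\<^sup>2" if "x \<in> closed_segment y0 z" for x u
        using GN that seg by blast
      have 3: "sqrt N \<ge> 0" using N(1) by simp
      show "piecewise_C1_curve A \<delta>" "curve_length A g \<delta> \<le> ennreal (sqrt N * norm (z - y0))"
        unfolding \<delta>_def by (rule chart_segment[OF g c(1) 1 2 3], assumption)+
    qed
    have j: "pathfinish \<gamma> = pathstart \<delta>" "pathfinish \<delta> = q"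
      using \<gamma>(3) chart_inv(3)[OF c] z(2) by (simp_all add: \<delta>_def y0_def pathstart_compose pathfinish_compose)
    note jc = join_curves[OF g \<gamma>(1) s(1) j(1)]
    have "curve_length A g (\<gamma> +++ \<delta>) \<le> ennreal L + ennreal (sqrt N * norm (z - y0))"
      using jc(2) s(2) L(1) by (metis add_left_mono order_trans)
    also have "\<dots> = ennreal (L + sqrt N * norm (z - y0))" using L(2) N(1) by (intro ennreal_plus[symmetric]) auto
    also have "\<dots> < ennreal r"
    proof -
      have "sqrt N * norm (z - y0) < sqrt N * \<rho>'"
        using z(1) N(1) by (intro mult_strict_left_mono) (auto simp: dist_norm norm_minus_commute)
      then have "L + sqrt N * norm (z - y0) < r" using \<rho>'(3) by linarith
      moreover have "0 < r" using Lr L(2) by linarith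
      ultimately show ?thesis by (intro ennreal_lessI)
    qed
    finally have "curve_length A g (\<gamma> +++ \<delta>) < ennreal r" .
    moreover have "pathstart (\<gamma> +++ \<delta>) = x" "pathfinish (\<gamma> +++ \<delta>) = q" using \<gamma>(2) j(2) by simp_all
    ultimately show "q \<in> riem_ball A g x r"
      unfolding riem_ball_def riem_dist_def INF_less_iff mem_Collect_eq using jc(1) by blast
  qed
  moreover have "open (inv_chart c ` ball y0 \<rho>')"
    using \<rho>' \<rho>(2) by (intro open_inv_chart_image[OF c(1)]) (auto simp: subset_iff)
  moreover have "y \<in> inv_chart c ` ball y0 \<rho>'"
    using chart_inv(3)[OF c] \<rho>'(1) by (auto simp: y0_def intro!: image_eqI[of _ _ "snd c y"])
  ultimately show "\<exists>T. open T \<and> y \<in> T \<and> T \<subseteq> riem_ball A g x r" by blast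
qed

lemma riem_ball_center:
  assumes g: "C1_metric A g" and "r > 0"
  shows "x \<in> riem_ball A g x r"
proof -
  obtain c where c: "c \<in> A" "x \<in> fst c" using chart_ex by metis
  let ?\<delta> = "inv_chart c \<circ> linepath (snd c x) (snd c x)"
  define N where "N = sqrt (\<Sum>a\<in>Basis. \<Sum>b\<in>Basis. \<bar>metric_in_chart A g c (snd c x) a b\<bar>)"
  have b: "metric_in_chart A g c (snd c x) u u \<le> N\<^sup>2 * (norm u)\<^sup>2" for u
  proof -
    have "\<bar>metric_in_chart A g c (snd c x) u u\<bar> \<le> N\<^sup>2 * (norm u)\<^sup>2"
      using bilinear_le_basis[OF metric_bilinear[OF g c(1) chart_inv(4)[OF c]], of u u]
      by (simp add: N_def power2_eq_square[of "norm u"] mult.commute sum_nonneg)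
    then show ?thesis by linarith
  qed
  have "N \<ge> 0" by (simp add: N_def sum_nonneg)
  have "closed_segment (snd c x) (snd c x) \<subseteq> chart_image c" using chart_inv(4)[OF c] by simp
  note cs = chart_segment[OF g c(1) this, of N]
  have "piecewise_C1_curve A ?\<delta>" "curve_length A g ?\<delta> \<le> ennreal (N * norm (snd c x - snd c x))"
    by (rule cs(1); use b \<open>N \<ge> 0\<close> in simp) (rule cs(2); use b \<open>N \<ge> 0\<close> in simp)
  then have "piecewise_C1_curve A ?\<delta>" "curve_length A g ?\<delta> < ennreal r" using \<open>r > 0\<close> by auto
  moreover have "pathstart ?\<delta> = x" "pathfinish ?\<delta> = x" using chart_inv(3)[OF c] by (simp_all add: pathstart_compose pathfinish_compose)
  ultimately show ?thesis unfolding riem_ball_def riem_dist_def INF_less_iff mem_Collect_eq by blast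
qed

text \<open>Distance balls are open, contain their centres and fit into any neighbourhood when
  small. From here on the blow-up set depends on the topology alone, and neighbourhoods may be taken
  in a chart.\<close>

lemma area_blowup_set_iff:
  assumes g: "C1_metric A g" and M: "\<And>i. varifold A m (M i)"
  shows "x \<in> area_blowup_set A g M \<longleftrightarrow>
    (\<forall>U. open U \<longrightarrow> x \<in> U \<longrightarrow> limsup (\<lambda>i. emeasure (weight (M i)) U) = \<infinity>)"
proof
  assume x: "x \<in> area_blowup_set A g M"
  show "\<forall>U. open U \<longrightarrow> x \<in> U \<longrightarrow> limsup (\<lambda>i. emeasure (weight (M i)) U) = \<infinity>"
  proof (intro allI impI)
    fix U assume U: "open U" "x \<in> U"
    obtain r where r: "r > 0" "riem_ball A g x r \<subseteq> U" using riem_ball_small[OF g U] by blast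
    have "emeasure (weight (M i)) (riem_ball A g x r) \<le> emeasure (weight (M i)) U" for i
      using r(2) U(1) by (intro emeasure_mono) (auto simp: weight_def)
    then have "limsup (\<lambda>i. emeasure (weight (M i)) (riem_ball A g x r)) \<le> limsup (\<lambda>i. emeasure (weight (M i)) U)"
      by (intro Limsup_mono always_eventually) auto
    then show "limsup (\<lambda>i. emeasure (weight (M i)) U) = \<infinity>"
      using x r(1) by (simp add: area_blowup_set_def top_unique)
  qed
next
  assume "\<forall>U. open U \<longrightarrow> x \<in> U \<longrightarrow> limsup (\<lambda>i. emeasure (weight (M i)) U) = \<infinity>"
  then show "x \<in> area_blowup_set A g M"
    unfolding area_blowup_set_def using riem_ball_open[OF g] riem_ball_center[OF g] by auto
qed

lemma area_blowup_set_closed: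
  assumes "C1_metric A g" and "\<And>i. varifold A m (M i)"
  shows "closed (area_blowup_set A g M)"
proof -
  have "\<exists>T. open T \<and> x \<in> T \<and> T \<subseteq> - area_blowup_set A g M" if x: "x \<in> - area_blowup_set A g M" for x
  proof -
    have "\<not> (\<forall>U. open U \<longrightarrow> x \<in> U \<longrightarrow> limsup (\<lambda>i. emeasure (weight (M i)) U) = \<infinity>)"
      using x area_blowup_set_iff[OF assms, of x] by simp
    then obtain U where U: "open U" "x \<in> U" "limsup (\<lambda>i. emeasure (weight (M i)) U) \<noteq> \<infinity>" by blast
    have "y \<notin> area_blowup_set A g M" if "y \<in> U" for y
    proof
      assume "y \<in> area_blowup_set A g M"
      then have "limsup (\<lambda>i. emeasure (weight (M i)) U) = \<infinity>"
        unfolding area_blowup_set_iff[OF assms] using U(1) that by simp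
      with U(3) show False by simp
    qed
    then show ?thesis using U by blast
  qed
  then have "open (- area_blowup_set A g M)" using open_subopen[of "- area_blowup_set A g M"] by blast
  then show ?thesis by (simp add: closed_def)
qed

end

section \<open>Singular part of the first variation\<close>

lemma ennreal_add_le_abs: "ennreal (a + b) \<le> ennreal a + ennreal \<bar>b\<bar>"
proof (cases "a \<ge> 0")
  case True
  have "ennreal (a + b) \<le> ennreal (a + \<bar>b\<bar>)" by (rule ennreal_leI) simp
  then show ?thesis using True by (simp add: ennreal_plus)
next
  case False
  then have "ennreal (a + b) \<le> ennreal \<bar>b\<bar>" by (intro ennreal_leI) simp
  then show ?thesis by (simp add: add_increasing)
qed

text \<open>For a function that is not integrable the left side is 0 by convention, so the bound is
  free in that case.\<close>

lemma abs_integral_le_nn_integral: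
  fixes f :: "'a \<Rightarrow> real"
  shows "ennreal \<bar>integral\<^sup>L M f\<bar> \<le> (\<integral>\<^sup>+x. ennreal \<bar>f x\<bar> \<partial>M)"
proof (cases "integrable M f")
  case True then show ?thesis using integral_norm_bound_ennreal[OF True] by simp
qed (simp add: not_integrable_integral_eq)

context manifold
begin

text \<open>The indicator of the chart domain discards the points where \<open>snd c\<close> carries
  no meaning. On the domain, expansion over the basis leaves products of Borel components and
  continuous coefficients.\<close>

lemma metric_measurable:
  assumes g: "C1_metric A g" and c: "c \<in> A"
    and X: "(\<lambda>p. X p c) \<in> borel_measurable borel" and Y: "(\<lambda>p. Y p c) \<in> borel_measurable borel"
  shows "(\<lambda>p. indicat_real (fst c) p * metric_in_chart A g c (snd c p) (X p c) (Y p c)) \<in> borel_measurable borel"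
proof -
  have [measurable]: "(\<lambda>p. indicat_real (fst c) p *\<^sub>R metric_in_chart A g c (snd c p) a b) \<in> borel_measurable borel" for a b
    by (rule borel_measurable_continuous_on_indicator[OF borel_open[OF chart_homeo(1)[OF c]]
          continuous_on_compose2[OF Ck_on_1_continuous[OF C1_metric_Ck[OF g c]] chart_inv(5)[OF c]]])
      (use chart_inv(4)[OF c] in auto)
  note [measurable] = X Y
  have "(\<lambda>p. \<Sum>a\<in>Basis. \<Sum>b\<in>Basis. (X p c \<bullet> a) * (Y p c \<bullet> b) * (indicat_real (fst c) p *\<^sub>R metric_in_chart A g c (snd c p) a b)) \<in> borel_measurable borel"
    by measurable
  moreover have "(\<Sum>a\<in>Basis. \<Sum>b\<in>Basis. (X p c \<bullet> a) * (Y p c \<bullet> b) * (indicat_real (fst c) p *\<^sub>R metric_in_chart A g c (snd c p) a b))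
     = indicat_real (fst c) p * metric_in_chart A g c (snd c p) (X p c) (Y p c)" for p
  proof (cases "p \<in> fst c")
    case True
    then show ?thesis
      using bilinear_expand[OF metric_bilinear[OF g c chart_inv(4)[OF c True]], of "X p c" "Y p c"] by simp
  qed simp
  ultimately show ?thesis by simp
qed

lemma tnorm_measurable:
  assumes g: "C1_metric A g" and c: "c \<in> A" and X: "vector_field A X" "(\<lambda>p. X p c) \<in> borel_measurable borel"
    and U: "U \<in> sets borel" "U \<subseteq> fst c"
  shows "(\<lambda>p. indicat_real U p * tnorm g p (X p)) \<in> borel_measurable borel"
proof -
  note [measurable] = metric_measurable[where X=X and Y=X, OF g c X(2) X(2)] U(1)
  have "(\<lambda>p. indicat_real U p * sqrt (indicat_real (fst c) p * metric_in_chart A g c (snd c p) (X p c) (X p c))) \<in> borel_measurable borel"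
    by measurable
  moreover have "indicat_real U p * sqrt (indicat_real (fst c) p * metric_in_chart A g c (snd c p) (X p c) (X p c))
     = indicat_real U p * tnorm g p (X p)" for p
  proof (cases "p \<in> U")
    case True
    then have p: "p \<in> fst c" using U(2) by blast
    have "X p \<in> tangent_space A p" using X(1) by (simp add: vector_field_def)
    then show ?thesis using p tnorm_chart[OF _ c p] by simp
  qed simp
  ultimately show ?thesis by simp
qed

lemma metric_cauchy_schwarz:
  assumes g: "C1_metric A g" and v: "v \<in> tangent_space A p" "w \<in> tangent_space A p"
  shows "\<bar>g p v w\<bar> \<le> tnorm g p v * tnorm g p w" "tnorm g p v \<ge> 0" "g p v (\<lambda>_. 0) = 0"
proof -
  obtain c where c: "c \<in> A" "p \<in> fst c" using chart_ex by metis
  have G: "inner_form (metric_in_chart A g c (snd c p))" by (rule C1_metric_inner_form[OF g c(1) chart_inv(4)[OF c]])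
  show "\<bar>g p v w\<bar> \<le> tnorm g p v * tnorm g p w"
    unfolding metric_tangent[OF v c] tnorm_chart[OF v(1) c] tnorm_chart[OF v(2) c]
    by (rule inner_form_cauchy_schwarz(2)[OF G])
  show "tnorm g p v \<ge> 0"
    unfolding tnorm_chart[OF v(1) c] using inner_formD(4)[OF G] by simp
  have z: "(\<lambda>_. 0) \<in> tangent_space A p" using tvec_in_tangent[OF c, of 0] by (simp add: tvec_zero[OF c])
  show "g p v (\<lambda>_. 0) = 0"
    unfolding metric_tangent[OF v(1) z c] by (rule bilinear_rzero[OF inner_formD(1)[OF G]])
qed

text \<open>The restriction of \<open>\<mu>\<close> to \<open>U\<close> is pushed forward by the
  chart to the model space, where finite Borel measures are outer regular, and the open set found
  there is pulled back.\<close>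

lemma chart_outer_regular:
  fixes \<mu> :: "'a measure"
  assumes sets: "sets \<mu> = sets borel" and c: "c \<in> A" and U: "open U" "U \<subseteq> fst c" "emeasure \<mu> U < \<infinity>"
    and B: "B \<in> sets borel" "B \<subseteq> U" and e: "e > 0"
  obtains V where "open V" "B \<subseteq> V" "V \<subseteq> U" "emeasure \<mu> V \<le> emeasure \<mu> B + ennreal e"
proof -
  \<comment> \<open>The chart map, extended by 0 to a Borel function on the whole manifold. The
    artificial value is harmless, since only points of \<open>U\<close> will carry mass.\<close>
  define f where "f p = indicat_real (fst c) p *\<^sub>R snd c p" for p
  have f: "f \<in> borel_measurable borel"
    unfolding f_def by (rule borel_measurable_continuous_on_indicator[OF borel_open[OF chart_homeo(1)[OF c]] chart_inv(5)[OF c]])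
  have fc: "f p = snd c p" if "p \<in> fst c" for p using that by (simp add: f_def)
  have spc: "space \<mu> = UNIV" using sets_eq_imp_space_eq[OF sets] by simp
  have Us: "U \<in> sets \<mu>" using U(1) sets by simp
  define N where "N = distr (density \<mu> (indicator U)) borel f"
  have fm: "f \<in> measurable (density \<mu> (indicator U)) borel"
    using f by (simp add: measurable_cong_sets[OF sets refl])
  have N: "emeasure N W = emeasure \<mu> (U \<inter> f -` W)" if W: "W \<in> sets borel" for W
  proof -
    have fW: "f -` W \<in> sets \<mu>" using measurable_sets[OF f W] sets by simp
    have "emeasure N W = emeasure (density \<mu> (indicator U)) (f -` W)"
      unfolding N_def by (subst emeasure_distr[OF fm W]) (simp add: spc)
    also have "\<dots> = (\<integral>\<^sup>+p. indicator U p * indicator (f -` W) p \<partial>\<mu>)"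
      using Us fW by (intro emeasure_density) auto
    also have "\<dots> = (\<integral>\<^sup>+p. indicator (U \<inter> f -` W) p \<partial>\<mu>)"
      by (intro nn_integral_cong) (auto simp: indicator_def)
    also have "\<dots> = emeasure \<mu> (U \<inter> f -` W)" using Us fW by (intro nn_integral_indicator) auto
    finally show ?thesis .
  qed
  have Nfin: "emeasure N (space N) \<noteq> \<infinity>" using U(3) N[of UNIV] by (simp add: N_def)
  define B' where "B' = snd c ` B"
  have B'eq: "B' = chart_image c \<inter> inv_chart c -` B"
    using B(2) U(2) chart_inv[OF c] by (force simp: B'_def image_iff)
  have B's: "B' \<in> sets borel"
  proof -
    have "inv_chart c \<in> borel_measurable (restrict_space borel (chart_image c))"
      by (rule borel_measurable_continuous_on_restrict[OF chart_inv(6)[OF c]])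
    from measurable_sets[OF this B(1)] have "B' \<in> sets (restrict_space borel (chart_image c))"
      by (simp add: space_restrict_space B'eq Int_commute)
    then show ?thesis using chart_homeo(2)[OF c] by (subst (asm) sets_restrict_space_iff) auto
  qed
  have UB: "U \<inter> f -` B' = B"
    using B(2) U(2) chart_inv(3)[OF c] fc by (auto simp: B'eq chart_inv(4)[OF c] subset_iff)
  have "emeasure N B' = (INF W \<in> {W. B' \<subseteq> W \<and> open W}. emeasure N W)"
    by (rule outer_regular) (use B's Nfin in \<open>auto simp: N_def\<close>)
  moreover have "emeasure N B' < emeasure N B' + ennreal e"
  proof -
    have "emeasure N B' < \<infinity>" using Nfin emeasure_space[of N B'] by (auto simp: less_top[symmetric] top_unique)
    then show ?thesis
      using e by (cases "emeasure N B'") (auto simp: ennreal_plus[symmetric] ennreal_less_iff simp del: ennreal_plus)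
  qed
  ultimately have "(INF W \<in> {W. B' \<subseteq> W \<and> open W}. emeasure N W) < emeasure N B' + ennreal e" by simp
  then obtain W where W: "B' \<subseteq> W" "open W" "emeasure N W < emeasure N B' + ennreal e"
    unfolding INF_less_iff by blast
  show thesis
  proof (rule that[of "U \<inter> snd c -` W"])
    show "open (U \<inter> snd c -` W)"
      by (rule continuous_open_preimage[OF continuous_on_subset[OF chart_inv(5)[OF c] U(2)] U(1) W(2)])
    show "B \<subseteq> U \<inter> snd c -` W" using B(2) W(1) by (auto simp: B'_def)
    have "U \<inter> f -` W = U \<inter> snd c -` W" using fc U(2) by auto
    then show "emeasure \<mu> (U \<inter> snd c -` W) \<le> emeasure \<mu> B + ennreal e"
      using W(2,3) N[of W] N[OF B's] UB by (simp add: less_imp_le)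
  qed simp
qed

end

context varifold_on
begin

text \<open>The singular part of the first variation is concentrated on a \<open>|M|\<close>-null set, where it is
  dominated by the total variation of the first variation, hence by its singular part \<open>\<beta>\<close>.\<close>

lemma variation_le_boundary:
  assumes g: "C1_metric A g" and lb: "locally_bounded_first_variation A g m M"
    and mc: "mean_curvature A g m M H" and bm: "boundary_measure A g m M \<beta>"
    and c: "c \<in> A" and U: "open U" "U \<subseteq> K" and K: "compact K" "K \<subseteq> fst c"
    and X: "X \<in> test_fields A g U"
  shows "ennreal (first_variation A g m M X + (\<integral>p. g p (H p) (X p) \<partial>weight M)) \<le> emeasure \<beta> U"
proof -
  let ?L = "\<lambda>X. first_variation A g m M X + (\<integral>p. g p (H p) (X p) \<partial>weight M)"
  obtain \<sigma> where \<sigma>: "total_variation_measure A g ?L \<sigma>" "mutually_singular (weight M) \<sigma>"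
    and H: "vector_field A H" "(\<lambda>p. H p c) \<in> borel_measurable borel"
      "(\<integral>\<^sup>+p\<in>K. ennreal (tnorm g p (H p)) \<partial>weight M) < \<infinity>"
    using mc c K(1) unfolding mean_curvature_def by blast
  obtain \<nu> \<rho> where \<nu>: "total_variation_measure A g (first_variation A g m M) \<nu>" "sets \<beta> = sets borel"
      "sets \<rho> = sets borel" "absolutely_continuous (weight M) \<rho>"
      "\<And>B. B \<in> sets borel \<Longrightarrow> emeasure \<nu> B = emeasure \<rho> B + emeasure \<beta> B"
    using bm unfolding boundary_measure_def by blast
  have Uc: "U \<subseteq> fst c" using U K by blast
  have s: "sets \<sigma> = sets borel" "sets \<nu> = sets borel"
    using \<sigma>(1) \<nu>(1) by (auto simp: total_variation_measure_def)
  have \<sigma>open: "emeasure \<sigma> V = (SUP X \<in> test_fields A g V. ennreal (?L X))"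
    and \<nu>open: "emeasure \<nu> V = (SUP X \<in> test_fields A g V. ennreal (first_variation A g m M X))" if "open V" for V
    using \<sigma>(1) \<nu>(1) that by (auto simp: total_variation_measure_def)
  have HT: "H p \<in> tangent_space A p" for p using H(1) by (simp add: vector_field_def)
  have Hm: "(\<lambda>p. ennreal (indicat_real U p * tnorm g p (H p))) \<in> borel_measurable borel"
    using tnorm_measurable[OF g c H(1,2) borel_open[OF U(1)] Uc] by measurable
  \<comment> \<open>The measure |H| |M| on \<open>U\<close>, through which the mean curvature term
    is controlled.\<close>
  define \<eta> where "\<eta> = density (weight M) (\<lambda>p. ennreal (indicat_real U p * tnorm g p (H p)))"
  have s\<eta>: "sets \<eta> = sets borel" by (simp add: \<eta>_def weight_simps)
  have \<eta>V: "emeasure \<eta> B = (\<integral>\<^sup>+p\<in>B. ennreal (tnorm g p (H p)) \<partial>weight M)" if "B \<in> sets borel" "B \<subseteq> U" for B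
  proof -
    have "emeasure \<eta> B = (\<integral>\<^sup>+p. ennreal (indicat_real U p * tnorm g p (H p)) * indicator B p \<partial>weight M)"
      unfolding \<eta>_def using Hm that by (intro emeasure_density) (simp_all add: weight_simps measurable_cong_sets[OF weight_simps(1) refl])
    also have "\<dots> = (\<integral>\<^sup>+p\<in>B. ennreal (tnorm g p (H p)) \<partial>weight M)"
      using that by (intro nn_integral_cong) (auto simp: indicator_def)
    finally show ?thesis .
  qed
  have \<nu>fin: "emeasure \<nu> U < \<infinity>"
  proof -
    obtain C where C: "\<And>X. X \<in> test_fields A g K \<Longrightarrow> \<bar>first_variation A g m M X\<bar> \<le> C"
      using lb K(1) unfolding locally_bounded_first_variation_def by blast
    have "test_fields A g U \<subseteq> test_fields A g K" using U(2) by (auto simp: test_fields_def)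
    then have "emeasure \<nu> U \<le> ennreal C"
      unfolding \<nu>open[OF U(1)] using C by (intro SUP_least ennreal_leI) (auto simp: abs_le_iff)
    then show ?thesis by (rule le_less_trans) simp
  qed
  have \<eta>fin: "emeasure \<eta> U < \<infinity>"
  proof -
    have "emeasure \<eta> U \<le> (\<integral>\<^sup>+p\<in>K. ennreal (tnorm g p (H p)) \<partial>weight M)"
      unfolding \<eta>V[OF borel_open[OF U(1)] order_refl] using U(2) by (intro nn_integral_mono) (auto simp: indicator_def)
    then show ?thesis using H(3) by (rule le_less_trans)
  qed
  \<comment> \<open>On open sets the comparison follows from the description of total variation by
    suprema over test fields; passing to the Borel set \<open>B\<close> below needs outer
    regularity.\<close>
  have le_open: "emeasure \<sigma> V \<le> emeasure \<nu> V + emeasure \<eta> V" if V: "open V" "V \<subseteq> U" for V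
    unfolding \<sigma>open[OF V(1)]
  proof (rule SUP_least)
    fix Y assume Y: "Y \<in> test_fields A g V"
    then have YT: "Y p \<in> tangent_space A p" and Y1: "tnorm g p (Y p) \<le> 1"
      and Y0: "p \<notin> V \<Longrightarrow> Y p = (\<lambda>_. 0)" for p
      using closure_subset[of "{p. Y p \<noteq> (\<lambda>_. 0)}"]
      by (auto simp: test_fields_def C1_vector_field_def vector_field_def vf_support_def)
    have "ennreal \<bar>\<integral>p. g p (H p) (Y p) \<partial>weight M\<bar> \<le> (\<integral>\<^sup>+p. ennreal \<bar>g p (H p) (Y p)\<bar> \<partial>weight M)"
      by (rule abs_integral_le_nn_integral)
    also have "\<dots> \<le> (\<integral>\<^sup>+p\<in>V. ennreal (tnorm g p (H p)) \<partial>weight M)"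
    proof (rule nn_integral_mono)
      fix p
      show "ennreal \<bar>g p (H p) (Y p)\<bar> \<le> ennreal (tnorm g p (H p)) * indicator V p"
      proof (cases "p \<in> V")
        case True
        have "\<bar>g p (H p) (Y p)\<bar> \<le> tnorm g p (H p) * tnorm g p (Y p)" by (rule metric_cauchy_schwarz(1)[OF g HT YT])
        also have "\<dots> \<le> tnorm g p (H p) * 1" by (rule mult_left_mono[OF Y1 metric_cauchy_schwarz(2)[OF g HT HT]])
        finally show ?thesis using True by (simp add: ennreal_leI)
      next
        case False
        then show ?thesis using metric_cauchy_schwarz(3)[OF g HT HT] Y0 by simp
      qed
    qed
    also have "\<dots> = emeasure \<eta> V" using \<eta>V V by simp
    finally have 1: "ennreal \<bar>\<integral>p. g p (H p) (Y p) \<partial>weight M\<bar> \<le> emeasure \<eta> V" .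
    have 2: "ennreal (first_variation A g m M Y) \<le> emeasure \<nu> V"
      unfolding \<nu>open[OF V(1)] by (rule SUP_upper[OF Y])
    show "ennreal (?L Y) \<le> emeasure \<nu> V + emeasure \<eta> V"
      using ennreal_add_le_abs add_mono[OF 2 1] by (rule order_trans)
  qed
  obtain N where N: "N \<in> sets borel" "emeasure (weight M) N = 0" "emeasure \<sigma> (- N) = 0"
    using \<sigma>(2) unfolding mutually_singular_def by blast
  \<comment> \<open>The complement of \<open>N\<close> is null for \<open>\<sigma>\<close>, while
    \<open>N\<close> is null for |M| and therefore for \<open>\<eta>\<close> and for the absolutely
    continuous part \<open>\<rho>\<close>. On \<open>B\<close> only \<open>\<beta>\<close>
    remains.\<close>
  define B where "B = U \<inter> N"
  have B: "B \<in> sets borel" "B \<subseteq> U" using N(1) U(1) by (auto simp: B_def)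
  have B0: "emeasure (weight M) B = 0"
    using emeasure_mono[of B N "weight M"] N(1,2) by (simp add: B_def weight_simps)
  have \<eta>B: "emeasure \<eta> B = 0"
  proof -
    have "AE p in weight M. p \<notin> B" using B0 B(1) by (intro AE_not_in) (auto simp: null_sets_def weight_simps)
    then have "(\<integral>\<^sup>+p\<in>B. ennreal (tnorm g p (H p)) \<partial>weight M) = (\<integral>\<^sup>+p. 0 \<partial>weight M)"
      by (intro nn_integral_cong_AE) (auto simp: indicator_def)
    then show ?thesis using \<eta>V[OF B] by simp
  qed
  have \<rho>B: "emeasure \<rho> B = 0"
    using \<nu>(4) B0 B(1) unfolding absolutely_continuous_def null_sets_def by (auto simp: weight_simps)
  have "ennreal (?L X) \<le> emeasure \<sigma> U" unfolding \<sigma>open[OF U(1)] by (rule SUP_upper[OF X])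
  also have "\<dots> \<le> emeasure \<sigma> (B \<union> - N)" using B(1) N(1) s by (intro emeasure_mono) (auto simp: B_def)
  also have "\<dots> \<le> emeasure \<sigma> B + emeasure \<sigma> (- N)" using B(1) N(1) s by (intro emeasure_subadditive) auto
  also have "\<dots> = emeasure \<sigma> B" using N(3) by simp
  also have "\<dots> \<le> emeasure \<nu> B"
  proof (rule ennreal_le_epsilon)
    fix e :: real assume "e > 0"
    then have e: "e / 2 > 0" by simp
    obtain V1 where V1: "open V1" "B \<subseteq> V1" "V1 \<subseteq> U" "emeasure \<nu> V1 \<le> emeasure \<nu> B + ennreal (e / 2)"
      using chart_outer_regular[OF s(2) c U(1) Uc \<nu>fin B e] by metis
    obtain V2 where V2: "open V2" "B \<subseteq> V2" "V2 \<subseteq> U" "emeasure \<eta> V2 \<le> emeasure \<eta> B + ennreal (e / 2)"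
      using chart_outer_regular[OF s\<eta> c U(1) Uc \<eta>fin B e] by metis
    \<comment> \<open>A single open set has to approximate \<open>B\<close> for \<open>\<nu>\<close>
      and for \<open>\<eta>\<close> at once.\<close>
    let ?V = "V1 \<inter> V2"
    have "emeasure \<sigma> B \<le> emeasure \<sigma> ?V" using V1 V2 s by (intro emeasure_mono) auto
    also have "\<dots> \<le> emeasure \<nu> ?V + emeasure \<eta> ?V" using V1 V2 by (intro le_open) auto
    also have "\<dots> \<le> emeasure \<nu> V1 + emeasure \<eta> V2"
      using V1(1) V2(1) s s\<eta> by (intro add_mono emeasure_mono) auto
    also have "\<dots> \<le> (emeasure \<nu> B + ennreal (e / 2)) + ennreal (e / 2)"
      using V1(4) V2(4) \<eta>B by (intro add_mono) auto
    also have "\<dots> = emeasure \<nu> B + ennreal e"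
      using \<open>e > 0\<close> by (simp add: add.assoc ennreal_plus[symmetric] del: ennreal_plus)
    finally show "emeasure \<sigma> B \<le> emeasure \<nu> B + ennreal e" .
  qed
  also have "\<dots> = emeasure \<beta> B" using \<nu>(5)[OF B(1)] \<rho>B by simp
  also have "\<dots> \<le> emeasure \<beta> U" using B U(1) \<nu>(2) by (intro emeasure_mono) auto
  finally show ?thesis .
qed

end

section \<open>Divergence of gradient fields\<close>

lemma Ck_on_1_add:
  assumes f: "Ck_on 1 S f" and g: "Ck_on 1 S g"
  shows "Ck_on 1 S (\<lambda>x. f x + g x)"
proof (rule Ck_on_1I)
  show "((\<lambda>x. f x + g x) has_derivative (\<lambda>h. fd f x h + fd g x h)) (at x)"
    if "x \<in> S" for x
    using fd_works[OF Ck_on_1_diff[OF f that]] fd_works[OF Ck_on_1_diff[OF g that]]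
    by (rule has_derivative_add)
  show "continuous_on S (\<lambda>x. fd f x v + fd g x v)" for v
    using f g by (intro continuous_intros Ck_on_1_fd_continuous)
qed

lemma Ck_on_1_sum:
  assumes "finite I" "\<And>i. i \<in> I \<Longrightarrow> Ck_on 1 S (f i)"
  shows "Ck_on 1 S (\<lambda>x. \<Sum>i\<in>I. f i x)"
  using assms
proof (induction I rule: finite_induct)
  case empty then show ?case by (simp only: sum.empty Ck_on_1_const)
next
  case (insert i I)
  have "Ck_on 1 S (\<lambda>x. f i x + (\<Sum>i\<in>I. f i x))" using insert by (intro Ck_on_1_add) auto
  moreover have "(\<lambda>x. \<Sum>i\<in>insert i I. f i x) = (\<lambda>x. f i x + (\<Sum>i\<in>I. f i x))"
    using insert.hyps by simp
  ultimately show ?case by (simp only:)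
qed

lemma Ck_on_1_inner:
  assumes f: "Ck_on 1 S f"
  shows "Ck_on 1 S (\<lambda>x. f x \<bullet> a)"
proof (rule Ck_on_1I)
  show "((\<lambda>x. f x \<bullet> a) has_derivative (\<lambda>h. fd f x h \<bullet> a)) (at x)" if "x \<in> S" for x
    using fd_works[OF Ck_on_1_diff[OF f that]] by (rule has_derivative_inner_left)
  show "continuous_on S (\<lambda>x. fd f x v \<bullet> a)" for v
    using f by (intro continuous_intros Ck_on_1_fd_continuous)
qed

lemma Ck_on_1_linear_apply:
  fixes L :: "'b::real_normed_vector \<Rightarrow> 'e::euclidean_space \<Rightarrow> 'c::real_normed_vector"
  assumes S: "open S" and L: "\<And>x. x \<in> S \<Longrightarrow> linear (L x)" "\<And>a. Ck_on 1 S (\<lambda>x. L x a)" and u: "Ck_on 1 S u"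
  shows "Ck_on 1 S (\<lambda>x. L x (u x))"
proof (rule Ck_on_1_cong[OF _ S])
  show "Ck_on 1 S (\<lambda>x. \<Sum>a\<in>Basis. (u x \<bullet> a) *\<^sub>R L x a)"
    by (intro Ck_on_1_sum Ck_on_1_scaleR Ck_on_1_inner L(2) u finite_Basis)
qed (simp add: linear_expand[OF L(1), symmetric])

lemma Ck_on_1_Un:
  assumes "Ck_on 1 S f" "Ck_on 1 T f" "open S" "open T"
  shows "Ck_on 1 (S \<union> T) f"
  using assms unfolding Ck_on_1_iff by (auto intro: continuous_on_open_Un)

text \<open>The second derivatives of \<open>F\<close> enter through differentiating the equation of the gradient \<open>z\<close>.\<close>

lemma gradient_field_identity:
  fixes G :: "'e::euclidean_space \<Rightarrow> 'e \<Rightarrow> 'e \<Rightarrow> real"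
  assumes S: "open S" "x \<in> S" and G: "\<And>y. y \<in> S \<Longrightarrow> inner_form (G y)" "\<And>a b. Ck_on 1 S (\<lambda>y. G y a b)"
    and F: "Ck_on 2 S F" and z: "Ck_on 1 S z" "\<And>y w. y \<in> S \<Longrightarrow> G y (z y) w = fd F y w" and \<psi>: "Ck_on 1 S \<psi>"
  shows "G x (fd (\<lambda>y. \<psi> y *\<^sub>R z y) x b) b + koszul G x b (\<psi> x *\<^sub>R z x) b
     = fd \<psi> x b * fd F x b + \<psi> x * (fd (\<lambda>y. fd F y b) x b - koszul G x b b (z x))"
proof -
  note bil = inner_formD(1)[OF G(1)]
  have dz: "(z has_derivative fd z x) (at x)" by (rule fd_works[OF Ck_on_1_diff[OF z(1) S(2)]])
  have d\<psi>: "(\<psi> has_derivative fd \<psi> x) (at x)" by (rule fd_works[OF Ck_on_1_diff[OF \<psi> S(2)]])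
  have 1: "fd (\<lambda>y. \<psi> y *\<^sub>R z y) x = (\<lambda>h. \<psi> x *\<^sub>R fd z x h + fd \<psi> x h *\<^sub>R z x)"
    by (rule fd_eq[OF has_derivative_scaleR[OF d\<psi> dz]])
  have "((\<lambda>y. G y (z y) b) has_derivative (\<lambda>h. fd (\<lambda>y. G y (z x) b) x h + G x (fd z x h) b + G x (z x) 0)) (at x)"
    by (rule bilinear_form_has_derivative[OF S bil _ dz has_derivative_const]) (use Ck_on_1_diff[OF G(2) S(2)] in auto)
  then have "((\<lambda>y. fd F y b) has_derivative (\<lambda>h. fd (\<lambda>y. G y (z x) b) x h + G x (fd z x h) b + G x (z x) 0)) (at x)"
    by (rule has_derivative_cong_open[OF _ S]) (simp add: z(2))
  then have 2: "fd (\<lambda>y. fd F y b) x b = fd (\<lambda>y. G y (z x) b) x b + G x (fd z x b) b"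
    by (simp add: fd_eq bilinear_rzero[OF bil[OF S(2)]])
  have 3: "fd (\<lambda>y. G y b (z x)) x = fd (\<lambda>y. G y (z x) b) x"
    by (rule fd_cong_open(2)[OF Ck_on_1_diff[OF G(2) S(2)] S]) (use inner_formD(2)[OF G(1)] in auto)
  have 4: "koszul G x b (\<psi> x *\<^sub>R z x) b = \<psi> x * koszul G x b (z x) b"
  proof -
    have "linear (\<lambda>v. koszul G x b v b)" by (rule koszul_linear(3)[OF S bil G(2)])
    from linear_scale[OF this] show ?thesis by simp
  qed
  show ?thesis
    unfolding 1 4 bilinear_ladd[OF bil[OF S(2)]] bilinear_lmul[OF bil[OF S(2)]] 2
    unfolding koszul_def 3 z(2)[OF S(2)]
    by (simp add: field_simps)
qed

text \<open>The pairing of \<open>v\<close> with the covariant derivative of \<open>w\<close> along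
  \<open>u\<close>, in chart coordinates and with the Christoffel part written through
  \<open>koszul\<close>. Its trace over a plane is the divergence \<open>plane_div\<close>.\<close>

definition div_form :: "('e::euclidean_space \<Rightarrow> 'e \<Rightarrow> 'e \<Rightarrow> real) \<Rightarrow> ('e \<Rightarrow> 'e) \<Rightarrow> 'e \<Rightarrow> 'e \<Rightarrow> 'e \<Rightarrow> real" where
  "div_form G w x u v = G x (fd w x u) v + koszul G x u (w x) v"

lemma div_form_bilinear_continuous:
  assumes S: "open S" and G: "\<And>y. y \<in> S \<Longrightarrow> bilinear (G y)" "\<And>a b. Ck_on 1 S (\<lambda>y. G y a b)" and w: "Ck_on 1 S w"
  shows "x \<in> S \<Longrightarrow> bilinear (div_form G w x)" "continuous_on S (\<lambda>x. div_form G w x a b)"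
proof -
  show "bilinear (div_form G w x)" if x: "x \<in> S"
  proof -
    have l1: "linear (\<lambda>u. G x u v)" and l2: "linear (\<lambda>v. G x u v)" for u v using G(1)[OF x] by (auto simp: bilinear_def)
    note k = koszul_linear[OF S x G]
    have "linear (\<lambda>u. G x (fd w x u) v)" for v
      using linear_compose[OF fd_linear[OF Ck_on_1_diff[OF w x]] l1] by (simp add: o_def)
    then show ?thesis
      unfolding bilinear_def div_form_def
      by (intro conjI allI linear_compose_add l2 k(1) k(2))
  qed
  show "continuous_on S (\<lambda>x. div_form G w x a b)"
    unfolding div_form_def
  proof (intro continuous_on_add)
    show "continuous_on S (\<lambda>x. G x (fd w x a) b)"
      by (rule continuous_on_bilinear_apply[where B=G, OF G(1) Ck_on_1_continuous[OF G(2)] Ck_on_1_fd_continuous[OF w] continuous_on_const])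
    have kc: "continuous_on S (\<lambda>x. koszul G x a v b)" for v
      unfolding koszul_def
    proof (intro continuous_intros Ck_on_1_fd_continuous[OF G(2)])
    qed simp
    show "continuous_on S (\<lambda>x. koszul G x a (w x) b)"
      by (rule continuous_on_linear_apply[where L="\<lambda>x v. koszul G x a v b", OF koszul_linear(3)[OF S _ G] kc Ck_on_1_continuous[OF w]])
  qed
qed

context manifold
begin

text \<open>\<open>plane_div\<close> sums over a chosen set of tangent vectors,
  \<open>plane_trace\<close> over a chosen indexed frame in the chart. A chart frame shows that an
  orthonormal basis exists, so the chosen set is one; enumerating it gives a frame, and the trace is
  the same for all frames.\<close>

lemma plane_div_chart:
  assumes g: "C1_metric A g" and X: "C1_vector_field A X" and pS: "(p, S) \<in> grassmann_bundle A m" and c: "c \<in> A" "p \<in> fst c"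
  shows "plane_div A g m X p S = plane_trace (metric_in_chart A g c (snd c p))
     (div_form (metric_in_chart A g c) (\<lambda>y. X (inv_chart c y) c) (snd c p)) m (in_chart c S)"
proof -
  let ?G = "metric_in_chart A g c" and ?x = "snd c p" and ?w = "\<lambda>y. X (inv_chart c y) c"
  note x = chart_inv(4)[OF c]
  have G: "inner_form (?G ?x)" by (rule C1_metric_inner_form[OF g c(1) x])
  note gr = grassmann_chart[OF pS c]
  have w: "Ck_on 1 (chart_image c) ?w" using X c(1) by (simp add: C1_vector_field_def)
  note Q = div_form_bilinear_continuous(1)[OF chart_homeo(2)[OF c(1)] metric_bilinear[OF g c(1)] C1_metric_Ck[OF g c(1)] w x]
  obtain b where b: "onb (?G ?x) m (in_chart c S) b" using onb_exists[OF G gr(1)] gr(2) by blast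
  have "orthonormal_basis g m p S (tvec A c p ` b ` {..<m})"
    unfolding orthonormal_basis_def
  proof (intro conjI ballI)
    show "tvec A c p ` b ` {..<m} \<subseteq> S" using b gr(3) by (auto simp: onb_def)
    have "inj (tvec A c p)" using tvec_self[OF c] by (metis injI)
    then show "card (tvec A c p ` b ` {..<m}) = m"
      using onb_independent(1)[OF b G] by (simp add: card_image inj_on_subset)
    fix v v' assume "v \<in> tvec A c p ` b ` {..<m}" "v' \<in> tvec A c p ` b ` {..<m}"
    then obtain i j where ij: "i < m" "j < m" "v = tvec A c p (b i)" "v' = tvec A c p (b j)" by auto
    have "g p v v' = ?G ?x (b i) (b j)"
      unfolding ij metric_tangent[OF tvec_in_tangent[OF c] tvec_in_tangent[OF c] c] tvec_self[OF c] ..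
    also have "\<dots> = (if i = j then 1 else 0)" using b ij by (simp add: onb_def)
    also have "\<dots> = (if v = v' then 1 else 0)"
    proof -
      have "v = v' \<longleftrightarrow> b i = b j" unfolding ij using tvec_self[OF c] by metis
      also have "\<dots> \<longleftrightarrow> i = j" using onb_independent(1)[OF b G] ij(1,2) by (auto simp: inj_on_def)
      finally show ?thesis by simp
    qed
    finally show "g p v v' = (if v = v' then 1 else 0)" .
  qed simp
  then have "orthonormal_basis g m p S (SOME B. orthonormal_basis g m p S B)"
    by (rule someI[where P="orthonormal_basis g m p S"])
  then obtain B where Bdef: "B = (SOME B. orthonormal_basis g m p S B)" and ob: "orthonormal_basis g m p S B" by blast
  have B: "B \<subseteq> S" "finite B" "card B = m" "\<And>v v'. v \<in> B \<Longrightarrow> v' \<in> B \<Longrightarrow> g p v v' = (if v = v' then 1 else 0)"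
    using ob unfolding orthonormal_basis_def by blast+
  obtain e where e: "bij_betw e {..<m} B" using ex_bij_betw_nat_finite[OF B(2)] B(3) by (auto simp: atLeast0LessThan)
  have eT: "e j \<in> tangent_space A p" "e j \<in> B" if "j < m" for j
    using bij_betwE[OF e] that B(1) gr(5) by blast+
  have onb': "onb (?G ?x) m (in_chart c S) (\<lambda>j. e j c)"
    unfolding onb_def
  proof (intro conjI allI impI)
    show "e j c \<in> in_chart c S" if "j < m" for j
      using eT(2)[OF that] B(1) by (auto simp: in_chart_def)
    fix i j assume ij: "i < m" "j < m"
    have "?G ?x (e i c) (e j c) = g p (e i) (e j)" by (rule metric_tangent[OF eT(1)[OF ij(1)] eT(1)[OF ij(2)] c, symmetric])
    also have "\<dots> = (if e i = e j then 1 else 0)" using B(4) eT ij by simp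
    also have "\<dots> = (if i = j then 1 else 0)" using e ij by (auto simp: bij_betw_def inj_on_def)
    finally show "?G ?x (e i c) (e j c) = (if i = j then 1 else 0)" .
  qed
  have "plane_div A g m X p S = (\<Sum>j<m. g p (cov_deriv A g X p (e j)) (e j))"
    unfolding plane_div_def Bdef[symmetric] by (rule sum.reindex_bij_betw[OF e, symmetric])
  also have "\<dots> = (\<Sum>j<m. div_form ?G ?w ?x (e j c) (e j c))"
  proof (rule sum.cong[OF refl])
    fix j assume "j \<in> {..<m}"
    then have j: "j < m" by simp
    note cd = cov_deriv_chart[OF g c eT(1)[OF j] X]
    have "X p c = ?w ?x" using chart_inv(3)[OF c] by simp
    then show "g p (cov_deriv A g X p (e j)) (e j) = div_form ?G ?w ?x (e j c) (e j c)"
      unfolding cd metric_tangent[OF tvec_in_tangent[OF c] eT(1)[OF j] c] tvec_self[OF c]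
        bilinear_ladd[OF inner_formD(1)[OF G]] christoffel_koszul[OF g c(1) x]
      by (simp add: div_form_def)
  qed
  also have "\<dots> = plane_trace (?G ?x) (div_form ?G ?w ?x) m (in_chart c S)"
    by (rule plane_trace_eq[OF onb' G gr(1,2) Q, symmetric])
  finally show ?thesis .
qed

lemma plane_div_outside_support:
  assumes g: "C1_metric A g" and X: "C1_vector_field A X" and pS: "(p, S) \<in> grassmann_bundle A m" and p: "p \<notin> vf_support X"
  shows "plane_div A g m X p S = 0"
proof -
  obtain c where c: "c \<in> A" "p \<in> fst c" using chart_ex by metis
  let ?G = "metric_in_chart A g c" and ?x = "snd c p" and ?w = "\<lambda>y. X (inv_chart c y) c"
  note x = chart_inv(4)[OF c]
  have G: "inner_form (?G ?x)" by (rule C1_metric_inner_form[OF g c(1) x])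
  note gr = grassmann_chart[OF pS c]
  have w: "Ck_on 1 (chart_image c) ?w" using X c(1) by (simp add: C1_vector_field_def)
  note Q = div_form_bilinear_continuous(1)[OF chart_homeo(2)[OF c(1)] metric_bilinear[OF g c(1)] C1_metric_Ck[OF g c(1)] w x]
  obtain b where b: "onb (?G ?x) m (in_chart c S) b" using onb_exists[OF G gr(1)] gr(2) by blast
  let ?U = "snd c ` (fst c \<inter> - vf_support X)"
  have U: "open ?U" "?x \<in> ?U"
    using p c chart_homeo(1)[OF c(1)] by (auto intro!: open_chart_image simp: vf_support_def)
  have X0: "X q = (\<lambda>_. 0)" if "q \<notin> vf_support X" for q
    using that closure_subset[of "{p. X p \<noteq> (\<lambda>_. 0)}"] by (auto simp: vf_support_def)
  have "(?w has_derivative (\<lambda>h. 0)) (at ?x)"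
    by (rule has_derivative_cong_open[OF has_derivative_const[of 0] U]) (use chart_inv(3)[OF c(1)] X0 in auto)
  then have f: "fd ?w ?x = (\<lambda>h. 0)" by (rule fd_eq)
  have w0: "?w ?x = 0" using chart_inv(3)[OF c] X0[OF p] by simp
  have d0: "div_form ?G ?w ?x u v = 0" for u v
    unfolding div_form_def f w0 bilinear_lzero[OF inner_formD(1)[OF G]]
    using linear_0[OF koszul_linear(3)[OF chart_homeo(2)[OF c(1)] x metric_bilinear[OF g c(1)] C1_metric_Ck[OF g c(1)]]] by simp
  have "plane_div A g m X p S = plane_trace (?G ?x) (div_form ?G ?w ?x) m (in_chart c S)"
    by (rule plane_div_chart[OF g X pS c])
  also have "\<dots> = (\<Sum>j<m. div_form ?G ?w ?x (b j) (b j))" by (rule plane_trace_eq[OF b G gr(1,2) Q])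
  also have "\<dots> = 0" unfolding d0 by simp
  finally show ?thesis .
qed

definition chart_field :: "('a, 'e) chart \<Rightarrow> ('e \<Rightarrow> 'e) \<Rightarrow> 'a \<Rightarrow> ('a, 'e) tangent" where
  "chart_field c w p = (if p \<in> fst c then tvec A c p (w (snd c p)) else (\<lambda>_. 0))"

text \<open>In another chart \<open>d\<close> regularity is checked on two open sets covering its
  image: the overlap with \<open>c\<close>, where the components are transformed by the differential
  of a smooth transition map, and the complement of the compact set carrying the field, where they
  vanish.\<close>

lemma chart_field:
  assumes c: "c \<in> A" and w: "Ck_on 1 (chart_image c) w" and K: "compact K" "K \<subseteq> chart_image c"
    and w0: "\<And>y. y \<in> chart_image c \<Longrightarrow> y \<notin> K \<Longrightarrow> w y = 0"
  shows "C1_vector_field A (chart_field c w)" "vf_support (chart_field c w) \<subseteq> inv_chart c ` K"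
    "compact (vf_support (chart_field c w))"
proof -
  let ?X = "chart_field c w"
  have cK: "compact (inv_chart c ` K)" by (rule compact_inv_chart_image[OF c K])
  have X0: "?X p = (\<lambda>_. 0)" if "p \<notin> inv_chart c ` K" for p
  proof (cases "p \<in> fst c")
    case True
    have "snd c p \<notin> K" using that chart_inv(3)[OF c True] by (metis imageI)
    then show ?thesis using True w0 chart_inv(4)[OF c True] by (simp add: chart_field_def tvec_zero[OF c True])
  qed (simp add: chart_field_def)
  show sup: "vf_support ?X \<subseteq> inv_chart c ` K"
    unfolding vf_support_def using X0 by (intro closure_minimal compact_imp_closed[OF cK]) auto
  then show "compact (vf_support ?X)"
    using cK by (metis closed_Int_compact closed_closure inf.absorb1 vf_support_def)
  have zT: "(\<lambda>_. 0) \<in> tangent_space A p" for p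
    using tvec_in_tangent[OF chart_at_in, of p 0] by (simp add: tvec_zero[OF chart_at_in])
  have vf: "vector_field A ?X"
    unfolding vector_field_def chart_field_def using tvec_in_tangent[OF c] zT by simp
  have "Ck_on 1 (chart_image d) (\<lambda>y. ?X (inv_chart d y) d)" if d: "d \<in> A" for d
  proof -
    let ?f = "\<lambda>y. ?X (inv_chart d y) d"
    let ?\<tau> = "snd d \<circ> inv_chart c" and ?\<tau>' = "snd c \<circ> inv_chart d"
    have O1: "Ck_on 1 (overlap d c) ?f"
    proof (rule Ck_on_1_cong[OF _ overlap(1)[OF d c]])
      have "Ck_on 1 (overlap c d) (\<lambda>x. fd ?\<tau> x (w x))"
      proof (rule Ck_on_1_linear_apply[where L="\<lambda>x. fd ?\<tau> x", OF overlap(1)[OF c d]])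
        show "linear (fd ?\<tau> x)" if "x \<in> overlap c d" for x
          by (rule fd_linear[OF Ck_on_1_diff[OF overlap(5)[OF c d] that]])
        show "Ck_on 1 (overlap c d) (\<lambda>x. fd ?\<tau> x a)" for a by (rule Ck_on_2D1[OF overlap(5)[OF c d]])
        show "Ck_on 1 (overlap c d) w" by (rule Ck_on_1_subset[OF w]) (use overlap(2)[OF c d] in auto)
      qed
      then show "Ck_on 1 (overlap d c) (\<lambda>y. fd ?\<tau> (?\<tau>' y) (w (?\<tau>' y)))"
        by (rule Ck_on_1_compose[OF _ overlap(5)[OF d c]]) (use overlap(4)[OF d c] in auto)
      fix y assume "y \<in> overlap d c"
      then have y: "y \<in> chart_image d" "inv_chart d y \<in> fst c" using overlap(2)[OF d c] by auto
      show "fd ?\<tau> (?\<tau>' y) (w (?\<tau>' y)) = ?f y"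
        using y chart_inv(1)[OF d y(1)] by (simp add: chart_field_def tvec_apply[OF d] jac_def)
    qed
    let ?O = "chart_image d \<inter> inv_chart d -` (- inv_chart c ` K)"
    have oO: "open ?O"
      by (rule continuous_open_preimage[OF chart_inv(6)[OF d] chart_homeo(2)[OF d]])
        (use compact_imp_closed[OF cK] in auto)
    have O2: "Ck_on 1 ?O ?f"
      by (rule Ck_on_1_cong[OF Ck_on_1_const[of _ 0] oO]) (use X0 in auto)
    have "chart_image d \<subseteq> overlap d c \<union> ?O"
    proof
      fix y assume y: "y \<in> chart_image d"
      show "y \<in> overlap d c \<union> ?O"
      proof (cases "inv_chart d y \<in> fst c")
        case True then show ?thesis using y overlap(2)[OF d c] by auto
      next
        case False
        then have "inv_chart d y \<notin> inv_chart c ` K" using K(2) chart_inv(1)[OF c] by auto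
        then show ?thesis using y by auto
      qed
    qed
    then show ?thesis
      by (rule Ck_on_1_subset[OF Ck_on_1_Un[OF O1 O2 overlap(1)[OF d c] oO]])
  qed
  then show "C1_vector_field A ?X" using vf by (simp add: C1_vector_field_def)
qed

lemma chart_field_apply:
  assumes "c \<in> A" "x \<in> chart_image c"
  shows "chart_field c w (inv_chart c x) c = w x"
  using chart_inv(1,2)[OF assms] assms(1) by (simp add: chart_field_def tvec_self)

end

context varifold_on
begin

text \<open>Over the compact support the divergence is continuous in point and plane, hence bounded;
  it vanishes elsewhere, and the bundle over the support has finite mass.\<close>

lemma plane_div_integrable:
  assumes g: "C1_metric A g" and X: "C1_vector_field A X" and sup: "compact (vf_support X)" "vf_support X \<subseteq> fst c" and c: "c \<in> A"
  shows "integrable M (\<lambda>(p, S). plane_div A g m X p S)"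
proof -
  let ?G = "metric_in_chart A g c" and ?w = "\<lambda>y. X (inv_chart c y) c"
  have w: "Ck_on 1 (chart_image c) ?w" using X c by (simp add: C1_vector_field_def)
  note Q = div_form_bilinear_continuous[OF chart_homeo(2)[OF c] metric_bilinear[OF g c] C1_metric_Ck[OF g c] w]
  note G = C1_metric_inner_form[OF g c] Ck_on_1_continuous[OF C1_metric_Ck[OF g c]]
  have ms: "(\<lambda>(p, S). plane_div A g m X p S) \<in> borel_measurable M"
  proof (rule plane_trace_measurable[where G="?G" and Q="div_form ?G ?w", OF c compact_imp_closed[OF sup(1)] sup(2) G Q])
    show "(case (p, S) of (p, S) \<Rightarrow> plane_div A g m X p S) = plane_trace (?G (snd c p)) (div_form ?G ?w (snd c p)) m (in_chart c S)"
      if "(p, S) \<in> grassmann_bundle A m" "p \<in> fst c" for p S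
      using plane_div_chart[OF g X that(1) c that(2)] by simp
    show "(case (p, S) of (p, S) \<Rightarrow> plane_div A g m X p S) = 0"
      if "(p, S) \<in> grassmann_bundle A m" "p \<notin> vf_support X" for p S
      using plane_div_outside_support[OF g X that] by simp
  qed
  have cK: "compact (snd c ` vf_support X)" and Ks: "snd c ` vf_support X \<subseteq> chart_image c"
    using sup chart_inv(4,5)[OF c] by (auto intro: compact_continuous_image continuous_on_subset)
  have "continuous_on (snd c ` vf_support X \<times> projections m)
      (\<lambda>(x, T). plane_trace (?G x) (div_form ?G ?w x) m (range (blinfun_apply T)))"
    by (rule continuous_on_subset[OF plane_trace_continuous[where G="?G" and Q="div_form ?G ?w", OF G Q]]) (use Ks in auto)
  then have "bounded ((\<lambda>(x, T). plane_trace (?G x) (div_form ?G ?w x) m (range (blinfun_apply T)))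
      ` (snd c ` vf_support X \<times> projections m))"
    by (intro compact_imp_bounded compact_continuous_image compact_Times cK compact_projections)
  then obtain B where B: "\<And>z. z \<in> snd c ` vf_support X \<times> projections m \<Longrightarrow>
     \<bar>(\<lambda>(x, T). plane_trace (?G x) (div_form ?G ?w x) m (range (blinfun_apply T))) z\<bar> \<le> B"
    unfolding bounded_iff by force
  let ?K = "{(p, S) \<in> grassmann_bundle A m. p \<in> vf_support X}"
  show ?thesis
  proof (rule integrableI_bounded_set[OF _ ms])
    have "?K = fst -` vf_support X \<inter> space M" by (auto simp: space_M)
    then show "?K \<in> sets M"
      using measurable_sets[OF fst_measurable borel_closed[OF compact_imp_closed[OF sup(1)]]] by simp
    show "emeasure M ?K < \<infinity>" by (rule finite_M[OF compactin_grassmann[OF c sup]])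
    show "AE x in M. x \<in> ?K \<longrightarrow> norm (case x of (p, S) \<Rightarrow> plane_div A g m X p S) \<le> B"
    proof (rule AE_I2, safe)
      fix p S assume pS: "(p, S) \<in> grassmann_bundle A m" "p \<in> vf_support X"
      then have pc: "p \<in> fst c" using sup(2) by blast
      note gr = grassmann_chart[OF pS(1) c pc]
      show "norm (plane_div A g m X p S) \<le> B"
        using B[of "(snd c p, ortho_proj (in_chart c S))"] pS(2) gr(4)
        unfolding plane_div_chart[OF g X pS(1) c pc] by (simp add: ortho_proj_fix(2)[OF gr(1)])
    qed
    show "AE x in M. x \<notin> ?K \<longrightarrow> (case x of (p, S) \<Rightarrow> plane_div A g m X p S) = 0"
    proof (rule AE_I2, intro impI)
      fix x assume x: "x \<in> space M" "x \<notin> ?K"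
      obtain p S where pS: "x = (p, S)" by force
      have "(p, S) \<in> grassmann_bundle A m" "p \<notin> vf_support X" using x by (auto simp: pS space_M)
      then show "(case x of (p, S) \<Rightarrow> plane_div A g m X p S) = 0"
        using plane_div_outside_support[OF g X] by (simp add: pS)
    qed
  qed
qed

end

section \<open>Estimates on the first variation\<close>

context varifold_on
begin

text \<open>Integrating \<open>div\<close> bounds the first variation from below. From above it is
  at most the boundary mass of \<open>U\<close> minus the pairing with \<open>H\<close>, and |H| |X|
  \<le> (|H| - h)^+ + h |X| because |X| \<le> 1. The two integrals of h |X| cancel, which is why the
  length of the field appears in \<open>div\<close>.\<close>

lemma first_variation_estimate:
  fixes \<Psi> :: "'a \<Rightarrow> real"
  assumes g: "C1_metric A g" and lb: "locally_bounded_first_variation A g m M"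
    and mc: "mean_curvature A g m M H" and bm: "boundary_measure A g m M \<beta>"
    and c: "c \<in> A" and U: "open U" "U \<subseteq> K" and K: "compact K" "K \<subseteq> fst c"
    and X: "X \<in> test_fields A g U"
    and div: "\<And>q S. (q, S) \<in> grassmann_bundle A m \<Longrightarrow>
       c0 * \<Psi> q + h * tnorm g q (X q) - C1 * indicat_real E q \<le> plane_div A g m X q S"
    and \<Psi>: "\<Psi> \<in> borel_measurable borel" "\<And>q. \<bar>\<Psi> q\<bar> \<le> B * indicat_real K q"
    and E: "E \<in> sets borel" "E \<subseteq> K"
    and C\<beta>: "emeasure \<beta> U \<le> ennreal C\<beta>" "C\<beta> \<ge> 0"
    and CP: "(\<integral>\<^sup>+q\<in>K. ennreal (max (tnorm g q (H q) - h) 0) \<partial>weight M) \<le> ennreal CP" "CP \<ge> 0"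
  shows "c0 * (\<integral>q. \<Psi> q \<partial>weight M) \<le> C\<beta> + CP + C1 * measure (weight M) E"
proof -
  let ?\<mu> = "weight M"
  have Hv: "vector_field A H" "(\<lambda>p. H p c) \<in> borel_measurable borel"
      "(\<integral>\<^sup>+p\<in>K. ennreal (tnorm g p (H p)) \<partial>?\<mu>) < \<infinity>"
    using mc c K(1) unfolding mean_curvature_def by blast+
  have X': "C1_vector_field A X" "compact (vf_support X)" "vf_support X \<subseteq> U" "\<And>q. tnorm g q (X q) \<le> 1"
    using X by (auto simp: test_fields_def)
  have HT: "H q \<in> tangent_space A q" and XT: "X q \<in> tangent_space A q" for q
    using Hv(1) X'(1) by (auto simp: vector_field_def C1_vector_field_def)
  have XU: "X q = (\<lambda>_. 0)" if "q \<notin> K" for q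
    using that X'(3) U(2) closure_subset[of "{p. X p \<noteq> (\<lambda>_. 0)}"] by (auto simp: vf_support_def)
  have t0: "tnorm g q (\<lambda>_. 0) = 0" for q
  proof -
    have z: "(\<lambda>_. 0) \<in> tangent_space A q" using tvec_in_tangent[OF chart_at_in, of q 0] by (simp add: tvec_zero[OF chart_at_in])
    show ?thesis unfolding tnorm_def using metric_cauchy_schwarz(3)[OF g z z] by simp
  qed
  have Ks: "K \<in> sets borel" using K(1) by (simp add: borel_closed compact_imp_closed)
  have \<mu>K: "emeasure ?\<mu> K < \<infinity>" by (rule weight_finite[OF c K])
  have meas: "f \<in> borel_measurable ?\<mu>" if "f \<in> borel_measurable borel" for f :: "'a \<Rightarrow> real"
    using that by (simp add: measurable_cong_sets[OF weight_simps(1) refl])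
  have Xm: "(\<lambda>q. X q c) \<in> borel_measurable borel"
  proof -
    have "continuous_on (fst c) (\<lambda>q. X q c)"
    proof (rule continuous_on_eq)
      have "continuous_on (chart_image c) (\<lambda>y. X (inv_chart c y) c)"
        using X'(1) c Ck_on_1_continuous unfolding C1_vector_field_def by blast
      from continuous_on_compose2[OF this chart_inv(5)[OF c]]
      show "continuous_on (fst c) (\<lambda>q. X (inv_chart c (snd c q)) c)" using chart_inv(4)[OF c] by auto
    qed (simp add: chart_inv(3)[OF c])
    from borel_measurable_continuous_on_indicator[OF borel_open[OF chart_homeo(1)[OF c]] this]
    have "(\<lambda>q. indicat_real (fst c) q *\<^sub>R X q c) \<in> borel_measurable borel" .
    moreover have "indicat_real (fst c) q *\<^sub>R X q c = X q c" for q
      using tangent_zero[OF XT, of c q] by (auto simp: indicator_def)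
    ultimately show ?thesis by simp
  qed
  define T where "T q = tnorm g q (X q)" for q
  define N where "N q = indicat_real K q * tnorm g q (H q)" for q
  define P where "P q = indicat_real K q * max (tnorm g q (H q) - h) 0" for q
  have T: "0 \<le> T q" "T q \<le> 1" "q \<notin> K \<Longrightarrow> T q = 0" for q
    using metric_cauchy_schwarz(2)[OF g XT XT] X'(4) XU t0 by (auto simp: T_def)
  have N: "0 \<le> N q" for q using metric_cauchy_schwarz(2)[OF g HT HT] by (simp add: N_def)
  have mT: "T \<in> borel_measurable borel"
  proof -
    have "(\<lambda>q. indicat_real K q * tnorm g q (X q)) \<in> borel_measurable borel"
      using X'(1) by (intro tnorm_measurable[where X=X, OF g c _ Xm Ks K(2)]) (simp add: C1_vector_field_def)
    moreover have "indicat_real K q * tnorm g q (X q) = T q" for q using T(3)[of q] by (auto simp: T_def indicator_def)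
    ultimately show ?thesis by simp
  qed
  have mN: "N \<in> borel_measurable borel" unfolding N_def by (rule tnorm_measurable[OF g c Hv(1,2) Ks K(2)])
  have mP: "P \<in> borel_measurable borel"
  proof -
    note [measurable] = mN Ks
    have "(\<lambda>q. max (N q - h * indicat_real K q) 0) \<in> borel_measurable borel" by measurable
    moreover have "max (N q - h * indicat_real K q) 0 = P q" for q by (auto simp: N_def P_def indicator_def)
    ultimately show ?thesis by simp
  qed
  have bdd: "integrable ?\<mu> f" if "f \<in> borel_measurable borel" "\<And>q. \<bar>f q\<bar> \<le> b * indicat_real K q" for f b
  proof (rule integrableI_bounded_set[OF _ meas[OF that(1)] \<mu>K])
    show "K \<in> sets ?\<mu>" using Ks by (simp add: weight_simps)
    show "AE x in ?\<mu>. x \<in> K \<longrightarrow> norm (f x) \<le> b"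
    proof (intro AE_I2 impI)
      fix x assume "x \<in> K" with that(2)[of x] show "norm (f x) \<le> b" by simp
    qed
    show "AE x in ?\<mu>. x \<notin> K \<longrightarrow> f x = 0"
    proof (intro AE_I2 impI)
      fix x assume "x \<notin> K" with that(2)[of x] show "f x = 0" by simp
    qed
  qed
  have iT: "integrable ?\<mu> T" by (rule bdd[OF mT, of 1]) (use T in \<open>auto simp: indicator_def\<close>)
  have i\<Psi>: "integrable ?\<mu> \<Psi>" by (rule bdd[OF \<Psi>])
  have iE: "integrable ?\<mu> (indicat_real E)" by (rule bdd[of _ 1]) (use E in \<open>auto simp: indicator_def\<close>)
  have iK: "integrable ?\<mu> (indicat_real K)" by (rule bdd[of _ 1]) (use Ks in \<open>auto simp: indicator_def\<close>)
  have iN: "integrable ?\<mu> N"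
  proof (rule integrableI_bounded[OF meas[OF mN]])
    have "(\<integral>\<^sup>+q. ennreal (norm (N q)) \<partial>?\<mu>) = (\<integral>\<^sup>+p\<in>K. ennreal (tnorm g p (H p)) \<partial>?\<mu>)"
      using metric_cauchy_schwarz(2)[OF g HT HT] by (intro nn_integral_cong) (auto simp: N_def indicator_def)
    then show "(\<integral>\<^sup>+q. ennreal (norm (N q)) \<partial>?\<mu>) < \<infinity>" using Hv(3) by simp
  qed
  have iP: "integrable ?\<mu> P"
  proof (rule Bochner_Integration.integrable_bound)
    show "integrable ?\<mu> (\<lambda>q. N q + \<bar>h\<bar> * indicat_real K q)" using iN iK by simp
    show "AE q in ?\<mu>. norm (P q) \<le> norm (N q + \<bar>h\<bar> * indicat_real K q)"
      using metric_cauchy_schwarz(2)[OF g HT HT] by (intro AE_I2) (auto simp: N_def P_def indicator_def)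
  qed (rule meas[OF mP])
  have iNT: "integrable ?\<mu> (\<lambda>q. N q * T q)"
  proof (rule Bochner_Integration.integrable_bound[OF iN])
    show "(\<lambda>q. N q * T q) \<in> borel_measurable ?\<mu>" using meas[OF mN] meas[OF mT] by measurable
    show "AE q in ?\<mu>. norm (N q * T q) \<le> norm (N q)"
      using T N by (intro AE_I2) (simp add: abs_mult mult_left_le)
  qed
  have NT: "(\<integral>q. N q * T q \<partial>?\<mu>) \<le> (\<integral>q. P q \<partial>?\<mu>) + h * (\<integral>q. T q \<partial>?\<mu>)"
  proof -
    have "N q * T q \<le> P q + h * T q" for q
    proof (cases "q \<in> K")
      case True
      have "(N q - h) * T q \<le> P q * T q" using True T(1)[of q] by (intro mult_right_mono) (auto simp: N_def P_def)
      also have "\<dots> \<le> P q" using T True by (intro mult_left_le) (auto simp: P_def)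
      finally show ?thesis by (simp add: algebra_simps)
    next
      case False then show ?thesis using T(3)[of q] by (simp add: P_def)
    qed
    then have "(\<integral>q. N q * T q \<partial>?\<mu>) \<le> (\<integral>q. P q + h * T q \<partial>?\<mu>)"
      using iNT iP iT by (intro integral_mono) auto
    also have "\<dots> = (\<integral>q. P q \<partial>?\<mu>) + h * (\<integral>q. T q \<partial>?\<mu>)" using iP iT by simp
    finally show ?thesis .
  qed
  have PC: "(\<integral>q. P q \<partial>?\<mu>) \<le> CP"
  proof -
    have "ennreal (\<integral>q. P q \<partial>?\<mu>) = (\<integral>\<^sup>+q. ennreal (P q) \<partial>?\<mu>)"
      by (rule nn_integral_eq_integral[OF iP, symmetric]) (simp add: P_def)
    also have "\<dots> = (\<integral>\<^sup>+q\<in>K. ennreal (max (tnorm g q (H q) - h) 0) \<partial>?\<mu>)"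
      by (intro nn_integral_cong) (auto simp: P_def indicator_def)
    also note CP(1)
    finally show ?thesis using CP(2) by (simp only: ennreal_le_iff)
  qed
  \<comment> \<open>If the pairing is not integrable its integral is 0 by convention, and the bound
    still holds because its left side is nonpositive.\<close>
  have gHX: "- (\<integral>q. N q * T q \<partial>?\<mu>) \<le> (\<integral>q. g q (H q) (X q) \<partial>?\<mu>)"
  proof (cases "integrable ?\<mu> (\<lambda>q. g q (H q) (X q))")
    case True
    have "- (N q * T q) \<le> g q (H q) (X q)" for q
    proof (cases "q \<in> K")
      case True
      then show ?thesis using metric_cauchy_schwarz(1)[OF g HT XT, of q] by (simp add: N_def T_def)
    next
      case False
      then show ?thesis using metric_cauchy_schwarz(3)[OF g HT HT, of q] XU by (simp add: N_def)
    qed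
    then have "(\<integral>q. - (N q * T q) \<partial>?\<mu>) \<le> (\<integral>q. g q (H q) (X q) \<partial>?\<mu>)"
      using iNT True by (intro integral_mono) auto
    then show ?thesis by simp
  next
    case False
    have "0 \<le> (\<integral>q. N q * T q \<partial>?\<mu>)" by (rule Bochner_Integration.integral_nonneg) (simp add: N T)
    then show ?thesis using False by (simp add: not_integrable_integral_eq)
  qed
  have \<delta>: "c0 * (\<integral>q. \<Psi> q \<partial>?\<mu>) + h * (\<integral>q. T q \<partial>?\<mu>) - C1 * measure ?\<mu> E \<le> first_variation A g m M X"
  proof -
    let ?f = "\<lambda>q. c0 * \<Psi> q + h * T q - C1 * indicat_real E q"
    have if': "integrable ?\<mu> ?f" using i\<Psi> iT iE by simp
    have mf: "?f \<in> borel_measurable borel" using \<Psi>(1) mT E(1) by measurable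
    have "c0 * (\<integral>q. \<Psi> q \<partial>?\<mu>) + h * (\<integral>q. T q \<partial>?\<mu>) - C1 * measure ?\<mu> E = (\<integral>q. ?f q \<partial>?\<mu>)"
      using i\<Psi> iT iE by (simp add: weight_simps)
    also have "\<dots> = (\<integral>z. ?f (fst z) \<partial>M)"
      unfolding weight_def by (rule integral_distr[OF fst_measurable mf])
    also have "\<dots> \<le> (\<integral>(p, S). plane_div A g m X p S \<partial>M)"
    proof (rule integral_mono)
      show "integrable M (\<lambda>z. ?f (fst z))"
        using if' unfolding weight_def by (simp only: integrable_distr_eq[OF fst_measurable mf])
      show "integrable M (\<lambda>(p, S). plane_div A g m X p S)"
        by (rule plane_div_integrable[OF g X'(1,2) _ c]) (use X'(3) U(2) K(2) in blast)
      fix z assume "z \<in> space M"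
      then show "?f (fst z) \<le> (case z of (p, S) \<Rightarrow> plane_div A g m X p S)"
        using div[of "fst z" "snd z"] by (simp add: space_M T_def case_prod_unfold)
    qed
    finally show ?thesis by (simp add: first_variation_def)
  qed
  have "ennreal (first_variation A g m M X + (\<integral>q. g q (H q) (X q) \<partial>?\<mu>)) \<le> ennreal C\<beta>"
    using variation_le_boundary[OF g lb mc bm c U K X] C\<beta>(1) by (rule order_trans)
  then have "first_variation A g m M X + (\<integral>q. g q (H q) (X q) \<partial>?\<mu>) \<le> C\<beta>" using C\<beta>(2) by simp
  with \<delta> gHX NT PC show ?thesis by linarith
qed

end

text \<open>Uniform convergence allows index and point to move together. The condition
  \<open>i k \<ge> k\<close> on the indices is what a sequence of counterexamples provides.\<close>

lemma uniform_limit_diagonal: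
  fixes f :: "nat \<Rightarrow> 'a::metric_space \<Rightarrow> real"
  assumes u: "uniform_limit K f g sequentially" and c: "continuous_on K g"
    and x: "\<And>k. x k \<in> K" "x \<longlonglongrightarrow> x0" "x0 \<in> K" and i: "\<And>k. i k \<ge> k"
  shows "(\<lambda>k. f (i k) (x k)) \<longlonglongrightarrow> g x0"
proof (rule tendstoI)
  fix e :: real assume e: "e > 0"
  from uniform_limitD[OF u, of "e / 2"] e obtain n where n: "\<And>k y. k \<ge> n \<Longrightarrow> y \<in> K \<Longrightarrow> dist (f k y) (g y) < e / 2"
    unfolding eventually_sequentially by force
  have "(\<lambda>k. g (x k)) \<longlonglongrightarrow> g x0" by (rule continuous_on_tendsto_compose[OF c x(2,3)]) (simp add: x(1))
  from tendstoD[OF this, of "e / 2"] e have "\<forall>\<^sub>F k in sequentially. dist (g (x k)) (g x0) < e / 2" by simp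
  with eventually_ge_at_top[of n] show "\<forall>\<^sub>F k in sequentially. dist (f (i k) (x k)) (g x0) < e"
  proof eventually_elim
    case (elim k)
    have "dist (f (i k) (x k)) (g (x k)) < e / 2" using n[OF order_trans[OF elim(1) i] x(1)] .
    then show ?case using elim(2) dist_triangle[of "f (i k) (x k)" "g x0" "g (x k)"] by simp
  qed
qed

text \<open>The analytic situation in a single chart, detached from the manifold:
  \<open>Gs i\<close> and \<open>G\<close> are the coordinate metrics and \<open>zs i\<close> is the
  gradient of \<open>F\<close> for \<open>Gs i\<close>. The gradient for the limit metric enters
  only at \<open>x0\<close>, as \<open>z0\<close>.\<close>

locale converging_forms =
  fixes W :: "'e::euclidean_space set" and Gs :: "nat \<Rightarrow> 'e \<Rightarrow> 'e \<Rightarrow> 'e \<Rightarrow> real" and G :: "'e \<Rightarrow> 'e \<Rightarrow> 'e \<Rightarrow> real"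
    and F :: "'e \<Rightarrow> real" and zs :: "nat \<Rightarrow> 'e \<Rightarrow> 'e" and x0 z0 :: 'e
  assumes W: "open W" "x0 \<in> W"
    and Gs: "\<And>i x. x \<in> W \<Longrightarrow> inner_form (Gs i x)" "\<And>i a b. Ck_on 1 W (\<lambda>x. Gs i x a b)"
    and G: "\<And>x. x \<in> W \<Longrightarrow> inner_form (G x)" "\<And>a b. Ck_on 1 W (\<lambda>x. G x a b)"
    and conv: "\<And>K a b. compact K \<Longrightarrow> K \<subseteq> W \<Longrightarrow> uniform_limit K (\<lambda>i x. Gs i x a b) (\<lambda>x. G x a b) sequentially"
    and convd: "\<And>K a b w. compact K \<Longrightarrow> K \<subseteq> W \<Longrightarrow>
       uniform_limit K (\<lambda>i x. fd (\<lambda>y. Gs i y a b) x w) (\<lambda>x. fd (\<lambda>y. G y a b) x w) sequentially"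
    and F: "Ck_on 2 W F"
    and zs: "\<And>i x w. x \<in> W \<Longrightarrow> Gs i x (zs i x) w = fd F x w" and z0: "\<And>w. G x0 z0 w = fd F x0 w"
begin

lemma fd_F_linear: "x \<in> W \<Longrightarrow> linear (fd F x)"
  by (rule fd_linear[OF Ck_on_1_diff[OF Ck_on_2_imp_1[OF F]]])

text \<open>The tolerance of \<open>coercive_near\<close> is split evenly between moving the point,
  by continuity of \<open>G\<close>, and changing the metric, by uniform convergence.\<close>

lemma uniform_ellipticity:
  obtains R lam I N where "R > 0" "lam > 0" "N \<ge> 0" "cball x0 R \<subseteq> W"
    "\<And>i x u. i \<ge> I \<Longrightarrow> x \<in> cball x0 R \<Longrightarrow> lam * (norm u)\<^sup>2 \<le> Gs i x u u"
    "\<And>x u. x \<in> cball x0 R \<Longrightarrow> \<bar>fd F x u\<bar> \<le> N * norm u"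
proof -
  obtain lam \<epsilon> where le: "lam > 0" "\<epsilon> > 0" and co: "\<And>G' u. bilinear G' \<Longrightarrow>
      (\<And>a b. a \<in> Basis \<Longrightarrow> b \<in> Basis \<Longrightarrow> \<bar>G' a b - G x0 a b\<bar> < \<epsilon>) \<Longrightarrow> lam * (norm u)\<^sup>2 \<le> G' u u"
    using coercive_near[OF G(1)[OF W(2)]] by metis
  have e2: "\<epsilon> / 2 > 0" using le by simp
  have "\<forall>\<^sub>F y in nhds x0. \<bar>G y a b - G x0 a b\<bar> < \<epsilon> / 2" for a b
  proof -
    have "isCont (\<lambda>y. G y a b) x0"
      using Ck_on_1_continuous[OF G(2)] continuous_on_eq_continuous_at[OF W(1)] W(2) by blast
    then have "((\<lambda>y. G y a b) \<longlongrightarrow> G x0 a b) (nhds x0)"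
      unfolding isCont_def by (rule tendsto_at_iff_tendsto_nhds[THEN iffD1])
    from tendstoD[OF this e2] show ?thesis by (simp add: dist_real_def)
  qed
  then have "\<forall>\<^sub>F y in nhds x0. \<forall>a\<in>Basis. \<forall>b\<in>Basis. \<bar>G y a b - G x0 a b\<bar> < \<epsilon> / 2"
    by (simp add: eventually_ball_finite_distrib)
  with eventually_nhds_in_open[OF W]
  have "\<forall>\<^sub>F y in nhds x0. y \<in> W \<and> (\<forall>a\<in>Basis. \<forall>b\<in>Basis. \<bar>G y a b - G x0 a b\<bar> < \<epsilon> / 2)"
    by eventually_elim simp
  then obtain d where d: "d > 0" "\<And>y. dist y x0 < d \<Longrightarrow> y \<in> W \<and> (\<forall>a\<in>Basis. \<forall>b\<in>Basis. \<bar>G y a b - G x0 a b\<bar> < \<epsilon> / 2)"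
    unfolding eventually_nhds_metric by blast
  define R where "R = d / 2"
  have R: "R > 0" using d by (simp add: R_def)
  have near: "y \<in> W" "a \<in> Basis \<Longrightarrow> b \<in> Basis \<Longrightarrow> \<bar>G y a b - G x0 a b\<bar> < \<epsilon> / 2" if "y \<in> cball x0 R" for y a b
    using d(2)[of y] that d(1) by (auto simp: R_def dist_commute)
  have cW: "cball x0 R \<subseteq> W" using near(1) by blast
  have "\<forall>\<^sub>F i in sequentially. \<forall>y\<in>cball x0 R. dist (Gs i y a b) (G y a b) < \<epsilon> / 2" for a b
    by (rule uniform_limitD[OF conv[OF compact_cball cW] e2])
  then have "\<forall>\<^sub>F i in sequentially. \<forall>a\<in>Basis. \<forall>b\<in>Basis. \<forall>y\<in>cball x0 R. dist (Gs i y a b) (G y a b) < \<epsilon> / 2"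
    by (simp add: eventually_ball_finite_distrib)
  then obtain I where I: "\<And>i a b y. i \<ge> I \<Longrightarrow> a \<in> Basis \<Longrightarrow> b \<in> Basis \<Longrightarrow> y \<in> cball x0 R \<Longrightarrow> \<bar>Gs i y a b - G y a b\<bar> < \<epsilon> / 2"
    unfolding eventually_sequentially dist_real_def by blast
  have "continuous_on (cball x0 R) (\<lambda>x. \<Sum>a\<in>Basis. \<bar>fd F x a\<bar>)"
    using Ck_on_1_fd_continuous[OF Ck_on_2_imp_1[OF F]] cW
    by (intro continuous_intros) (blast intro: continuous_on_subset)
  then have "bounded ((\<lambda>x. \<Sum>a\<in>Basis. \<bar>fd F x a\<bar>) ` cball x0 R)"
    by (intro compact_imp_bounded compact_continuous_image) auto
  then obtain N where N: "N > 0" "\<And>x. x \<in> cball x0 R \<Longrightarrow> (\<Sum>a\<in>Basis. \<bar>fd F x a\<bar>) \<le> N"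
    unfolding bounded_pos by force
  show thesis
  proof (rule that[OF R le(1) less_imp_le[OF N(1)] cW])
    fix i x u assume i: "i \<ge> I" and x: "x \<in> cball x0 R"
    show "lam * (norm u)\<^sup>2 \<le> Gs i x u u"
    proof (rule co[OF inner_formD(1)[OF Gs(1)[OF near(1)[OF x]]]])
      fix a b :: 'e assume ab: "a \<in> Basis" "b \<in> Basis"
      show "\<bar>Gs i x a b - G x0 a b\<bar> < \<epsilon>" using near(2)[OF x ab] I[OF i ab x] by linarith
    qed
  next
    fix x u assume x: "x \<in> cball x0 R"
    have "\<bar>fd F x u\<bar> \<le> norm u * (\<Sum>a\<in>Basis. \<bar>fd F x a\<bar>)" by (rule linear_le_basis[OF fd_F_linear[OF near(1)[OF x]]])
    also have "\<dots> \<le> norm u * N" by (rule mult_left_mono[OF N(2)[OF x]]) simp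
    finally show "\<bar>fd F x u\<bar> \<le> N * norm u" by (simp add: mult.commute)
  qed
qed

text \<open>The summand in \<open>pos\<close> is the Hessian of \<open>F\<close> on
  \<open>b j\<close>, since \<open>koszul\<close> applied to the gradient is the derivative of
  \<open>F\<close> along the Christoffel vector. Without a uniform margin there would be
  counterexamples at points tending to \<open>x0\<close> with indices tending to infinity; their
  gradients converge, their frames do so after extraction, and the limit contradicts
  \<open>pos\<close>.\<close>

lemma hessian_trace_positive:
  assumes pos: "\<And>b. onb (G x0) m UNIV b \<Longrightarrow>
      h * sqrt (G x0 z0 z0) < (\<Sum>j<m. fd (\<lambda>y. fd F y (b j)) x0 (b j) - koszul G x0 (b j) (b j) z0)"
  obtains c R I where "c > 0" "R > 0" "cball x0 R \<subseteq> W"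
    "\<And>i x b P. i \<ge> I \<Longrightarrow> x \<in> cball x0 R \<Longrightarrow> onb (Gs i x) m P b \<Longrightarrow>
      c + h * sqrt (Gs i x (zs i x) (zs i x)) \<le> (\<Sum>j<m. fd (\<lambda>y. fd F y (b j)) x (b j) - koszul (Gs i) x (b j) (b j) (zs i x))"
proof -
  obtain R0 where R0: "R0 > 0" "cball x0 R0 \<subseteq> W" using open_contains_cball W by blast
  define \<Phi> where "\<Phi> i x b = (\<Sum>j<m. fd (\<lambda>y. fd F y (b j)) x (b j) - koszul (Gs i) x (b j) (b j) (zs i x))" for i x and b :: "nat \<Rightarrow> 'e"
  define Q where "Q i x = h * sqrt (Gs i x (zs i x) (zs i x))" for i x
  \<comment> \<open>One \<open>k\<close> governs the index, the radius and the margin, so that the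
    negation yields a single sequence along which all three degenerate together.\<close>
  have "\<exists>k. \<forall>i\<ge>k. \<forall>x\<in>cball x0 (R0 / Suc k). \<forall>b P. onb (Gs i x) m P b \<longrightarrow> 1 / Suc k + Q i x \<le> \<Phi> i x b"
  proof (rule ccontr)
    assume "\<not> ?thesis"
    then have "\<forall>k. \<exists>i x b P. i \<ge> k \<and> x \<in> cball x0 (R0 / Suc k) \<and> onb (Gs i x) m P b \<and> \<Phi> i x b < 1 / Suc k + Q i x"
      by (meson not_le)
    then obtain i x b P where ix: "\<And>k. i k \<ge> k" "\<And>k. x k \<in> cball x0 (R0 / Suc k)"
      and b: "\<And>k. onb (Gs (i k) (x k)) m (P k) (b k)" and lt: "\<And>k. \<Phi> (i k) (x k) (b k) < 1 / Suc k + Q (i k) (x k)"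
      by metis
    have sub: "cball x0 (R0 / Suc k) \<subseteq> cball x0 R0" for k
      using R0(1) by (intro subset_cball) (simp add: field_simps)
    have xK: "x k \<in> cball x0 R0" for k using ix(2) sub by blast
    have xW: "x k \<in> W" for k using xK R0(2) by blast
    have x0K: "x0 \<in> cball x0 R0" using R0(1) by simp
    have limx: "x \<longlonglongrightarrow> x0"
    proof -
      have "(\<lambda>k. R0 * (1 / Suc k)) \<longlonglongrightarrow> R0 * 0" by (intro tendsto_mult_left LIMSEQ_Suc[OF lim_1_over_n])
      then have "(\<lambda>k. R0 / Suc k) \<longlonglongrightarrow> 0" by simp
      then have "(\<lambda>k. x k - x0) \<longlonglongrightarrow> 0"
        by (rule Lim_null_comparison[rotated]) (use ix(2) in \<open>auto simp: dist_norm norm_minus_commute\<close>)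
      then show ?thesis by (simp add: Lim_null[symmetric])
    qed
    have cK: "continuous_on (cball x0 R0) (\<lambda>x. G x a b)" "continuous_on (cball x0 R0) (\<lambda>x. fd (\<lambda>y. G y a b) x w)" for a b w
      using Ck_on_1_continuous[OF G(2)] Ck_on_1_fd_continuous[OF G(2)] R0(2) continuous_on_subset by blast+
    have limG: "(\<lambda>k. Gs (i k) (x k) a b) \<longlonglongrightarrow> G x0 a b" for a b
      by (rule uniform_limit_diagonal[OF conv[OF compact_cball R0(2)] cK(1) xK limx x0K ix(1)])
    have limdG: "(\<lambda>k. fd (\<lambda>y. Gs (i k) y a b) (x k) w) \<longlonglongrightarrow> fd (\<lambda>y. G y a b) x0 w" for a b w
      by (rule uniform_limit_diagonal[OF convd[OF compact_cball R0(2)] cK(2) xK limx x0K ix(1)])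
    have limK: "(\<lambda>k. koszul (Gs (i k)) (x k) u v w) \<longlonglongrightarrow> koszul G x0 u v w" for u v w
      unfolding koszul_def by (intro tendsto_intros limdG) simp
    have Fc: "continuous_on W (\<lambda>y. fd F y w)" for w by (rule Ck_on_1_fd_continuous[OF Ck_on_2_imp_1[OF F]])
    have limF: "(\<lambda>k. fd F (x k) w) \<longlonglongrightarrow> fd F x0 w" for w
      by (rule continuous_on_tendsto_compose[OF Fc limx W(2)]) (simp add: xW)
    have Fc2: "continuous_on W (\<lambda>x. fd (\<lambda>y. fd F y u) x v)" for u v
      by (rule Ck_on_1_fd_continuous[OF Ck_on_2D1[OF F]])
    have limF2: "(\<lambda>k. fd (\<lambda>y. fd F y u) (x k) v) \<longlonglongrightarrow> fd (\<lambda>y. fd F y u) x0 v" for u v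
      by (rule continuous_on_tendsto_compose[OF Fc2 limx W(2)]) (simp add: xW)
    have limz: "(\<lambda>k. zs (i k) (x k)) \<longlonglongrightarrow> z0"
      by (rule riesz_tendsto[where G="\<lambda>k. Gs (i k) (x k)" and l="\<lambda>k. fd F (x k)", OF G(1)[OF W(2)] fd_F_linear[OF W(2)] z0 _ limG limF])
        (intro always_eventually allI conjI inner_formD(1)[OF Gs(1)[OF xW]] fd_F_linear[OF xW] zs[OF xW])
    obtain r l where r: "strict_mono r" "\<And>j. j < m \<Longrightarrow> (\<lambda>k. b (r k) j) \<longlonglongrightarrow> l j" "onb (G x0) m UNIV l"
      using onb_subseq[OF inner_formD(1)[OF Gs(1)[OF xW]] G(1)[OF W(2)] limG b] by metis
    note kl = koszul_linear[OF W(1) _ inner_formD(1)[OF Gs(1)] Gs(2)] and kl0 = koszul_linear[OF W inner_formD(1)[OF G(1)] G(2)]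
    have L: "(\<lambda>k. X (r k)) \<longlonglongrightarrow> a" if "X \<longlonglongrightarrow> a" for X :: "nat \<Rightarrow> real" and a
      using LIMSEQ_subseq_LIMSEQ[OF that r(1)] by (simp add: o_def)
    have limzr: "(\<lambda>k. zs (i (r k)) (x (r k))) \<longlonglongrightarrow> z0"
      using LIMSEQ_subseq_LIMSEQ[OF limz r(1)] by (simp add: o_def)
    have t: "(\<lambda>k. fd (\<lambda>y. fd F y (b (r k) j)) (x (r k)) (b (r k) j) - koszul (Gs (i (r k))) (x (r k)) (b (r k) j) (b (r k) j) (zs (i (r k)) (x (r k))))
       \<longlonglongrightarrow> fd (\<lambda>y. fd F y (l j)) x0 (l j) - koszul G x0 (l j) (l j) z0" if j: "j < m" for j
    proof (rule tendsto_diff)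
      show "(\<lambda>k. fd (\<lambda>y. fd F y (b (r k) j)) (x (r k)) (b (r k) j)) \<longlonglongrightarrow> fd (\<lambda>y. fd F y (l j)) x0 (l j)"
        by (rule bilinear_tendsto[where B="\<lambda>k u v. fd (\<lambda>y. fd F y u) (x (r k)) v" and ?B0.0="\<lambda>u v. fd (\<lambda>y. fd F y u) x0 v",
              OF Ck_on_2_second_linear[OF F W(1) xW] Ck_on_2_second_linear[OF F W] L[OF limF2] r(2)[OF j] r(2)[OF j]])
      show "(\<lambda>k. koszul (Gs (i (r k))) (x (r k)) (b (r k) j) (b (r k) j) (zs (i (r k)) (x (r k)))) \<longlonglongrightarrow> koszul G x0 (l j) (l j) z0"
      proof (rule linear_tendsto[where L="\<lambda>k. koszul (Gs (i (r k))) (x (r k)) (b (r k) j) (b (r k) j)" and ?L0.0="koszul G x0 (l j) (l j)",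
            OF kl(1)[OF xW] kl0(1) _ limzr])
        fix w
        have b1: "bilinear (\<lambda>u v. koszul (Gs (i (r k))) (x (r k)) u v w)" for k
          unfolding bilinear_def by (intro conjI allI kl(2,3)[OF xW])
        have b2: "bilinear (\<lambda>u v. koszul G x0 u v w)"
          unfolding bilinear_def by (intro conjI allI kl0(2,3))
        show "(\<lambda>k. koszul (Gs (i (r k))) (x (r k)) (b (r k) j) (b (r k) j) w) \<longlonglongrightarrow> koszul G x0 (l j) (l j) w"
          by (rule bilinear_tendsto[where B="\<lambda>k u v. koszul (Gs (i (r k))) (x (r k)) u v w" and ?B0.0="\<lambda>u v. koszul G x0 u v w",
                OF b1 b2 L[OF limK] r(2)[OF j] r(2)[OF j]])
      qed
    qed
    have lim\<Phi>: "(\<lambda>k. \<Phi> (i (r k)) (x (r k)) (b (r k))) \<longlonglongrightarrow> (\<Sum>j<m. fd (\<lambda>y. fd F y (l j)) x0 (l j) - koszul G x0 (l j) (l j) z0)"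
      unfolding \<Phi>_def by (rule tendsto_sum) (simp add: t)
    have "(\<lambda>k. Gs (i k) (x k) (zs (i k) (x k)) (zs (i k) (x k))) \<longlonglongrightarrow> G x0 z0 z0"
      by (rule bilinear_tendsto[OF inner_formD(1)[OF Gs(1)[OF xW]] inner_formD(1)[OF G(1)[OF W(2)]] limG limz limz])
    then have "(\<lambda>k. 1 / Suc k + Q (i k) (x k)) \<longlonglongrightarrow> 0 + h * sqrt (G x0 z0 z0)"
      unfolding Q_def by (intro tendsto_intros LIMSEQ_Suc[OF lim_1_over_n])
    from L[OF this] have limQ: "(\<lambda>k. 1 / Suc (r k) + Q (i (r k)) (x (r k))) \<longlonglongrightarrow> h * sqrt (G x0 z0 z0)" by simp
    have "(\<Sum>j<m. fd (\<lambda>y. fd F y (l j)) x0 (l j) - koszul G x0 (l j) (l j) z0) \<le> h * sqrt (G x0 z0 z0)"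
      by (rule LIMSEQ_le[OF lim\<Phi> limQ]) (use lt in \<open>auto intro: less_imp_le\<close>)
    with pos[OF r(3)] show False by simp
  qed
  then obtain k where k: "\<And>i x b P. i \<ge> k \<Longrightarrow> x \<in> cball x0 (R0 / Suc k) \<Longrightarrow> onb (Gs i x) m P b \<Longrightarrow> 1 / Suc k + Q i x \<le> \<Phi> i x b"
    by blast
  show thesis
  proof (rule that[of "1 / Suc k" "R0 / Suc k" k])
    have "cball x0 (R0 / Suc k) \<subseteq> cball x0 R0" using R0(1) by (intro subset_cball) (simp add: field_simps)
    then show "cball x0 (R0 / Suc k) \<subseteq> W" using R0(2) by blast
  qed (use R0(1) k in \<open>auto simp: Q_def \<Phi>_def\<close>)
qed

end

text \<open>The square of the positive part: of class C^1, nondecreasing, and positive exactly for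
  positive \<open>t\<close>. Written as a product it falls under
  \<open>has_derivative_mult_vanishing\<close> at 0.\<close>

definition kap :: "real \<Rightarrow> real" where "kap t = max 0 t * t"

lemma kap_has_derivative: "(kap has_derivative (\<lambda>h. 2 * max 0 t * h)) (at t)"
proof (cases "t = 0")
  case True
  have "((\<lambda>t. max 0 t * t) has_derivative (\<lambda>h. max 0 (0::real) * h)) (at 0)"
    by (rule has_derivative_mult_vanishing) (auto intro!: continuous_intros)
  then show ?thesis using True by (simp add: kap_def[abs_def])
next
  case False
  show ?thesis
  proof (cases "t > 0")
    case True
    have "((\<lambda>t. t * t) has_derivative (\<lambda>h. 2 * max 0 t * h)) (at t)"
      using True by (auto intro!: derivative_eq_intros simp: algebra_simps)
    then show ?thesis
      by (rule has_derivative_cong_open[where S="{0<..}"]) (use True in \<open>auto simp: kap_def\<close>)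
  next
    case neg: False
    have "((\<lambda>t. 0) has_derivative (\<lambda>h. 2 * max 0 t * h)) (at t)" using neg by simp
    then show ?thesis
      by (rule has_derivative_cong_open[where S="{..<0}"]) (use False neg in \<open>auto simp: kap_def\<close>)
  qed
qed

lemma kap_C1: "Ck_on 1 UNIV kap"
  by (rule Ck_on_1I[OF kap_has_derivative]) (intro continuous_intros)

lemma kap_simps: "t \<le> 0 \<Longrightarrow> kap t = 0" "kap t \<ge> 0" "t > 0 \<Longrightarrow> kap t > 0" "0 \<le> t \<Longrightarrow> kap t = t * t"
  "t \<le> 1 \<Longrightarrow> kap t \<le> 1"
proof -
  show "t \<le> 1 \<Longrightarrow> kap t \<le> 1"
    by (cases "t \<ge> 0") (auto simp: kap_def max_def intro: mult_le_one)
qed (auto simp: kap_def max_def zero_le_mult_iff)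

lemma square_dist_has_derivative:
  fixes x0 :: "'e::euclidean_space"
  shows "((\<lambda>y. (y - x0) \<bullet> (y - x0)) has_derivative (\<lambda>v. 2 * ((y - x0) \<bullet> v))) (at y)"
  by (auto intro!: derivative_eq_intros simp: inner_commute)

text \<open>Two applications of \<open>kap\<close> suffice: the inner one vanishes on the ball of
  radius \<open>R / 2\<close>, and the outer one vanishes as soon as the rescaled inner one reaches
  1.\<close>

lemma smooth_cutoff:
  fixes x0 :: "'e::euclidean_space"
  assumes R: "R > 0"
  obtains \<zeta> :: "'e \<Rightarrow> real" where "Ck_on 1 UNIV \<zeta>" "\<And>y. 0 \<le> \<zeta> y" "\<And>y. \<zeta> y \<le> 1" "\<zeta> x0 = 1"
    "\<And>y v. dist y x0 < R / 2 \<Longrightarrow> fd \<zeta> y v = 0" "\<And>y. dist y x0 \<ge> 3 / 4 * R \<Longrightarrow> \<zeta> y = 0"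
proof -
  define q where "q y = (y - x0) \<bullet> (y - x0)" for y
  define r where "r = R / 2"
  have r: "r > 0" using R by (simp add: r_def)
  define \<zeta> where "\<zeta> y = kap (1 - 1 / r ^ 4 * kap (q y - r\<^sup>2))" for y
  have q: "q y = (dist y x0)\<^sup>2" for y by (simp add: q_def dist_norm power2_norm_eq_inner)
  have Cq: "Ck_on 1 UNIV q"
    unfolding q_def by (rule Ck_on_1I[OF square_dist_has_derivative]) (intro continuous_intros)
  have 1: "Ck_on 1 UNIV (\<lambda>y. kap (q y - r\<^sup>2))"
    by (rule Ck_on_1_compose[OF kap_C1 Ck_on_1_diff_fun[OF Cq Ck_on_1_const]]) simp
  have C: "Ck_on 1 UNIV \<zeta>"
    unfolding \<zeta>_def
    by (rule Ck_on_1_compose[OF kap_C1 Ck_on_1_diff_fun[OF Ck_on_1_const Ck_on_1_mult[OF Ck_on_1_const 1]]]) simp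
  have one: "\<zeta> y = 1" if "dist y x0 < r" for y
  proof -
    have "q y \<le> r\<^sup>2" unfolding q using that by (intro power_mono) auto
    then show ?thesis by (simp add: \<zeta>_def kap_simps(1,4))
  qed
  show thesis
  proof (rule that[OF C])
    show "0 \<le> \<zeta> y" for y by (simp add: \<zeta>_def kap_simps)
    have "1 / r ^ 4 * kap (q y - r\<^sup>2) \<ge> 0" for y using r by (simp add: kap_simps(2))
    then show "\<zeta> y \<le> 1" for y unfolding \<zeta>_def by (intro kap_simps(5)) simp
    show "\<zeta> x0 = 1" by (rule one) (use r in simp)
    fix y v assume y: "dist y x0 < R / 2"
    have "(\<zeta> has_derivative (\<lambda>v. 0)) (at y)"
      by (rule has_derivative_cong_open[OF has_derivative_const[of 1] open_ball[of x0 r]])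
        (use y one in \<open>auto simp: r_def dist_commute\<close>)
    then show "fd \<zeta> y v = 0" by (simp add: fd_eq)
  next
    fix y assume y: "dist y x0 \<ge> 3 / 4 * R"
    have "(3 / 4 * R)\<^sup>2 \<le> q y" unfolding q using y R by (intro power_mono) auto
    \<comment> \<open>With \<open>R = 2 * r\<close> the distance \<open>3 / 4 * R\<close> is
      \<open>3 / 2 * r\<close>, so \<open>q y\<close> is at least \<open>9 / 4 * r\<^sup>2\<close>.
      As 5/4 exceeds 1, the inner \<open>kap\<close> is then at least \<open>r ^ 4\<close>.\<close>
    then have a: "5 / 4 * r\<^sup>2 \<le> q y - r\<^sup>2" by (simp add: r_def power2_eq_square)
    have nn: "0 \<le> q y - r\<^sup>2" using order_trans[OF _ a, of 0] by simp
    have "r ^ 4 = r\<^sup>2 * r\<^sup>2" by (simp add: power2_eq_square power4_eq_xxxx)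
    also have "\<dots> \<le> (5 / 4 * r\<^sup>2) * (5 / 4 * r\<^sup>2)" by simp
    also have "\<dots> \<le> (q y - r\<^sup>2) * (q y - r\<^sup>2)" by (rule mult_mono[OF a a nn]) simp
    also have "\<dots> = kap (q y - r\<^sup>2)" using nn by (simp add: kap_simps(4))
    finally have "1 \<le> 1 / r ^ 4 * kap (q y - r\<^sup>2)" using r by (simp add: field_simps)
    then show "\<zeta> y = 0" unfolding \<zeta>_def by (intro kap_simps(1)) simp
  qed
qed

text \<open>The squared distance would alter the Hessian at \<open>x0\<close>; its square is still
  positive away from \<open>x0\<close> but flat to second order there.\<close>

lemma quartic:
  fixes x0 :: "'e::euclidean_space"
  defines "q \<equiv> \<lambda>y. ((y - x0) \<bullet> (y - x0)) * ((y - x0) \<bullet> (y - x0))"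
  shows "Ck_on 2 S q" "fd q x0 v = 0" "fd (\<lambda>y. fd q y v) x0 w = 0"
proof -
  have 1: "(q has_derivative (\<lambda>v. 4 * ((y - x0) \<bullet> (y - x0)) * ((y - x0) \<bullet> v))) (at y)" for y
    unfolding q_def by (rule has_derivative_eq_rhs[OF has_derivative_mult[OF square_dist_has_derivative square_dist_has_derivative]]) auto
  have fq: "fd q y v = 4 * ((y - x0) \<bullet> (y - x0)) * ((y - x0) \<bullet> v)" for y v
    using fd_eq[OF 1] by metis
  have l: "((\<lambda>y. (y - x0) \<bullet> v) has_derivative (\<lambda>w. w \<bullet> v)) (at y)" for y v
    by (auto intro!: derivative_eq_intros)
  have 2: "((\<lambda>y. fd q y v) has_derivative
     (\<lambda>w. 4 * ((y - x0) \<bullet> (y - x0)) * (w \<bullet> v) + 4 * (2 * ((y - x0) \<bullet> w)) * ((y - x0) \<bullet> v))) (at y)" for y v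
    unfolding fq by (rule has_derivative_mult[OF has_derivative_mult_right[OF square_dist_has_derivative] l])
  show "Ck_on 2 S q"
    unfolding Ck_on_2_iff
  proof (intro conjI ballI allI)
    show "q differentiable at y" for y using 1 by (auto simp: differentiable_def)
    show "Ck_on 1 S (\<lambda>y. fd q y v)" for v
      by (rule Ck_on_1I[OF 2]) (intro continuous_intros)
  qed
  show "fd q x0 v = 0" by (simp add: fq)
  show "fd (\<lambda>y. fd q y v) x0 w = 0" using fd_eq[OF 2[of v x0]] by simp
qed

lemma Ck_on_2_diff_fun:
  fixes f g :: "'b::real_normed_vector \<Rightarrow> 'c::real_normed_vector"
  assumes f: "Ck_on 2 S f" and g: "Ck_on 2 S g" and S: "open S"
  shows "Ck_on 2 S (\<lambda>x. f x - g x)" "x \<in> S \<Longrightarrow> fd (\<lambda>x. f x - g x) x v = fd f x v - fd g x v"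
    "x \<in> S \<Longrightarrow> fd (\<lambda>y. fd (\<lambda>x. f x - g x) y v) x w = fd (\<lambda>y. fd f y v) x w - fd (\<lambda>y. fd g y v) x w"
proof -
  have d: "((\<lambda>x. f x - g x) has_derivative (\<lambda>v. fd f x v - fd g x v)) (at x)" if "x \<in> S" for x
    using f g that by (intro has_derivative_diff fd_works) (auto simp: Ck_on_2_iff)
  have 1: "fd (\<lambda>x. f x - g x) y u = fd f y u - fd g y u" if "y \<in> S" for y u using fd_eq[OF d[OF that]] by simp
  then show "x \<in> S \<Longrightarrow> fd (\<lambda>x. f x - g x) x v = fd f x v - fd g x v" .
  have d2: "((\<lambda>x. fd (\<lambda>x. f x - g x) x v) has_derivative (\<lambda>w. fd (\<lambda>y. fd f y v) x w - fd (\<lambda>y. fd g y v) x w)) (at x)"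
    if x: "x \<in> S" for x v
    by (rule has_derivative_cong_open[OF has_derivative_diff[OF fd_works[OF Ck_on_1_diff[OF Ck_on_2D1[OF f] x]] fd_works[OF Ck_on_1_diff[OF Ck_on_2D1[OF g] x]]] S x])
      (simp add: 1)
  show "x \<in> S \<Longrightarrow> fd (\<lambda>y. fd (\<lambda>x. f x - g x) y v) x w = fd (\<lambda>y. fd f y v) x w - fd (\<lambda>y. fd g y v) x w"
    using fd_eq[OF d2, of x v] by simp
  show "Ck_on 2 S (\<lambda>x. f x - g x)"
    unfolding Ck_on_2_iff
  proof (intro conjI ballI allI)
    show "(\<lambda>x. f x - g x) differentiable at y" if "y \<in> S" for y using d[OF that] by (auto simp: differentiable_def)
    show "Ck_on 1 S (\<lambda>x. fd (\<lambda>x. f x - g x) x v)" for v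
      by (rule Ck_on_1_cong[OF Ck_on_1_diff_fun[OF Ck_on_2D1[OF f] Ck_on_2D1[OF g]] S]) (simp add: 1)
  qed
qed

section \<open>Eventual bounds from finite limits superior\<close>

lemma limsup_finite_bound:
  fixes f :: "nat \<Rightarrow> ennreal"
  assumes "limsup f < \<infinity>"
  obtains C where "C \<ge> 0" "\<forall>\<^sub>F i in sequentially. f i \<le> ennreal C"
proof -
  obtain C where C: "limsup f = ennreal C" "C \<ge> 0" using assms by (cases "limsup f") auto
  then have "limsup f < ennreal (C + 1)" by (simp add: ennreal_less_iff)
  then have "\<forall>\<^sub>F i in sequentially. f i < ennreal (C + 1)" by (rule Limsup_lessD)
  then have "\<forall>\<^sub>F i in sequentially. f i \<le> ennreal (C + 1)" by eventually_elim simp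
  then show thesis using that[of "C + 1"] C(2) by simp
qed

text \<open>Finitely many of the good neighbourhoods cover \<open>E\<close>, and their eventual
  bounds add up.\<close>

lemma compact_mass_bound:
  fixes \<mu> :: "nat \<Rightarrow> 'a::t2_space measure"
  assumes s: "\<And>i. sets (\<mu> i) = sets borel" and E: "compact E"
    and loc: "\<And>q. q \<in> E \<Longrightarrow> \<exists>U. open U \<and> q \<in> U \<and> limsup (\<lambda>i. emeasure (\<mu> i) U) < \<infinity>"
  obtains C where "C \<ge> 0" "\<forall>\<^sub>F i in sequentially. emeasure (\<mu> i) E \<le> ennreal C"
proof -
  define \<U> where "\<U> = {U. open U \<and> limsup (\<lambda>i. emeasure (\<mu> i) U) < \<infinity>}"
  have "E \<subseteq> \<Union>\<U>" using loc by (auto simp: \<U>_def)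
  then obtain \<F> where \<F>: "\<F> \<subseteq> \<U>" "finite \<F>" "E \<subseteq> \<Union>\<F>"
    using compactE[OF E, of \<U>] by (metis (no_types, lifting) \<U>_def mem_Collect_eq)
  have "\<exists>C\<ge>0. \<forall>\<^sub>F i in sequentially. emeasure (\<mu> i) (\<Union>\<F>) \<le> ennreal C"
    using \<F>(2,1)
  proof (induction \<F> rule: finite_induct)
    case empty then show ?case by (intro exI[of _ 0]) simp
  next
    case (insert U \<F>)
    obtain C1 where C1: "C1 \<ge> 0" "\<forall>\<^sub>F i in sequentially. emeasure (\<mu> i) (\<Union>\<F>) \<le> ennreal C1" using insert by auto
    obtain C2 where C2: "C2 \<ge> 0" "\<forall>\<^sub>F i in sequentially. emeasure (\<mu> i) U \<le> ennreal C2"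
      using insert.prems limsup_finite_bound[of "\<lambda>i. emeasure (\<mu> i) U"] by (auto simp: \<U>_def)
    have "open (\<Union>\<F>)" "open U" using insert.prems by (auto simp: \<U>_def)
    then have o: "U \<in> sets (\<mu> i)" "\<Union>\<F> \<in> sets (\<mu> i)" for i using s by auto
    have "\<forall>\<^sub>F i in sequentially. emeasure (\<mu> i) (\<Union>(insert U \<F>)) \<le> ennreal (C2 + C1)"
      using C1(2) C2(2)
    proof eventually_elim
      case (elim i)
      have "emeasure (\<mu> i) (\<Union>(insert U \<F>)) \<le> emeasure (\<mu> i) U + emeasure (\<mu> i) (\<Union>\<F>)"
        using emeasure_subadditive[OF o] by simp
      also have "\<dots> \<le> ennreal C2 + ennreal C1" using elim by (intro add_mono)
      finally show ?case using C1(1) C2(1) by simp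
    qed
    then show ?case using C1(1) C2(1) by (intro exI[of _ "C2 + C1"]) simp
  qed
  then obtain C where C: "C \<ge> 0" "\<forall>\<^sub>F i in sequentially. emeasure (\<mu> i) (\<Union>\<F>) \<le> ennreal C" by blast
  have "open (\<Union>\<F>)" using \<F>(1) by (auto simp: \<U>_def)
  then have "\<Union>\<F> \<in> sets (\<mu> i)" for i using s by auto
  then have "emeasure (\<mu> i) E \<le> emeasure (\<mu> i) (\<Union>\<F>)" for i using \<F>(3) by (rule emeasure_mono[rotated])
  then have "\<forall>\<^sub>F i in sequentially. emeasure (\<mu> i) E \<le> ennreal C"
    using C(2) by (auto elim!: eventually_mono intro: order_trans)
  with C(1) show thesis by (rule that)
qed

context converging_forms
begin

text \<open>The derivative of \<open>\<phi>(F)\<close> contributes the square of \<open>fd F\<close> with the nonnegative factor \<open>\<phi>'(F)\<close>,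
  and the derivative of the cutoff \<open>\<zeta>\<close> is only seen on \<open>E\<close>.\<close>

lemma div_form_lower_bound:
  fixes \<zeta> :: "'e \<Rightarrow> real"
  assumes \<zeta>: "Ck_on 1 UNIV \<zeta>" "\<And>y. 0 \<le> \<zeta> y" and s: "s > 0" and x: "x \<in> W"
    and b: "\<And>j. j < m \<Longrightarrow> norm (b j) \<le> N1"
    and err: "\<And>v. \<bar>s * kap (F x - a) * fd \<zeta> x v * fd F x v\<bar> \<le> e * (norm v)\<^sup>2" and e: "e \<ge> 0"
    and pos: "c \<le> (\<Sum>j<m. fd (\<lambda>y. fd F y (b j)) x (b j) - koszul (Gs i) x (b j) (b j) (zs i x))"
  defines "\<psi> \<equiv> \<lambda>y. s * (\<zeta> y * kap (F y - a))"
  shows "\<psi> x * c - real m * (e * N1\<^sup>2) \<le> (\<Sum>j<m. div_form (Gs i) (\<lambda>y. \<psi> y *\<^sub>R zs i y) x (b j) (b j))"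
    "Ck_on 1 W \<psi>" "Ck_on 1 W (zs i)"
proof -
  have F1: "Ck_on 1 W F" by (rule Ck_on_2_imp_1[OF F])
  have \<phi>: "Ck_on 1 W (\<lambda>y. kap (F y - a))"
    by (rule Ck_on_1_compose[OF kap_C1 Ck_on_1_diff_fun[OF F1 Ck_on_1_const]]) simp
  have \<zeta>W: "Ck_on 1 W \<zeta>" by (rule Ck_on_1_subset[OF \<zeta>(1)]) simp
  show \<psi>: "Ck_on 1 W \<psi>" unfolding \<psi>_def by (rule Ck_on_1_mult[OF Ck_on_1_const Ck_on_1_mult[OF \<zeta>W \<phi>]])
  show z: "Ck_on 1 W (zs i)"
    by (rule riesz_C1[OF W(1) Gs(1) Gs(2) fd_F_linear Ck_on_2D1[OF F] zs])
  have dF: "(F has_derivative fd F x) (at x)" by (rule fd_works[OF Ck_on_1_diff[OF F1 x]])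
  have d\<zeta>: "(\<zeta> has_derivative fd \<zeta> x) (at x)" by (rule fd_works[OF Ck_on_1_diff[OF \<zeta>(1) UNIV_I]])
  have "((\<lambda>y. F y - a) has_derivative fd F x) (at x)" using has_derivative_diff[OF dF has_derivative_const] by simp
  from has_derivative_compose[OF this kap_has_derivative]
  have d\<phi>: "((\<lambda>y. kap (F y - a)) has_derivative (\<lambda>v. 2 * max 0 (F x - a) * fd F x v)) (at x)" .
  have f\<psi>: "fd \<psi> x = (\<lambda>v. s * (\<zeta> x * (2 * max 0 (F x - a) * fd F x v) + fd \<zeta> x v * kap (F x - a)))"
    unfolding \<psi>_def by (rule fd_eq[OF has_derivative_mult_right[OF has_derivative_mult[OF d\<zeta> d\<phi>]]])
  have low: "- (e * N1\<^sup>2) \<le> fd \<psi> x (b j) * fd F x (b j)" if j: "j < m" for j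
  proof -
    have "0 \<le> s * (\<zeta> x * (2 * max 0 (F x - a) * (fd F x (b j))\<^sup>2))" using s \<zeta>(2) by simp
    moreover have "- (e * (norm (b j))\<^sup>2) \<le> s * kap (F x - a) * fd \<zeta> x (b j) * fd F x (b j)"
      using err[of "b j"] by linarith
    moreover have "e * (norm (b j))\<^sup>2 \<le> e * N1\<^sup>2" using b[OF j] e by (intro mult_left_mono power_mono) auto
    ultimately show ?thesis unfolding f\<psi> by (simp add: algebra_simps power2_eq_square)
  qed
  have "\<psi> x * c - real m * (e * N1\<^sup>2) \<le> \<psi> x * (\<Sum>j<m. fd (\<lambda>y. fd F y (b j)) x (b j) - koszul (Gs i) x (b j) (b j) (zs i x)) + (\<Sum>j<m. - (e * N1\<^sup>2))"
    using pos s \<zeta>(2) by (simp add: \<psi>_def kap_simps(2) mult_left_mono)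
  also have "\<dots> \<le> \<psi> x * (\<Sum>j<m. fd (\<lambda>y. fd F y (b j)) x (b j) - koszul (Gs i) x (b j) (b j) (zs i x)) + (\<Sum>j<m. fd \<psi> x (b j) * fd F x (b j))"
    using low by (intro add_left_mono sum_mono) auto
  also have "\<dots> = (\<Sum>j<m. div_form (Gs i) (\<lambda>y. \<psi> y *\<^sub>R zs i y) x (b j) (b j))"
  proof -
    have "div_form (Gs i) (\<lambda>y. \<psi> y *\<^sub>R zs i y) x u u = fd \<psi> x u * fd F x u
       + \<psi> x * (fd (\<lambda>y. fd F y u) x u - koszul (Gs i) x u u (zs i x))" for u
      unfolding div_form_def by (rule gradient_field_identity[OF W(1) x Gs(1) Gs(2) F z zs \<psi>])
    then show ?thesis by (simp only: sum.distrib sum_distrib_left add.commute)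
  qed
  finally show "\<psi> x * c - real m * (e * N1\<^sup>2) \<le> (\<Sum>j<m. div_form (Gs i) (\<lambda>y. \<psi> y *\<^sub>R zs i y) x (b j) (b j))" .
qed

end

lemma div_form_cong:
  assumes S: "open S" "x \<in> S" and w: "Ck_on 1 S w" and eq: "\<And>y. y \<in> S \<Longrightarrow> w y = w' y"
  shows "div_form G w' x = div_form G w x"
  unfolding div_form_def[abs_def] using fd_cong_open(2)[OF Ck_on_1_diff[OF w S(2)] S eq] eq[OF S(2)] by simp

section \<open>Maximum principle for the area blow-up set\<close>

lemma C1_derivative_bound:
  fixes f :: "'e::euclidean_space \<Rightarrow> real"
  assumes f: "Ck_on 1 W f" and K: "compact K" "K \<subseteq> W"
  obtains N where "N \<ge> 0" "\<And>x v. x \<in> K \<Longrightarrow> \<bar>fd f x v\<bar> \<le> N * norm v"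
proof -
  have "continuous_on K (\<lambda>x. \<Sum>a\<in>Basis. \<bar>fd f x a\<bar>)"
    using Ck_on_1_fd_continuous[OF f] K(2) by (intro continuous_intros) (blast intro: continuous_on_subset)
  then have "bounded ((\<lambda>x. \<Sum>a\<in>Basis. \<bar>fd f x a\<bar>) ` K)"
    by (intro compact_imp_bounded compact_continuous_image K(1))
  then obtain N where N: "N > 0" "\<And>x. x \<in> K \<Longrightarrow> (\<Sum>a\<in>Basis. \<bar>fd f x a\<bar>) \<le> N"
    unfolding bounded_pos by force
  show thesis
  proof (rule that[OF less_imp_le[OF N(1)]])
    fix x v assume x: "x \<in> K"
    then have "\<bar>fd f x v\<bar> \<le> norm v * (\<Sum>a\<in>Basis. \<bar>fd f x a\<bar>)"
      using K(2) by (intro linear_le_basis fd_linear[OF Ck_on_1_diff[OF f]]) auto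
    also have "\<dots> \<le> norm v * N" by (rule mult_left_mono[OF N(2)[OF x]]) simp
    finally show "\<bar>fd f x v\<bar> \<le> N * norm v" by (simp add: mult.commute)
  qed
qed

context manifold
begin

lemma chart_field_tnorm:
  assumes "c \<in> A" "q \<in> fst c"
  shows "tnorm g q (chart_field c w q) = sqrt (metric_in_chart A g c (snd c q) (w (snd c q)) (w (snd c q)))"
  unfolding chart_field_def using assms by (simp add: tnorm_chart[OF tvec_in_tangent[OF assms] assms] tvec_self)

text \<open>The sets \<open>E\<close>, \<open>K\<close>, \<open>U\<close>, \<open>V\<close> and all
  constants are fixed before an index \<open>i\<close> is considered; this is what makes the final
  mass bound \<open>D\<close> uniform in \<open>i\<close>.\<close>

lemma local_maximum_trace_le:
  fixes f :: "'a \<Rightarrow> real"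
  assumes gs: "\<And>i. C1_metric A (gs i)" and g: "C1_metric A g" and conv: "C1_metrics_converge A gs g"
    and M: "\<And>i. varifold A m (M i)"
    and lb: "\<And>i. locally_bounded_first_variation A (gs i) m (M i)"
    and mc: "\<And>i. mean_curvature A (gs i) m (M i) (H i)"
    and bm: "\<And>i. boundary_measure A (gs i) m (M i) (\<beta> i)"
    and b\<beta>: "\<And>U. compact (closure U) \<Longrightarrow> limsup (\<lambda>i. emeasure (\<beta> i) U) < \<infinity>"
    and bH: "\<And>K. compact K \<Longrightarrow>
       limsup (\<lambda>i. \<integral>\<^sup>+p\<in>K. ennreal (max (tnorm (gs i) p (H i p) - h) 0) \<partial>weight (M i)) < \<infinity>"
    and f: "C2_function A f" and p: "p \<in> area_blowup_set A g M"
    and U0: "open U0" "p \<in> U0" "\<And>x. x \<in> area_blowup_set A g M \<Longrightarrow> x \<in> U0 \<Longrightarrow> f x \<le> f p"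
  shows "trace_lowest A g m p (hessian A g f p) \<le> h * deriv_norm A g f p"
proof (rule ccontr)
  assume "\<not> ?thesis"
  then have gt: "h * deriv_norm A g f p < trace_lowest A g m p (hessian A g f p)" by simp
  define c where "c = chart_at A p"
  have c: "c \<in> A" "p \<in> fst c" using chart_at_in by (auto simp: c_def)
  define W where "W = chart_image c"
  define x0 where "x0 = snd c p"
  have W: "open W" "x0 \<in> W" using chart_homeo(2)[OF c(1)] chart_inv(4)[OF c] by (auto simp: W_def x0_def)
  have px0: "inv_chart c x0 = p" using chart_inv(3)[OF c] by (simp add: x0_def)
  define F0 where "F0 = f \<circ> inv_chart c"
  define q4 where "q4 y = ((y - x0) \<bullet> (y - x0)) * ((y - x0) \<bullet> (y - x0))" for y
  define F where "F y = F0 y - q4 y" for y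
  define Gs where "Gs i = metric_in_chart A (gs i) c" for i
  define G where "G = metric_in_chart A g c"
  note q4 = quartic[where ?x0.0=x0, folded q4_def]
  have F0: "Ck_on 2 W F0" using f c(1) by (simp add: C2_function_def F0_def W_def)
  have F: "Ck_on 2 W F" unfolding F_def by (rule Ck_on_2_diff_fun(1)[OF F0 q4(1) W(1)])
  have F1: "Ck_on 1 W F" by (rule Ck_on_2_imp_1[OF F])
  have dF0: "fd F x0 v = fd F0 x0 v" for v
    unfolding F_def using Ck_on_2_diff_fun(2)[OF F0 q4(1) W(1) W(2)] q4(2) by simp
  have ddF0: "fd (\<lambda>y. fd F y v) x0 w = fd (\<lambda>y. fd F0 y v) x0 w" for v w
    unfolding F_def using Ck_on_2_diff_fun(3)[OF F0 q4(1) W(1) W(2)] q4(3) by simp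
  have lF: "linear (fd F x)" if "x \<in> W" for x by (rule fd_linear[OF Ck_on_1_diff[OF F1 that]])
  have iGs: "inner_form (Gs i x)" and iG: "inner_form (G x)" if "x \<in> W" for i x
    unfolding Gs_def G_def using C1_metric_inner_form[OF gs c(1)] C1_metric_inner_form[OF g c(1)] that W_def by auto
  define zs where "zs i x = (THE z. \<forall>w. Gs i x z w = fd F x w)" for i x
  define z0 where "z0 = (THE z. \<forall>w. G x0 z w = fd F x0 w)"
  have zs: "Gs i x (zs i x) w = fd F x w" if "x \<in> W" for i x w
    using theI'[OF riesz_ex1[OF iGs[OF that] lF[OF that]]] by (simp add: zs_def)
  have z0: "G x0 z0 w = fd F x0 w" for w
    using theI'[OF riesz_ex1[OF iG[OF W(2)] lF[OF W(2)]]] by (simp add: z0_def)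
  interpret cf: converging_forms W Gs G F zs x0 z0
  proof
    show "open W" "x0 \<in> W" "Ck_on 2 W F" by (fact W F)+
    show "Ck_on 1 W (\<lambda>x. Gs i x a b)" "Ck_on 1 W (\<lambda>x. G x a b)" for i a b
      unfolding Gs_def G_def W_def by (rule C1_metric_Ck[OF gs c(1)], rule C1_metric_Ck[OF g c(1)])
    fix K a b assume K: "compact K" "K \<subseteq> W"
    show "uniform_limit K (\<lambda>i x. Gs i x a b) (\<lambda>x. G x a b) sequentially"
      using conv c(1) K unfolding C1_metrics_converge_def Gs_def G_def W_def by blast
    show "uniform_limit K (\<lambda>i x. fd (\<lambda>y. Gs i y a b) x w) (\<lambda>x. fd (\<lambda>y. G y a b) x w) sequentially" for w
      using conv c(1) K unfolding C1_metrics_converge_def Gs_def G_def W_def by blast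
  qed (fact iGs iG zs z0)+
  \<comment> \<open>\<open>F\<close> and \<open>F0\<close> have the same 2-jet at \<open>x0\<close>,
    and the trace over any frame is at least the sum of the lowest eigenvalues. The assumed strict
    inequality therefore holds for every frame.\<close>
  have pos: "h * sqrt (G x0 z0 z0) < (\<Sum>j<m. fd (\<lambda>y. fd F y (b j)) x0 (b j) - koszul G x0 (b j) (b j) z0)"
    if b: "onb (G x0) m UNIV b" for b
  proof -
    define Bc where "Bc u v = fd (\<lambda>y. fd F0 y v) x0 u - koszul G x0 u v z0" for u v
    have kb: "linear (\<lambda>u. koszul G x0 u v z0)" "linear (\<lambda>v. koszul G x0 u v z0)" for u v
      using koszul_linear(2,3)[OF W inner_formD(1)[OF iG] cf.G(2)] by blast+
    have hb: "bilinear (\<lambda>v u. fd (\<lambda>y. fd F0 y v) x0 u)" by (rule Ck_on_2_second_linear[OF F0 W])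
    have Bb: "bilinear Bc"
      using hb kb unfolding Bc_def bilinear_def by (auto intro!: linear_compose_sub)
    have Bs: "Bc u v = Bc v u" for u v
    proof -
      have "koszul G x0 u v z0 = koszul G x0 v u z0"
        by (rule koszul_sym[OF W inner_formD(2)[OF iG] cf.G(2)])
      moreover have "fd (\<lambda>y. fd F0 y v) x0 u = fd (\<lambda>y. fd F0 y u) x0 v"
        by (rule second_derivative_symmetric[OF F0 W])
      ultimately show ?thesis by (simp add: Bc_def)
    qed
    have hess: "hessian A g f p v w = Bc (v c) (w c)" for v w
    proof -
      have "fd F0 x0 (christoffel A g c x0 (v c) (w c)) = G x0 z0 (christoffel A g c x0 (v c) (w c))"
        unfolding z0 dF0 ..
      also have "\<dots> = G x0 (christoffel A g c x0 (v c) (w c)) z0" by (rule inner_formD(2)[OF iG[OF W(2)]])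
      also have "\<dots> = koszul G x0 (v c) (w c) z0"
        unfolding G_def by (rule christoffel_koszul[OF g c(1)]) (use W(2) in \<open>simp add: W_def\<close>)
      finally show ?thesis
        unfolding hessian_def Let_def c_def[symmetric] x0_def[symmetric] F0_def[symmetric] Bc_def by simp
    qed
    have "deriv_norm A g f p = sqrt (G x0 z0 z0)"
      unfolding G_def x0_def c_def
      by (rule deriv_norm_eq[OF g]) (use z0 dF0 in \<open>simp add: G_def x0_def c_def F0_def\<close>)
    moreover have "trace_lowest A g m p (hessian A g f p) \<le> (\<Sum>j<m. Bc (b j) (b j))"
      by (rule trace_lowest_le[OF g _ Bb Bs]) (use hess b in \<open>auto simp: c_def G_def x0_def\<close>)
    ultimately show ?thesis using gt by (simp add: Bc_def ddF0)
  qed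
  obtain c1 R1 I1 where c1: "c1 > 0" "R1 > 0" "cball x0 R1 \<subseteq> W"
    and trace: "\<And>i x b P. i \<ge> I1 \<Longrightarrow> x \<in> cball x0 R1 \<Longrightarrow> onb (Gs i x) m P b \<Longrightarrow>
      c1 + h * sqrt (Gs i x (zs i x) (zs i x)) \<le> (\<Sum>j<m. fd (\<lambda>y. fd F y (b j)) x (b j) - koszul (Gs i) x (b j) (b j) (zs i x))"
    by (rule cf.hessian_trace_positive[OF pos], assumption) (rule that, assumption+)
  obtain R2 lam I2 N where R2: "R2 > 0" "lam > 0" "N \<ge> 0" "cball x0 R2 \<subseteq> W"
    and ell: "\<And>i x u. i \<ge> I2 \<Longrightarrow> x \<in> cball x0 R2 \<Longrightarrow> lam * (norm u)\<^sup>2 \<le> Gs i x u u"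
    and FN: "\<And>x u. x \<in> cball x0 R2 \<Longrightarrow> \<bar>fd F x u\<bar> \<le> N * norm u"
    by (rule cf.uniform_ellipticity) (rule that, assumption+)
  have "open (snd c ` (U0 \<inter> fst c))" using U0(1) chart_homeo(1)[OF c(1)] by (intro open_chart_image[OF c(1)]) auto
  moreover have "x0 \<in> snd c ` (U0 \<inter> fst c)" using U0(2) c by (auto simp: x0_def)
  ultimately obtain R3 where R3: "R3 > 0" "cball x0 R3 \<subseteq> snd c ` (U0 \<inter> fst c)"
    using open_contains_cball by blast
  define R where "R = min R1 (min R2 R3)"
  have R: "R > 0" "cball x0 R \<subseteq> cball x0 R1" "cball x0 R \<subseteq> cball x0 R2" "cball x0 R \<subseteq> cball x0 R3"
    using c1 R2 R3 by (auto simp: R_def)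
  have RW: "cball x0 R \<subseteq> W" using R(2) c1(3) by blast
  have RU0: "inv_chart c y \<in> U0" if "y \<in> cball x0 R" for y
  proof -
    have "y \<in> snd c ` (U0 \<inter> fst c)" using that R(4) R3(2) by blast
    then show ?thesis using chart_inv(3)[OF c(1)] by auto
  qed
  obtain \<zeta> :: "'e \<Rightarrow> real" where \<zeta>: "Ck_on 1 UNIV \<zeta>" "\<And>y. 0 \<le> \<zeta> y" "\<And>y. \<zeta> y \<le> 1" "\<zeta> x0 = 1"
    "\<And>y v. dist y x0 < R / 2 \<Longrightarrow> fd \<zeta> y v = 0" "\<And>y. dist y x0 \<ge> 3 / 4 * R \<Longrightarrow> \<zeta> y = 0"
    by (rule smooth_cutoff[OF R(1), of x0]) (rule that)
  \<comment> \<open>The value of \<open>q4\<close> at distance \<open>R / 2\<close>, hence a lower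
    bound for the drop of \<open>F\<close> below \<open>F x0\<close> at points of the blow-up set
    that lie in the ball but at least this far from \<open>x0\<close>.\<close>
  define r4 where "r4 = (R / 2)\<^sup>2 * (R / 2)\<^sup>2"
  have r4: "r4 > 0" using R(1) by (simp add: r4_def)
  \<comment> \<open>Half of the drop: \<open>F x0\<close> stays above this level, while the points
    just described stay below it.\<close>
  define a where "a = F x0 - r4 / 2"
  \<comment> \<open>A closed condition that holds at every point of the ball where the derivative of
    \<open>\<zeta>\<close> and \<open>kap (F y - a)\<close> are both nonzero.\<close>
  define E0 where "E0 = cball x0 R \<inter> (\<lambda>y. (dist y x0, F y)) -` ({R / 2..} \<times> {a..})"
  have FcK: "continuous_on (cball x0 R) F" by (rule continuous_on_subset[OF Ck_on_1_continuous[OF F1] RW])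
  have "closed E0" unfolding E0_def
    by (rule continuous_closed_preimage) (auto intro!: continuous_intros FcK closed_Times)
  then have cE0: "compact E0" using bounded_subset[OF bounded_cball, of E0 x0 R] by (auto simp: compact_eq_bounded_closed E0_def)
  have E0: "y \<in> E0 \<longleftrightarrow> y \<in> cball x0 R \<and> R / 2 \<le> dist y x0 \<and> a \<le> F y" for y by (auto simp: E0_def)
  define E where "E = inv_chart c ` E0"
  define K where "K = inv_chart c ` cball x0 R"
  define U where "U = inv_chart c ` ball x0 R"
  have cE: "compact E" unfolding E_def using E0 RW by (intro compact_inv_chart_image[OF c(1) cE0]) (auto simp: W_def)
  have cK: "compact K" unfolding K_def using RW by (intro compact_inv_chart_image[OF c(1)]) (auto simp: W_def)
  have oU: "open U" unfolding U_def using RW by (intro open_inv_chart_image[OF c(1)]) (auto simp: W_def)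
  have UK: "U \<subseteq> K" by (auto simp: U_def K_def)
  have EK: "E \<subseteq> K" by (auto simp: E_def K_def E0)
  have Kc: "K \<subseteq> fst c" using RW chart_inv(1)[OF c(1)] by (auto simp: K_def W_def)
  have Kx: "q \<in> K \<longleftrightarrow> snd c q \<in> cball x0 R" if "q \<in> fst c" for q
    using that RW chart_inv(2,3)[OF c(1)] by (force simp: K_def W_def image_iff)
  have Ex: "q \<in> E \<longleftrightarrow> snd c q \<in> E0" if "q \<in> fst c" for q
  proof -
    have "E0 \<subseteq> W" using E0 RW by blast
    then show ?thesis using that chart_inv(2,3)[OF c(1)] by (force simp: E_def W_def image_iff)
  qed
  have EZ: "q \<notin> area_blowup_set A g M" if "q \<in> E" for q
  proof
    assume qZ: "q \<in> area_blowup_set A g M"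
    obtain y where y: "y \<in> E0" "q = inv_chart c y" using \<open>q \<in> E\<close> by (auto simp: E_def)
    then have yR: "y \<in> cball x0 R" "R / 2 \<le> dist y x0" "a \<le> F y" by (auto simp: E0)
    have "F0 y \<le> F0 x0" using U0(3)[OF qZ] RU0[OF yR(1)] y(2) px0 by (simp add: F0_def)
    moreover have "r4 \<le> q4 y"
    proof -
      have "(y - x0) \<bullet> (y - x0) = (dist y x0)\<^sup>2" by (simp add: dist_norm power2_norm_eq_inner)
      moreover have "(R / 2)\<^sup>2 \<le> (dist y x0)\<^sup>2" using yR(2) R(1) by (intro power_mono) auto
      ultimately show ?thesis unfolding r4_def q4_def by (metis mult_mono zero_le_power2)
    qed
    moreover have "q4 x0 = 0" by (simp add: q4_def)
    ultimately have "F y \<le> F x0 - r4" by (simp add: F_def)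
    then show False using yR(3) r4 by (simp add: a_def)
  qed
  obtain CE where CE: "CE \<ge> 0" "\<forall>\<^sub>F i in sequentially. emeasure (weight (M i)) E \<le> ennreal CE"
  proof (rule compact_mass_bound[of "\<lambda>i. weight (M i)" E])
    show "sets (weight (M i)) = sets borel" for i by (simp add: weight_def)
    show "\<exists>U. open U \<and> q \<in> U \<and> limsup (\<lambda>i. emeasure (weight (M i)) U) < \<infinity>" if "q \<in> E" for q
      using EZ[OF that] unfolding area_blowup_set_iff[OF g M] less_top[symmetric] infinity_ennreal_def by blast
  qed (use cE in auto)
  have "closure U \<subseteq> K" by (rule closure_minimal[OF UK compact_imp_closed[OF cK]])
  then have cU: "compact (closure U)" using cK closed_closure compact_Int_closed by (metis inf.absorb_iff2)
  obtain C\<beta> where C\<beta>: "C\<beta> \<ge> 0" "\<forall>\<^sub>F i in sequentially. emeasure (\<beta> i) U \<le> ennreal C\<beta>"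
    by (rule limsup_finite_bound[OF b\<beta>[OF cU]]) (rule that)
  obtain CP where CP: "CP \<ge> 0" "\<forall>\<^sub>F i in sequentially.
      (\<integral>\<^sup>+p\<in>K. ennreal (max (tnorm (gs i) p (H i p) - h) 0) \<partial>weight (M i)) \<le> ennreal CP"
    by (rule limsup_finite_bound[OF bH[OF cK]]) (rule that)
  have "continuous_on (cball x0 R) (\<lambda>x. kap (F x - a))"
    by (rule continuous_on_compose2[OF Ck_on_1_continuous[OF kap_C1]]) (auto intro!: continuous_intros FcK)
  then have "bounded ((\<lambda>x. kap (F x - a)) ` cball x0 R)"
    by (intro compact_imp_bounded compact_continuous_image) auto
  then obtain NF where NF: "NF > 0" "\<And>x. x \<in> cball x0 R \<Longrightarrow> kap (F x - a) \<le> NF"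
    unfolding bounded_pos by force
  obtain Nz where Nz: "Nz \<ge> 0" "\<And>x v. x \<in> cball x0 R \<Longrightarrow> \<bar>fd \<zeta> x v\<bar> \<le> Nz * norm v"
    using C1_derivative_bound[OF \<zeta>(1) compact_cball subset_UNIV] by metis
  \<comment> \<open>A bound for the length of the gradient \<open>zs i x\<close> in the metric
    \<open>Gs i\<close>. With z for the gradient, lam |z|^2 \<le> Gs i x z z = dF z \<le> N |z|
    gives |z| \<le> N / lam, and then Gs i x z z \<le> N^2 / lam.\<close>
  define N2 where "N2 = N / sqrt lam"
  have N2: "N2 \<ge> 0" using R2 by (simp add: N2_def)
  \<comment> \<open>Normalises the field to length at most 1, as \<open>test_fields\<close> demands;
    the summand 1 keeps the denominator positive.\<close>
  define s where "s = 1 / (NF * N2 + 1)"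
  have s: "s > 0" "s * (NF * N2) \<le> 1"
  proof -
    have "NF * N2 \<ge> 0" using NF(1) N2 by simp
    then show "s > 0" "s * (NF * N2) \<le> 1" by (auto simp: s_def field_simps)
  qed
  \<comment> \<open>The product of the bounds for the factors of the error caused by the
    cutoff.\<close>
  define e where "e = s * NF * Nz * N"
  have e: "e \<ge> 0" using s NF(1) Nz(1) R2(3) by (simp add: e_def)
  define \<psi> where "\<psi> y = s * (\<zeta> y * kap (F y - a))" for y
  have \<psi>0: "\<psi> y \<ge> 0" for y using s \<zeta>(2) by (simp add: \<psi>_def kap_simps(2))
  have \<psi>le: "\<psi> y \<le> s * NF" if "y \<in> cball x0 R" for y
  proof -
    have "\<zeta> y * kap (F y - a) \<le> 1 * NF" using \<zeta>(2,3) NF(2)[OF that] by (intro mult_mono) (auto simp: kap_simps(2))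
    then show ?thesis using s by (simp add: \<psi>_def)
  qed
  have \<psi>out: "\<psi> y = 0" if "y \<notin> cball x0 (3 / 4 * R)" for y
    using \<zeta>(6)[of y] that by (simp add: \<psi>_def dist_commute)
  have KR: "cball x0 (3 / 4 * R) \<subseteq> ball x0 R" using R(1) by auto
  have \<psi>C: "Ck_on 1 W \<psi>" and zC: "Ck_on 1 W (zs i)" for i
  proof -
    have "Ck_on 1 W (\<lambda>y. kap (F y - a))"
      by (rule Ck_on_1_compose[OF kap_C1 Ck_on_1_diff_fun[OF F1 Ck_on_1_const]]) simp
    then show "Ck_on 1 W \<psi>"
      unfolding \<psi>_def by (intro Ck_on_1_mult Ck_on_1_const Ck_on_1_subset[OF \<zeta>(1)]) auto
    show "Ck_on 1 W (zs i)"
      by (rule riesz_C1[OF W(1) iGs cf.Gs(2) lF Ck_on_2D1[OF F] zs])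
  qed
  define \<Psi> where "\<Psi> q = indicat_real (fst c) q *\<^sub>R \<psi> (snd c q)" for q
  have \<Psi>m: "\<Psi> \<in> borel_measurable borel"
    unfolding \<Psi>_def
    by (rule borel_measurable_continuous_on_indicator[OF borel_open[OF chart_homeo(1)[OF c(1)]]
          continuous_on_compose2[OF Ck_on_1_continuous[OF \<psi>C] chart_inv(5)[OF c(1)]]])
      (use chart_inv(4)[OF c(1)] in \<open>auto simp: W_def\<close>)
  have \<Psi>out: "\<Psi> q = 0" if "q \<notin> K" for q
  proof (cases "q \<in> fst c")
    case True
    have "snd c q \<notin> cball x0 R" using that Kx[OF True] by blast
    then have "snd c q \<notin> cball x0 (3 / 4 * R)" using KR ball_subset_cball by blast
    then show ?thesis by (simp add: \<Psi>_def \<psi>out)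
  qed (simp add: \<Psi>_def)
  have \<Psi>B: "\<bar>\<Psi> q\<bar> \<le> s * NF * indicat_real K q" for q
  proof (cases "q \<in> K")
    case True
    then have q: "q \<in> fst c" using Kc by blast
    then have "\<Psi> q = \<psi> (snd c q)" by (simp add: \<Psi>_def)
    then show ?thesis using \<psi>0 \<psi>le[of "snd c q"] Kx[OF q] True by simp
  qed (simp add: \<Psi>out)
  \<comment> \<open>An open neighbourhood of \<open>x0\<close> with a positive lower bound for
    \<open>\<psi>\<close>, so that a bound for the integral of \<open>\<Psi>\<close> becomes a bound
    for the mass.\<close>
  define V0 where "V0 = {y \<in> ball x0 R. \<psi> x0 / 2 < \<psi> y}"
  define V where "V = inv_chart c ` V0"
  have \<psi>x0: "\<psi> x0 > 0" using s \<zeta>(4) r4 by (simp add: \<psi>_def a_def kap_simps(3))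
  have oV0: "open V0"
  proof -
    have "V0 = ball x0 R \<inter> \<psi> -` {\<psi> x0 / 2<..}" by (auto simp: V0_def)
    moreover have "continuous_on (ball x0 R) \<psi>"
      by (rule continuous_on_subset[OF Ck_on_1_continuous[OF \<psi>C]]) (use RW in auto)
    ultimately show ?thesis using continuous_open_preimage[OF _ open_ball open_greaterThan] by metis
  qed
  have oV: "open V" unfolding V_def using RW by (intro open_inv_chart_image[OF c(1) oV0]) (auto simp: V0_def W_def)
  have pV: "p \<in> V" unfolding V_def using px0 \<psi>x0 R(1) by (intro image_eqI[of _ _ x0]) (auto simp: V0_def)
  have VK: "V \<subseteq> K" by (auto simp: V_def K_def V0_def)
  have \<Psi>V: "\<psi> x0 / 2 \<le> \<Psi> q" if q: "q \<in> V" for q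
  proof -
    obtain y where y: "y \<in> V0" "q = inv_chart c y" using q by (auto simp: V_def)
    then have "y \<in> W" using RW by (auto simp: V0_def)
    then have "q \<in> fst c" "snd c q = y" using chart_inv(1,2)[OF c(1)] y(2) by (auto simp: W_def)
    then show ?thesis using y(1) by (simp add: \<Psi>_def V0_def)
  qed
  \<comment> \<open>Each of the \<open>m\<close> frame vectors has unit length for
    \<open>Gs i\<close>, hence Euclidean norm at most \<open>1 / sqrt lam\<close>, and contributes
    an error of at most \<open>e\<close> times its squared norm.\<close>
  define C1 where "C1 = real m * (e * (1 / sqrt lam)\<^sup>2)"
  have C1: "C1 \<ge> 0" using e by (simp add: C1_def)
  \<comment> \<open>The right side of \<open>first_variation_estimate\<close>, with the mass of
    \<open>E\<close> replaced by its bound, divided by \<open>c1\<close> and then by the lower bound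
    \<open>\<psi> x0 / 2\<close> of \<open>\<Psi>\<close> on \<open>V\<close>.\<close>
  define D where "D = (C\<beta> + CP + C1 * CE) / c1 / (\<psi> x0 / 2)"
  have bound: "emeasure (weight (M i)) V \<le> ennreal D"
    if i: "i \<ge> I1" "i \<ge> I2" and bE: "emeasure (weight (M i)) E \<le> ennreal CE" and bb: "emeasure (\<beta> i) U \<le> ennreal C\<beta>"
      and bP: "(\<integral>\<^sup>+p\<in>K. ennreal (max (tnorm (gs i) p (H i p) - h) 0) \<partial>weight (M i)) \<le> ennreal CP" for i
  proof -
    interpret v: varifold_on A m "M i" by unfold_locales (rule M)
    define w where "w y = \<psi> y *\<^sub>R zs i y" for y
    have wC: "Ck_on 1 W w" unfolding w_def by (rule Ck_on_1_scaleR[OF \<psi>C zC])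
    define X where "X = chart_field c w"
    \<comment> \<open>The cutoff vanishes outside the ball of radius \<open>3 / 4 * R\<close>, so
      the support of the field is a compact subset of the open set \<open>U\<close>.\<close>
    have K0W: "cball x0 (3 / 4 * R) \<subseteq> chart_image c" using KR RW by (auto simp: W_def subset_iff)
    have "w y = 0" if "y \<notin> cball x0 (3 / 4 * R)" for y using \<psi>out[OF that] by (simp add: w_def)
    note cf' = chart_field[OF c(1) wC[unfolded W_def] compact_cball K0W this, folded X_def]
    have supU: "vf_support X \<subseteq> U" using cf'(2) KR by (auto simp: U_def)
    have gz: "sqrt (Gs i x (zs i x) (zs i x)) \<le> N2" if x: "x \<in> cball x0 R" for x
    proof -
      have xW: "x \<in> W" and xR2: "x \<in> cball x0 R2" using x RW R(3) by auto
      let ?z = "zs i x"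
      have eq: "Gs i x ?z ?z = fd F x ?z" by (rule zs[OF xW])
      have le: "fd F x ?z \<le> N * norm ?z" using FN[OF xR2, of ?z] by linarith
      have "lam * (norm ?z)\<^sup>2 \<le> N * norm ?z" using ell[OF i(2) xR2, of ?z] eq le by linarith
      then have "norm ?z * (lam * norm ?z) \<le> norm ?z * N" by (simp add: power2_eq_square mult_ac)
      then have "lam * norm ?z \<le> N" using R2(3) by (cases "?z = 0") auto
      then have nz: "norm ?z \<le> N / lam" using R2(2) by (simp add: field_simps)
      have "Gs i x ?z ?z \<le> N * norm ?z" using eq le by simp
      also have "\<dots> \<le> N * (N / lam)" by (rule mult_left_mono[OF nz R2(3)])
      also have "\<dots> = N2\<^sup>2" using R2(2) by (simp add: N2_def power_divide power2_eq_square)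
      finally show ?thesis using N2 by (simp add: real_le_lsqrt)
    qed
    have tX: "tnorm (gs i) q (X q) = \<Psi> q * sqrt (Gs i (snd c q) (zs i (snd c q)) (zs i (snd c q)))" if q: "q \<in> fst c" for q
    proof -
      have b: "bilinear (Gs i (snd c q))" using inner_formD(1)[OF iGs] chart_inv(4)[OF c(1) q] by (simp add: W_def)
      have r: "sqrt (k * (k * t)) = k * sqrt t" if "k \<ge> 0" for k t :: real
        using that by (simp add: mult.assoc[symmetric] real_sqrt_mult)
      have "tnorm (gs i) q (X q) = sqrt (Gs i (snd c q) (w (snd c q)) (w (snd c q)))"
        unfolding X_def Gs_def by (rule chart_field_tnorm[OF c(1) q])
      also have "\<dots> = \<psi> (snd c q) * sqrt (Gs i (snd c q) (zs i (snd c q)) (zs i (snd c q)))"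
        unfolding w_def bilinear_lmul[OF b] bilinear_rmul[OF b] real_scaleR_def by (rule r[OF \<psi>0])
      finally show ?thesis using q by (simp add: \<Psi>_def)
    qed
    have X0: "X q = (\<lambda>_. 0)" if "q \<notin> K" for q
      using that supU UK closure_subset[of "{p. X p \<noteq> (\<lambda>_. 0)}"] by (auto simp: vf_support_def)
    have t0: "tnorm (gs i) q (\<lambda>_. 0) = 0" for q
    proof -
      have z: "(\<lambda>_. 0) \<in> tangent_space A q" using tvec_in_tangent[OF chart_at_in, of q 0] by (simp add: tvec_zero[OF chart_at_in])
      show ?thesis unfolding tnorm_def using metric_cauchy_schwarz(3)[OF gs z z] by simp
    qed
    have X1: "tnorm (gs i) q (X q) \<le> 1" for q
    proof (cases "q \<in> K")
      case True
      then have q: "q \<in> fst c" "snd c q \<in> cball x0 R" using Kc Kx by auto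
      have "snd c q \<in> W" using q(2) RW by blast
      from inner_formD(4)[OF iGs[OF this]]
      have "\<Psi> q * sqrt (Gs i (snd c q) (zs i (snd c q)) (zs i (snd c q))) \<le> (s * NF) * N2"
        using gz[OF q(2)] \<psi>le[OF q(2)] \<psi>0[of "snd c q"] s(1) NF(1) q(1)
        by (intro mult_mono) (auto simp: \<Psi>_def)
      then show ?thesis using s(2) tX[OF q(1)] by (simp add: mult.assoc)
    next
      case False then show ?thesis using X0 t0 by simp
    qed
    have tf: "X \<in> test_fields A (gs i) U" using cf'(1,3) supU X1 by (simp add: test_fields_def)
    have div: "c1 * \<Psi> q + h * tnorm (gs i) q (X q) - C1 * indicat_real E q \<le> plane_div A (gs i) m X q S"
      if qS: "(q, S) \<in> grassmann_bundle A m" for q S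
    proof (cases "q \<in> K")
      case True
      then have q: "q \<in> fst c" and x: "snd c q \<in> cball x0 R" using Kc Kx by auto
      define x where "x = snd c q"
      have xR: "x \<in> cball x0 R" "x \<in> W" "x \<in> cball x0 R1" "x \<in> cball x0 R2" using x RW R(2,3) by (auto simp: x_def)
      note gr = grassmann_chart[OF qS c(1) q]
      obtain b where b: "onb (Gs i x) m (in_chart c S) b" using onb_exists[OF iGs[OF xR(2)] gr(1)] gr(2) by blast
      have nb: "norm (b j) \<le> 1 / sqrt lam" if "j < m" for j
      proof -
        have "lam * (norm (b j))\<^sup>2 \<le> 1" using ell[OF i(2) xR(4), of "b j"] b that by (simp add: onb_def)
        then have "(norm (b j))\<^sup>2 \<le> 1 / lam" using R2(2) by (simp add: field_simps)
        then have "norm (b j) \<le> sqrt (1 / lam)" using real_le_rsqrt by blast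
        then show ?thesis by (simp add: real_sqrt_divide)
      qed
      \<comment> \<open>The indicator confines the error to \<open>E0\<close>, over which the mass
        is bounded; the full set \<open>K\<close> contains \<open>p\<close>, where it blows
        up.\<close>
      have err: "\<bar>s * kap (F x - a) * fd \<zeta> x v * fd F x v\<bar> \<le> (e * indicat_real E0 x) * (norm v)\<^sup>2" for v
      proof (cases "x \<in> E0")
        case True
        have pr: "\<bar>fd \<zeta> x v\<bar> * \<bar>fd F x v\<bar> \<le> (Nz * norm v) * (N * norm v)"
          by (rule mult_mono[OF Nz(2)[OF xR(1)] FN[OF xR(4)]]) (use Nz(1) in auto)
        have "(s * kap (F x - a)) * (\<bar>fd \<zeta> x v\<bar> * \<bar>fd F x v\<bar>) \<le> (s * NF) * ((Nz * norm v) * (N * norm v))"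
          by (rule mult_mono[OF mult_left_mono[OF NF(2)[OF xR(1)] less_imp_le[OF s(1)]] pr]) (use s(1) NF(1) in auto)
        then show ?thesis using True s(1) kap_simps(2)[of "F x - a"]
          by (simp add: abs_mult e_def power2_eq_square mult_ac)
      next
        case False
        \<comment> \<open>Outside \<open>E0\<close> the point lies either where the cutoff is
          constant or where \<open>F x < a\<close>.\<close>
        then have "fd \<zeta> x v = 0 \<or> kap (F x - a) = 0" using xR(1) \<zeta>(5)[of x v] kap_simps(1)[of "F x - a"] by (auto simp: E0)
        then show ?thesis using False by auto
      qed
      have e0: "0 \<le> e * indicat_real E0 x" by (rule mult_nonneg_nonneg[OF e]) simp
      \<comment> \<open>By \<open>tX\<close> the length of the field is \<open>\<psi> x\<close>
        times the length of the gradient. The summand with \<open>h\<close> in the trace bound thus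
        becomes exactly the term with \<open>h\<close> required by
        \<open>first_variation_estimate\<close>.\<close>
      have "\<psi> x * (c1 + h * sqrt (Gs i x (zs i x) (zs i x))) - real m * ((e * indicat_real E0 x) * (1 / sqrt lam)\<^sup>2)
         \<le> (\<Sum>j<m. div_form (Gs i) (\<lambda>y. \<psi> y *\<^sub>R zs i y) x (b j) (b j))"
        unfolding \<psi>_def
        by (rule cf.div_form_lower_bound(1)[OF \<zeta>(1,2) s(1) xR(2) nb err e0 trace[OF i(1) xR(3) b]])
      also have "\<dots> = plane_trace (Gs i x) (div_form (Gs i) w x) m (in_chart c S)"
      proof -
        have "bilinear (div_form (Gs i) w x)"
          by (rule div_form_bilinear_continuous(1)[OF W(1) inner_formD(1)[OF iGs] cf.Gs(2) wC xR(2)])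
        from plane_trace_eq[OF b iGs[OF xR(2)] gr(1,2) this] show ?thesis by (simp add: w_def[abs_def])
      qed
      also have "\<dots> = plane_div A (gs i) m X q S"
      proof -
        have "div_form (Gs i) (\<lambda>y. X (inv_chart c y) c) x = div_form (Gs i) w x"
          by (rule div_form_cong[OF W(1) xR(2) wC]) (simp add: X_def W_def chart_field_apply[OF c(1)])
        then show ?thesis
          using plane_div_chart[OF gs cf'(1) qS c(1) q] by (simp add: Gs_def x_def)
      qed
      finally show ?thesis
        using tX[OF q] q Ex[OF q] by (simp add: \<Psi>_def x_def C1_def indicator_def algebra_simps split: if_splits)
    next
      case False
      have "q \<notin> vf_support X" using False supU UK by blast
      then have "plane_div A (gs i) m X q S = 0"
        using plane_div_outside_support[OF gs[of i] cf'(1) qS] by simp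
      then show ?thesis using False \<Psi>out X0 t0 EK by (auto simp: indicator_def)
    qed
    have Eb: "E \<in> sets borel" using cE by (simp add: borel_closed compact_imp_closed)
    have est: "c1 * (\<integral>q. \<Psi> q \<partial>weight (M i)) \<le> C\<beta> + CP + C1 * measure (weight (M i)) E"
      by (rule v.first_variation_estimate[OF gs lb mc bm c(1) oU UK cK Kc tf div \<Psi>m \<Psi>B Eb EK bb C\<beta>(1) bP CP(1)])
    have "measure (weight (M i)) E \<le> CE"
      unfolding measure_def using bE CE(1) by (simp add: enn2real_leI)
    then have "c1 * (\<integral>q. \<Psi> q \<partial>weight (M i)) \<le> C\<beta> + CP + C1 * CE"
      using est C1 by (meson add_left_mono mult_left_mono order_trans)
    then have int: "(\<integral>q. \<Psi> q \<partial>weight (M i)) \<le> (C\<beta> + CP + C1 * CE) / c1" using c1(1) by (simp add: field_simps)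
    have Kfin: "emeasure (weight (M i)) K < \<infinity>" by (rule v.weight_finite[OF c(1) cK Kc])
    have Ks: "K \<in> sets (weight (M i))" using cK by (simp add: v.weight_simps borel_closed compact_imp_closed)
    have Vs: "V \<in> sets (weight (M i))" using oV by (simp add: v.weight_simps)
    have Vfin: "emeasure (weight (M i)) V < \<infinity>"
      using emeasure_mono[OF VK Ks] Kfin by (rule le_less_trans)
    have i\<Psi>: "integrable (weight (M i)) \<Psi>"
    proof (rule integrableI_bounded_set[OF Ks _ Kfin])
      show "\<Psi> \<in> borel_measurable (weight (M i))" using \<Psi>m by (simp add: measurable_cong_sets[OF v.weight_simps(1) refl])
      show "AE q in weight (M i). q \<in> K \<longrightarrow> norm (\<Psi> q) \<le> s * NF"
      proof (intro AE_I2 impI)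
        fix q assume "q \<in> K" with \<Psi>B[of q] show "norm (\<Psi> q) \<le> s * NF" by simp
      qed
    qed (use \<Psi>out in auto)
    have "\<psi> x0 / 2 * measure (weight (M i)) V = (\<integral>q. \<psi> x0 / 2 * indicat_real V q \<partial>weight (M i))"
      using Vs Vfin by (simp add: v.weight_simps)
    also have "\<dots> \<le> (\<integral>q. \<Psi> q \<partial>weight (M i))"
    proof (rule integral_mono[OF _ i\<Psi>])
      show "integrable (weight (M i)) (\<lambda>q. \<psi> x0 / 2 * indicat_real V q)"
        using Vs Vfin by simp
      show "\<psi> x0 / 2 * indicat_real V q \<le> \<Psi> q" for q
        using \<Psi>V[of q] \<psi>0[of "snd c q"] by (cases "q \<in> V") (auto simp: \<Psi>_def)
    qed
    finally have "\<psi> x0 / 2 * measure (weight (M i)) V \<le> (C\<beta> + CP + C1 * CE) / c1" using int by linarith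
    then have "measure (weight (M i)) V * (\<psi> x0 / 2) \<le> (C\<beta> + CP + C1 * CE) / c1" by (simp only: mult.commute)
    moreover have "\<psi> x0 / 2 > 0" using \<psi>x0 by simp
    ultimately have "measure (weight (M i)) V \<le> D" unfolding D_def by (simp only: pos_le_divide_eq)
    then have "ennreal (measure (weight (M i)) V) \<le> ennreal D" by (rule ennreal_leI)
    then show ?thesis using Vfin by (simp add: emeasure_eq_ennreal_measure less_top)
  qed
  have "\<forall>\<^sub>F i in sequentially. emeasure (weight (M i)) V \<le> ennreal D"
    using eventually_ge_at_top[of I1] eventually_ge_at_top[of I2] CE(2) C\<beta>(2) CP(2)
    by eventually_elim (rule bound)
  then have "limsup (\<lambda>i. emeasure (weight (M i)) V) \<le> ennreal D" by (rule Limsup_bounded)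
  moreover have "limsup (\<lambda>i. emeasure (weight (M i)) V) = \<infinity>"
    using p oV pV unfolding area_blowup_set_iff[OF g M] by blast
  ultimately show False by (simp add: top_unique)
qed

end

theorem theorem2p6:
  fixes A :: "('a::{t2_space, second_countable_topology}, 'e::euclidean_space) chart set"
    and g :: "('a, 'e) metric" and gs :: "nat \<Rightarrow> ('a, 'e) metric"
    and m :: nat and h :: real
    and M :: "nat \<Rightarrow> ('a \<times> ('a, 'e) tangent set) measure"
    and H :: "nat \<Rightarrow> 'a \<Rightarrow> ('a, 'e) tangent"
    and \<beta> :: "nat \<Rightarrow> 'a measure"
  assumes "smooth_atlas A"
    and "\<And>i. C1_metric A (gs i)"
    and "C1_metric A g"
    and "C1_metrics_converge A gs g"
    and "\<And>i. varifold A m (M i)"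
    and "\<And>i. locally_bounded_first_variation A (gs i) m (M i)"
    and "\<And>i. mean_curvature A (gs i) m (M i) (H i)"
    and "\<And>i. boundary_measure A (gs i) m (M i) (\<beta> i)"
    and "\<And>U. compact (closure U) \<Longrightarrow> limsup (\<lambda>i. emeasure (\<beta> i) U) < \<infinity>"
  shows "((\<forall>i. AE p in weight (M i). tnorm (gs i) p (H i p) \<le> h) \<longrightarrow>
           mh_subset A g m h (area_blowup_set A g M)) \<and>
         ((\<forall>K. compact K \<longrightarrow>
             limsup (\<lambda>i. \<integral>\<^sup>+p\<in>K. ennreal (max (tnorm (gs i) p (H i p) - h) 0) \<partial>weight (M i)) < \<infinity>) \<longrightarrow>
           mh_subset A g m h (area_blowup_set A g M))"
proof -
  interpret manifold A by unfold_locales (rule assms(1))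
  have main: "mh_subset A g m h (area_blowup_set A g M)"
    if bH: "\<And>K. compact K \<Longrightarrow>
             limsup (\<lambda>i. \<integral>\<^sup>+p\<in>K. ennreal (max (tnorm (gs i) p (H i p) - h) 0) \<partial>weight (M i)) < \<infinity>"
    unfolding mh_subset_def
  proof (intro conjI allI impI)
    show "closed (area_blowup_set A g M)" by (rule area_blowup_set_closed[OF assms(3,5)])
    fix f p
    assume "C2_function A f \<and> p \<in> area_blowup_set A g M \<and>
      (\<exists>U. open U \<and> p \<in> U \<and> (\<forall>x\<in>area_blowup_set A g M \<inter> U. f x \<le> f p))"
    then obtain U where "C2_function A f" "p \<in> area_blowup_set A g M" "open U" "p \<in> U"
      "\<forall>x\<in>area_blowup_set A g M \<inter> U. f x \<le> f p" by blast
    then show "trace_lowest A g m p (hessian A g f p) \<le> h * deriv_norm A g f p"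
      by (intro local_maximum_trace_le[where ?U0.0=U, OF assms(2-9) bH]) auto
  qed
  \<comment> \<open>If |H| \<le> h almost everywhere, all integrals of the excess are 0, so the
    first assertion is a case of the second.\<close>
  have "limsup (\<lambda>i. \<integral>\<^sup>+p\<in>K. ennreal (max (tnorm (gs i) p (H i p) - h) 0) \<partial>weight (M i)) < \<infinity>"
    if AE: "\<forall>i. AE p in weight (M i). tnorm (gs i) p (H i p) \<le> h" for K
  proof -
    have "(\<integral>\<^sup>+p\<in>K. ennreal (max (tnorm (gs i) p (H i p) - h) 0) \<partial>weight (M i)) = (\<integral>\<^sup>+p. 0 \<partial>weight (M i))" for i
      by (rule nn_integral_cong_AE) (use AE[rule_format, of i] in \<open>eventually_elim, auto simp: max_def\<close>)
    then show ?thesis by (simp add: Limsup_const)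
  qed
  with main show ?thesis by blast
qed

end
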